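(* Let $G$ be a sequentially complete, locally minimal, totally disconnected, precompact Abelian group with completion $K=\widetilde G$. Then (a) $K$ is totally disconnected, so $K=\prod_{p\in\mathbb P}K_p$ and $G=\prod_{p\in\mathbb P}G_p$, where $G_p=td_p(G)$ and $K_p=td_p(K)$ for every prime $p$; (b) for every prime $p$ there exists $k_p\in\mathbb N$ such that $N=\prod_p p^{k_p}K_p\le G$, and, setting $N^*=\prod_p p^{k_p+1}K_p$, the quotient $G/N^*$ is locally minimal.
   Context: Groups are Abelian and Hausdorff; $\mathbb P$ is the set of primes. A group is totally disconnected if the quasi-component of $0$ (intersection of all clopen sets containing $0$) is trivial. $G$ is precompact if its completion $\widetilde G$ is compact; sequentially complete if every Cauchy sequence in $G$ converges in $G$. $G$ is locally minimal if there is a neighbourhood $V$ of $0$ such that every continuous isomorphism $f:G\to H$ onto a Hausdorff group with $f(V)$ a neighbourhood of $0$ in $H$ is open. A topological group is $p$-monothetic if it is a cyclic $p$-group or topologically isomorphic to a subgroup of $\mathbb Z_p$; $td_p(A)$ is the union of all $p$-monothetic subgroups of $A$ (a subgroup). The equality $G=\prod_p G_p$ means that, under $K=\prod_pK_p$, $G$ consists exactly of the elements all of whose coordinates lie in the respective $G_p$. *)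

theory Defs
  imports "HOL-Analysis.Analysis" "HOL-Algebra.Algebra"
begin

(* the set of primes (Algebra's prime shadows the number-theoretic one) *)
definition primes_set :: "nat set" where
  "primes_set \<equiv> {p. Factorial_Ring.prime p}"

definition topgroup :: "'a monoid \<Rightarrow> 'a topology \<Rightarrow> bool" where
  "topgroup G T \<equiv> group G \<and> topspace T = carrier G \<and>
     continuous_map (prod_topology T T) T (\<lambda>(x, y). x \<otimes>\<^bsub>G\<^esub> y) \<and>
     continuous_map T T (\<lambda>x. inv\<^bsub>G\<^esub> x)"

definition nbhd :: "'a topology \<Rightarrow> 'a \<Rightarrow> 'a set \<Rightarrow> bool" where
  "nbhd T x V \<equiv> V \<subseteq> topspace T \<and> (\<exists>U. openin T U \<and> x \<in> U \<and> U \<subseteq> V)"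

definition tot_disconnected :: "'a monoid \<Rightarrow> 'a topology \<Rightarrow> bool" where
  "tot_disconnected G T \<equiv> quasi_component_of_set T \<one>\<^bsub>G\<^esub> = {\<one>\<^bsub>G\<^esub>}"

definition group_cauchy :: "'a monoid \<Rightarrow> 'a topology \<Rightarrow> (nat \<Rightarrow> 'a) \<Rightarrow> bool" where
  "group_cauchy G T x \<equiv> (\<forall>n. x n \<in> carrier G) \<and>
     (\<forall>U. openin T U \<and> \<one>\<^bsub>G\<^esub> \<in> U \<longrightarrow>
        (\<exists>N. \<forall>m\<ge>N. \<forall>n\<ge>N. x m \<otimes>\<^bsub>G\<^esub> inv\<^bsub>G\<^esub> (x n) \<in> U))"

definition seq_complete :: "'a monoid \<Rightarrow> 'a topology \<Rightarrow> bool" where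
  "seq_complete G T \<equiv> (\<forall>x. group_cauchy G T x \<longrightarrow>
      (\<exists>l\<in>carrier G. limitin T x l sequentially))"

(* Locally minimal.  The target groups H range over groups whose elements have
   the same type as those of G; since f is a bijection onto H, every target
   group can be transported to such a one, so this loses no generality. *)
definition locally_minimal :: "'a monoid \<Rightarrow> 'a topology \<Rightarrow> bool" where
  "locally_minimal G T \<equiv> (\<exists>V. nbhd T \<one>\<^bsub>G\<^esub> V \<and>
     (\<forall>(H :: 'a monoid) TH f.
        topgroup H TH \<and> Hausdorff_space TH \<and> f \<in> iso G H \<and>
        continuous_map T TH f \<and> nbhd TH \<one>\<^bsub>H\<^esub> (f ` V)
        \<longrightarrow> open_map T TH f))"

(* The p-adic integers Z_p as the inverse limit of the Z/p^n Z (written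
   multiplicatively, as HOL-Algebra groups are), with its profinite topology. *)
definition Zp :: "nat \<Rightarrow> (nat \<Rightarrow> int) monoid" where
  "Zp p \<equiv> \<lparr>carrier = {a. \<forall>n. 0 \<le> a n \<and> a n < int p ^ n \<and>
                              a (Suc n) mod (int p ^ n) = a n},
           monoid.mult = (\<lambda>a b n. (a n + b n) mod (int p ^ n)),
           one = (\<lambda>n. 0)\<rparr>"

definition Zp_top :: "nat \<Rightarrow> (nat \<Rightarrow> int) topology" where
  "Zp_top p \<equiv> subtopology (product_topology (\<lambda>_. discrete_topology UNIV) UNIV)
                          (carrier (Zp p))"

definition p_monothetic :: "'a monoid \<Rightarrow> 'a topology \<Rightarrow> nat \<Rightarrow> 'a set \<Rightarrow> bool" where
  "p_monothetic G T p A \<equiv>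
     (finite A \<and> (\<exists>g\<in>A. A = generate G {g}) \<and> (\<exists>k. card A = p ^ k)) \<or>
     (\<exists>B f. subgroup B (Zp p) \<and>
        f \<in> iso (G\<lparr>carrier := A\<rparr>) ((Zp p)\<lparr>carrier := B\<rparr>) \<and>
        homeomorphic_map (subtopology T A) (subtopology (Zp_top p) B) f)"

definition td :: "'a monoid \<Rightarrow> 'a topology \<Rightarrow> nat \<Rightarrow> 'a set" where
  "td G T p \<equiv> \<Union>{A. subgroup A G \<and> p_monothetic G T p A}"

definition pow_set :: "'a monoid \<Rightarrow> nat \<Rightarrow> 'a set \<Rightarrow> 'a set" where
  "pow_set G n A \<equiv> (\<lambda>x. x [^]\<^bsub>G\<^esub> n) ` A"

definition quot_top :: "'a monoid \<Rightarrow> 'a topology \<Rightarrow> 'a set \<Rightarrow> 'a set topology" where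
  "quot_top G T N \<equiv> topology (\<lambda>U. U \<subseteq> rcosets\<^bsub>G\<^esub> N \<and> openin T (\<Union>U))"

end

theory Submission
  imports Defs "HOL-Number_Theory.Cong"
begin

text \<open>Call a subgroup of K small if it lies in a suitable neighbourhood of the identity. Local minimality
  of the dense subgroup S makes every small nontrivial closed subgroup of K meet S nontrivially, and
  sequential completeness makes S sequentially closed in K.

  Let D be the largest divisible subgroup of K. If countably many neighbourhoods separate the points of
  D, then D is contained in S by sequential closedness, so D is trivial because S is totally
  disconnected. Otherwise a small divisible closed subgroup maps onto an infinite torus via countably
  many characters, and inside it one finds a monothetic closed subgroup that meets S trivially. So D is
  trivial, all characters have finite order, and open subgroups form a base at the identity. The
  characters are supplied by Fourier analysis on finite groups that approximate K.

  Now K is profinite, and its p-component is the limit of suitable powers of the identity map, whence S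
  contains the components of its elements and both groups are products of their p-components. The Baire
  category theorem bounds the exponent of each p-component of K modulo S. Local minimality of the quotient
  reduces to elements of order p by essentiality.\<close>

section \<open>Compact Abelian groups\<close>

text \<open>Sequential completeness controls only limits of sequences, while K need not be
  metrizable; this obstacle shapes the proof. Apart from explicit limits of powers and of partial
  products, elements are placed in S inside a closed subgroup M whose identity is cut out by
  countably many neighbourhoods. Compactness makes a decreasing sequence of closed neighbourhoods
  with this property eventually small in M, so that closure points of the trace of S on M are
  reached by sequences and the trace is closed. Uncountably many characters are an obstacle only on
  the divisible part, and there an infinite sequence of them, each nontrivial on what the previous
  ones leave, already contradicts essentiality. The exponents k_p + 1 come from root extraction: if
  y^p is a p^(k_p+1)-th power of z, then y and the p^(k_p)-th power of z, which lies in N, differ by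
  an element of order dividing p, and by essentiality such an element near the identity lies in
  S.\<close>

locale compact_abelian_group = comm_group G for G :: "'a monoid" (structure) +
  fixes T :: "'a topology"
  assumes topgroup: "topgroup G T"
    and Hausdorff: "Hausdorff_space T"
    and compact: "compact_space T"
begin

definition open_nbhd :: "'a set \<Rightarrow> bool" where
  "open_nbhd U \<longleftrightarrow> openin T U \<and> \<one> \<in> U"

definition closed_subgroup :: "'a set \<Rightarrow> bool" where
  "closed_subgroup H \<longleftrightarrow> subgroup H G \<and> closedin T H"

lemma topspace_eq [simp]: "topspace T = carrier G"
  using topgroup by (simp add: topgroup_def)

lemma continuous_map_mult:
  assumes "continuous_map Y T f" "continuous_map Y T g"
  shows "continuous_map Y T (\<lambda>x. f x \<otimes> g x)"
proof -
  have "continuous_map (prod_topology T T) T (\<lambda>(x, y). x \<otimes> y)"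
    using topgroup by (simp add: topgroup_def)
  moreover have "continuous_map Y (prod_topology T T) (\<lambda>x. (f x, g x))"
    using assms by (simp add: continuous_map_pairedI)
  ultimately have "continuous_map Y T ((\<lambda>(x, y). x \<otimes> y) \<circ> (\<lambda>x. (f x, g x)))"
    by (rule continuous_map_compose[rotated])
  then show ?thesis by (simp add: o_def)
qed

lemma continuous_map_inv:
  assumes "continuous_map Y T f"
  shows "continuous_map Y T (\<lambda>x. inv (f x))"
proof -
  have "continuous_map T T (\<lambda>x. inv x)"
    using topgroup by (simp add: topgroup_def)
  then have "continuous_map Y T ((\<lambda>x. inv x) \<circ> f)"
    using assms continuous_map_compose by blast
  then show ?thesis by (simp add: o_def)
qed

lemma continuous_map_pow:
  assumes "continuous_map Y T f"
  shows "continuous_map Y T (\<lambda>x. f x [^] (n::nat))"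
proof (induction n)
  case 0
  then show ?case by simp
next
  case (Suc n)
  then show ?case by (simp add: continuous_map_mult assms)
qed

lemmas continuous_intros_group =
  continuous_map_mult continuous_map_inv continuous_map_pow continuous_map_id[unfolded id_def]

lemma continuous_map_const_group [simp]: "a \<in> carrier G \<Longrightarrow> continuous_map Y T (\<lambda>x. a)"
  by simp

lemma openin_preimage:
  assumes "continuous_map T T f" "openin T U"
  shows "openin T {x \<in> carrier G. f x \<in> U}"
  using openin_continuous_map_preimage[OF assms] by simp

lemma closedin_preimage:
  assumes "continuous_map T T f" "closedin T U"
  shows "closedin T {x \<in> carrier G. f x \<in> U}"
  using closedin_continuous_map_preimage[OF assms] by simp

lemma open_nbhd_carrier [simp]: "open_nbhd (carrier G)"
  using openin_topspace[of T] by (simp add: open_nbhd_def)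

lemma open_nbhd_subset: "open_nbhd U \<Longrightarrow> U \<subseteq> carrier G"
  using openin_subset by (fastforce simp: open_nbhd_def)

lemma open_nbhd_Int: "open_nbhd U \<Longrightarrow> open_nbhd W \<Longrightarrow> open_nbhd (U \<inter> W)"
  by (auto simp: open_nbhd_def)

lemma open_nbhd_one: "open_nbhd U \<Longrightarrow> \<one> \<in> U"
  by (simp add: open_nbhd_def)

lemma open_nbhd_INT:
  assumes "finite I" "\<And>i. i \<in> I \<Longrightarrow> open_nbhd (U i)"
  shows "open_nbhd (carrier G \<inter> (\<Inter>i\<in>I. U i))"
  using assms
proof (induction I)
  case (insert i I)
  then have "open_nbhd (U i \<inter> (carrier G \<inter> (\<Inter>i\<in>I. U i)))" by (simp add: open_nbhd_Int)
  moreover have "U i \<inter> (carrier G \<inter> (\<Inter>i\<in>I. U i)) = carrier G \<inter> (\<Inter>i\<in>insert i I. U i)" by auto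
  ultimately show ?case by simp
qed simp

lemma open_nbhd_translate:
  assumes "openin T U" "a \<in> U"
  shows "open_nbhd {x \<in> carrier G. a \<otimes> x \<in> U}"
proof -
  have a: "a \<in> carrier G" using assms openin_subset by fastforce
  then have "continuous_map T T (\<lambda>x. a \<otimes> x)"
    by (intro continuous_intros_group continuous_map_const_group)
  then show ?thesis using openin_preimage[of "\<lambda>x. a \<otimes> x" U] assms a by (simp add: open_nbhd_def)
qed

lemma open_nbhd_inv:
  assumes "open_nbhd U" shows "open_nbhd {x \<in> carrier G. inv x \<in> U}"
proof -
  have "continuous_map T T (\<lambda>x. inv x)" by (intro continuous_intros_group)
  then show ?thesis using openin_preimage[of "\<lambda>x. inv x" U] assms by (simp add: open_nbhd_def)
qed

lemma open_nbhd_mult: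
  assumes "open_nbhd U"
  obtains W where "open_nbhd W" "W \<subseteq> U" "\<And>x y. x \<in> W \<Longrightarrow> y \<in> W \<Longrightarrow> x \<otimes> y \<in> U"
    "\<And>x. x \<in> W \<Longrightarrow> inv x \<in> W"
proof -
  have "continuous_map (prod_topology T T) T (\<lambda>(x, y). x \<otimes> y)"
    using topgroup by (simp add: topgroup_def)
  then have o: "openin (prod_topology T T) {z \<in> topspace (prod_topology T T). (\<lambda>(x, y). x \<otimes> y) z \<in> U}"
    using assms openin_continuous_map_preimage unfolding open_nbhd_def by blast
  have 1: "(\<one>, \<one>) \<in> {z \<in> topspace (prod_topology T T). (\<lambda>(x, y). x \<otimes> y) z \<in> U}"
    using assms by (simp add: open_nbhd_def)
  obtain A B where AB: "openin T A" "openin T B" "\<one> \<in> A" "\<one> \<in> B"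
    "A \<times> B \<subseteq> {z \<in> topspace (prod_topology T T). (\<lambda>(x, y). x \<otimes> y) z \<in> U}"
    using o[unfolded openin_prod_topology_alt, rule_format, OF 1] by (elim exE conjE)
  define C where "C = A \<inter> B \<inter> U"
  define W where "W = C \<inter> {x \<in> carrier G. inv x \<in> C}"
  have C: "open_nbhd C" unfolding C_def using AB assms by (auto simp: open_nbhd_def)
  then have "open_nbhd W" unfolding W_def using open_nbhd_inv open_nbhd_Int by blast
  moreover have "x \<otimes> y \<in> U" if "x \<in> W" "y \<in> W" for x y
    using that AB(5) unfolding W_def C_def by auto
  moreover have "inv x \<in> W" if "x \<in> W" for x
    using that open_nbhd_subset[OF C] unfolding W_def by auto
  ultimately show ?thesis using that unfolding W_def C_def by blast
qed

lemma open_nbhd_mult_ex: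
  "open_nbhd U \<Longrightarrow> \<exists>W. open_nbhd W \<and> W \<subseteq> U \<and> (\<forall>x\<in>W. \<forall>y\<in>W. x \<otimes> y \<in> U) \<and> (\<forall>x\<in>W. inv x \<in> W)"
  by (erule open_nbhd_mult) blast

lemma closedin_compactin: "closedin T C \<Longrightarrow> compactin T C"
  by (simp add: closedin_compact_space compact)

lemma compactin_closedin: "compactin T C \<Longrightarrow> closedin T C"
  by (simp add: compactin_imp_closedin Hausdorff)

lemma closedin_image: "continuous_map T T f \<Longrightarrow> closedin T C \<Longrightarrow> closedin T (f ` C)"
  by (meson compactin_closedin closedin_compactin image_compactin)

lemma closedin_one: "closedin T {\<one>}"
  by (simp add: closedin_Hausdorff_singleton Hausdorff)

text \<open>Take \<open>W\<close> symmetric with products of two of its elements in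
  \<open>U\<close>. If \<open>x\<close> is a closure point, the translate of \<open>W\<close> by
  \<open>x\<close> meets \<open>W\<close>, so \<open>x\<close> is a quotient of two elements of
  \<open>W\<close>.\<close>

lemma closure_open_nbhd:
  assumes "open_nbhd U"
  obtains W where "open_nbhd W" "T closure_of W \<subseteq> U"
proof -
  obtain W where W: "open_nbhd W" "W \<subseteq> U" "\<And>x y. x \<in> W \<Longrightarrow> y \<in> W \<Longrightarrow> x \<otimes> y \<in> U"
    "\<And>x. x \<in> W \<Longrightarrow> inv x \<in> W" using open_nbhd_mult[OF assms] by blast
  have "x \<in> U" if x: "x \<in> T closure_of W" for x
  proof -
    have xc: "x \<in> carrier G" using x closure_of_subset_topspace by fastforce
    have "continuous_map T T (\<lambda>y. inv x \<otimes> y)" using xc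
      by (intro continuous_intros_group continuous_map_const_group) auto
    then have "openin T {y \<in> carrier G. inv x \<otimes> y \<in> W}"
      using openin_preimage W(1) unfolding open_nbhd_def by blast
    moreover have "x \<in> {y \<in> carrier G. inv x \<otimes> y \<in> W}" using xc W(1) by (simp add: open_nbhd_def)
    ultimately obtain y where y: "y \<in> W" "y \<in> carrier G" "inv x \<otimes> y \<in> W"
      using x[unfolded in_closure_of] by (metis (no_types, lifting) mem_Collect_eq)
    then have "y \<otimes> inv (inv x \<otimes> y) \<in> U" using W by blast
    moreover have "y \<otimes> inv (inv x \<otimes> y) = x"
      using xc y by (simp add: inv_mult_group m_assoc[symmetric])
    ultimately show ?thesis by simp
  qed
  then show ?thesis using that W by blast
qed

lemma nest_nonempty:
  assumes "\<And>n::nat. closedin T (C n)" "\<And>n. C n \<noteq> {}" "\<And>n. C (Suc n) \<subseteq> C n"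
  shows "(\<Inter>n. C n) \<noteq> {}"
  by (rule compact_space_imp_nest[OF compact]) (use assms in \<open>auto intro!: decseq_SucI\<close>)

lemma nest_subset:
  assumes "\<And>n::nat. closedin T (C n)" "\<And>n. C (Suc n) \<subseteq> C n" "openin T U" "(\<Inter>n. C n) \<subseteq> U"
  obtains n where "C n \<subseteq> U"
proof -
  have "\<not> (\<forall>n. C n - U \<noteq> {})"
  proof
    assume "\<forall>n. C n - U \<noteq> {}"
    then have "(\<Inter>n. C n - U) \<noteq> {}"
      by (intro nest_nonempty) (use assms in \<open>auto intro: closedin_diff\<close>)
    then show False using assms(4) by blast
  qed
  then show ?thesis using that by blast
qed

text \<open>The fibre over \<open>y\<close> cuts the decreasing closed sets in nonempty closed sets,
  and compactness gives a common solution. Choosing a solution at each level separately would not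
  do, since the choices need not agree.\<close>

lemma nest_solve:
  assumes "\<And>n::nat. closedin T (C n)" "\<And>n. C (Suc n) \<subseteq> C n"
    and "continuous_map T Y f" "Hausdorff_space Y"
    and "\<And>n. \<exists>x\<in>C n. f x = y"
  shows "\<exists>x. (\<forall>n. x \<in> C n) \<and> f x = y"
proof -
  have y: "y \<in> topspace Y"
  proof -
    obtain x where "x \<in> C 0" "f x = y" using assms(5) by blast
    then show ?thesis using assms(1)[of 0] assms(3) closedin_subset
      by (metis continuous_map_image_subset_topspace image_subset_iff subset_iff)
  qed
  have cl: "closedin T {x \<in> topspace T. f x \<in> {y}}"
    by (rule closedin_continuous_map_preimage[OF assms(3)]) (simp add: closedin_Hausdorff_singleton assms y)
  have "(\<Inter>n. C n \<inter> {x \<in> topspace T. f x \<in> {y}}) \<noteq> {}"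
  proof (rule nest_nonempty)
    show "closedin T (C n \<inter> {x \<in> topspace T. f x \<in> {y}})" for n
      using cl assms(1) by blast
    show "C n \<inter> {x \<in> topspace T. f x \<in> {y}} \<noteq> {}" for n
      using assms(5)[of n] closedin_subset[OF assms(1)[of n]] by auto
    show "C (Suc n) \<inter> {x \<in> topspace T. f x \<in> {y}} \<subseteq> C n \<inter> {x \<in> topspace T. f x \<in> {y}}" for n
      using assms(2) by blast
  qed
  then show ?thesis by auto
qed

text \<open>Compactness turns neighbourhoods that work at single points of \<open>C\<close> into one
  that works for all of \<open>C\<close>.\<close>

lemma tube:
  assumes C: "closedin T C" and U: "openin T U" and "C \<subseteq> U"
  obtains W where "open_nbhd W" "\<And>w c. w \<in> W \<Longrightarrow> c \<in> C \<Longrightarrow> c \<otimes> w \<in> U"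
proof -
  \<comment> \<open>Two factors are reserved: one absorbs the step from the centre \<open>c\<close>
    to a nearby point of \<open>C\<close>, the other is the later shift by \<open>w\<close>.\<close>
  have "\<exists>V. open_nbhd V \<and> (\<forall>x\<in>V. \<forall>y\<in>V. c \<otimes> (x \<otimes> y) \<in> U)" if "c \<in> C" for c
  proof -
    have "open_nbhd {x \<in> carrier G. c \<otimes> x \<in> U}" using open_nbhd_translate[OF U] that assms by blast
    from open_nbhd_mult_ex[OF this] show ?thesis by blast
  qed
  then obtain V where V: "\<And>c. c \<in> C \<Longrightarrow> open_nbhd (V c)"
    "\<And>c x y. c \<in> C \<Longrightarrow> x \<in> V c \<Longrightarrow> y \<in> V c \<Longrightarrow> c \<otimes> (x \<otimes> y) \<in> U"
    by metis
  have Cc: "C \<subseteq> carrier G" using C closedin_subset by fastforce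
  define O' where "O' = (\<lambda>c. {x \<in> carrier G. inv c \<otimes> x \<in> V c})"
  have O': "openin T (O' c)" if "c \<in> C" for c
  proof -
    have "continuous_map T T (\<lambda>y. inv c \<otimes> y)" using that Cc
      by (intro continuous_intros_group continuous_map_const_group) auto
    then show ?thesis unfolding O'_def using openin_preimage V(1)[OF that] by (simp add: open_nbhd_def)
  qed
  have "C \<subseteq> \<Union>(O' ` C)"
  proof
    fix c assume c: "c \<in> C"
    then have "c \<in> O' c" using Cc open_nbhd_one[OF V(1)[OF c]] by (auto simp: O'_def)
    then show "c \<in> \<Union>(O' ` C)" using c by blast
  qed
  then obtain F where F: "finite F" "F \<subseteq> O' ` C" "C \<subseteq> \<Union>F"
    using closedin_compactin[OF C] O' unfolding compactin_def by (metis (no_types, lifting) imageE)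
  obtain D where D: "finite D" "D \<subseteq> C" "F = O' ` D" using F finite_subset_image by metis
  define W where "W = carrier G \<inter> (\<Inter>c\<in>D. V c)"
  have "open_nbhd W" unfolding W_def using D V by (intro open_nbhd_INT) auto
  moreover have "c \<otimes> w \<in> U" if w: "w \<in> W" and c: "c \<in> C" for w c
  proof -
    obtain d where d: "d \<in> D" "c \<in> O' d" using F D c by blast
    then have "d \<otimes> ((inv d \<otimes> c) \<otimes> w) \<in> U"
      using V(2)[of d "inv d \<otimes> c" w] w D unfolding O'_def W_def by auto
    moreover have "d \<otimes> ((inv d \<otimes> c) \<otimes> w) = c \<otimes> w"
      using d D Cc c w unfolding W_def by (auto simp: m_assoc[symmetric] subset_iff)
    ultimately show ?thesis by simp
  qed
  ultimately show ?thesis using that by blast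
qed

lemma closed_subgroupD:
  assumes "closed_subgroup H"
  shows "closedin T H" "subgroup H G" "H \<subseteq> carrier G" "\<one> \<in> H"
    "\<And>x y. x \<in> H \<Longrightarrow> y \<in> H \<Longrightarrow> x \<otimes> y \<in> H" "\<And>x. x \<in> H \<Longrightarrow> inv x \<in> H"
  using assms by (auto simp: closed_subgroup_def subgroup_def intro: subgroup.m_inv_closed)

lemma subgroup_pow:
  assumes "subgroup H G" "x \<in> H" shows "x [^] (n::nat) \<in> H"
  using assms by (induction n) (auto intro: subgroup.m_closed subgroup.one_closed)

lemma subgroupI':
  assumes "H \<subseteq> carrier G" "\<one> \<in> H" "\<And>x y. x \<in> H \<Longrightarrow> y \<in> H \<Longrightarrow> x \<otimes> y \<in> H"
    "\<And>x. x \<in> H \<Longrightarrow> inv x \<in> H"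
  shows "subgroup H G"
  using assms by (simp add: subgroup.intro)

lemma closed_subgroup_carrier: "closed_subgroup (carrier G)"
  unfolding closed_subgroup_def using closedin_topspace[of T] subgroup_self by auto

lemma closed_subgroup_Int: "closed_subgroup H \<Longrightarrow> closed_subgroup L \<Longrightarrow> closed_subgroup (H \<inter> L)"
  unfolding closed_subgroup_def using subgroups_Inter_pair by blast

lemma closed_subgroup_Inter:
  assumes "\<H> \<noteq> {}" "\<And>H. H \<in> \<H> \<Longrightarrow> closed_subgroup H"
  shows "closed_subgroup (\<Inter>\<H>)"
  unfolding closed_subgroup_def
  using assms subgroups_Inter[of \<H>] closedin_Inter[of \<H> T] unfolding closed_subgroup_def by blast

lemma closed_subgroup_pow_set:
  assumes "closed_subgroup H" shows "closed_subgroup (pow_set G n H)"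
proof -
  note H = closed_subgroupD[OF assms]
  have "subgroup (pow_set G n H) G"
  proof (rule subgroupI')
    show "pow_set G n H \<subseteq> carrier G" using H by (auto simp: pow_set_def)
    show "\<one> \<in> pow_set G n H" using H by (auto simp: pow_set_def image_iff intro!: bexI[of _ \<one>])
    show "x \<otimes> y \<in> pow_set G n H" if xy: "x \<in> pow_set G n H" "y \<in> pow_set G n H" for x y
    proof -
      obtain a b where "a \<in> H" "b \<in> H" "x = a [^] n" "y = b [^] n" using xy by (auto simp: pow_set_def)
      then have "x \<otimes> y = (a \<otimes> b) [^] n" "a \<otimes> b \<in> H"
        using H by (auto simp: pow_mult_distrib m_comm subset_iff)
      then show ?thesis by (auto simp: pow_set_def)
    qed
    show "inv x \<in> pow_set G n H" if x: "x \<in> pow_set G n H" for x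
    proof -
      obtain a where "a \<in> H" "x = a [^] n" using x by (auto simp: pow_set_def)
      then have "inv x = (inv a) [^] n" "inv a \<in> H"
        using H by (auto simp: nat_pow_inv subset_iff)
      then show ?thesis by (auto simp: pow_set_def)
    qed
  qed
  moreover have "closedin T (pow_set G n H)"
    unfolding pow_set_def by (intro closedin_image continuous_intros_group H)
  ultimately show ?thesis by (simp add: closed_subgroup_def)
qed

lemma pow_set_mult:
  assumes "H \<subseteq> carrier G"
  shows "pow_set G n (pow_set G m H) = pow_set G (m * n) H"
  using assms by (auto simp: pow_set_def image_iff nat_pow_pow subset_iff)

lemma pow_set_subset: "closed_subgroup H \<Longrightarrow> pow_set G n H \<subseteq> H"
  using closed_subgroupD(2) subgroup_pow by (auto simp: pow_set_def)

lemma pow_set_mono: "H \<subseteq> L \<Longrightarrow> pow_set G n H \<subseteq> pow_set G n L"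
  by (auto simp: pow_set_def)

lemma pow_set_dvd:
  assumes "closed_subgroup H" "m dvd n" shows "pow_set G n H \<subseteq> pow_set G m H"
proof -
  obtain k where "n = k * m" using assms by (metis dvd_def mult.commute)
  then show ?thesis using pow_set_mult[OF closed_subgroupD(3)[OF assms(1)], of m k] pow_set_mono pow_set_subset assms
    by metis
qed

lemma closure_subgroup:
  assumes "subgroup H G" shows "closed_subgroup (T closure_of H)"
proof -
  have Hc: "H \<subseteq> carrier G" using assms subgroup.subset by blast
  have cc: "T closure_of H \<subseteq> carrier G" using closure_of_subset_topspace by fastforce
  have HT: "H \<subseteq> T closure_of H" using Hc by (simp add: closure_of_subset)
  have im: "f ` (T closure_of H) \<subseteq> T closure_of H"
    if "continuous_map T T f" "f ` H \<subseteq> T closure_of H" for f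
    by (meson that closedin_closure_of closure_of_minimal continuous_map_image_closure_subset order_trans)
  have m1: "a \<otimes> b \<in> T closure_of H" if "a \<in> H" "b \<in> T closure_of H" for a b
  proof -
    have "(\<lambda>b. a \<otimes> b) ` (T closure_of H) \<subseteq> T closure_of H"
      by (rule im) (use that Hc HT assms subgroup.m_closed[OF assms] in \<open>auto intro!: continuous_intros_group\<close>)
    then show ?thesis using that by blast
  qed
  have m2: "a \<otimes> b \<in> T closure_of H" if "a \<in> T closure_of H" "b \<in> T closure_of H" for a b
  proof -
    have "(\<lambda>a. a \<otimes> b) ` (T closure_of H) \<subseteq> T closure_of H"
      by (rule im) (use that cc m1 in \<open>auto intro!: continuous_intros_group\<close>)
    then show ?thesis using that by blast
  qed
  have i: "inv a \<in> T closure_of H" if "a \<in> T closure_of H" for a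
  proof -
    have "(\<lambda>a. inv a) ` (T closure_of H) \<subseteq> T closure_of H"
      by (rule im) (use HT assms subgroup.m_inv_closed[OF assms] in \<open>auto intro!: continuous_intros_group\<close>)
    then show ?thesis using that by blast
  qed
  show ?thesis unfolding closed_subgroup_def
    using subgroupI'[OF cc _ m2 i] HT assms subgroup.one_closed by auto
qed

section \<open>Divisible closed subgroups\<close>

definition divisible :: "'a set \<Rightarrow> bool" where
  "divisible H \<longleftrightarrow> (\<forall>n>0. H \<subseteq> pow_set G n H)"

text \<open>Factorials are cofinal for divisibility, so these are the elements with an n-th root in
  \<open>H\<close> for every positive n, written as the intersection of a decreasing sequence. Every
  divisible subset of \<open>H\<close> lies in it.\<close>

definition divisible_part :: "'a set \<Rightarrow> 'a set" where
  "divisible_part H = (\<Inter>n. pow_set G (fact n) H)"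

lemma pow_set_fact_Suc: "closed_subgroup H \<Longrightarrow> pow_set G (fact (Suc n)) H \<subseteq> pow_set G (fact n) H"
  by (rule pow_set_dvd) auto

lemma closed_subgroup_divisible_part: "closed_subgroup H \<Longrightarrow> closed_subgroup (divisible_part H)"
  unfolding divisible_part_def by (intro closed_subgroup_Inter) (auto intro: closed_subgroup_pow_set)

lemma divisible_part_subset: "closed_subgroup H \<Longrightarrow> divisible_part H \<subseteq> H"
  unfolding divisible_part_def using pow_set_subset by blast

lemma divisible_part_mono: "H \<subseteq> L \<Longrightarrow> divisible_part H \<subseteq> divisible_part L"
  unfolding divisible_part_def by (intro INF_mono') (rule pow_set_mono)

text \<open>An arbitrary m-th root of a member might leave the intersection. At level n the root is
  taken from a root of order \<open>fact (n + m)\<close>, which leaves enough divisibility because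
  \<open>fact n * m\<close> divides \<open>fact (n + m)\<close>; compactness then yields a root
  lying in all levels at once.\<close>

lemma divisible_divisible_part:
  assumes "closed_subgroup H" shows "divisible (divisible_part H)"
  unfolding divisible_def
proof (intro allI impI subsetI)
  fix m :: nat and x assume m: "m > 0" and x: "x \<in> divisible_part H"
  have "\<exists>y. (\<forall>n. y \<in> pow_set G (fact n) H) \<and> y [^] m = x"
  proof (rule nest_solve[where Y = T])
    show "closedin T (pow_set G (fact n) H)" for n using closed_subgroup_pow_set[OF assms] closed_subgroupD by blast
    show "pow_set G (fact (Suc n)) H \<subseteq> pow_set G (fact n) H" for n by (rule pow_set_fact_Suc[OF assms])
    show "continuous_map T T (\<lambda>y. y [^] m)" by (intro continuous_intros_group)
    show "Hausdorff_space T" by (rule Hausdorff)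
    show "\<exists>y\<in>pow_set G (fact n) H. y [^] m = x" for n
    proof -
      have "fact n * m dvd fact (n + m)"
      proof -
        have "m dvd fact m" using m by (simp add: dvd_fact)
        then have "fact n * m dvd fact n * fact m" by simp
        then show ?thesis using fact_fact_dvd_fact[of n m] dvd_trans by (metis of_nat_id)
      qed
      then obtain k where k: "fact (n + m) = k * (fact n * m)" by (metis dvd_def mult.commute)
      obtain z where z: "z \<in> H" "x = z [^] (fact (n + m) :: nat)"
        using x unfolding divisible_part_def pow_set_def by blast
      have zc: "z \<in> carrier G" using z closed_subgroupD[OF assms] by blast
      have "(z [^] k) [^] (fact n :: nat) \<in> pow_set G (fact n) H"
        using z subgroup_pow closed_subgroupD[OF assms] by (auto simp: pow_set_def)
      moreover have "((z [^] k) [^] (fact n :: nat)) [^] m = x"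
        using z zc k by (simp add: nat_pow_pow mult.assoc)
      ultimately show ?thesis by blast
    qed
  qed
  then obtain y where "\<forall>n. y \<in> pow_set G (fact n) H" "y [^] m = x" by blast
  then show "x \<in> pow_set G m (divisible_part H)" by (auto simp: divisible_part_def pow_set_def)
qed

end

section \<open>Characters separate points\<close>

text \<open>Parseval's identity. The hypothesis is the completeness relation, with the sum running
  over the characters; after expanding the square, summing over \<open>k\<close> first leaves only
  the diagonal.\<close>

lemma sum_character_square:
  fixes e :: "'c \<Rightarrow> 'b \<Rightarrow> complex" and a :: "'b \<Rightarrow> real"
  assumes "finite B" "finite I"
    and "\<And>x y. x \<in> B \<Longrightarrow> y \<in> B \<Longrightarrow> (\<Sum>k\<in>I. e k x * cnj (e k y)) = (if x = y then of_nat n else 0)"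
  shows "(\<Sum>k\<in>I. (cmod (\<Sum>x\<in>B. of_real (a x) * cnj (e k x)))\<^sup>2) = real n * (\<Sum>x\<in>B. (a x)\<^sup>2)"
proof -
  have "of_real (\<Sum>k\<in>I. (cmod (\<Sum>x\<in>B. of_real (a x) * cnj (e k x)))\<^sup>2) =
    (\<Sum>k\<in>I. (\<Sum>x\<in>B. of_real (a x) * cnj (e k x)) * (\<Sum>y\<in>B. of_real (a y) * e k y))"
    unfolding of_real_sum by (intro sum.cong refl) (simp only: complex_norm_square cnj_sum complex_cnj_mult complex_cnj_complex_of_real complex_cnj_cnj)
  also have "\<dots> = (\<Sum>k\<in>I. \<Sum>x\<in>B. \<Sum>y\<in>B. of_real (a x) * of_real (a y) * (e k y * cnj (e k x)))"
    unfolding sum_product by (intro sum.cong refl) (simp add: mult_ac)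
  also have "\<dots> = (\<Sum>x\<in>B. \<Sum>y\<in>B. of_real (a x) * of_real (a y) * (\<Sum>k\<in>I. e k y * cnj (e k x)))"
    by (subst sum.swap, rule sum.cong[OF refl], subst sum.swap) (simp add: sum_distrib_left)
  also have "\<dots> = (\<Sum>x\<in>B. \<Sum>y\<in>B. if y = x then of_real (a x) * of_real (a x) * of_nat n else 0)"
    by (intro sum.cong refl) (simp add: assms(3))
  also have "\<dots> = (\<Sum>x\<in>B. of_real (a x) * of_real (a x) * of_nat n)"
    using assms(1) by (simp add: sum.delta)
  also have "\<dots> = of_real (real n * (\<Sum>x\<in>B. (a x)\<^sup>2))"
    by (simp add: sum_distrib_left power2_eq_square mult_ac)
  finally show ?thesis using of_real_eq_iff by blast
qed

text \<open>A weighted average: with \<open>F\<close> the transform of \<open>g\<close>,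
  \<open>E\<close> its square sum and \<open>S\<close> the square sum of its autocorrelation
  \<open>\<phi>\<close>, Parseval for \<open>g\<close> and for \<open>\<phi>\<close> makes the sum
  of |F k|^2 (S - |F k|^2 E) vanish. Hence S cannot exceed |F k|^2 E for every k, except when all
  coefficients vanish, and then \<open>S\<close> is 0 too.\<close>

lemma large_Fourier_coefficient:
  fixes \<Gamma> :: "'b monoid" and e :: "'c \<Rightarrow> 'b \<Rightarrow> complex" and g :: "'b \<Rightarrow> real"
  assumes grp: "group \<Gamma>" and fin: "finite (carrier \<Gamma>)" "finite I"
    and hom: "\<And>k x y. k \<in> I \<Longrightarrow> x \<in> carrier \<Gamma> \<Longrightarrow> y \<in> carrier \<Gamma> \<Longrightarrow> e k (x \<otimes>\<^bsub>\<Gamma>\<^esub> y) = e k x * e k y"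
    and nrm: "\<And>k x. k \<in> I \<Longrightarrow> cmod (e k x) = 1"
    and compl: "\<And>x y. x \<in> carrier \<Gamma> \<Longrightarrow> y \<in> carrier \<Gamma> \<Longrightarrow>
      (\<Sum>k\<in>I. e k x * cnj (e k y)) = (if x = y then of_nat (card (carrier \<Gamma>)) else 0)"
  shows "\<exists>k\<in>I. (\<Sum>u\<in>carrier \<Gamma>. (\<Sum>t\<in>carrier \<Gamma>. g (t \<otimes>\<^bsub>\<Gamma>\<^esub> u) * g t)\<^sup>2)
     \<le> (cmod (\<Sum>x\<in>carrier \<Gamma>. of_real (g x) * cnj (e k x)))\<^sup>2 * (\<Sum>t\<in>carrier \<Gamma>. (g t)\<^sup>2)"
proof (rule ccontr)
  interpret group \<Gamma> by (rule grp)
  define B where "B = carrier \<Gamma>"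
  define n where "n = card B"
  define F where "F = (\<lambda>k. \<Sum>x\<in>B. of_real (g x) * cnj (e k x))"
  define \<phi> where "\<phi> = (\<lambda>u. \<Sum>t\<in>B. g (t \<otimes>\<^bsub>\<Gamma>\<^esub> u) * g t)"
  define E where "E = (\<Sum>t\<in>B. (g t)\<^sup>2)"
  define S where "S = (\<Sum>u\<in>B. (\<phi> u)\<^sup>2)"
  assume "\<not> ?thesis"
  then have less: "(cmod (F k))\<^sup>2 * E < S" if "k \<in> I" for k
    using that unfolding F_def E_def S_def \<phi>_def B_def by (meson not_less)
  have Bf: "finite B" using fin by (simp add: B_def)
  have npos: "n > 0" unfolding n_def B_def using fin(1) one_closed by (metis card_gt_0_iff empty_iff)
  \<comment> \<open>The transform of the autocorrelation is |F|^2; the substitution of x for the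
    product of t and u separates the double sum.\<close>
  have F2: "of_real ((cmod (F k))\<^sup>2) = (\<Sum>u\<in>B. of_real (\<phi> u) * cnj (e k u))" if k: "k \<in> I" for k
  proof -
    have ek: "e k t * cnj (e k t) = 1" for t
      using nrm[OF k, of t] complex_norm_square[of "e k t"] by simp
    have "(\<Sum>u\<in>B. of_real (\<phi> u) * cnj (e k u))
      = (\<Sum>u\<in>B. \<Sum>t\<in>B. of_real (g (t \<otimes>\<^bsub>\<Gamma>\<^esub> u)) * of_real (g t) * cnj (e k u))"
      unfolding \<phi>_def by (simp add: sum_distrib_right)
    also have "\<dots> = (\<Sum>t\<in>B. \<Sum>u\<in>B. of_real (g (t \<otimes>\<^bsub>\<Gamma>\<^esub> u)) * of_real (g t) * cnj (e k u))"
      by (rule sum.swap)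
    also have "\<dots> = (\<Sum>t\<in>B. \<Sum>x\<in>B. of_real (g x) * of_real (g t) * (cnj (e k x) * e k t))"
    proof (rule sum.cong[OF refl])
      fix t assume t: "t \<in> B"
      have bij: "bij_betw (\<lambda>u. t \<otimes>\<^bsub>\<Gamma>\<^esub> u) B B"
        unfolding bij_betw_def B_def using t inj_on_cmult[of t] surj_const_mult[of t] by (simp add: B_def)
      have "(\<Sum>x\<in>B. of_real (g x) * of_real (g t) * (cnj (e k x) * e k t)) =
         (\<Sum>u\<in>B. of_real (g (t \<otimes>\<^bsub>\<Gamma>\<^esub> u)) * of_real (g t) * (cnj (e k (t \<otimes>\<^bsub>\<Gamma>\<^esub> u)) * e k t))"
        by (rule sum.reindex_bij_betw[OF bij, symmetric])
      also have "\<dots> = (\<Sum>u\<in>B. of_real (g (t \<otimes>\<^bsub>\<Gamma>\<^esub> u)) * of_real (g t) * cnj (e k u))"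
      proof (rule sum.cong[OF refl])
        fix u assume u: "u \<in> B"
        have "cnj (e k (t \<otimes>\<^bsub>\<Gamma>\<^esub> u)) * e k t = (e k t * cnj (e k t)) * cnj (e k u)"
          using hom[OF k] t u by (simp add: B_def)
        then show "of_real (g (t \<otimes>\<^bsub>\<Gamma>\<^esub> u)) * of_real (g t) * (cnj (e k (t \<otimes>\<^bsub>\<Gamma>\<^esub> u)) * e k t)
          = of_real (g (t \<otimes>\<^bsub>\<Gamma>\<^esub> u)) * of_real (g t) * cnj (e k u)" by (simp add: ek)
      qed
      finally show "(\<Sum>u\<in>B. of_real (g (t \<otimes>\<^bsub>\<Gamma>\<^esub> u)) * of_real (g t) * cnj (e k u)) =
        (\<Sum>x\<in>B. of_real (g x) * of_real (g t) * (cnj (e k x) * e k t))" by simp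
    qed
    also have "\<dots> = (\<Sum>x\<in>B. of_real (g x) * cnj (e k x)) * (\<Sum>t\<in>B. of_real (g t) * e k t)"
      unfolding sum_product by (subst sum.swap) (simp add: mult_ac)
    also have "\<dots> = F k * cnj (F k)" by (simp add: F_def)
    also have "\<dots> = of_real ((cmod (F k))\<^sup>2)" by (metis complex_norm_square)
    finally show ?thesis by simp
  qed
  have pars1: "(\<Sum>k\<in>I. (cmod (F k))\<^sup>2) = n * E"
    unfolding F_def E_def n_def
    by (rule sum_character_square) (use Bf fin compl in \<open>auto simp: B_def\<close>)
  have "(\<Sum>k\<in>I. ((cmod (F k))\<^sup>2)\<^sup>2) = (\<Sum>k\<in>I. (cmod (\<Sum>u\<in>B. of_real (\<phi> u) * cnj (e k u)))\<^sup>2)"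
  proof (rule sum.cong[OF refl])
    fix k assume "k \<in> I"
    then have "cmod (\<Sum>u\<in>B. of_real (\<phi> u) * cnj (e k u)) = (cmod (F k))\<^sup>2"
      by (metis F2 abs_of_nonneg norm_of_real zero_le_power2)
    then show "((cmod (F k))\<^sup>2)\<^sup>2 = (cmod (\<Sum>u\<in>B. of_real (\<phi> u) * cnj (e k u)))\<^sup>2" by simp
  qed
  also have "\<dots> = n * S" unfolding S_def n_def
    by (rule sum_character_square) (use Bf fin compl in \<open>auto simp: B_def\<close>)
  finally have pars2: "(\<Sum>k\<in>I. ((cmod (F k))\<^sup>2)\<^sup>2) = n * S" .
  have "(\<Sum>k\<in>I. (cmod (F k))\<^sup>2 * (S - (cmod (F k))\<^sup>2 * E)) =
     S * (\<Sum>k\<in>I. (cmod (F k))\<^sup>2) - E * (\<Sum>k\<in>I. ((cmod (F k))\<^sup>2)\<^sup>2)"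
    by (simp add: sum_distrib_left sum_subtractf[symmetric] algebra_simps power2_eq_square)
  also have "\<dots> = 0" unfolding pars1 pars2 by simp
  finally have "(\<Sum>k\<in>I. (cmod (F k))\<^sup>2 * (S - (cmod (F k))\<^sup>2 * E)) = 0" .
  moreover have "0 \<le> (cmod (F k))\<^sup>2 * (S - (cmod (F k))\<^sup>2 * E)" if "k \<in> I" for k
    using less[OF that] by simp
  ultimately have "(cmod (F k))\<^sup>2 * (S - (cmod (F k))\<^sup>2 * E) = 0" if "k \<in> I" for k
    using that fin(2) by (simp add: sum_nonneg_eq_0_iff)
  then have "(cmod (F k))\<^sup>2 = 0" if "k \<in> I" for k
    using less[OF that] that by fastforce
  then have "n * E = 0" using pars1 by simp
  then have "E = 0" using npos by simp
  then have g0: "g t = 0" if "t \<in> B" for t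
    using that Bf unfolding E_def by (simp add: sum_nonneg_eq_0_iff)
  then have "\<phi> u = 0" if "u \<in> B" for u unfolding \<phi>_def by simp
  then have "S = 0" by (simp add: S_def)
  moreover obtain k where "k \<in> I"
  proof -
    have "(\<Sum>k\<in>I. e k \<one>\<^bsub>\<Gamma>\<^esub> * cnj (e k \<one>\<^bsub>\<Gamma>\<^esub>)) \<noteq> 0" using compl[of "\<one>\<^bsub>\<Gamma>\<^esub>" "\<one>\<^bsub>\<Gamma>\<^esub>"] npos by (simp add: n_def B_def)
    then have "I \<noteq> {}" by auto
    then show ?thesis using that by blast
  qed
  ultimately show False using less[of k] \<open>E = 0\<close> by simp
qed

text \<open>The completeness relation for the integers modulo \<open>N\<close>: the sum runs over
  the exponent \<open>j\<close>, and for distinct residues it is geometric with ratio an N-th root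
  of unity other than 1.\<close>

lemma roots_of_unity_orthogonality:
  assumes "x \<in> {0..<int N}" "y \<in> {0..<int N}"
  shows "(\<Sum>j<N. cis (2 * pi * of_int x / real N) ^ j * cnj (cis (2 * pi * of_int y / real N) ^ j))
    = (if x = y then of_nat N else 0)"
proof -
  have N: "N > 0" using assms by auto
  define w where "w = (\<lambda>x::int. cis (2 * pi * of_int x / real N))"
  have wN: "w x ^ N = 1" for x
    using N by (simp add: w_def Complex.DeMoivre)
  have wu: "w x * cnj (w x) = 1" for x by (simp add: w_def cis_cnj cis_mult)
  have inj: "w x \<noteq> w y" if "x \<noteq> y"
  proof
    assume eq: "w x = w y"
    have "nat x \<in> {..<N}" "nat y \<in> {..<N}" using assms by auto
    moreover have "cis (2 * pi * real (nat x) / real N) = cis (2 * pi * real (nat y) / real N)"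
      using eq assms unfolding w_def by simp
    ultimately have "nat x = nat y"
      using Complex.bij_betw_roots_unity[OF N] unfolding bij_betw_def inj_on_def by blast
    then show False using that assms by auto
  qed
  define z where "z = w x * cnj (w y)"
  have "(\<Sum>j<N. w x ^ j * cnj (w y ^ j)) = (\<Sum>j<N. z ^ j)"
    by (simp add: z_def power_mult_distrib)
  also have "\<dots> = (if x = y then of_nat N else 0)"
  proof (cases "x = y")
    case True
    then show ?thesis by (simp add: z_def wu)
  next
    case False
    have "z \<noteq> 1"
    proof
      assume "z = 1"
      then have "w y * z = w y" by simp
      then have "w x * (w y * cnj (w y)) = w y" by (simp add: z_def mult_ac)
      then show False using wu inj[OF False] by simp
    qed
    moreover have "z ^ N = 1" by (simp add: z_def power_mult_distrib wN complex_cnj_power[symmetric] del: complex_cnj_power)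
    ultimately show ?thesis using False by (simp add: sum_gp_strict)
  qed
  finally show ?thesis unfolding w_def .
qed

context compact_abelian_group
begin

section \<open>Finite models of a compact Abelian group\<close>

lemma finite_cover:
  assumes "open_nbhd W"
  obtains F where "finite F" "F \<subseteq> carrier G" "\<And>x. x \<in> carrier G \<Longrightarrow> \<exists>f\<in>F. inv f \<otimes> x \<in> W"
proof -
  define O' where "O' = (\<lambda>c. {x \<in> carrier G. inv c \<otimes> x \<in> W})"
  have O': "openin T (O' c)" if "c \<in> carrier G" for c
  proof -
    have "continuous_map T T (\<lambda>y. inv c \<otimes> y)" using that
      by (intro continuous_intros_group continuous_map_const_group) auto
    then show ?thesis unfolding O'_def using openin_preimage assms by (simp add: open_nbhd_def)
  qed
  have "carrier G \<subseteq> \<Union>(O' ` carrier G)"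
  proof
    fix c assume c: "c \<in> carrier G"
    then have "c \<in> O' c" using open_nbhd_one[OF assms] by (auto simp: O'_def)
    then show "c \<in> \<Union>(O' ` carrier G)" using c by blast
  qed
  moreover have "compactin T (carrier G)" using compact by (simp add: compact_space_def)
  ultimately obtain F where F: "finite F" "F \<subseteq> O' ` carrier G" "carrier G \<subseteq> \<Union>F"
    using O' unfolding compactin_def by (metis (no_types, lifting) imageE)
  obtain D where D: "finite D" "D \<subseteq> carrier G" "F = O' ` D" using F finite_subset_image by metis
  have "\<exists>f\<in>D. inv f \<otimes> x \<in> W" if "x \<in> carrier G" for x
    using F(3) D(3) that unfolding O'_def by blast
  then show ?thesis using that D by blast
qed

lemma open_nbhd_finprod:
  assumes "finite A" "open_nbhd W"
  obtains W0 where "open_nbhd W0" "\<And>g. g \<in> A \<rightarrow> W0 \<Longrightarrow> finprod G g A \<in> W"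
proof -
  have "\<exists>W0. open_nbhd W0 \<and> (\<forall>g. g \<in> A \<rightarrow> W0 \<longrightarrow> finprod G g A \<in> W)"
    using assms
  proof (induction A arbitrary: W rule: finite_induct)
    case empty
    then show ?case using open_nbhd_one by auto
  next
    case (insert a A)
    obtain W1 where W1: "open_nbhd W1" "W1 \<subseteq> W" "\<And>x y. x \<in> W1 \<Longrightarrow> y \<in> W1 \<Longrightarrow> x \<otimes> y \<in> W"
      "\<And>x. x \<in> W1 \<Longrightarrow> inv x \<in> W1"
      using open_nbhd_mult[OF insert.prems] by blast
    obtain W0 where W0: "open_nbhd W0" "\<forall>g. g \<in> A \<rightarrow> W0 \<longrightarrow> finprod G g A \<in> W1"
      using insert.IH[OF W1(1)] by blast
    have "finprod G g (insert a A) \<in> W" if g: "g \<in> insert a A \<rightarrow> W0 \<inter> W1" for g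
    proof -
      have c: "g \<in> A \<rightarrow> carrier G" "g a \<in> carrier G" using g open_nbhd_subset[OF W0(1)] by auto
      have "finprod G g (insert a A) = g a \<otimes> finprod G g A"
        using insert.hyps c by simp
      moreover have "g a \<in> W1" "finprod G g A \<in> W1" using g W0(2) by auto
      ultimately show ?thesis using W1(3) by simp
    qed
    then show ?case using open_nbhd_Int[OF W0(1) W1(1)] by blast
  qed
  then show ?thesis using that by blast
qed

text \<open>Simultaneous Dirichlet approximation: colour n by the cells of a finite cover that
  contain the n-th powers of the elements of \<open>A\<close>. Two exponents of the same colour
  differ by a suitable \<open>N\<close>.\<close>

lemma simultaneous_recurrence:
  assumes A: "finite A" "A \<subseteq> carrier G" and W: "open_nbhd W"
  obtains N :: nat where "N \<ge> 2" "\<And>a. a \<in> A \<Longrightarrow> a [^] N \<in> W"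
proof -
  obtain W1 where W1: "open_nbhd W1" "W1 \<subseteq> W" "\<And>x y. x \<in> W1 \<Longrightarrow> y \<in> W1 \<Longrightarrow> x \<otimes> y \<in> W"
      "\<And>x. x \<in> W1 \<Longrightarrow> inv x \<in> W1"
      using open_nbhd_mult[OF W] by blast
  obtain F where F: "finite F" "F \<subseteq> carrier G" "\<And>x. x \<in> carrier G \<Longrightarrow> \<exists>f\<in>F. inv f \<otimes> x \<in> W1"
    using finite_cover[OF W1(1)] by blast
  then obtain s where s: "\<And>x. x \<in> carrier G \<Longrightarrow> s x \<in> F \<and> inv (s x) \<otimes> x \<in> W1" by metis
  define c where "c = (\<lambda>n::nat. \<lambda>a\<in>A. s (a [^] n))"
  have "c ` UNIV \<subseteq> PiE A (\<lambda>_. F)" using s A unfolding c_def by auto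
  then have "finite (c ` UNIV)" using A F finite_PiE finite_subset by metis
  then obtain m where m: "infinite {n \<in> UNIV. c n = c m}"
    using pigeonhole_infinite[of UNIV c] by auto
  \<comment> \<open>Cutting at \<open>m + 1\<close> instead of \<open>m\<close> makes
    \<open>N\<close> at least 2, so that 1 is a reduced residue modulo \<open>N\<close>, as the unit
    tuples of the finite model require.\<close>
  then have "infinite ({n \<in> UNIV. c n = c m} - {..m + 1})" by auto
  then have "{n \<in> UNIV. c n = c m} - {..m + 1} \<noteq> {}" by (metis finite.emptyI)
  then obtain n where "n \<in> {n \<in> UNIV. c n = c m} - {..m + 1}" by blast
  then have n: "c n = c m" "n > m + 1" by auto
  have "a [^] (n - m) \<in> W" if a: "a \<in> A" for a
  proof -
    have ac: "a \<in> carrier G" using a A by blast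
    define f where "f = s (a [^] n)"
    have f': "f = s (a [^] m)" using n(1) a unfolding c_def f_def by (metis restrict_apply')
    have fc: "f \<in> carrier G" using s[of "a [^] n"] ac F unfolding f_def by auto
    have "inv f \<otimes> a [^] n \<in> W1" "inv f \<otimes> a [^] m \<in> W1"
      using s[of "a [^] n"] s[of "a [^] m"] ac f' f_def by auto
    then have "inv (inv f \<otimes> a [^] m) \<otimes> (inv f \<otimes> a [^] n) \<in> W" using W1 by blast
    moreover have "a [^] n = a [^] m \<otimes> a [^] (n - m)" using ac n(2) by (simp add: nat_pow_mult)
    moreover have "inv (inv f \<otimes> a [^] m) \<otimes> (inv f \<otimes> (a [^] m \<otimes> a [^] (n - m))) = a [^] (n - m)"
    proof -
      have "inv p \<otimes> (p \<otimes> c) = c" if "p \<in> carrier G" "c \<in> carrier G" for p c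
        using that by (simp add: m_assoc[symmetric])
      from this[of "inv f \<otimes> a [^] m" "a [^] (n - m)"] show ?thesis using ac fc by (simp add: m_assoc)
    qed
    ultimately show ?thesis by simp
  qed
  moreover have "n - m \<ge> 2" using n(2) by simp
  ultimately show ?thesis using that by blast
qed

text \<open>The model is a power of the integers modulo N, where the N-th powers of the elements of A are close
  to the identity; a tuple x is sent to the product of the powers of a with exponents x a.\<close>

lemma finite_model:
  assumes A: "finite A" "A \<subseteq> carrier G" and W: "open_nbhd W"
  shows "\<exists>(\<Gamma> :: ('a \<Rightarrow> int) monoid) (I :: ('a \<Rightarrow> nat) set) (e :: ('a \<Rightarrow> nat) \<Rightarrow> ('a \<Rightarrow> int) \<Rightarrow> complex) \<alpha> E.
    group \<Gamma> \<and> finite (carrier \<Gamma>) \<and> finite I \<and>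
    (\<forall>k\<in>I. \<forall>x\<in>carrier \<Gamma>. \<forall>y\<in>carrier \<Gamma>. e k (x \<otimes>\<^bsub>\<Gamma>\<^esub> y) = e k x * e k y) \<and>
    (\<forall>k\<in>I. \<forall>x. cmod (e k x) = 1) \<and>
    (\<forall>x\<in>carrier \<Gamma>. \<forall>y\<in>carrier \<Gamma>. 
      (\<Sum>k\<in>I. e k x * cnj (e k y)) = (if x = y then of_nat (card (carrier \<Gamma>)) else 0)) \<and>
    (\<forall>x\<in>carrier \<Gamma>. \<alpha> x \<in> carrier G) \<and>
    (\<forall>x\<in>carrier \<Gamma>. \<forall>y\<in>carrier \<Gamma>. \<exists>w\<in>W. \<alpha> x \<otimes> \<alpha> y = \<alpha> (x \<otimes>\<^bsub>\<Gamma>\<^esub> y) \<otimes> w) \<and>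
    (\<forall>a\<in>A. E a \<in> carrier \<Gamma> \<and> \<alpha> (E a) = a)"
proof -
  obtain W0 where W0: "open_nbhd W0" "\<And>g. g \<in> A \<rightarrow> W0 \<Longrightarrow> finprod G g A \<in> W"
    using open_nbhd_finprod[OF A(1) W] by blast
  obtain N :: nat where N: "N \<ge> 2" "\<And>a. a \<in> A \<Longrightarrow> a [^] N \<in> W0"
    using simultaneous_recurrence[OF A W0(1)] by blast
  have Ac: "a \<in> carrier G" if "a \<in> A" for a using that A by blast
  define \<Gamma> where "\<Gamma> = product_group A (\<lambda>_. integer_mod_group N)"
  define I where "I = PiE A (\<lambda>_. {..<N})"
  define w where "w = (\<lambda>x::int. cis (2 * pi * of_int x / real N))"
  define e where "e = (\<lambda>(k :: 'a \<Rightarrow> nat) (x :: 'a \<Rightarrow> int). \<Prod>a\<in>A. w (x a) ^ k a)"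
  define \<alpha> where "\<alpha> = (\<lambda>x :: 'a \<Rightarrow> int. finprod G (\<lambda>a. a [^] x a) A)"
  \<comment> \<open>Unit tuples: through them \<open>\<alpha>\<close> hits every element of
    \<open>A\<close> exactly, not just approximately.\<close>
  define E where "E = (\<lambda>a. \<lambda>b\<in>A. if b = a then 1 else (0::int))"
  have car: "carrier \<Gamma> = PiE A (\<lambda>_. {0..<int N})"
    using N(1) by (simp add: \<Gamma>_def carrier_integer_mod_group)
  have fin: "finite (carrier \<Gamma>)" unfolding car using A by (intro finite_PiE) auto
  have cd: "card (carrier \<Gamma>) = N ^ card A" unfolding car using A by (simp add: card_PiE)
  have mul: "x \<otimes>\<^bsub>\<Gamma>\<^esub> y = (\<lambda>a\<in>A. (x a + y a) mod int N)" for x y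
    by (simp add: \<Gamma>_def)
  have wadd: "w (x + y) = w x * w y" for x y
    by (simp add: w_def cis_mult add_divide_distrib distrib_left)
  have wN: "w (int N * q) = 1" for q
  proof -
    have "2 * pi * of_int (int N * q) / real N = 2 * pi * of_int q" using N(1) by simp
    then show ?thesis unfolding w_def by (metis Ints_of_int cis_multiple_2pi)
  qed
  have wmod: "w (x mod int N) = w x" for x
  proof -
    have "w x = w (int N * (x div int N) + x mod int N)" by simp
    also have "\<dots> = w (x mod int N)" unfolding wadd wN by simp
    finally show ?thesis by simp
  qed
  have hom: "e k (x \<otimes>\<^bsub>\<Gamma>\<^esub> y) = e k x * e k y" for k x y
    unfolding e_def mul by (simp add: wmod wadd power_mult_distrib prod.distrib)
  have nrm: "cmod (e k x) = 1" for k x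
    unfolding e_def w_def by (simp add: prod_norm[symmetric] norm_power)
  have compl: "(\<Sum>k\<in>I. e k x * cnj (e k y)) = (if x = y then of_nat (card (carrier \<Gamma>)) else 0)"
    if x: "x \<in> carrier \<Gamma>" and y: "y \<in> carrier \<Gamma>" for x y
  proof -
    have "(\<Sum>k\<in>I. e k x * cnj (e k y)) = (\<Sum>k\<in>I. \<Prod>a\<in>A. w (x a) ^ k a * cnj (w (y a) ^ k a))"
      unfolding e_def by (simp add: prod.distrib)
    also have "\<dots> = (\<Prod>a\<in>A. \<Sum>j<N. w (x a) ^ j * cnj (w (y a) ^ j))"
      unfolding I_def by (rule prod_sum_PiE[symmetric]) (use A in auto)
    also have "\<dots> = (\<Prod>a\<in>A. if x a = y a then of_nat N else 0)"
      unfolding w_def using x y unfolding car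
      by (intro prod.cong refl roots_of_unity_orthogonality) auto
    also have "\<dots> = (if x = y then of_nat (card (carrier \<Gamma>)) else 0)"
    proof (cases "x = y")
      case False
      then obtain a where "a \<in> A" "x a \<noteq> y a" using x y unfolding car by (metis PiE_ext)
      then show ?thesis using False A by (auto intro!: prod_zero)
    qed (simp add: cd)
    finally show ?thesis .
  qed
  have ac: "\<alpha> x \<in> carrier G" for x
    unfolding \<alpha>_def using Ac by (intro finprod_closed) auto
  have def: "\<exists>v\<in>W. \<alpha> x \<otimes> \<alpha> y = \<alpha> (x \<otimes>\<^bsub>\<Gamma>\<^esub> y) \<otimes> v"
    if x: "x \<in> carrier \<Gamma>" and y: "y \<in> carrier \<Gamma>" for x y
  proof -
    \<comment> \<open>The carry: a sum of two residues passes \<open>N\<close> at most once, so the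
      defect of \<open>\<alpha>\<close> is a product of factors that are \<open>\<one>\<close> or an
      N-th power of some \<open>a\<close>, all in \<open>W0\<close>.\<close>
    define v where "v = (\<lambda>a. (a [^] N) [^] ((x a + y a) div int N))"
    have vW: "v a \<in> W0" if a: "a \<in> A" for a
    proof -
      have "x a \<in> {0..<int N}" "y a \<in> {0..<int N}" using x y a unfolding car by auto
      then have "(x a + y a) div int N = 0 \<or> (x a + y a) div int N = 1"
        using N(1) by (cases "x a + y a < int N") (auto simp: div_pos_geq)
      then show ?thesis using N(2)[OF a] open_nbhd_one[OF W0(1)] Ac[OF a] unfolding v_def by auto
    qed
    have vc: "v a \<in> carrier G" if "a \<in> A" for a using vW[OF that] open_nbhd_subset[OF W0(1)] by blast
    have "\<alpha> x \<otimes> \<alpha> y = finprod G (\<lambda>a. a [^] x a \<otimes> a [^] y a) A"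
      unfolding \<alpha>_def by (rule finprod_multf[symmetric]) (use Ac in auto)
    also have "\<dots> = finprod G (\<lambda>a. a [^] ((x \<otimes>\<^bsub>\<Gamma>\<^esub> y) a) \<otimes> v a) A"
    proof (rule finprod_cong')
      fix a assume a: "a \<in> A"
      have "a [^] x a \<otimes> a [^] y a = a [^] ((x a + y a) mod int N + int N * ((x a + y a) div int N))"
        using Ac[OF a] by (simp add: int_pow_mult)
      also have "\<dots> = a [^] ((x a + y a) mod int N) \<otimes> v a"
        using Ac[OF a] by (simp only: int_pow_mult v_def int_pow_pow[symmetric] int_pow_int)
      finally show "a [^] x a \<otimes> a [^] y a = a [^] ((x \<otimes>\<^bsub>\<Gamma>\<^esub> y) a) \<otimes> v a" using a by (simp add: mul)
    qed (use Ac vc in auto)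
    also have "\<dots> = \<alpha> (x \<otimes>\<^bsub>\<Gamma>\<^esub> y) \<otimes> finprod G v A"
      unfolding \<alpha>_def by (rule finprod_multf) (use Ac vc in auto)
    finally show ?thesis using W0(2)[of v] vW by blast
  qed
  have E: "E a \<in> carrier \<Gamma> \<and> \<alpha> (E a) = a" if a: "a \<in> A" for a
  proof
    show "E a \<in> carrier \<Gamma>" unfolding E_def car using N(1) by auto
    have "\<alpha> (E a) = finprod G (\<lambda>b. if b = a then b else \<one>) A"
      unfolding \<alpha>_def by (rule finprod_cong') (use Ac in \<open>auto simp: E_def\<close>)
    also have "\<dots> = a" using finprod_singleton_swap[OF a A(1), of "\<lambda>x. x"] Ac by auto
    finally show "\<alpha> (E a) = a" .
  qed
  have "finite I" unfolding I_def using A by (intro finite_PiE) auto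
  moreover have "group \<Gamma>" unfolding \<Gamma>_def by (rule product_group) simp
  ultimately show ?thesis
    using fin hom nrm compl ac def E
    by (intro exI[of _ \<Gamma>] exI[of _ I] exI[of _ e] exI[of _ \<alpha>] exI[of _ E]) simp
qed

text \<open>The values are covered by finitely many closed bands of half-width 1/n. The tube lemma
  keeps small translates of each band inside the open band of twice that half-width, and finitely
  many neighbourhoods can be intersected.\<close>

lemma uniform_continuity:
  fixes f :: "'a \<Rightarrow> real"
  assumes f: "continuous_map T euclideanreal f" "\<And>x. x \<in> carrier G \<Longrightarrow> 0 \<le> f x \<and> f x \<le> 1" and \<epsilon>: "\<epsilon> > 0"
  obtains U where "open_nbhd U" "\<And>u t. u \<in> U \<Longrightarrow> t \<in> carrier G \<Longrightarrow> \<bar>f (t \<otimes> u) - f t\<bar> \<le> \<epsilon>"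
proof -
  obtain n :: nat where n: "n > 0" "3 / real n < \<epsilon>"
  proof -
    obtain n :: nat where "real n > max 1 (3 / \<epsilon>)" using reals_Archimedean2 by blast
    then have "n > 0" "3 / \<epsilon> < real n" by auto
    then show ?thesis using that[of n] \<epsilon> by (simp add: field_simps)
  qed
  define C where "C = (\<lambda>j::nat. {t \<in> topspace T. f t \<in> {real j / n - 1 / n .. real j / n + 1 / n}})"
  define V where "V = (\<lambda>j::nat. {t \<in> topspace T. f t \<in> {real j / n - 2 / n <..< real j / n + 2 / n}})"
  have C: "closedin T (C j)" for j
    unfolding C_def by (rule closedin_continuous_map_preimage[OF f(1)]) (simp add: closed_closedin[symmetric])
  have V: "openin T (V j)" for j
    unfolding V_def by (rule openin_continuous_map_preimage[OF f(1)]) (simp add: open_openin[symmetric])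
  have CV: "C j \<subseteq> V j" for j unfolding C_def V_def using n(1) by (auto simp: field_simps)
  have "\<exists>W. open_nbhd W \<and> (\<forall>w\<in>W. \<forall>c\<in>C j. c \<otimes> w \<in> V j)" for j
    using tube[OF C V CV, of j] by metis
  then obtain W where W: "\<And>j. open_nbhd (W j)" "\<And>j w c. w \<in> W j \<Longrightarrow> c \<in> C j \<Longrightarrow> c \<otimes> w \<in> V j"
    by metis
  define U where "U = carrier G \<inter> (\<Inter>j\<in>{..n}. W j)"
  have "open_nbhd U" unfolding U_def by (rule open_nbhd_INT) (use W in auto)
  moreover have "\<bar>f (t \<otimes> u) - f t\<bar> \<le> \<epsilon>" if u: "u \<in> U" and t: "t \<in> carrier G" for u t
  proof -
    define j where "j = nat \<lfloor>f t * n\<rfloor>"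
    have j1: "real j \<le> f t * n" "f t * n < real j + 1"
      using f(2)[OF t] unfolding j_def by (auto simp: of_nat_nat)
    have "real j \<le> real n" using j1(1) f(2)[OF t] mult_right_mono[of "f t" 1 "real n"] by simp
    then have jn: "j \<le> n" by simp
    have tC: "t \<in> C j" using t j1 n(1) unfolding C_def by (auto simp: field_simps)
    moreover have "u \<in> W j" using u jn unfolding U_def by auto
    ultimately have "t \<otimes> u \<in> V j" using W(2) by blast
    then have "f (t \<otimes> u) < real j / n + 2 / n" "f (t \<otimes> u) > real j / n - 2 / n" unfolding V_def by auto
    moreover have "f t \<le> real j / n + 1 / n" "f t \<ge> real j / n - 1 / n" using tC unfolding C_def by auto
    ultimately have "\<bar>f (t \<otimes> u) - f t\<bar> < 3 / n" by (auto simp: abs_less_iff add_divide_distrib diff_divide_distrib)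
    then show ?thesis using n by simp
  qed
  ultimately show ?thesis using that by blast
qed

text \<open>Counting in the model replaces an estimate with Haar measure: the translates by the
  elements \<open>E b\<close>, with b in \<open>F\<close>, of the set where \<open>\<alpha>\<close>
  lands in \<open>U\<close> cover the model. That set has proportion at least 1 /
  \<open>card F\<close>, whatever the size of the model.\<close>

lemma model_density:
  fixes \<Gamma> :: "'b monoid"
  assumes grp: "group \<Gamma>" "finite (carrier \<Gamma>)"
    and \<alpha>: "\<And>x. x \<in> carrier \<Gamma> \<Longrightarrow> \<alpha> x \<in> carrier G"
    and "def": "\<And>x y. x \<in> carrier \<Gamma> \<Longrightarrow> y \<in> carrier \<Gamma> \<Longrightarrow> \<exists>w\<in>W. \<alpha> x \<otimes> \<alpha> y = \<alpha> (x \<otimes>\<^bsub>\<Gamma>\<^esub> y) \<otimes> w"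
    and E: "\<And>a. a \<in> A \<Longrightarrow> E a \<in> carrier \<Gamma> \<and> \<alpha> (E a) = a"
    and F: "finite F" "F \<subseteq> A" "F \<subseteq> carrier G" "\<And>x. x \<in> carrier G \<Longrightarrow> \<exists>f\<in>F. inv f \<otimes> x \<in> U'"
    and U: "W \<subseteq> U'" "U' \<subseteq> carrier G" "\<And>x y. x \<in> U' \<Longrightarrow> y \<in> U' \<Longrightarrow> x \<otimes> y \<in> U"
  shows "card (carrier \<Gamma>) \<le> card F * card {t \<in> carrier \<Gamma>. \<alpha> t \<in> U}"
proof -
  interpret \<Gamma>: group \<Gamma> by (rule grp)
  define Q where "Q = {t \<in> carrier \<Gamma>. \<alpha> t \<in> U}"
  have "carrier \<Gamma> \<subseteq> (\<Union>b\<in>F. (\<lambda>t'. t' \<otimes>\<^bsub>\<Gamma>\<^esub> E b) ` Q)"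
  proof
    fix t assume t: "t \<in> carrier \<Gamma>"
    obtain b where b: "b \<in> F" "inv b \<otimes> \<alpha> t \<in> U'" using F(4) \<alpha>[OF t] by blast
    have bc: "b \<in> carrier G" "E b \<in> carrier \<Gamma>" "\<alpha> (E b) = b" using b F E by auto
    define t' where "t' = t \<otimes>\<^bsub>\<Gamma>\<^esub> inv\<^bsub>\<Gamma>\<^esub> E b"
    have t': "t' \<in> carrier \<Gamma>" "t' \<otimes>\<^bsub>\<Gamma>\<^esub> E b = t" using t bc by (auto simp: t'_def \<Gamma>.m_assoc)
    obtain w where w: "w \<in> W" "\<alpha> t' \<otimes> b = \<alpha> t \<otimes> w" using "def"[OF t'(1) bc(2)] bc t' by auto
    have wc: "w \<in> carrier G" using w U by blast
    have "\<alpha> t' = inv b \<otimes> (b \<otimes> \<alpha> t')" using \<alpha>[OF t'(1)] bc(1) by (simp add: m_assoc[symmetric])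
    also have "\<dots> = inv b \<otimes> (\<alpha> t \<otimes> w)" using w(2) m_comm[OF \<alpha>[OF t'(1)] bc(1)] by simp
    also have "\<dots> = (inv b \<otimes> \<alpha> t) \<otimes> w" using \<alpha>[OF t] bc wc by (simp add: m_assoc)
    finally have "\<alpha> t' \<in> U" using U(3) b(2) w(1) U(1) by auto
    then have "t' \<in> Q" using t' by (simp add: Q_def)
    then show "t \<in> (\<Union>b\<in>F. (\<lambda>t'. t' \<otimes>\<^bsub>\<Gamma>\<^esub> E b) ` Q)" using t'(2) b(1) by blast
  qed
  moreover have Qf: "finite Q" using grp by (simp add: Q_def)
  ultimately have "card (carrier \<Gamma>) \<le> card (\<Union>b\<in>F. (\<lambda>t'. t' \<otimes>\<^bsub>\<Gamma>\<^esub> E b) ` Q)"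
    using F(1) by (intro card_mono) auto
  also have "\<dots> \<le> (\<Sum>b\<in>F. card ((\<lambda>t'. t' \<otimes>\<^bsub>\<Gamma>\<^esub> E b) ` Q))" by (rule card_UN_le[OF F(1)])
  also have "\<dots> \<le> (\<Sum>b\<in>F. card Q)" by (intro sum_mono card_image_le Qf)
  finally show ?thesis by (simp add: Q_def)
qed

text \<open>The transform of h on a finite model has a large coefficient at some character. Comparing it with the
  transform of a translate of h shows that the character is close to 1 wherever translation hardly
  changes h.\<close>

lemma approximate_character:
  fixes f :: "'a \<Rightarrow> real"
  assumes f: "continuous_map T euclideanreal f" "\<And>x. x \<in> carrier G \<Longrightarrow> 0 \<le> f x \<and> f x \<le> 1"
    and x0: "x0 \<in> carrier G" "f x0 \<noteq> f \<one>"
  defines "h \<equiv> \<lambda>t. f t - f (t \<otimes> x0)"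
  shows "\<exists>\<kappa>>0. \<forall>A \<eta>. finite A \<and> A \<subseteq> carrier G \<and> \<eta> > 0 \<longrightarrow> (\<exists>\<xi> :: 'a \<Rightarrow> complex.
    (\<forall>a. cmod (\<xi> a) = 1) \<and> (\<forall>a\<in>A. \<forall>b\<in>A. cmod (\<xi> (a \<otimes> b) - \<xi> a * \<xi> b) \<le> \<eta>) \<and>
    (\<forall>a\<in>A. \<forall>c. (\<forall>t\<in>carrier G. \<bar>h (t \<otimes> a) - h t\<bar> \<le> c) \<longrightarrow> cmod (\<xi> a - 1) * \<kappa> \<le> c + \<eta>) \<and>
    \<kappa> \<le> cmod (\<xi> x0 - 1))"
proof -
  have hU: "\<exists>U. open_nbhd U \<and> (\<forall>u\<in>U. \<forall>t\<in>carrier G. \<bar>h (t \<otimes> u) - h t\<bar> \<le> \<epsilon> \<and> \<bar>f (t \<otimes> u) - f t\<bar> \<le> \<epsilon>)"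
    if e: "\<epsilon> > 0" for \<epsilon>
  proof -
    have "\<epsilon> / 2 > 0" using e by simp
    then obtain U where U: "open_nbhd U" "\<And>u t. u \<in> U \<Longrightarrow> t \<in> carrier G \<Longrightarrow> \<bar>f (t \<otimes> u) - f t\<bar> \<le> \<epsilon> / 2"
      using uniform_continuity[OF f] by blast
    have "\<bar>h (t \<otimes> u) - h t\<bar> \<le> \<epsilon> \<and> \<bar>f (t \<otimes> u) - f t\<bar> \<le> \<epsilon>" if u: "u \<in> U" and t: "t \<in> carrier G" for u t
    proof -
      have uc: "u \<in> carrier G" using u open_nbhd_subset[OF U(1)] by blast
      have "t \<otimes> u \<otimes> x0 = t \<otimes> x0 \<otimes> u" using uc t x0 by (simp add: m_ac)
      then have "h (t \<otimes> u) - h t = (f (t \<otimes> u) - f t) - (f (t \<otimes> x0 \<otimes> u) - f (t \<otimes> x0))"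
        unfolding h_def by simp
      moreover have "\<bar>f (t \<otimes> x0 \<otimes> u) - f (t \<otimes> x0)\<bar> \<le> \<epsilon> / 2" using U(2)[OF u, of "t \<otimes> x0"] t x0 by simp
      ultimately show ?thesis using U(2)[OF u t] e by linarith
    qed
    then show ?thesis using U(1) by blast
  qed
  have hb: "\<bar>h t\<bar> \<le> 1" if "t \<in> carrier G" for t
    using f(2)[OF that] f(2)[of "t \<otimes> x0"] that x0 unfolding h_def by auto
  define \<delta> where "\<delta> = \<bar>h \<one>\<bar>"
  have \<delta>: "\<delta> > 0" using x0 unfolding \<delta>_def h_def by auto
  have "\<delta> / 2 > 0" using \<delta> by simp
  then obtain U0 where U0: "open_nbhd U0" "\<forall>u\<in>U0. \<forall>t\<in>carrier G. \<bar>h (t \<otimes> u) - h t\<bar> \<le> \<delta> / 2 \<and> \<bar>f (t \<otimes> u) - f t\<bar> \<le> \<delta> / 2"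
    using hU by blast
  obtain V0 where V0: "open_nbhd V0" "V0 \<subseteq> U0" "\<And>x y. x \<in> V0 \<Longrightarrow> y \<in> V0 \<Longrightarrow> x \<otimes> y \<in> U0" "\<And>x. x \<in> V0 \<Longrightarrow> inv x \<in> V0"
    using open_nbhd_mult[OF U0(1)] by blast
  obtain F0 where F0: "finite F0" "F0 \<subseteq> carrier G" "\<And>x. x \<in> carrier G \<Longrightarrow> \<exists>f\<in>F0. inv f \<otimes> x \<in> V0"
    using finite_cover[OF V0(1)] by blast
  have F0n: "card F0 > 0" using F0(1) F0(3)[OF one_closed] by (auto simp: card_gt_0_iff)
  \<comment> \<open>Lower bound for the mean square of \<open>h\<close> over the models below: near
    the identity |h| is at least \<open>\<delta> / 2\<close>, and this region has proportion at
    least 1 / \<open>card F0\<close>.\<close>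
  define c0 where "c0 = \<delta>\<^sup>2 / (4 * card F0)"
  have c0: "c0 > 0" using \<delta> F0n by (simp add: c0_def)
  have "sqrt c0 > 0" using c0 by simp
  then obtain U1 where U1: "open_nbhd U1" "\<forall>u\<in>U1. \<forall>t\<in>carrier G. \<bar>h (t \<otimes> u) - h t\<bar> \<le> sqrt c0 \<and> \<bar>f (t \<otimes> u) - f t\<bar> \<le> sqrt c0"
    using hU by blast
  obtain V1 where V1: "open_nbhd V1" "V1 \<subseteq> U1" "\<And>x y. x \<in> V1 \<Longrightarrow> y \<in> V1 \<Longrightarrow> x \<otimes> y \<in> U1" "\<And>x. x \<in> V1 \<Longrightarrow> inv x \<in> V1"
    using open_nbhd_mult[OF U1(1)] by blast
  obtain V2 where V2: "open_nbhd V2" "V2 \<subseteq> V1" "\<And>x y. x \<in> V2 \<Longrightarrow> y \<in> V2 \<Longrightarrow> x \<otimes> y \<in> V1" "\<And>x. x \<in> V2 \<Longrightarrow> inv x \<in> V2"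
    using open_nbhd_mult[OF V1(1)] by blast
  obtain F1 where F1: "finite F1" "F1 \<subseteq> carrier G" "\<And>x. x \<in> carrier G \<Longrightarrow> \<exists>f\<in>F1. inv f \<otimes> x \<in> V2"
    using finite_cover[OF V2(1)] by blast
  have F1n: "card F1 > 0" using F1(1) F1(3)[OF one_closed] by (auto simp: card_gt_0_iff)
  \<comment> \<open>Lower bound for |F| / n: the autocorrelation is at least \<open>En / 2\<close>
    on a proportion 1 / \<open>card F1\<close> of the model, so |F|^2 is at least n
    \<open>En\<close> / (4 \<open>card F1\<close>), and \<open>En\<close> is at least n
    \<open>c0\<close>. The constant is fixed before \<open>A\<close> and \<open>\<eta>\<close>, as
    the later passage to the limit requires.\<close>
  define \<kappa> where "\<kappa> = sqrt (c0 / (4 * card F1))"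
  have \<kappa>: "\<kappa> > 0" using c0 F1n by (simp add: \<kappa>_def)
  \<comment> \<open>Only half of \<open>\<kappa>\<close> is claimed because the bound at
    \<open>x0\<close> loses up to \<open>\<eta>'\<close>, which is at most
    \<open>\<kappa> / 2\<close>.\<close>
  have main: "\<exists>\<xi> :: 'a \<Rightarrow> complex.
    (\<forall>a. cmod (\<xi> a) = 1) \<and> (\<forall>a\<in>A. \<forall>b\<in>A. cmod (\<xi> (a \<otimes> b) - \<xi> a * \<xi> b) \<le> \<eta>) \<and>
    (\<forall>a\<in>A. \<forall>c. (\<forall>t\<in>carrier G. \<bar>h (t \<otimes> a) - h t\<bar> \<le> c) \<longrightarrow> cmod (\<xi> a - 1) * (\<kappa> / 2) \<le> c + \<eta>) \<and>
    \<kappa> / 2 \<le> cmod (\<xi> x0 - 1)" if A: "finite A" "A \<subseteq> carrier G" and \<eta>: "\<eta> > 0" for A \<eta>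
  proof -
    define \<eta>' where "\<eta>' = min (min (\<eta> * \<kappa> / 3) \<eta>) (\<kappa> / 2)"
    have \<eta>': "\<eta>' > 0" "3 * \<eta>' \<le> \<eta> * \<kappa>" "\<eta>' \<le> \<eta>" "\<eta>' \<le> \<kappa> / 2" unfolding \<eta>'_def using \<eta> \<kappa> by auto
    obtain U3 where U3: "open_nbhd U3" "\<forall>u\<in>U3. \<forall>t\<in>carrier G. \<bar>h (t \<otimes> u) - h t\<bar> \<le> \<eta>' \<and> \<bar>f (t \<otimes> u) - f t\<bar> \<le> \<eta>'"
      using hU[OF \<eta>'(1)] by blast
    define W where "W = U3 \<inter> (V0 \<inter> V2)"
    have W: "open_nbhd W" "W \<subseteq> U3" "W \<subseteq> V0" "W \<subseteq> V2" "W \<subseteq> V1"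
      unfolding W_def using U3(1) V0(1) V2 open_nbhd_Int by auto
    have Wc: "W \<subseteq> carrier G" using open_nbhd_subset W by blast
    \<comment> \<open>Besides \<open>A\<close> and its products, the model must hit exactly the two
      covers used for counting and the point \<open>x0\<close>.\<close>
    define A' where "A' = A \<union> (\<lambda>(a, b). a \<otimes> b) ` (A \<times> A) \<union> F0 \<union> F1 \<union> {x0}"
    have A': "finite A'" "A' \<subseteq> carrier G" unfolding A'_def using A F0 F1 x0 by auto
    from finite_model[OF A' W(1)]
    obtain \<Gamma> :: "('a \<Rightarrow> int) monoid" and I :: "('a \<Rightarrow> nat) set" and e \<alpha> E where M0:
    "group \<Gamma> \<and> finite (carrier \<Gamma>) \<and> finite I \<and>
    (\<forall>k\<in>I. \<forall>x\<in>carrier \<Gamma>. \<forall>y\<in>carrier \<Gamma>. e k (x \<otimes>\<^bsub>\<Gamma>\<^esub> y) = e k x * e k y) \<and>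
    (\<forall>k\<in>I. \<forall>x. cmod (e k x) = 1) \<and>
    (\<forall>x\<in>carrier \<Gamma>. \<forall>y\<in>carrier \<Gamma>. 
      (\<Sum>k\<in>I. e k x * cnj (e k y)) = (if x = y then of_nat (card (carrier \<Gamma>)) else 0)) \<and>
    (\<forall>x\<in>carrier \<Gamma>. \<alpha> x \<in> carrier G) \<and>
    (\<forall>x\<in>carrier \<Gamma>. \<forall>y\<in>carrier \<Gamma>. \<exists>w\<in>W. \<alpha> x \<otimes> \<alpha> y = \<alpha> (x \<otimes>\<^bsub>\<Gamma>\<^esub> y) \<otimes> w) \<and>
    (\<forall>a\<in>A'. E a \<in> carrier \<Gamma> \<and> \<alpha> (E a) = a)"
      by (elim exE) (rule that)
    have M:
      "group \<Gamma>" "finite (carrier \<Gamma>)" "finite I"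
      "\<And>k x y. k \<in> I \<Longrightarrow> x \<in> carrier \<Gamma> \<Longrightarrow> y \<in> carrier \<Gamma> \<Longrightarrow> e k (x \<otimes>\<^bsub>\<Gamma>\<^esub> y) = e k x * e k y"
      "\<And>k x. k \<in> I \<Longrightarrow> cmod (e k x) = 1"
      "\<And>x y. x \<in> carrier \<Gamma> \<Longrightarrow> y \<in> carrier \<Gamma> \<Longrightarrow>
        (\<Sum>k\<in>I. e k x * cnj (e k y)) = (if x = y then of_nat (card (carrier \<Gamma>)) else 0)"
      "\<And>x. x \<in> carrier \<Gamma> \<Longrightarrow> \<alpha> x \<in> carrier G"
      "\<And>x y. x \<in> carrier \<Gamma> \<Longrightarrow> y \<in> carrier \<Gamma> \<Longrightarrow> \<exists>w\<in>W. \<alpha> x \<otimes> \<alpha> y = \<alpha> (x \<otimes>\<^bsub>\<Gamma>\<^esub> y) \<otimes> w"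
      "\<And>a. a \<in> A' \<Longrightarrow> E a \<in> carrier \<Gamma> \<and> \<alpha> (E a) = a"
      using M0 by blast+
    interpret \<Gamma>: group \<Gamma> by (rule M(1))
    define B where "B = carrier \<Gamma>"
    define n where "n = card B"
    have npos: "n > 0" unfolding n_def B_def using M(2) \<Gamma>.one_closed by (metis card_gt_0_iff empty_iff)
    define g where "g = (\<lambda>t. h (\<alpha> t))"
    define En where "En = (\<Sum>t\<in>B. (g t)\<^sup>2)"
    define \<phi> where "\<phi> = (\<lambda>u. \<Sum>t\<in>B. g (t \<otimes>\<^bsub>\<Gamma>\<^esub> u) * g t)"
    have Bf: "finite B" using M by (simp add: B_def)
    have Ec: "E a \<in> B" "\<alpha> (E a) = a" if "a \<in> A'" for a using M(9)[OF that] by (auto simp: B_def)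
    have \<alpha>B: "\<alpha> t \<in> carrier G" if "t \<in> B" for t using M(7) that by (simp add: B_def)
    have Bm: "t \<otimes>\<^bsub>\<Gamma>\<^esub> u \<in> B" if "t \<in> B" "u \<in> B" for t u using that by (simp add: B_def)
    have d0: "real n \<le> card F0 * card {t \<in> carrier \<Gamma>. \<alpha> t \<in> U0}"
    proof -
      have "card (carrier \<Gamma>) \<le> card F0 * card {t \<in> carrier \<Gamma>. \<alpha> t \<in> U0}"
        by (rule model_density[OF M(1,2,7,8,9) F0(1) _ F0(2,3) W(3) open_nbhd_subset[OF V0(1)] V0(3)])
          (auto simp: A'_def)
      then show ?thesis unfolding n_def B_def by (metis of_nat_le_iff of_nat_mult)
    qed
    have d1: "real n \<le> card F1 * card {t \<in> carrier \<Gamma>. \<alpha> t \<in> V1}"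
    proof -
      have "card (carrier \<Gamma>) \<le> card F1 * card {t \<in> carrier \<Gamma>. \<alpha> t \<in> V1}"
        by (rule model_density[OF M(1,2,7,8,9) F1(1) _ F1(2,3) W(4) open_nbhd_subset[OF V2(1)] V2(3)])
          (unfold A'_def, blast+)
      then show ?thesis unfolding n_def B_def by (metis of_nat_le_iff of_nat_mult)
    qed
    have En: "En \<ge> n * c0"
    proof -
      have "(\<delta> / 2)\<^sup>2 \<le> (g t)\<^sup>2" if "t \<in> carrier \<Gamma>" "\<alpha> t \<in> U0" for t
      proof -
        have "\<bar>h (\<one> \<otimes> \<alpha> t) - h \<one>\<bar> \<le> \<delta> / 2" using U0(2) that(2) one_closed by blast
        then have "\<bar>h (\<alpha> t) - h \<one>\<bar> \<le> \<delta> / 2" using M(7)[OF that(1)] by simp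
        then have "\<delta> / 2 \<le> \<bar>g t\<bar>" unfolding g_def \<delta>_def by linarith
        then show ?thesis using \<delta> by (metis abs_le_square_iff abs_of_pos half_gt_zero power2_abs)
      qed
      then have "(\<Sum>t\<in>{t \<in> carrier \<Gamma>. \<alpha> t \<in> U0}. (\<delta> / 2)\<^sup>2) \<le> (\<Sum>t\<in>{t \<in> carrier \<Gamma>. \<alpha> t \<in> U0}. (g t)\<^sup>2)"
        by (intro sum_mono) auto
      also have "\<dots> \<le> En" unfolding En_def B_def using M(2) by (intro sum_mono2) auto
      finally have "card {t \<in> carrier \<Gamma>. \<alpha> t \<in> U0} * (\<delta> / 2)\<^sup>2 \<le> En" by simp
      then have "(card F0 * card {t \<in> carrier \<Gamma>. \<alpha> t \<in> U0}) * \<delta>\<^sup>2 \<le> En * (4 * card F0)"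
        using F0n mult_left_mono[of "card {t \<in> carrier \<Gamma>. \<alpha> t \<in> U0} * (\<delta> / 2)\<^sup>2" En "4 * card F0"]
        by (simp add: power_divide mult_ac)
      then have "n * \<delta>\<^sup>2 \<le> En * (4 * card F0)"
        using mult_right_mono[OF d0, of "\<delta>\<^sup>2"] by simp
      then show ?thesis unfolding c0_def using F0n by (simp add: field_simps)
    qed
    have "n * c0 > 0" using npos c0 by simp
    then have Epos: "En > 0" using En by linarith
    have shift: "\<exists>w\<in>W. \<alpha> t \<otimes> \<alpha> u = \<alpha> (t \<otimes>\<^bsub>\<Gamma>\<^esub> u) \<otimes> w" if "t \<in> B" "u \<in> B" for t u
      using M(8) that by (simp add: B_def)
    \<comment> \<open>Polarization: 2 \<open>\<phi> u\<close> is 2 \<open>En\<close> minus the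
      square sum of the increments of \<open>g\<close> under translation by \<open>u\<close>. For
      \<open>\<alpha> u\<close> near the identity that sum is at most n \<open>c0\<close>, hence at
      most \<open>En\<close>.\<close>
    have ph: "\<phi> u \<ge> En / 2" if u: "u \<in> carrier \<Gamma>" "\<alpha> u \<in> V1" for u
    proof -
      have d: "(g (t \<otimes>\<^bsub>\<Gamma>\<^esub> u) - g t)\<^sup>2 \<le> c0" if t: "t \<in> B" for t
      proof -
        have uB: "u \<in> B" using u by (simp add: B_def)
        obtain w where w: "w \<in> W" "\<alpha> t \<otimes> \<alpha> u = \<alpha> (t \<otimes>\<^bsub>\<Gamma>\<^esub> u) \<otimes> w" using shift[OF t uB] by blast
        have wc: "w \<in> carrier G" using w Wc by blast
        have "\<alpha> u \<otimes> inv w \<in> U1" using V1(3,4) u(2) w(1) W(5) by blast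
        moreover have "\<alpha> (t \<otimes>\<^bsub>\<Gamma>\<^esub> u) = \<alpha> t \<otimes> (\<alpha> u \<otimes> inv w)"
          using w(2) wc \<alpha>B[OF t] \<alpha>B[OF uB] \<alpha>B[OF Bm[OF t uB]] by (simp add: m_assoc[symmetric] inv_solve_right)
        ultimately have "\<bar>g (t \<otimes>\<^bsub>\<Gamma>\<^esub> u) - g t\<bar> \<le> sqrt c0"
          using U1(2) \<alpha>B[OF t] unfolding g_def by auto
        then have "\<bar>g (t \<otimes>\<^bsub>\<Gamma>\<^esub> u) - g t\<bar>\<^sup>2 \<le> (sqrt c0)\<^sup>2" by (intro power_mono) auto
        then show ?thesis using c0 by simp
      qed
      have bij: "bij_betw (\<lambda>t. t \<otimes>\<^bsub>\<Gamma>\<^esub> u) B B"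
      proof -
        have "inj_on (\<lambda>t. t \<otimes>\<^bsub>\<Gamma>\<^esub> u) B" using \<Gamma>.inj_on_multc u by (simp add: B_def)
        moreover have "(\<lambda>t. t \<otimes>\<^bsub>\<Gamma>\<^esub> u) ` B \<subseteq> B" using u by (auto simp: B_def)
        ultimately show ?thesis using Bf by (simp add: bij_betw_def endo_inj_surj)
      qed
      have "En = (\<Sum>t\<in>B. (g (t \<otimes>\<^bsub>\<Gamma>\<^esub> u))\<^sup>2)" unfolding En_def
        by (rule sum.reindex_bij_betw[OF bij, symmetric])
      then have "2 * \<phi> u = 2 * En - (\<Sum>t\<in>B. (g (t \<otimes>\<^bsub>\<Gamma>\<^esub> u) - g t)\<^sup>2)"
        unfolding \<phi>_def En_def
        by (simp add: power2_diff sum.distrib sum_subtractf sum_distrib_left mult_ac)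
      moreover have "(\<Sum>t\<in>B. (g (t \<otimes>\<^bsub>\<Gamma>\<^esub> u) - g t)\<^sup>2) \<le> n * c0"
        using sum_bounded_above[of B "\<lambda>t. (g (t \<otimes>\<^bsub>\<Gamma>\<^esub> u) - g t)\<^sup>2" c0] d by (simp add: n_def)
      ultimately show ?thesis using En by linarith
    qed
    obtain k where k: "k \<in> I" "(\<Sum>u\<in>carrier \<Gamma>. (\<Sum>t\<in>carrier \<Gamma>. g (t \<otimes>\<^bsub>\<Gamma>\<^esub> u) * g t)\<^sup>2)
     \<le> (cmod (\<Sum>x\<in>carrier \<Gamma>. of_real (g x) * cnj (e k x)))\<^sup>2 * (\<Sum>t\<in>carrier \<Gamma>. (g t)\<^sup>2)"
      using large_Fourier_coefficient[of \<Gamma> I e g, OF M(1-6)] by blast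
    define F where "F = (\<Sum>x\<in>B. of_real (g x) * cnj (e k x))"
    have k2: "(\<Sum>u\<in>B. (\<phi> u)\<^sup>2) \<le> (cmod F)\<^sup>2 * En" using k(2) unfolding F_def En_def \<phi>_def B_def .
    have Fbig: "cmod F \<ge> n * \<kappa>"
    proof -
      have "card {t \<in> carrier \<Gamma>. \<alpha> t \<in> V1} * (En / 2)\<^sup>2 = (\<Sum>u\<in>{t \<in> carrier \<Gamma>. \<alpha> t \<in> V1}. (En / 2)\<^sup>2)" by simp
      also have "\<dots> \<le> (\<Sum>u\<in>{t \<in> carrier \<Gamma>. \<alpha> t \<in> V1}. (\<phi> u)\<^sup>2)"
        using ph Epos by (intro sum_mono power_mono) auto
      also have "\<dots> \<le> (\<Sum>u\<in>B. (\<phi> u)\<^sup>2)" unfolding B_def using M(2) by (intro sum_mono2) auto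
      finally have "card {t \<in> carrier \<Gamma>. \<alpha> t \<in> V1} * (En / 2)\<^sup>2 \<le> (cmod F)\<^sup>2 * En" using k2 by linarith
      then have "(card {t \<in> carrier \<Gamma>. \<alpha> t \<in> V1} * En / 4) * En \<le> (cmod F)\<^sup>2 * En"
        by (simp add: power2_eq_square mult_ac)
      then have 1: "card {t \<in> carrier \<Gamma>. \<alpha> t \<in> V1} * En / 4 \<le> (cmod F)\<^sup>2" using Epos by simp
      have "n * En / (4 * card F1) \<le> card {t \<in> carrier \<Gamma>. \<alpha> t \<in> V1} * En / 4"
        using mult_right_mono[OF d1, of En] Epos F1n by (simp add: field_simps)
      then have "n * En / (4 * card F1) \<le> (cmod F)\<^sup>2" using 1 by linarith
      moreover have "n * (n * c0) / (4 * card F1) \<le> n * En / (4 * card F1)"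
        using En by (intro divide_right_mono mult_left_mono) auto
      moreover have "n * (n * c0) / (4 * card F1) = (n * \<kappa>)\<^sup>2"
        unfolding \<kappa>_def power_mult_distrib using c0 by (simp add: power2_eq_square)
      ultimately have "(n * \<kappa>)\<^sup>2 \<le> (cmod F)\<^sup>2" by linarith
      then show ?thesis by (rule power2_le_imp_le) simp
    qed
    \<comment> \<open>Translating a function by \<open>u\<close> multiplies its transform by
      \<open>e k u\<close>. The estimates for \<open>\<xi>\<close> compare such transforms and
      exploit the lower bound for |F|.\<close>
    have tr: "(\<Sum>t\<in>B. of_real (p (t \<otimes>\<^bsub>\<Gamma>\<^esub> u)) * cnj (e k t)) = e k u * (\<Sum>t\<in>B. of_real (p t) * cnj (e k t))"
      if u: "u \<in> B" for u and p :: "('a \<Rightarrow> int) \<Rightarrow> real"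
    proof -
      have bij: "bij_betw (\<lambda>t. t \<otimes>\<^bsub>\<Gamma>\<^esub> u) B B"
      proof -
        have "inj_on (\<lambda>t. t \<otimes>\<^bsub>\<Gamma>\<^esub> u) B" using \<Gamma>.inj_on_multc u by (simp add: B_def)
        moreover have "(\<lambda>t. t \<otimes>\<^bsub>\<Gamma>\<^esub> u) ` B \<subseteq> B" using u by (auto simp: B_def)
        ultimately show ?thesis using Bf by (simp add: bij_betw_def endo_inj_surj)
      qed
      have eu: "e k u * cnj (e k u) = 1" using M(5)[OF k(1), of u] complex_norm_square[of "e k u"] by simp
      have "(\<Sum>t\<in>B. of_real (p t) * cnj (e k t)) =
        (\<Sum>t\<in>B. of_real (p (t \<otimes>\<^bsub>\<Gamma>\<^esub> u)) * cnj (e k (t \<otimes>\<^bsub>\<Gamma>\<^esub> u)))"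
        by (rule sum.reindex_bij_betw[OF bij, symmetric])
      also have "\<dots> = (\<Sum>t\<in>B. cnj (e k u) * (of_real (p (t \<otimes>\<^bsub>\<Gamma>\<^esub> u)) * cnj (e k t)))"
        using u by (intro sum.cong refl) (simp add: M(4)[OF k(1)] B_def mult_ac)
      also have "\<dots> = cnj (e k u) * (\<Sum>t\<in>B. of_real (p (t \<otimes>\<^bsub>\<Gamma>\<^esub> u)) * cnj (e k t))"
        by (simp add: sum_distrib_left)
      finally show ?thesis using eu by (simp add: mult.assoc[symmetric])
    qed
    have bound: "cmod ((\<Sum>t\<in>B. of_real (p t) * cnj (e k t)) - (\<Sum>t\<in>B. of_real (q t) * cnj (e k t))) \<le> n * c"
      if pq: "\<And>t. t \<in> B \<Longrightarrow> \<bar>p t - q t\<bar> \<le> c" for p q :: "('a \<Rightarrow> int) \<Rightarrow> real" and c :: real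
    proof -
      have "(\<Sum>t\<in>B. of_real (p t) * cnj (e k t)) - (\<Sum>t\<in>B. of_real (q t) * cnj (e k t))
        = (\<Sum>t\<in>B. of_real (p t - q t) * cnj (e k t))"
        by (simp add: sum_subtractf[symmetric] left_diff_distrib)
      also have "cmod \<dots> \<le> (\<Sum>t\<in>B. \<bar>p t - q t\<bar>)"
        by (rule order_trans[OF norm_sum]) (simp add: norm_mult M(5)[OF k(1)] del: of_real_diff)
      also have "\<dots> \<le> n * c" using sum_bounded_above[of B "\<lambda>t. \<bar>p t - q t\<bar>" c] pq by (simp add: n_def)
      finally show ?thesis .
    qed
    have near: "\<bar>h (\<alpha> (t \<otimes>\<^bsub>\<Gamma>\<^esub> E a)) - h (\<alpha> t \<otimes> a)\<bar> \<le> \<eta>' \<and> \<bar>f (\<alpha> (t \<otimes>\<^bsub>\<Gamma>\<^esub> E a)) - f (\<alpha> t \<otimes> a)\<bar> \<le> \<eta>'"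
      if t: "t \<in> B" and a: "a \<in> A'" for t a
    proof -
      obtain w where w: "w \<in> W" "\<alpha> t \<otimes> a = \<alpha> (t \<otimes>\<^bsub>\<Gamma>\<^esub> E a) \<otimes> w"
        using shift[OF t Ec(1)[OF a]] Ec(2)[OF a] by auto
      then show ?thesis using U3(2) W(2) \<alpha>B[OF Bm[OF t Ec(1)[OF a]]] by (auto simp: abs_minus_commute)
    qed
    define \<xi> where "\<xi> = (\<lambda>a. if a \<in> A' then e k (E a) else 1)"
    have X1: "cmod (\<xi> a) = 1" for a unfolding \<xi>_def using M(5)[OF k(1)] by simp
    \<comment> \<open>In the model \<open>E (a \<otimes> b)\<close> need not be the product of
      \<open>E a\<close> and \<open>E b\<close>, but the corresponding translates of
      \<open>g\<close> differ by at most \<open>3 * \<eta>'\<close>.\<close>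
    have X2: "cmod (\<xi> (a \<otimes> b) - \<xi> a * \<xi> b) \<le> \<eta>" if a: "a \<in> A" and b: "b \<in> A" for a b
    proof -
      have A'': "a \<in> A'" "b \<in> A'" "a \<otimes> b \<in> A'" using a b unfolding A'_def by auto
      have ac: "a \<in> carrier G" "b \<in> carrier G" using A'' A' by auto
      have c: "E a \<in> B" "E b \<in> B" "E (a \<otimes> b) \<in> B" using Ec A'' by auto
      have "cmod ((\<Sum>t\<in>B. of_real (g (t \<otimes>\<^bsub>\<Gamma>\<^esub> E (a \<otimes> b))) * cnj (e k t)) -
         (\<Sum>t\<in>B. of_real (g ((t \<otimes>\<^bsub>\<Gamma>\<^esub> E a) \<otimes>\<^bsub>\<Gamma>\<^esub> E b)) * cnj (e k t))) \<le> n * (3 * \<eta>')"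
      proof (rule bound[of "\<lambda>t. g (t \<otimes>\<^bsub>\<Gamma>\<^esub> E (a \<otimes> b))" "\<lambda>t. g ((t \<otimes>\<^bsub>\<Gamma>\<^esub> E a) \<otimes>\<^bsub>\<Gamma>\<^esub> E b)"])
        fix t assume t: "t \<in> B"
        have ta: "t \<otimes>\<^bsub>\<Gamma>\<^esub> E a \<in> B" using t c Bm by blast
        obtain w where w: "w \<in> W" "\<alpha> t \<otimes> a = \<alpha> (t \<otimes>\<^bsub>\<Gamma>\<^esub> E a) \<otimes> w"
          using shift[OF t c(1)] Ec(2)[OF A''(1)] by auto
        have wc: "w \<in> carrier G" using w Wc by blast
        have "\<alpha> t \<otimes> (a \<otimes> b) = (\<alpha> (t \<otimes>\<^bsub>\<Gamma>\<^esub> E a) \<otimes> b) \<otimes> w"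
          using w(2) ac wc \<alpha>B[OF t] \<alpha>B[OF ta] by (metis m_assoc m_comm)
        then have "\<bar>h (\<alpha> t \<otimes> (a \<otimes> b)) - h (\<alpha> (t \<otimes>\<^bsub>\<Gamma>\<^esub> E a) \<otimes> b)\<bar> \<le> \<eta>'"
          using U3(2) w(1) W(2) \<alpha>B[OF ta] ac by auto
        then show "\<bar>g (t \<otimes>\<^bsub>\<Gamma>\<^esub> E (a \<otimes> b)) - g ((t \<otimes>\<^bsub>\<Gamma>\<^esub> E a) \<otimes>\<^bsub>\<Gamma>\<^esub> E b)\<bar> \<le> 3 * \<eta>'"
          using near[OF t A''(3)] near[OF ta A''(2)] unfolding g_def by linarith
      qed
      moreover have "(\<Sum>t\<in>B. of_real (g (t \<otimes>\<^bsub>\<Gamma>\<^esub> E (a \<otimes> b))) * cnj (e k t)) = \<xi> (a \<otimes> b) * F"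
        using tr[OF c(3), of g] A'' by (simp add: \<xi>_def F_def)
      moreover have "(\<Sum>t\<in>B. of_real (g ((t \<otimes>\<^bsub>\<Gamma>\<^esub> E a) \<otimes>\<^bsub>\<Gamma>\<^esub> E b)) * cnj (e k t)) = \<xi> a * \<xi> b * F"
        using tr[OF c(1), of "\<lambda>t. g (t \<otimes>\<^bsub>\<Gamma>\<^esub> E b)"] tr[OF c(2), of g] A'' by (simp add: \<xi>_def F_def)
      ultimately have "cmod ((\<xi> (a \<otimes> b) - \<xi> a * \<xi> b) * F) \<le> n * (3 * \<eta>')" by (simp add: left_diff_distrib)
      then have "cmod (\<xi> (a \<otimes> b) - \<xi> a * \<xi> b) * (n * \<kappa>) \<le> n * (3 * \<eta>')"
        using mult_left_mono[OF Fbig, of "cmod (\<xi> (a \<otimes> b) - \<xi> a * \<xi> b)"]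
        unfolding norm_mult by simp
      also have "\<dots> \<le> n * (\<eta> * \<kappa>)" using \<eta>'(2) by (intro mult_left_mono) auto
      finally show ?thesis using npos \<kappa> by simp
    qed
    have X3: "cmod (\<xi> a - 1) * (\<kappa> / 2) \<le> c + \<eta>"
      if a: "a \<in> A" and c: "\<forall>t\<in>carrier G. \<bar>h (t \<otimes> a) - h t\<bar> \<le> c" for a c
    proof -
      have A'': "a \<in> A'" using a unfolding A'_def by auto
      have "cmod ((\<Sum>t\<in>B. of_real (g (t \<otimes>\<^bsub>\<Gamma>\<^esub> E a)) * cnj (e k t)) -
         (\<Sum>t\<in>B. of_real (g t) * cnj (e k t))) \<le> n * (c + \<eta>')"
      proof (rule bound[of "\<lambda>t. g (t \<otimes>\<^bsub>\<Gamma>\<^esub> E a)" g])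
        fix t assume t: "t \<in> B"
        have "\<bar>h (\<alpha> t \<otimes> a) - h (\<alpha> t)\<bar> \<le> c" using c \<alpha>B[OF t] by blast
        then show "\<bar>g (t \<otimes>\<^bsub>\<Gamma>\<^esub> E a) - g t\<bar> \<le> c + \<eta>'" using near[OF t A''] unfolding g_def by linarith
      qed
      moreover have "(\<Sum>t\<in>B. of_real (g (t \<otimes>\<^bsub>\<Gamma>\<^esub> E a)) * cnj (e k t)) = \<xi> a * F"
        using tr[OF Ec(1)[OF A''], of g] A'' by (simp add: \<xi>_def F_def)
      ultimately have "cmod ((\<xi> a - 1) * F) \<le> n * (c + \<eta>')" by (simp add: left_diff_distrib F_def)
      then have "cmod (\<xi> a - 1) * (n * \<kappa>) \<le> n * (c + \<eta>')"
        using mult_left_mono[OF Fbig, of "cmod (\<xi> a - 1)"] by (simp add: norm_mult)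
      then have "n * (cmod (\<xi> a - 1) * \<kappa>) \<le> n * (c + \<eta>')" by (simp add: mult_ac)
      then have "cmod (\<xi> a - 1) * \<kappa> \<le> c + \<eta>'" using npos by simp
      moreover have "cmod (\<xi> a - 1) * (\<kappa> / 2) \<le> cmod (\<xi> a - 1) * \<kappa>" using \<kappa> by (intro mult_left_mono) auto
      ultimately show ?thesis using \<eta>'(3) by linarith
    qed
    \<comment> \<open>Since \<open>h\<close> is \<open>f\<close> minus its translate by
      \<open>x0\<close>, \<open>F\<close> is nearly (1 - \<open>\<xi> x0\<close>) times the
      transform of \<open>f\<close>, whose modulus is at most n. A value \<open>\<xi> x0\<close> too
      close to 1 would make \<open>F\<close> too small.\<close>
    have X4: "\<kappa> / 2 \<le> cmod (\<xi> x0 - 1)"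
    proof -
      define Ff where "Ff = (\<Sum>t\<in>B. of_real (f (\<alpha> t)) * cnj (e k t))"
      have A'': "x0 \<in> A'" unfolding A'_def by auto
      have "cmod ((\<Sum>t\<in>B. of_real (f (\<alpha> (t \<otimes>\<^bsub>\<Gamma>\<^esub> E x0))) * cnj (e k t)) -
         (\<Sum>t\<in>B. of_real (f (\<alpha> t \<otimes> x0)) * cnj (e k t))) \<le> n * \<eta>'"
        by (rule bound[of "\<lambda>t. f (\<alpha> (t \<otimes>\<^bsub>\<Gamma>\<^esub> E x0))" "\<lambda>t. f (\<alpha> t \<otimes> x0)"]) (use near[OF _ A''] in blast)
      moreover have "(\<Sum>t\<in>B. of_real (f (\<alpha> (t \<otimes>\<^bsub>\<Gamma>\<^esub> E x0))) * cnj (e k t)) = \<xi> x0 * Ff"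
        using tr[OF Ec(1)[OF A''], of "\<lambda>t. f (\<alpha> t)"] A'' by (simp add: \<xi>_def Ff_def)
      moreover have "F = Ff - (\<Sum>t\<in>B. of_real (f (\<alpha> t \<otimes> x0)) * cnj (e k t))"
        unfolding F_def Ff_def g_def h_def by (simp add: left_diff_distrib sum_subtractf)
      ultimately have "cmod (\<xi> x0 * Ff - (Ff - F)) \<le> n * \<eta>'" by simp
      moreover have "\<xi> x0 * Ff - (Ff - F) = F - (1 - \<xi> x0) * Ff" by (simp add: algebra_simps)
      ultimately have 1: "cmod (F - (1 - \<xi> x0) * Ff) \<le> n * \<eta>'" by metis
      have "cmod (Ff - (\<Sum>t\<in>B. of_real ((\<lambda>t. 0) t) * cnj (e k t))) \<le> real n * 1"
        unfolding Ff_def by (rule bound[of "\<lambda>t. f (\<alpha> t)" "\<lambda>t. 0"]) (use f(2) \<alpha>B in auto)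
      then have Ff: "cmod Ff \<le> n" by simp
      have "cmod F \<le> cmod (F - (1 - \<xi> x0) * Ff) + cmod ((1 - \<xi> x0) * Ff)"
        by (metis norm_triangle_sub add.commute)
      also have "\<dots> \<le> n * \<eta>' + cmod (1 - \<xi> x0) * n"
        using 1 Ff by (simp add: norm_mult add_mono mult_left_mono)
      finally have "n * \<kappa> \<le> n * (\<eta>' + cmod (\<xi> x0 - 1))" using Fbig by (simp add: algebra_simps norm_minus_commute)
      then have "\<kappa> \<le> \<eta>' + cmod (\<xi> x0 - 1)" using npos by simp
      then show ?thesis using \<eta>'(4) by linarith
    qed
    show ?thesis using X1 X2 X3 X4 by blast
  qed
  have "\<kappa> / 2 > 0" using \<kappa> by simp
  then show ?thesis using main by blast
qed

section \<open>From approximate to exact characters\<close>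

definition chars :: "('a \<Rightarrow> complex) set" where
  "chars = {\<theta>. continuous_map T euclidean \<theta> \<and> (\<forall>x\<in>carrier G. cmod (\<theta> x) = 1) \<and>
     (\<forall>x\<in>carrier G. \<forall>y\<in>carrier G. \<theta> (x \<otimes> y) = \<theta> x * \<theta> y)}"

text \<open>The approximate conditions are closed in the compact product of unit circles, and any
  finitely many of them can be met together. A point meeting all of them is exactly multiplicative.
  The bound by the variation of \<open>h\<close> is included in the family because a pointwise limit
  of functions need not be continuous.\<close>

theorem characters_separate:
  assumes x0: "x0 \<in> carrier G" "x0 \<noteq> \<one>"
  obtains \<theta> where "\<theta> \<in> chars" "\<theta> x0 \<noteq> 1"
proof -
  have "completely_regular_space T"
    by (intro normal_imp_completely_regular_space compact_Hausdorff_or_regular_imp_normal_space)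
      (auto simp: compact Hausdorff)
  moreover have "closedin T {x0}" using x0 by (simp add: closedin_Hausdorff_singleton Hausdorff)
  ultimately obtain f :: "'a \<Rightarrow> real" where f: "continuous_map T (top_of_set {0..1}) f" "f \<one> = 0" "f x0 = 1"
    unfolding completely_regular_space_def using x0 by (auto dest!: spec[of _ "{x0}"])
  have fc: "continuous_map T euclideanreal f" using f(1) continuous_map_into_fulltopology by blast
  have fb: "0 \<le> f x \<and> f x \<le> 1" if "x \<in> carrier G" for x
    using f(1) that unfolding continuous_map_in_subtopology by auto
  have fx: "f x0 \<noteq> f \<one>" using f by simp
  define h where "h = (\<lambda>t. f t - f (t \<otimes> x0))"
  have "\<exists>\<kappa>>0. \<forall>A \<eta>. finite A \<and> A \<subseteq> carrier G \<and> \<eta> > 0 \<longrightarrow> (\<exists>\<xi> :: 'a \<Rightarrow> complex.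
    (\<forall>a. cmod (\<xi> a) = 1) \<and> (\<forall>a\<in>A. \<forall>b\<in>A. cmod (\<xi> (a \<otimes> b) - \<xi> a * \<xi> b) \<le> \<eta>) \<and>
    (\<forall>a\<in>A. \<forall>c. (\<forall>t\<in>carrier G. \<bar>h (t \<otimes> a) - h t\<bar> \<le> c) \<longrightarrow> cmod (\<xi> a - 1) * \<kappa> \<le> c + \<eta>) \<and>
    \<kappa> \<le> cmod (\<xi> x0 - 1))"
    unfolding h_def by (rule approximate_character[OF fc fb x0(1) fx])
  then obtain \<kappa> where \<kappa>: "\<kappa> > 0" and app: "\<forall>A \<eta>. finite A \<and> A \<subseteq> carrier G \<and> \<eta> > 0 \<longrightarrow> (\<exists>\<xi> :: 'a \<Rightarrow> complex.
    (\<forall>a. cmod (\<xi> a) = 1) \<and> (\<forall>a\<in>A. \<forall>b\<in>A. cmod (\<xi> (a \<otimes> b) - \<xi> a * \<xi> b) \<le> \<eta>) \<and>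
    (\<forall>a\<in>A. \<forall>c. (\<forall>t\<in>carrier G. \<bar>h (t \<otimes> a) - h t\<bar> \<le> c) \<longrightarrow> cmod (\<xi> a - 1) * \<kappa> \<le> c + \<eta>) \<and>
    \<kappa> \<le> cmod (\<xi> x0 - 1))"
    by (elim exE conjE) (rule that; assumption)
  define P where "P = (\<lambda>(A, \<eta>). {\<xi> :: 'a \<Rightarrow> complex.
    (\<forall>a\<in>A. \<forall>b\<in>A. cmod (\<xi> (a \<otimes> b) - \<xi> a * \<xi> b) \<le> \<eta>) \<and>
    (\<forall>a\<in>A. \<forall>c. (\<forall>t\<in>carrier G. \<bar>h (t \<otimes> a) - h t\<bar> \<le> c) \<longrightarrow> cmod (\<xi> a - 1) * \<kappa> \<le> c + \<eta>) \<and>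
    \<kappa> \<le> cmod (\<xi> x0 - 1)})"
  define J where "J = {(A, \<eta> :: real). finite A \<and> A \<subseteq> carrier G \<and> \<eta> > 0}"
  define Z where "Z = (PiE UNIV (\<lambda>_. sphere 0 1) :: ('a \<Rightarrow> complex) set)"
  have "compactin (product_topology (\<lambda>_ :: 'a. euclidean :: complex topology) UNIV) Z"
    unfolding Z_def by (subst compactin_PiE) auto
  then have Zc: "compact Z" unfolding euclidean_product_topology by simp
  have "Z \<inter> (\<Inter>i\<in>J. P i) \<noteq> {}"
  proof (rule compact_imp_fip_image[OF Zc])
    fix i assume "i \<in> J"
    obtain A \<eta> where i: "i = (A, \<eta>)" by force
    have "P i = (\<Inter>a\<in>A. \<Inter>b\<in>A. {\<xi>. cmod (\<xi> (a \<otimes> b) - \<xi> a * \<xi> b) \<le> \<eta>}) \<inter>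
      (\<Inter>a\<in>A. \<Inter>c\<in>{c. \<forall>t\<in>carrier G. \<bar>h (t \<otimes> a) - h t\<bar> \<le> c}. {\<xi>. cmod (\<xi> a - 1) * \<kappa> \<le> c + \<eta>}) \<inter>
      {\<xi>. \<kappa> \<le> cmod (\<xi> x0 - 1)}" unfolding P_def i by auto
    also have "closed \<dots>"
      by (intro closed_Int closed_INT ballI closed_Collect_le continuous_intros) auto
    finally show "closed (P i)" .
  next
    fix I' assume I': "finite I'" "I' \<subseteq> J"
    define A where "A = (\<Union>i\<in>I'. fst i)"
    define \<eta> where "\<eta> = Min (insert 1 (snd ` I'))"
    have "finite A" "A \<subseteq> carrier G" "\<eta> > 0"
      using I' unfolding A_def \<eta>_def J_def by (fastforce simp: split_beta)+
    then obtain \<xi> :: "'a \<Rightarrow> complex" where \<xi>: "\<forall>a. cmod (\<xi> a) = 1" "\<forall>a\<in>A. \<forall>b\<in>A. cmod (\<xi> (a \<otimes> b) - \<xi> a * \<xi> b) \<le> \<eta>"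
      "\<forall>a\<in>A. \<forall>c. (\<forall>t\<in>carrier G. \<bar>h (t \<otimes> a) - h t\<bar> \<le> c) \<longrightarrow> cmod (\<xi> a - 1) * \<kappa> \<le> c + \<eta>"
      "\<kappa> \<le> cmod (\<xi> x0 - 1)" using app[rule_format, of A \<eta>] by (elim meta_impE) auto
    have "\<xi> \<in> P i" if i: "i \<in> I'" for i
    proof -
      have s: "fst i \<subseteq> A" "\<eta> \<le> snd i" using i I'(1) unfolding A_def \<eta>_def by auto
      have "cmod (\<xi> (a \<otimes> b) - \<xi> a * \<xi> b) \<le> snd i" if "a \<in> fst i" "b \<in> fst i" for a b
        using \<xi>(2) s that by (meson order_trans subsetD)
      moreover have "cmod (\<xi> a - 1) * \<kappa> \<le> c + snd i" if "a \<in> fst i" "\<forall>t\<in>carrier G. \<bar>h (t \<otimes> a) - h t\<bar> \<le> c" for a c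
      proof -
        have "cmod (\<xi> a - 1) * \<kappa> \<le> c + \<eta>" using \<xi>(3) s that by blast
        then show ?thesis using s by linarith
      qed
      ultimately show ?thesis using \<xi>(4) unfolding P_def by (simp add: split_beta)
    qed
    moreover have "\<xi> \<in> Z" using \<xi>(1) unfolding Z_def by auto
    ultimately show "Z \<inter> (\<Inter>i\<in>I'. P i) \<noteq> {}" by blast
  qed
  then obtain \<theta> where \<theta>: "\<theta> \<in> Z" "\<And>i. i \<in> J \<Longrightarrow> \<theta> \<in> P i" by blast
  have n1: "cmod (\<theta> x) = 1" for x using \<theta>(1) unfolding Z_def by auto
  have hom: "\<theta> (a \<otimes> b) = \<theta> a * \<theta> b" if ab: "a \<in> carrier G" "b \<in> carrier G" for a b
  proof -
    have "cmod (\<theta> (a \<otimes> b) - \<theta> a * \<theta> b) \<le> \<eta>" if "\<eta> > 0" for \<eta>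
      using \<theta>(2)[of "({a, b}, \<eta>)"] ab that unfolding J_def P_def by auto
    then have "cmod (\<theta> (a \<otimes> b) - \<theta> a * \<theta> b) \<le> 0"
      using field_le_epsilon[of "cmod (\<theta> (a \<otimes> b) - \<theta> a * \<theta> b)" 0] by fastforce
    then show ?thesis by simp
  qed
  have sm: "cmod (\<theta> a - 1) * \<kappa> \<le> c" if a: "a \<in> carrier G" and c: "\<forall>t\<in>carrier G. \<bar>h (t \<otimes> a) - h t\<bar> \<le> c" for a c
  proof (rule field_le_epsilon)
    fix \<eta> :: real assume "\<eta> > 0"
    then show "cmod (\<theta> a - 1) * \<kappa> \<le> c + \<eta>"
      using \<theta>(2)[of "({a}, \<eta>)"] a c unfolding J_def P_def by auto
  qed
  have nt: "\<theta> x0 \<noteq> 1"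
    using \<theta>(2)[of "({}, 1)"] \<kappa> unfolding J_def P_def by auto
  have cont: "continuous_map T euclidean \<theta>"
    unfolding continuous_map_def
  proof (intro conjI allI impI)
    fix V :: "complex set" assume "openin euclidean V"
    then have V: "open V" by simp
    show "openin T {x \<in> topspace T. \<theta> x \<in> V}"
    proof (subst openin_subopen, intro ballI)
      fix x assume x: "x \<in> {x \<in> topspace T. \<theta> x \<in> V}"
      then have xc: "x \<in> carrier G" by simp
      obtain \<epsilon> where \<epsilon>: "\<epsilon> > 0" "ball (\<theta> x) \<epsilon> \<subseteq> V" using V x open_contains_ball by blast
      have "\<epsilon> * \<kappa> / 4 > 0" using \<epsilon> \<kappa> by simp
      then obtain U where U: "open_nbhd U" "\<And>u t. u \<in> U \<Longrightarrow> t \<in> carrier G \<Longrightarrow> \<bar>f (t \<otimes> u) - f t\<bar> \<le> \<epsilon> * \<kappa> / 4"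
        using uniform_continuity[OF fc fb] by blast
      \<comment> \<open>Continuity at the identity: small translations hardly change
        \<open>h\<close>, so the limiting inequality forces \<open>\<theta> u\<close> near 1. Other
        points follow by translation.\<close>
      have ub: "cmod (\<theta> u - 1) < \<epsilon>" if u: "u \<in> U" for u
      proof -
        have uc: "u \<in> carrier G" using u open_nbhd_subset[OF U(1)] by blast
        have "\<bar>h (t \<otimes> u) - h t\<bar> \<le> \<epsilon> * \<kappa> / 2" if t: "t \<in> carrier G" for t
        proof -
          have "t \<otimes> u \<otimes> x0 = t \<otimes> x0 \<otimes> u" using uc t x0 by (simp add: m_ac)
          then have "h (t \<otimes> u) - h t = (f (t \<otimes> u) - f t) - (f (t \<otimes> x0 \<otimes> u) - f (t \<otimes> x0))"
            unfolding h_def by simp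
          moreover have "\<bar>f (t \<otimes> x0 \<otimes> u) - f (t \<otimes> x0)\<bar> \<le> \<epsilon> * \<kappa> / 4" using U(2)[OF u, of "t \<otimes> x0"] t x0 by simp
          ultimately show ?thesis using U(2)[OF u t] by linarith
        qed
        then have "cmod (\<theta> u - 1) * \<kappa> \<le> \<epsilon> * \<kappa> / 2" using sm[OF uc] by blast
        then have "cmod (\<theta> u - 1) \<le> \<epsilon> / 2" using \<kappa> by (simp add: field_simps)
        then show ?thesis using \<epsilon>(1) by simp
      qed
      have "continuous_map T T (\<lambda>y. inv x \<otimes> y)" using xc
        by (intro continuous_intros_group continuous_map_const_group) auto
      then have o: "openin T {y \<in> carrier G. inv x \<otimes> y \<in> U}"
        using openin_preimage U(1) unfolding open_nbhd_def by blast
      have "y \<in> {x \<in> topspace T. \<theta> x \<in> V}" if y: "y \<in> carrier G" "inv x \<otimes> y \<in> U" for y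
      proof -
        have "y = x \<otimes> (inv x \<otimes> y)" using xc y by (simp add: m_assoc[symmetric])
        then have "\<theta> y = \<theta> x * \<theta> (inv x \<otimes> y)" using hom[of x "inv x \<otimes> y"] xc y by simp
        then have "\<theta> x - \<theta> y = \<theta> x * (1 - \<theta> (inv x \<otimes> y))" by (simp add: algebra_simps)
        then have "cmod (\<theta> x - \<theta> y) = cmod (\<theta> (inv x \<otimes> y) - 1)" by (simp add: norm_mult n1 norm_minus_commute)
        then have "\<theta> y \<in> ball (\<theta> x) \<epsilon>" using ub[OF y(2)] by (simp add: dist_norm)
        then show ?thesis using \<epsilon>(2) y by auto
      qed
      moreover have "x \<in> {y \<in> carrier G. inv x \<otimes> y \<in> U}" using xc open_nbhd_one[OF U(1)] by simp
      ultimately show "\<exists>S. openin T S \<and> x \<in> S \<and> S \<subseteq> {x \<in> topspace T. \<theta> x \<in> V}"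
        using o by blast
    qed
  qed auto
  show ?thesis using that[of \<theta>] cont n1 hom nt unfolding chars_def by blast
qed

end

section \<open>Divisible subgroups and countable families of characters\<close>

text \<open>Divisibility excludes a finite \<open>R\<close>, and an infinite \<open>R\<close>
  contains arbitrarily small rotations, namely quotients of two members near a common limit point.
  Powers of a small rotation come close to every point of the circle, and \<open>R\<close> is
  closed.\<close>

lemma divisible_circle_subgroup:
  fixes R :: "complex set"
  assumes R: "closed R" "R \<subseteq> sphere 0 1"
    and mult: "\<And>x y. x \<in> R \<Longrightarrow> y \<in> R \<Longrightarrow> x * y \<in> R" and cnj: "\<And>x. x \<in> R \<Longrightarrow> cnj x \<in> R"
    and div: "\<And>x n. x \<in> R \<Longrightarrow> n > 0 \<Longrightarrow> \<exists>y\<in>R. y ^ n = x"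
    and w: "w \<in> R" "w \<noteq> 1"
  shows "R = sphere 0 1"
proof -
  have n1: "cmod x = 1" if "x \<in> R" for x using that R(2) by auto
  have xc: "x * cnj x = 1" if "x \<in> R" for x
    using n1[OF that] complex_norm_square[of x] by simp
  have one: "1 \<in> R" using mult[OF w(1) cnj[OF w(1)]] xc[OF w(1)] by simp
  have pow: "x ^ n \<in> R" if "x \<in> R" for x and n :: nat
    using that by (induction n) (auto intro: mult one)
  have inf: "infinite R"
  proof
    assume fin: "finite R"
    \<comment> \<open>In a finite \<open>R\<close> the order of \<open>r\<close> is at most
      \<open>card R\<close>, so it divides the factorial and \<open>w\<close> would be 1.\<close>
    obtain r where r: "r \<in> R" "r ^ fact (card R) = w" using div[OF w(1), of "fact (card R)"] by auto
    have "\<not> inj_on (\<lambda>n. r ^ n) {..card R}"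
    proof
      assume "inj_on (\<lambda>n. r ^ n) {..card R}"
      then have "card {..card R} \<le> card R" using fin pow[OF r(1)] by (intro card_inj_on_le[of "\<lambda>n. r ^ n"]) auto
      then show False by simp
    qed
    then obtain i j where ij: "i < j" "j \<le> card R" "r ^ i = r ^ j"
      unfolding inj_on_def by (metis atMost_iff nat_neq_iff)
    have "r ^ i \<noteq> 0" using n1[OF r(1)] by auto
    moreover have "r ^ j = r ^ i * r ^ (j - i)" using ij(1) by (simp add: power_add[symmetric])
    ultimately have "r ^ (j - i) = 1" using ij(3) by (metis mult_cancel_left1)
    moreover have "(j - i) dvd fact (card R)" using ij by (intro dvd_fact) auto
    ultimately have "r ^ fact (card R) = 1" by (metis dvd_def power_mult power_one)
    then show False using r w by simp
  qed
  have small: "\<exists>\<phi>. 0 < \<phi> \<and> \<phi> < \<delta> \<and> cis \<phi> \<in> R" if \<delta>: "\<delta> > 0" for \<delta>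
  proof -
    have "continuous (at (1::complex)) Arg" by (rule continuous_at_Arg) auto
    then obtain \<epsilon> where \<epsilon>: "\<epsilon> > 0" "\<And>z. dist z 1 < \<epsilon> \<Longrightarrow> dist (Arg z) (Arg 1) < \<delta>"
      unfolding continuous_at_eps_delta using \<delta> by blast
    have "bounded R" using R(2) bounded_subset bounded_sphere by blast
    then obtain l where l: "l islimpt R" using bounded_infinite_imp_islimpt[of R R] inf by blast
    obtain x where x: "x \<in> R" "x \<noteq> l" "dist x l < \<epsilon> / 2"
      using l \<epsilon>(1) unfolding islimpt_approachable by (metis half_gt_zero)
    then have "dist x l > 0" by simp
    then obtain y where y: "y \<in> R" "y \<noteq> l" "dist y l < dist x l"
      using l unfolding islimpt_approachable by metis
    define r where "r = x * cnj y"
    have rR: "r \<in> R" unfolding r_def using x y mult cnj by blast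
    have xy: "x \<noteq> y" using y by auto
    have "x - y = (r - 1) * y" using xc[OF y(1)] by (simp add: r_def algebra_simps)
    then have d: "dist r 1 = dist x y" using n1[OF y(1)] by (simp add: dist_norm norm_mult)
    have "dist x y < \<epsilon>" using x(3) y(3) dist_triangle[of x y l] by (simp add: dist_commute)
    then have A: "\<bar>Arg r\<bar> < \<delta>" using \<epsilon>(2)[of r] d by (simp add: dist_norm Arg_eq_0[THEN iffD2])
    have r1: "r \<noteq> 1" using d xy by auto
    have cr: "cis (Arg r) = r" using n1[OF rR] by (metis cis_Arg norm_zero scaleR_one sgn_div_norm inverse_1 zero_neq_one)
    then have A0: "Arg r \<noteq> 0" using r1 by auto
    have "cis (- Arg r) \<in> R" using cnj[OF rR] cr by (metis cis_cnj)
    then have "cis \<bar>Arg r\<bar> \<in> R" using rR cr by (cases "Arg r \<ge> 0") auto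
    then show ?thesis using A A0 by (intro exI[of _ "\<bar>Arg r\<bar>"]) auto
  qed
  have "t \<in> R" if t: "cmod t = 1" for t
  proof -
    define \<tau> where "\<tau> = (if Arg t \<ge> 0 then Arg t else Arg t + 2 * pi)"
    have \<tau>0: "\<tau> \<ge> 0" unfolding \<tau>_def using Arg_bounded[of t] by auto
    have "cis (Arg t) = t" using t by (metis cis_Arg norm_zero scaleR_one sgn_div_norm inverse_1 zero_neq_one)
    then have \<tau>: "cis \<tau> = t" unfolding \<tau>_def by (auto simp: cis_mult[symmetric])
    have "t \<in> closure R"
      unfolding closure_approachable
    proof (intro allI impI)
      fix \<delta> :: real assume "\<delta> > 0"
      then obtain \<phi> where \<phi>: "0 < \<phi>" "\<phi> < \<delta>" "cis \<phi> \<in> R" using small by blast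
      define n where "n = nat \<lfloor>\<tau> / \<phi>\<rfloor>"
      have "real n \<le> \<tau> / \<phi>" "\<tau> / \<phi> < real n + 1" unfolding n_def using \<tau>0 \<phi>(1) by (auto simp: of_nat_nat)
      then have n: "n * \<phi> \<le> \<tau>" "\<tau> - n * \<phi> < \<phi>" using \<phi>(1) by (auto simp: field_simps)
      have "cis (n * \<phi>) \<in> R" using pow[OF \<phi>(3), of n] by (simp add: Complex.DeMoivre)
      moreover have "dist (cis (n * \<phi>)) t < \<delta>"
      proof -
        have "t - cis (n * \<phi>) = cis (n * \<phi>) * (cis (\<tau> - n * \<phi>) - 1)"
          by (simp add: \<tau>[symmetric] right_diff_distrib cis_mult)
        then have "cmod (t - cis (n * \<phi>)) = cmod (cis (\<tau> - n * \<phi>) - 1)" by (simp add: norm_mult)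
        also have "\<dots> = 2 * \<bar>sin ((\<tau> - n * \<phi>) / 2)\<bar>" using dist_exp_i_1[of "\<tau> - n * \<phi>"] by (simp add: cis_conv_exp)
        also have "\<dots> \<le> 2 * \<bar>(\<tau> - n * \<phi>) / 2\<bar>" by (intro mult_left_mono abs_sin_x_le_abs_x) auto
        also have "\<dots> < \<delta>" using n \<phi> by simp
        finally show ?thesis by (simp add: dist_norm norm_minus_commute)
      qed
      ultimately show "\<exists>y\<in>R. dist y t < \<delta>" by blast
    qed
    then show ?thesis using R(1) by simp
  qed
  then show ?thesis using R(2) by auto
qed

context compact_abelian_group
begin

section \<open>Characters on divisible subgroups\<close>

lemma charsD:
  assumes "\<theta> \<in> chars"
  shows "continuous_map T euclidean \<theta>" "\<And>x. x \<in> carrier G \<Longrightarrow> cmod (\<theta> x) = 1"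
    "\<And>x y. x \<in> carrier G \<Longrightarrow> y \<in> carrier G \<Longrightarrow> \<theta> (x \<otimes> y) = \<theta> x * \<theta> y"
  using assms by (auto simp: chars_def)

lemma char_one: assumes "\<theta> \<in> chars" shows "\<theta> \<one> = 1"
proof -
  have "\<theta> \<one> = \<theta> \<one> * \<theta> \<one>" using charsD(3)[OF assms, of \<one> \<one>] by simp
  moreover have "\<theta> \<one> \<noteq> 0" using charsD(2)[OF assms, of \<one>] by auto
  ultimately show ?thesis by simp
qed

lemma char_pow: "\<theta> \<in> chars \<Longrightarrow> x \<in> carrier G \<Longrightarrow> \<theta> (x [^] (n::nat)) = \<theta> x ^ n"
  by (induction n) (auto simp: char_one charsD)

lemma char_inv: assumes "\<theta> \<in> chars" "x \<in> carrier G" shows "\<theta> (inv x) = cnj (\<theta> x)"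
proof -
  have "\<theta> x * \<theta> (inv x) = 1" using charsD(3)[OF assms(1), of x "inv x"] assms char_one[OF assms(1)] by simp
  moreover have "\<theta> x * cnj (\<theta> x) = 1" using charsD(2)[OF assms] complex_norm_square[of "\<theta> x"] by simp
  moreover have "\<theta> x \<noteq> 0" using charsD(2)[OF assms] by auto
  ultimately show ?thesis by (metis mult_left_cancel)
qed

lemma char_closedin: assumes "\<theta> \<in> chars" "closed C" shows "closedin T {x \<in> carrier G. \<theta> x \<in> C}"
  using closedin_continuous_map_preimage[OF charsD(1)[OF assms(1)], of C] assms(2) by simp

lemma char_open_nbhd: assumes "\<theta> \<in> chars" "open C" "1 \<in> C" shows "open_nbhd {x \<in> carrier G. \<theta> x \<in> C}"
  using openin_continuous_map_preimage[OF charsD(1)[OF assms(1)], of C] assms(2,3) char_one[OF assms(1)]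
  by (simp add: open_nbhd_def)

lemma closed_subgroup_ker: assumes "\<theta> \<in> chars" shows "closed_subgroup {x \<in> carrier G. \<theta> x = 1}"
proof -
  have "closedin T {x \<in> carrier G. \<theta> x = 1}" using char_closedin[OF assms, of "{1}"] by simp
  moreover have "subgroup {x \<in> carrier G. \<theta> x = 1} G"
    by (rule subgroupI') (auto simp: char_one[OF assms] charsD(3)[OF assms] char_inv[OF assms])
  ultimately show ?thesis by (simp add: closed_subgroup_def)
qed

lemma char_const: "(\<lambda>x. 1) \<in> chars"
  by (simp add: chars_def)

lemma char_power: assumes "\<theta> \<in> chars" shows "(\<lambda>x. \<theta> x ^ n) \<in> chars"
proof -
  have "continuous_map T euclidean (\<lambda>x. \<theta> x ^ n)"
  proof -
    have "continuous_map euclidean euclidean (\<lambda>z :: complex. z ^ n)"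
      by (simp add: continuous_map_iff_continuous2 continuous_intros)
    then have "continuous_map T euclidean ((\<lambda>z. z ^ n) \<circ> \<theta>)"
      using continuous_map_compose[OF charsD(1)[OF assms]] by blast
    then show ?thesis by (simp add: o_def)
  qed
  then show ?thesis unfolding chars_def using charsD[OF assms] by (auto simp: norm_power power_mult_distrib)
qed

lemma char_image_divisible:
  assumes D: "closed_subgroup D" "divisible D" and \<theta>: "\<theta> \<in> chars" and d: "d \<in> D" "\<theta> d \<noteq> 1" and t: "cmod t = 1"
  obtains x where "x \<in> D" "\<theta> x = t"
proof -
  note D' = closed_subgroupD[OF D(1)]
  have Dc: "x \<in> carrier G" if "x \<in> D" for x using D' that by blast
  have "\<theta> ` D = sphere 0 1"
  proof (rule divisible_circle_subgroup)
    have "compactin euclidean (\<theta> ` D)" using image_compactin[OF closedin_compactin[OF D'(1)] charsD(1)[OF \<theta>]] .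
    then show "closed (\<theta> ` D)" using compact_imp_closed by simp
    show "\<theta> ` D \<subseteq> sphere 0 1" using charsD(2)[OF \<theta>] Dc by auto
    show "x * y \<in> \<theta> ` D" if xy: "x \<in> \<theta> ` D" "y \<in> \<theta> ` D" for x y
    proof -
      obtain a b where "a \<in> D" "b \<in> D" "x = \<theta> a" "y = \<theta> b" using xy by blast
      then show ?thesis using charsD(3)[OF \<theta>, of a b] D'(5)[of a b] Dc by (metis imageI)
    qed
    show "cnj x \<in> \<theta> ` D" if "x \<in> \<theta> ` D" for x
      using that char_inv[OF \<theta>] D'(6) Dc by (metis (no_types, lifting) image_iff)
    show "\<exists>y\<in>\<theta> ` D. y ^ n = x" if x: "x \<in> \<theta> ` D" and n: "n > 0" for x and n :: nat
    proof -
      obtain a where a: "a \<in> D" "x = \<theta> a" using x by blast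
      then obtain b where "b \<in> D" "a = b [^] n" using D(2) n unfolding divisible_def pow_set_def by blast
      then show ?thesis using a char_pow[OF \<theta>] Dc by auto
    qed
    show "\<theta> d \<in> \<theta> ` D" "\<theta> d \<noteq> 1" using d by auto
  qed
  then have "t \<in> \<theta> ` D" using t by auto
  then show ?thesis using that by blast
qed

text \<open>Only downward directedness is asked for, so the same statement serves Zorn chains,
  finite sets of characters and neighbourhood filters.\<close>

lemma chain_fip:
  assumes "\<And>C. C \<in> \<C> \<Longrightarrow> closedin T C \<and> C \<noteq> {}"
    and "\<C> \<noteq> {}" and "\<And>C D. C \<in> \<C> \<Longrightarrow> D \<in> \<C> \<Longrightarrow> \<exists>E\<in>\<C>. E \<subseteq> C \<inter> D"
  shows "\<Inter>\<C> \<noteq> {}"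
proof -
  have fin: "finite \<F> \<Longrightarrow> \<F> \<subseteq> \<C> \<Longrightarrow> \<exists>E\<in>\<C>. E \<subseteq> \<Inter>\<F>" for \<F>
  proof (induction \<F> rule: finite_induct)
    case empty
    then show ?case using assms(2) by blast
  next
    case (insert C \<F>)
    then obtain E where "E \<in> \<C>" "E \<subseteq> \<Inter>\<F>" by auto
    moreover obtain E' where "E' \<in> \<C>" "E' \<subseteq> E \<inter> C" using assms(3)[of E C] calculation insert.prems by auto
    ultimately show ?case by (intro bexI[of _ E']) auto
  qed
  have ne: "\<Inter>\<F> \<noteq> {}" if F: "finite \<F>" "\<F> \<subseteq> \<C>" for \<F>
  proof -
    obtain E where "E \<in> \<C>" "E \<subseteq> \<Inter>\<F>" using fin[OF F] by blast
    moreover have "E \<noteq> {}" using assms(1) calculation(1) by blast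
    ultimately show ?thesis by (metis subset_empty)
  qed
  show ?thesis
    by (rule compact[unfolded compact_space_fip, THEN spec, THEN mp]) (simp add: assms(1) ne)
qed

text \<open>The joint map of all \<open>c i\<close> takes every value in \<open>Q\<close> on
  \<open>H\<close>. Two choices of \<open>Q\<close> occur: the infinite torus, and a product of
  cyclic groups of order 2^i.\<close>

definition lifts :: "(nat \<Rightarrow> 'a \<Rightarrow> complex) \<Rightarrow> 'a set \<Rightarrow> (nat \<Rightarrow> complex) set \<Rightarrow> bool" where
  "lifts c H Q \<longleftrightarrow> (\<forall>t\<in>Q. \<exists>x\<in>H. \<forall>i. c i x = t i)"

text \<open>Minimality passes properties of \<open>Q\<close> on to \<open>H\<close>: if every
  element of \<open>Q\<close> has an n-th root in \<open>Q\<close>, the n-th powers of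
  \<open>H\<close> still cover \<open>Q\<close> and are therefore all of \<open>H\<close>.\<close>

definition min_lifts :: "(nat \<Rightarrow> 'a \<Rightarrow> complex) \<Rightarrow> 'a set \<Rightarrow> (nat \<Rightarrow> complex) set \<Rightarrow> bool" where
  "min_lifts c H Q \<longleftrightarrow> closed_subgroup H \<and> lifts c H Q \<and> (\<forall>L. closed_subgroup L \<and> L \<subseteq> H \<and> lifts c L Q \<longrightarrow> L = H)"

lemma closedin_fibre:
  assumes "\<And>i::nat. c i \<in> chars" "closedin T H" shows "closedin T {x \<in> H. \<forall>i. c i x = t i}"
proof -
  have "closedin T (H \<inter> (\<Inter>i. {x \<in> carrier G. c i x \<in> {t i}}))"
    by (intro closedin_Int assms closedin_INT char_closedin) auto
  moreover have "H \<inter> (\<Inter>i. {x \<in> carrier G. c i x \<in> {t i}}) = {x \<in> H. \<forall>i. c i x = t i}"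
    using closedin_subset[OF assms(2)] by auto
  ultimately show ?thesis by simp
qed

text \<open>Zorn's lemma, applied to complements so that maximal elements become minimal subgroups.
  The intersection of a chain still covers \<open>Q\<close> because the fibres over a fixed
  \<open>t\<close> form a chain of nonempty closed sets.\<close>

lemma minimal_lifts_exists:
  assumes c: "\<And>i. c i \<in> chars" and M: "closed_subgroup M" "lifts c M Q"
  obtains H where "H \<subseteq> M" "min_lifts c H Q"
proof -
  define \<A> where "\<A> = {carrier G - H | H. closed_subgroup H \<and> H \<subseteq> M \<and> lifts c H Q}"
  have "\<exists>U\<in>\<A>. \<forall>V\<in>\<A>. U \<subseteq> V \<longrightarrow> V = U"
  proof (rule subset_Zorn_nonempty)
    show "\<A> \<noteq> {}" using M unfolding \<A>_def by blast
  next
    fix \<C> assume ne: "\<C> \<noteq> {}" and ch: "subset.chain \<A> \<C>"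
    define \<H> where "\<H> = (\<lambda>C. carrier G - C) ` \<C>"
    have sub: "\<C> \<subseteq> \<A>" using ch by (simp add: subset.chain_def)
    have H: "closed_subgroup H \<and> H \<subseteq> M \<and> lifts c H Q \<and> carrier G - H \<in> \<C>" if H: "H \<in> \<H>" for H
    proof -
      obtain C where C: "C \<in> \<C>" "H = carrier G - C" using H by (auto simp: \<H>_def)
      then obtain L where L: "C = carrier G - L" "closed_subgroup L" "L \<subseteq> M" "lifts c L Q" using sub by (auto simp: \<A>_def)
      then have "H = L" using C closed_subgroupD(3)[OF L(2)] by blast
      then show ?thesis using L C by simp
    qed
    have dir: "H \<subseteq> L \<or> L \<subseteq> H" if HL: "H \<in> \<H>" "L \<in> \<H>" for H L
    proof -
      obtain C D where "C \<in> \<C>" "H = carrier G - C" "D \<in> \<C>" "L = carrier G - D"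
        using HL by (auto simp: \<H>_def)
      moreover then have "C \<subseteq> D \<or> D \<subseteq> C" using ch by (auto simp: subset.chain_def)
      ultimately show ?thesis by blast
    qed
    have Hne: "\<H> \<noteq> {}" using ne by (simp add: \<H>_def)
    have "closed_subgroup (\<Inter>\<H>)" by (rule closed_subgroup_Inter[OF Hne]) (use H in blast)
    moreover have "\<Inter>\<H> \<subseteq> M" using H Hne by blast
    moreover have "lifts c (\<Inter>\<H>) Q"
      unfolding lifts_def
    proof
      fix t assume t: "t \<in> Q"
      have "\<Inter>((\<lambda>H. {x \<in> H. \<forall>i. c i x = t i}) ` \<H>) \<noteq> {}"
      proof (rule chain_fip)
        fix C assume "C \<in> (\<lambda>H. {x \<in> H. \<forall>i. c i x = t i}) ` \<H>"
        then obtain H where "H \<in> \<H>" "C = {x \<in> H. \<forall>i. c i x = t i}" by blast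
        moreover have "\<exists>x\<in>H. \<forall>i. c i x = t i" using H[OF calculation(1)] t unfolding lifts_def by blast
        moreover have "closedin T {x \<in> H. \<forall>i. c i x = t i}"
          by (rule closedin_fibre[OF c]) (use H[OF calculation(1)] closed_subgroupD(1) in blast)
        ultimately show "closedin T C \<and> C \<noteq> {}" by auto
      next
        fix C D assume "C \<in> (\<lambda>H. {x \<in> H. \<forall>i. c i x = t i}) ` \<H>" "D \<in> (\<lambda>H. {x \<in> H. \<forall>i. c i x = t i}) ` \<H>"
        then obtain H L where "H \<in> \<H>" "C = {x \<in> H. \<forall>i. c i x = t i}" "L \<in> \<H>" "D = {x \<in> L. \<forall>i. c i x = t i}" by blast
        moreover then have "H \<subseteq> L \<or> L \<subseteq> H" using dir by blast
        ultimately show "\<exists>E\<in>(\<lambda>H. {x \<in> H. \<forall>i. c i x = t i}) ` \<H>. E \<subseteq> C \<inter> D" by blast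
      qed (use Hne in auto)
      then show "\<exists>x\<in>\<Inter>\<H>. \<forall>i. c i x = t i" using Hne by blast
    qed
    moreover have "\<Union>\<C> = carrier G - \<Inter>\<H>"
    proof -
      have "C \<subseteq> carrier G" if "C \<in> \<C>" for C using that sub by (auto simp: \<A>_def)
      then show ?thesis using ne unfolding \<H>_def by auto
    qed
    ultimately show "\<Union>\<C> \<in> \<A>" unfolding \<A>_def by blast
  qed
  then obtain U where U: "U \<in> \<A>" "\<And>V. V \<in> \<A> \<Longrightarrow> U \<subseteq> V \<Longrightarrow> V = U" by blast
  then obtain H where H: "U = carrier G - H" "closed_subgroup H" "H \<subseteq> M" "lifts c H Q" by (auto simp: \<A>_def)
  have "L = H" if L: "closed_subgroup L" "L \<subseteq> H" "lifts c L Q" for L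
  proof -
    have "carrier G - L \<in> \<A>" using L H(3) by (auto simp: \<A>_def)
    then have "carrier G - L = carrier G - H" using U(2) H(1) L(2) by blast
    then show ?thesis using closed_subgroupD(3)[OF L(1)] closed_subgroupD(3)[OF H(2)] by blast
  qed
  then show ?thesis using that H unfolding min_lifts_def by blast
qed

text \<open>A character that is nontrivial on a divisible subgroup maps it onto the circle, so its kernel
  is a supplement of that subgroup.\<close>

lemma min_lifts_reduced:
  assumes H: "min_lifts c H Q" and D: "closed_subgroup D" "divisible D" "D \<subseteq> H" and triv: "\<And>i x. x \<in> D \<Longrightarrow> c i x = 1"
    and c: "\<And>i. c i \<in> chars"
  shows "D = {\<one>}"
proof (rule ccontr)
  assume "D \<noteq> {\<one>}"
  then obtain d where d: "d \<in> D" "d \<noteq> \<one>" using closed_subgroupD(4)[OF D(1)] by blast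
  have Hs: "closed_subgroup H" using H by (simp add: min_lifts_def)
  have dc: "d \<in> carrier G" using d closed_subgroupD[OF D(1)] by blast
  obtain \<theta> where \<theta>: "\<theta> \<in> chars" "\<theta> d \<noteq> 1" using characters_separate[OF dc d(2)] by blast
  define L where "L = H \<inter> {x \<in> carrier G. \<theta> x = 1}"
  have "closed_subgroup L" unfolding L_def by (intro closed_subgroup_Int closed_subgroup_ker Hs \<theta>)
  moreover have "lifts c L Q"
    unfolding lifts_def
  proof
    fix t assume "t \<in> Q"
    then obtain x where x: "x \<in> H" "\<forall>i. c i x = t i" using H unfolding min_lifts_def lifts_def by blast
    have xc: "x \<in> carrier G" using x closed_subgroupD[OF Hs] by blast
    obtain y where y: "y \<in> D" "\<theta> y = cnj (\<theta> x)"
      using char_image_divisible[OF D(1,2) \<theta>(1) d(1) \<theta>(2), of "cnj (\<theta> x)"] charsD(2)[OF \<theta>(1) xc] by auto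
    have yc: "y \<in> carrier G" using y closed_subgroupD[OF D(1)] by blast
    have "\<theta> x * cnj (\<theta> x) = 1" using charsD(2)[OF \<theta>(1) xc] complex_norm_square[of "\<theta> x"] by simp
    then have "x \<otimes> y \<in> L" unfolding L_def using x y D(3) closed_subgroupD(5)[OF Hs] xc yc charsD(3)[OF \<theta>(1) xc yc] by auto
    moreover have "c i (x \<otimes> y) = t i" for i using charsD(3)[OF c xc yc] x(2) triv[OF y(1)] by simp
    ultimately show "\<exists>x\<in>L. \<forall>i. c i x = t i" by blast
  qed
  ultimately have "L = H" using H unfolding min_lifts_def L_def by blast
  then show False using d(1) D(3) \<theta>(2) unfolding L_def by blast
qed

text \<open>Countable pseudocharacter at the identity. For a closed subgroup of a compact group this
  amounts to metrizability; it is the condition under which sequences suffice.\<close>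

definition gdelta_one :: "'a set \<Rightarrow> bool" where
  "gdelta_one M \<longleftrightarrow> (\<exists>U::nat \<Rightarrow> 'a set. (\<forall>n. open_nbhd (U n)) \<and> M \<inter> (\<Inter>n. U n) \<subseteq> {\<one>})"

text \<open>Closures of smaller neighbourhoods give the closed decreasing sets that the compactness
  arguments need, while each of them still contains a neighbourhood.\<close>

lemma gdelta_one_nested:
  assumes "gdelta_one M"
  obtains C :: "nat \<Rightarrow> 'a set" where "\<And>n. closedin T (C n)" "\<And>n. \<exists>W. open_nbhd W \<and> W \<subseteq> C n" "\<And>n. C (Suc n) \<subseteq> C n"
    "M \<inter> (\<Inter>n. C n) \<subseteq> {\<one>}"
proof -
  obtain U :: "nat \<Rightarrow> 'a set" where U: "\<And>n. open_nbhd (U n)" "M \<inter> (\<Inter>n. U n) \<subseteq> {\<one>}"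
    using assms unfolding gdelta_one_def by blast
  have "\<exists>W. open_nbhd W \<and> T closure_of W \<subseteq> U n" for n using closure_open_nbhd[OF U(1)] by metis
  then obtain W where W: "\<And>n. open_nbhd (W n)" "\<And>n. T closure_of (W n) \<subseteq> U n" by metis
  define C where "C = (\<lambda>n. \<Inter>i\<in>{..n}. T closure_of (W i))"
  have 1: "closedin T (C n)" for n unfolding C_def by (intro closedin_INT) auto
  have 2: "\<exists>V. open_nbhd V \<and> V \<subseteq> C n" for n
  proof (intro exI conjI)
    show "open_nbhd (carrier G \<inter> (\<Inter>i\<in>{..n}. W i))" by (rule open_nbhd_INT) (use W in auto)
    have "W i \<subseteq> T closure_of (W i)" for i using open_nbhd_subset[OF W(1)] by (simp add: closure_of_subset)
    then show "carrier G \<inter> (\<Inter>i\<in>{..n}. W i) \<subseteq> C n" unfolding C_def by blast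
  qed
  have 3: "C (Suc n) \<subseteq> C n" for n unfolding C_def by (intro INT_anti_mono) auto
  have "C n \<subseteq> U n" for n using W(2)[of n] unfolding C_def by auto
  then have "(\<Inter>n. C n) \<subseteq> (\<Inter>n. U n)" by (intro INF_mono') auto
  then have "M \<inter> (\<Inter>n. C n) \<subseteq> {\<one>}" using U(2) by (meson Int_mono order_refl order_trans)
  with that 1 2 3 show ?thesis by blast
qed

text \<open>For a divisible closed subgroup M with n-th power map q, the images q(W) of relatively open
  W form neighbourhoods of the identity in M, whence M inherits countably many
  neighbourhoods separating points from the annihilator A of the characters, its powers and finally their intersection.\<close>

lemma gdelta_one_of_countable_characters:
  assumes M: "closed_subgroup M" "divisible M" and c: "\<And>i::nat. c i \<in> chars"
    and A: "divisible_part {x \<in> M. \<forall>i. c i x = 1} = {\<one>}"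
  shows "gdelta_one M"
proof -
  note M' = closed_subgroupD[OF M(1)]
  have Mc: "x \<in> carrier G" if "x \<in> M" for x using that M' by blast
  define Ann where "Ann = {x \<in> M. \<forall>i. c i x = 1}"
  \<comment> \<open>Shrinking boxes around the joint kernel: box j restricts only the first j + 1
    characters, and all boxes together intersect in \<open>Ann\<close>.\<close>
  define K where "K = (\<lambda>j::nat. {x \<in> M. \<forall>i\<in>{..j}. c i x \<in> cball 1 (1 / (real j + 1))})"
  define U where "U = (\<lambda>j::nat. carrier G \<inter> (\<Inter>i\<in>{..j}. {x \<in> carrier G. c i x \<in> ball 1 (1 / (real j + 1))}))"
  have U: "open_nbhd (U j)" for j unfolding U_def by (intro open_nbhd_INT char_open_nbhd c) auto
  have UK: "M \<inter> U j \<subseteq> K j" for j unfolding U_def K_def by (auto simp: less_imp_le)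
  have Kcl: "closedin T (K j)" for j
  proof -
    have "closedin T (M \<inter> (\<Inter>i\<in>{..j}. {x \<in> carrier G. c i x \<in> cball 1 (1 / (real j + 1))}))"
      by (intro closedin_Int M' closedin_INT char_closedin c) auto
    moreover have "M \<inter> (\<Inter>i\<in>{..j}. {x \<in> carrier G. c i x \<in> cball 1 (1 / (real j + 1))}) = K j"
      unfolding K_def using Mc by auto
    ultimately show ?thesis by simp
  qed
  have Kdec: "K (Suc j) \<subseteq> K j" for j
  proof -
    have "1 / (real (Suc j) + 1) \<le> 1 / (real j + 1)" by (simp add: field_simps)
    then show ?thesis unfolding K_def by (auto intro: order_trans)
  qed
  have Kint: "x \<in> Ann" if x: "\<And>j. x \<in> K j" for x
  proof -
    have "c i x = 1" for i
    proof (rule ccontr)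
      assume ne: "c i x \<noteq> 1"
      then obtain n :: nat where n: "1 / (real n + 1) < dist 1 (c i x)"
        by (metis nat_approx_posE dist_pos_lt of_nat_Suc add.commute)
      have "c i x \<in> cball 1 (1 / (real (max n i) + 1))" using x[of "max n i"] unfolding K_def by auto
      then have "dist 1 (c i x) \<le> 1 / (real (max n i) + 1)" by simp
      also have "\<dots> \<le> 1 / (real n + 1)" by (simp add: frac_le)
      finally show False using n by simp
    qed
    moreover have "x \<in> M" using x[of 0] by (simp add: K_def)
    ultimately show ?thesis by (simp add: Ann_def)
  qed
  have ex: "\<exists>W. open_nbhd W \<and> (\<forall>y\<in>M \<inter> W. \<exists>x\<in>K j. x [^] (n::nat) = y)" if n: "n > 0" for n j
  proof -
    \<comment> \<open>\<open>C\<close> collects the elements of \<open>M\<close> that no n-torsion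
      element of \<open>M\<close> moves into \<open>U j\<close>. Its image under the power map is
      closed and misses the identity. Any \<open>y\<close> in \<open>M\<close> off that image has,
      by divisibility, an n-th root that some torsion element moves into \<open>U j\<close>, hence
      into \<open>K j\<close>.\<close>
    define P where "P = {k \<in> M. k [^] n = \<one>}"
    define C where "C = M \<inter> (\<Inter>k\<in>P. {x \<in> carrier G. x \<otimes> k \<in> carrier G - U j})"
    have "closedin T C"
    proof (cases "P = {}")
      case True
      then show ?thesis unfolding C_def using M'(1) by simp
    next
      case False
      have "continuous_map T T (\<lambda>x. x \<otimes> k)" if "k \<in> P" for k
        using that Mc unfolding P_def by (intro continuous_intros_group continuous_map_const_group) auto
      moreover have "closedin T (carrier G - U j)"
        using U[of j] closedin_diff[OF closedin_topspace, of T "U j"] by (simp add: open_nbhd_def)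
      ultimately show ?thesis unfolding C_def using False M'(1)
        by (intro closedin_Int closedin_INT closedin_preimage) auto
    qed
    then have cl: "closedin T ((\<lambda>x. x [^] n) ` C)" by (intro closedin_image continuous_intros_group)
    have inv: "\<one> \<notin> (\<lambda>x. x [^] n) ` C"
    proof
      assume "\<one> \<in> (\<lambda>x. x [^] n) ` C"
      then obtain x where x: "x \<in> C" "x [^] n = \<one>" by force
      then have xM: "x \<in> M" by (simp add: C_def)
      then have "inv x \<in> P" using x(2) M'(6) Mc by (simp add: P_def nat_pow_inv)
      then have "x \<otimes> inv x \<in> carrier G - U j" using x(1) unfolding C_def by blast
      then show False using Mc[OF xM] open_nbhd_one[OF U] by simp
    qed
    define W where "W = carrier G - (\<lambda>x. x [^] n) ` C"
    have "open_nbhd W" unfolding W_def open_nbhd_def using cl inv openin_diff[OF openin_topspace cl] by simp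
    moreover have "\<exists>x\<in>K j. x [^] n = y" if y: "y \<in> M \<inter> W" for y
    proof -
      obtain x where x: "x \<in> M" "y = x [^] n" using y M(2) n unfolding divisible_def pow_set_def by blast
      have "x \<notin> C" using y x(2) unfolding W_def by blast
      then obtain k where k: "k \<in> P" "x \<otimes> k \<in> U j" using x(1) Mc unfolding C_def P_def by auto
      have kM: "k \<in> M" "k [^] n = \<one>" using k by (auto simp: P_def)
      have "x \<otimes> k \<in> K j" using UK k(2) M'(5)[OF x(1) kM(1)] by blast
      moreover have "(x \<otimes> k) [^] n = y" using x kM Mc by (simp add: pow_mult_distrib m_comm)
      ultimately show ?thesis by blast
    qed
    ultimately show ?thesis by blast
  qed
  define E where "E = (\<lambda>p. SOME W. open_nbhd W \<and> (\<forall>y\<in>M \<inter> W. \<exists>x\<in>K (snd p). x [^] (fact (fst p) :: nat) = y))"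
  have E: "open_nbhd (E p) \<and> (\<forall>y\<in>M \<inter> E p. \<exists>x\<in>K (snd p). x [^] (fact (fst p) :: nat) = y)" for p
    unfolding E_def by (rule someI_ex) (use ex[of "fact (fst p)" "snd p"] in simp)
  have "y = \<one>" if y: "y \<in> M" "\<And>n. y \<in> E (prod_decode n)" for y
  proof -
    have yE: "y \<in> E p" for p using y(2)[of "prod_encode p"] by simp
    have "y \<in> pow_set G (fact n) Ann" for n
    proof -
      have "\<exists>x. (\<forall>j. x \<in> K j) \<and> x [^] (fact n :: nat) = y"
      proof (rule nest_solve[where Y = T])
        show "continuous_map T T (\<lambda>x. x [^] (fact n :: nat))" by (intro continuous_intros_group)
        show "\<exists>x\<in>K j. x [^] (fact n :: nat) = y" for j using E[of "(n, j)"] yE[of "(n, j)"] y(1) by auto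
      qed (use Kcl Kdec Hausdorff in auto)
      then show ?thesis using Kint by (auto simp: pow_set_def)
    qed
    then have "y \<in> divisible_part Ann" by (simp add: divisible_part_def)
    then show ?thesis using A by (simp add: Ann_def)
  qed
  then have "M \<inter> (\<Inter>n. E (prod_decode n)) \<subseteq> {\<one>}" by blast
  moreover have "open_nbhd (E (prod_decode n))" for n using E by blast
  ultimately show ?thesis unfolding gdelta_one_def by (intro exI[of _ "\<lambda>n. E (prod_decode n)"]) simp
qed

end

text \<open>The circle has no small subgroups: squaring doubles the angle, so the real parts satisfy
  x(k + 1) = 2 x(k)^2 - 1 and the gap 1 - x(k) at least doubles while x(k) is positive. A gap that
  stays below 1 forever must be 0.\<close>

lemma unit_complex_powers_Re_pos:
  assumes "cmod z = 1" "\<And>m::nat. Re (z ^ m) > 0"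
  shows "z = 1"
proof -
  define x where "x = (\<lambda>k::nat. Re (z ^ (2 ^ k)))"
  have x1: "x k \<le> 1" for k
  proof -
    have "cmod (z ^ (2 ^ k)) = 1" using assms(1) by (simp add: norm_power)
    then show ?thesis unfolding x_def using complex_Re_le_cmod[of "z ^ (2 ^ k)"] by simp
  qed
  have rec: "x (Suc k) = 2 * (x k)\<^sup>2 - 1" for k
  proof -
    define w where "w = z ^ (2 ^ k)"
    have w: "cmod w = 1" using assms(1) by (simp add: w_def norm_power)
    have "z ^ (2 ^ Suc k) = w\<^sup>2" unfolding w_def by (simp add: power_mult[symmetric] mult.commute)
    moreover have "(Re w)\<^sup>2 + (Im w)\<^sup>2 = 1" using w by (metis cmod_power2 one_power2)
    ultimately show ?thesis unfolding x_def w_def[symmetric] by (simp add: power2_eq_square)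
  qed
  have "2 ^ k * (1 - x 0) \<le> 1 - x k" for k
  proof (induction k)
    case (Suc k)
    have "0 < x k" using assms(2) by (simp add: x_def)
    then have "2 * (1 - x k) \<le> 2 * (1 - x k) * (1 + x k)" using x1[of k] by (simp add: mult_le_cancel_left1)
    also have "\<dots> = 1 - x (Suc k)" by (simp add: rec power2_eq_square algebra_simps)
    finally show ?case using Suc by simp
  qed simp
  then have b: "2 ^ k * (1 - x 0) < 1" for k
    using assms(2)[of "2 ^ k"] by (smt (verit) x_def)
  have "1 - x 0 \<le> 0"
  proof (rule ccontr)
    assume "\<not> ?thesis"
    then have p: "1 - x 0 > 0" by simp
    obtain k :: nat where "1 / (1 - x 0) < 2 ^ k" using real_arch_pow[of 2 "1 / (1 - x 0)"] by auto
    then have "1 < 2 ^ k * (1 - x 0)" using p by (simp add: field_simps)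
    then show False using b[of k] by simp
  qed
  then have "Re z = 1" using x1[of 0] by (simp add: x_def)
  moreover have "(Re z)\<^sup>2 + (Im z)\<^sup>2 = 1" using assms(1) by (metis cmod_power2 one_power2)
  ultimately show ?thesis by (simp add: complex_eq_iff)
qed

context compact_abelian_group
begin

lemma open_nbhd_Inter_one:
  assumes "x \<in> carrier G" "\<And>U. open_nbhd U \<Longrightarrow> x \<in> U" shows "x = \<one>"
proof (rule ccontr)
  assume "x \<noteq> \<one>"
  have "closedin T {x}" using assms(1) by (simp add: closedin_Hausdorff_singleton Hausdorff)
  then have "openin T (carrier G - {x})" using openin_diff[OF openin_topspace] by fastforce
  then have "open_nbhd (carrier G - {x})" using \<open>x \<noteq> \<one>\<close> by (simp add: open_nbhd_def)
  then show False using assms(2) by blast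
qed

lemma open_nbhd_mult_at:
  assumes "openin T B" "a \<in> B"
  shows "\<exists>W. open_nbhd W \<and> (\<forall>w\<in>W. \<forall>w'\<in>W. a \<otimes> (w \<otimes> w') \<in> B) \<and> (\<forall>w\<in>W. inv w \<in> W)"
  using open_nbhd_mult_ex[OF open_nbhd_translate[OF assms]] by blast

text \<open>Modulo \<open>Q\<close> the element \<open>y\<close> has finite order, so its powers lie
  in finitely many closed cosets, whose union already contains the closure.\<close>

lemma closure_powers_in_cosets:
  assumes Q: "closed_subgroup Q" and y: "y \<in> carrier G" and N: "N > 0" "y [^] (N::nat) \<in> Q"
    and s: "s \<in> T closure_of (range (\<lambda>k::int. y [^] k))"
  obtains r where "r < N" "s \<otimes> inv (y [^] (r::nat)) \<in> Q"
proof -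
  define C where "C = (\<Union>r\<in>{..<N}. {x \<in> carrier G. x \<otimes> inv (y [^] r) \<in> Q})"
  have "closedin T {x \<in> carrier G. x \<otimes> inv (y [^] r) \<in> Q}" for r :: nat
    using y closed_subgroupD(1)[OF Q] by (intro closedin_preimage continuous_intros_group continuous_map_const_group) auto
  then have "closedin T C" unfolding C_def by (intro closedin_Union) auto
  moreover have "range (\<lambda>k::int. y [^] k) \<subseteq> C"
  proof
    fix x assume "x \<in> range (\<lambda>k::int. y [^] k)"
    then obtain k :: int where k: "x = y [^] k" by blast
    define r where "r = nat (k mod int N)"
    have r: "r < N" "int r = k mod int N" unfolding r_def using N(1) by (auto simp: nat_less_iff)
    have "x = y [^] (int r + int N * (k div int N))" unfolding k r(2) by simp
    also have "\<dots> = y [^] r \<otimes> (y [^] N) [^] (k div int N)"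
      using y by (simp add: int_pow_mult int_pow_int int_pow_pow[symmetric])
    finally have "x = y [^] r \<otimes> (y [^] N) [^] (k div int N)" .
    then have "x \<otimes> inv (y [^] r) = (y [^] N) [^] (k div int N)"
      using y by (metis inv_solve_right int_pow_closed m_closed m_comm nat_pow_closed)
    moreover have "(y [^] N) [^] (k div int N) \<in> Q"
      by (rule subgroup_int_pow_closed[OF closed_subgroupD(2)[OF Q] N(2)])
    ultimately have "x \<in> {x \<in> carrier G. x \<otimes> inv (y [^] r) \<in> Q}" using k y by simp
    then show "x \<in> C" unfolding C_def using r(1) by blast
  qed
  ultimately have "T closure_of (range (\<lambda>k::int. y [^] k)) \<subseteq> C" using closure_of_minimal by blast
  then show ?thesis using s that by (auto simp: C_def)
qed

lemma closed_subgroup_annihilator: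
  assumes "closed_subgroup H" "\<F> \<subseteq> chars" shows "closed_subgroup {x \<in> H. \<forall>\<theta>\<in>\<F>. \<theta> x = 1}"
proof -
  have "closed_subgroup (\<Inter>(insert H ((\<lambda>\<theta>. {x \<in> carrier G. \<theta> x = 1}) ` \<F>)))"
    by (rule closed_subgroup_Inter) (use assms closed_subgroup_ker in auto)
  moreover have "\<Inter>(insert H ((\<lambda>\<theta>. {x \<in> carrier G. \<theta> x = 1}) ` \<F>)) = {x \<in> H. \<forall>\<theta>\<in>\<F>. \<theta> x = 1}"
    using closed_subgroupD(3)[OF assms(1)] by auto
  ultimately show ?thesis by simp
qed

text \<open>Otherwise compactness would give a point of \<open>D\<close> outside \<open>U\<close>
  that every character sends to 1, against the separation of points.\<close>

lemma finitely_many_characters: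
  assumes D: "closed_subgroup D" and U: "open_nbhd U"
  obtains \<F> where "finite \<F>" "\<F> \<subseteq> chars" "{x \<in> D. \<forall>\<theta>\<in>\<F>. \<theta> x = 1} \<subseteq> U"
proof -
  define k where "k = (\<lambda>\<F> :: ('a \<Rightarrow> complex) set. {x \<in> D. \<forall>\<theta>\<in>\<F>. \<theta> x = 1} - U)"
  define \<J> where "\<J> = {\<F>. finite \<F> \<and> \<F> \<subseteq> chars}"
  have "\<exists>\<F>\<in>\<J>. k \<F> = {}"
  proof (rule ccontr)
    assume neg: "\<not> (\<exists>\<F>\<in>\<J>. k \<F> = {})"
    have "\<Inter>(k ` \<J>) \<noteq> {}"
    proof (rule chain_fip)
      fix C assume "C \<in> k ` \<J>"
      then obtain \<F> where F: "\<F> \<in> \<J>" "C = k \<F>" by blast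
      have "closed_subgroup {x \<in> D. \<forall>\<theta>\<in>\<F>. \<theta> x = 1}" by (rule closed_subgroup_annihilator[OF D]) (use F in \<open>simp add: \<J>_def\<close>)
      then have "closedin T C" unfolding F(2) k_def using closed_subgroupD(1) U
        by (intro closedin_diff) (auto simp: open_nbhd_def)
      then show "closedin T C \<and> C \<noteq> {}" using neg F by blast
    next
      show "k ` \<J> \<noteq> {}" by (auto simp: \<J>_def)
    next
      fix C C' assume "C \<in> k ` \<J>" "C' \<in> k ` \<J>"
      then obtain \<F> \<F>' where F: "\<F> \<in> \<J>" "C = k \<F>" "\<F>' \<in> \<J>" "C' = k \<F>'" by blast
      then have "k (\<F> \<union> \<F>') \<subseteq> C \<inter> C'" "\<F> \<union> \<F>' \<in> \<J>" by (auto simp: k_def \<J>_def)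
      then show "\<exists>E\<in>k ` \<J>. E \<subseteq> C \<inter> C'" by blast
    qed
    then obtain x where x: "\<And>\<F>. \<F> \<in> \<J> \<Longrightarrow> x \<in> k \<F>" by blast
    have "{} \<in> \<J>" by (simp add: \<J>_def)
    then have xD: "x \<in> D" "x \<notin> U" using x by (auto simp: k_def)
    have xc: "x \<in> carrier G" using xD closed_subgroupD[OF D] by blast
    have "x \<noteq> \<one>" using xD open_nbhd_one[OF U] by auto
    then obtain \<theta> where "\<theta> \<in> chars" "\<theta> x \<noteq> 1" using characters_separate[OF xc] by blast
    then show False using x[of "{\<theta>}"] by (auto simp: k_def \<J>_def)
  qed
  then obtain \<F> where "\<F> \<in> \<J>" "k \<F> = {}" by blast
  then show ?thesis using that[of \<F>] by (auto simp: k_def \<J>_def)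
qed

lemma closed_subgroup_sequence_annihilator:
  assumes "closed_subgroup H" "\<And>i::nat. c i \<in> chars" shows "closed_subgroup {x \<in> H. \<forall>i. c i x = 1}"
proof -
  have "closed_subgroup {x \<in> H. \<forall>\<theta>\<in>range c. \<theta> x = 1}" by (rule closed_subgroup_annihilator) (use assms in auto)
  then show ?thesis by simp
qed

end

section \<open>Essentiality and total disconnectedness\<close>

text \<open>The precompact group of the theorem is the dense subgroup \<open>S\<close>; the ambient
  compact group plays the role of its completion.\<close>

locale locally_minimal_dense_subgroup = compact_abelian_group +
  fixes S :: "'a set"
  assumes subgroup_S: "subgroup S G"
    and dense_S: "T closure_of S = carrier G"
    and seq_complete_S: "seq_complete (G\<lparr>carrier := S\<rparr>) (subtopology T S)"
    and locally_minimal_S: "locally_minimal (G\<lparr>carrier := S\<rparr>) (subtopology T S)"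
    and tot_disconnected_S: "tot_disconnected (G\<lparr>carrier := S\<rparr>) (subtopology T S)"
begin

section \<open>Sequential closedness and local essentiality\<close>

lemma S_carrier: "S \<subseteq> carrier G" by (rule subgroup.subset[OF subgroup_S])
lemma S_one: "\<one> \<in> S" by (rule subgroup.one_closed[OF subgroup_S])
lemma S_mult: "x \<in> S \<Longrightarrow> y \<in> S \<Longrightarrow> x \<otimes> y \<in> S" by (rule subgroup.m_closed[OF subgroup_S])
lemma S_inv: "x \<in> S \<Longrightarrow> inv x \<in> S" by (rule subgroup.m_inv_closed[OF subgroup_S])
lemma S_pow: "x \<in> S \<Longrightarrow> x [^] (n::nat) \<in> S" using subgroup_pow[OF subgroup_S] .

text \<open>Convergence in the ambient group makes the sequence Cauchy in \<open>S\<close>. Its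
  limit in \<open>S\<close> is also a limit in the ambient Hausdorff group, so it is
  \<open>y\<close>.\<close>

lemma seq_closed:
  assumes x: "\<And>n::nat. x n \<in> S" and y: "y \<in> carrier G"
    and lim: "\<And>U. open_nbhd U \<Longrightarrow> \<exists>N. \<forall>n\<ge>N. x n \<otimes> inv y \<in> U"
  shows "y \<in> S"
proof -
  have xc: "x n \<in> carrier G" for n using x S_carrier by blast
  have "group_cauchy (G\<lparr>carrier := S\<rparr>) (subtopology T S) x"
    unfolding group_cauchy_def
  proof (intro conjI allI impI)
    fix U assume U: "openin (subtopology T S) U \<and> \<one>\<^bsub>G\<lparr>carrier := S\<rparr>\<^esub> \<in> U"
    then obtain V where V: "openin T V" "U = V \<inter> S" by (auto simp: openin_subtopology)
    then have "open_nbhd V" using U by (auto simp: open_nbhd_def)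
    then obtain W where W: "open_nbhd W" "W \<subseteq> V" "\<And>x y. x \<in> W \<Longrightarrow> y \<in> W \<Longrightarrow> x \<otimes> y \<in> V" "\<And>x. x \<in> W \<Longrightarrow> inv x \<in> W"
      using open_nbhd_mult by blast
    obtain N where N: "\<And>n. n \<ge> N \<Longrightarrow> x n \<otimes> inv y \<in> W" using lim[OF W(1)] by blast
    have "x m \<otimes> inv\<^bsub>G\<lparr>carrier := S\<rparr>\<^esub> (x n) \<in> U" if "m \<ge> N" "n \<ge> N" for m n
    proof -
      have "(x m \<otimes> inv y) \<otimes> inv (x n \<otimes> inv y) \<in> V" using N W that by blast
      moreover have "(x m \<otimes> inv y) \<otimes> inv (x n \<otimes> inv y) = x m \<otimes> inv (x n)"
      proof -
        have "(a \<otimes> inv y) \<otimes> (inv b \<otimes> y) = a \<otimes> inv b" if "a \<in> carrier G" "b \<in> carrier G" for a b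
        proof -
          have "inv y \<otimes> (inv b \<otimes> y) = inv b"
            using that y by (simp add: m_comm[of "inv b" y] m_assoc[symmetric])
          then show ?thesis using that y by (simp add: m_assoc)
        qed
        then show ?thesis using xc y by (simp add: inv_mult)
      qed
      moreover have "inv\<^bsub>G\<lparr>carrier := S\<rparr>\<^esub> (x n) = inv (x n)" using m_inv_consistent[OF subgroup_S x] .
      ultimately show ?thesis using V S_mult[OF x S_inv[OF x]] by simp
    qed
    then show "\<exists>N. \<forall>m\<ge>N. \<forall>n\<ge>N. x m \<otimes>\<^bsub>G\<lparr>carrier := S\<rparr>\<^esub> inv\<^bsub>G\<lparr>carrier := S\<rparr>\<^esub> (x n) \<in> U" by auto
  qed (use x in simp)
  then obtain l where l: "l \<in> S" "limitin (subtopology T S) x l sequentially"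
    using seq_complete_S unfolding seq_complete_def by auto
  then have 1: "limitin T x l sequentially" by (simp add: limitin_subtopology)
  have 2: "limitin T x y sequentially"
    unfolding limitin_def
  proof (intro conjI allI impI)
    fix V assume V: "openin T V \<and> y \<in> V"
    then obtain N where N: "\<And>n. n \<ge> N \<Longrightarrow> x n \<otimes> inv y \<in> {x \<in> carrier G. y \<otimes> x \<in> V}"
      using lim[OF open_nbhd_translate] by blast
    have "x n \<in> V" if "n \<ge> N" for n
    proof -
      have "y \<otimes> (x n \<otimes> inv y) = x n" using xc y by (metis inv_closed m_closed m_comm r_inv r_one m_assoc)
      then show ?thesis using N[OF that] by simp
    qed
    then show "\<forall>\<^sub>F n in sequentially. x n \<in> V" by (auto simp: eventually_sequentially)
  qed (use y in simp)
  have "l = y" using limitin_Hausdorff_unique[OF 1 2 _ Hausdorff] by simp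
  then show ?thesis using l by simp
qed

text \<open>By compactness the nested closed neighbourhoods, cut with \<open>M\<close>, are
  eventually inside every neighbourhood of the identity. A closure point of
  \<open>S \<inter> M\<close> is therefore the limit of a sequence, and \<open>seq_closed\<close>
  applies.\<close>

lemma closed_subgroup_gdelta_one_Int:
  assumes M: "closed_subgroup M" "gdelta_one M" shows "closed_subgroup (S \<inter> M)"
proof -
  note M' = closed_subgroupD[OF M(1)]
  obtain C :: "nat \<Rightarrow> 'a set" where C: "\<And>n. closedin T (C n)" "\<And>n. \<exists>W. open_nbhd W \<and> W \<subseteq> C n" "\<And>n. C (Suc n) \<subseteq> C n"
    "M \<inter> (\<Inter>n. C n) \<subseteq> {\<one>}" using gdelta_one_nested[OF M(2)] by blast
  have "y \<in> S" if y: "y \<in> T closure_of (S \<inter> M)" for y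
  proof -
    have yM: "y \<in> M" using closure_of_minimal[of "S \<inter> M" M T] M'(1) y by blast
    then have yc: "y \<in> carrier G" using M' by blast
    have "\<exists>x. x \<in> S \<and> x \<in> M \<and> x \<otimes> inv y \<in> C n" for n
    proof -
      obtain W where W: "open_nbhd W" "W \<subseteq> C n" using C(2) by blast
      have "continuous_map T T (\<lambda>x. x \<otimes> inv y)" using yc
        by (intro continuous_intros_group continuous_map_const_group) auto
      then have "openin T {x \<in> carrier G. x \<otimes> inv y \<in> W}"
        using openin_preimage W(1) unfolding open_nbhd_def by blast
      moreover have "y \<in> {x \<in> carrier G. x \<otimes> inv y \<in> W}" using yc open_nbhd_one[OF W(1)] by simp
      ultimately obtain x where "x \<in> S \<inter> M" "x \<in> {x \<in> carrier G. x \<otimes> inv y \<in> W}"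
        using y[unfolded in_closure_of] by meson
      then show ?thesis using W(2) by blast
    qed
    then obtain x where x: "\<And>n. x n \<in> S" "\<And>n. x n \<in> M" "\<And>n. x n \<otimes> inv y \<in> C n" by metis
    show ?thesis
    proof (rule seq_closed[OF x(1) yc])
      fix U assume U: "open_nbhd U"
      have "closedin T (M \<inter> C n)" for n using M'(1) C(1) by blast
      moreover have "M \<inter> C (Suc n) \<subseteq> M \<inter> C n" for n using C(3) by blast
      moreover have "openin T U" "(\<Inter>n. M \<inter> C n) \<subseteq> U" using U C(4) open_nbhd_one[OF U] by (auto simp: open_nbhd_def)
      ultimately obtain N where N: "M \<inter> C N \<subseteq> U" by (rule nest_subset)
      have "C n \<subseteq> C N" if "n \<ge> N" for n using lift_Suc_antimono_le[of C, OF C(3) that] .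
      moreover have "x n \<otimes> inv y \<in> M" for n using x(2) M'(5,6) yM by simp
      ultimately have "x n \<otimes> inv y \<in> U" if "n \<ge> N" for n using that N x(3)[of n] by auto
      then show "\<exists>N. \<forall>n\<ge>N. x n \<otimes> inv y \<in> U" by blast
    qed
  qed
  moreover have "T closure_of (S \<inter> M) \<subseteq> M" using closure_of_minimal[of "S \<inter> M" M T] M'(1) by blast
  ultimately have "closedin T (S \<inter> M)"
    using closure_of_subset_eq[of "S \<inter> M" T] S_carrier by auto
  then show ?thesis using subgroup_S M'(2) subgroups_Inter_pair by (auto simp: closed_subgroup_def)
qed

text \<open>A closed subgroup L close to the identity that meets S trivially induces on S the coarser
  group topology of the quotient by L; local minimality makes both topologies equal, and density of S
  then forces L into every neighbourhood of the identity.\<close>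

lemma locally_essential:
  obtains V0 where "open_nbhd V0" "\<And>L. closed_subgroup L \<Longrightarrow> L \<subseteq> V0 \<Longrightarrow> L \<inter> S \<subseteq> {\<one>} \<Longrightarrow> L = {\<one>}"
proof -
  obtain V where V: "nbhd (subtopology T S) \<one> V"
    and min: "\<And>(H :: 'a monoid) TH f. topgroup H TH \<Longrightarrow> Hausdorff_space TH \<Longrightarrow> f \<in> iso (G\<lparr>carrier := S\<rparr>) H \<Longrightarrow>
       continuous_map (subtopology T S) TH f \<Longrightarrow> nbhd TH \<one>\<^bsub>H\<^esub> (f ` V) \<Longrightarrow> open_map (subtopology T S) TH f"
    using locally_minimal_S unfolding locally_minimal_def by auto
  obtain U0 where U0: "openin (subtopology T S) U0" "\<one> \<in> U0" "U0 \<subseteq> V" using V unfolding nbhd_def by blast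
  have VS: "V \<subseteq> S" using V unfolding nbhd_def by auto
  obtain Q where Q: "openin T Q" "U0 = Q \<inter> S" using U0(1) by (auto simp: openin_subtopology)
  have "open_nbhd Q" using Q U0(2) by (simp add: open_nbhd_def)
  then obtain V0 where V0: "open_nbhd V0" "V0 \<subseteq> Q" "\<And>x y. x \<in> V0 \<Longrightarrow> y \<in> V0 \<Longrightarrow> x \<otimes> y \<in> Q" "\<And>x. x \<in> V0 \<Longrightarrow> inv x \<in> V0"
    using open_nbhd_mult by blast
  have "L = {\<one>}" if L: "closed_subgroup L" "L \<subseteq> V0" "L \<inter> S \<subseteq> {\<one>}" for L
  proof -
    note L' = closed_subgroupD[OF L(1)]
    have Lc: "l \<in> carrier G" if "l \<in> L" for l using that L' by blast
    define H where "H = G\<lparr>carrier := S\<rparr>"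
    \<comment> \<open>Open \<open>L\<close>-saturated sets correspond to the open sets of the
      quotient by \<open>L\<close>. Their traces topologize \<open>S\<close> itself instead of a set
      of cosets, so the target group has the element type that \<open>locally_minimal\<close>
      prescribes.\<close>
    define sat where "sat = (\<lambda>B. \<forall>b\<in>B. \<forall>l\<in>L. b \<otimes> l \<in> B)"
    define op where "op = (\<lambda>A. \<exists>B. openin T B \<and> sat B \<and> A = B \<inter> S)"
    define TH where "TH = topology op"
    have "istopology op"
      unfolding istopology_def
    proof (intro conjI allI impI)
      fix A A' assume "op A" "op A'"
      then obtain B B' where "openin T B" "sat B" "A = B \<inter> S" "openin T B'" "sat B'" "A' = B' \<inter> S"
        unfolding op_def by blast
      then show "op (A \<inter> A')" unfolding op_def sat_def by (intro exI[of _ "B \<inter> B'"]) auto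
    next
      fix \<K> assume "\<forall>A\<in>\<K>. op A"
      then obtain B where B: "\<And>A. A \<in> \<K> \<Longrightarrow> openin T (B A) \<and> sat (B A) \<and> A = B A \<inter> S"
        unfolding op_def by metis
      have "openin T (\<Union>(B ` \<K>))" using B by (intro openin_Union) auto
      moreover have "sat (\<Union>(B ` \<K>))" using B unfolding sat_def by blast
      moreover have "\<Union>\<K> = \<Union>(B ` \<K>) \<inter> S" using B by blast
      ultimately show "op (\<Union>\<K>)" unfolding op_def by blast
    qed
    then have opTH: "openin TH = op" unfolding TH_def by simp
    \<comment> \<open>The product set of \<open>x\<close>, \<open>W\<close> and \<open>L\<close>, a
      saturated open neighbourhood of \<open>x\<close>.\<close>
    define nbh where "nbh = (\<lambda>x W. {z \<in> carrier G. \<exists>l\<in>L. inv x \<otimes> (z \<otimes> l) \<in> W})"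
    have nbh: "openin T (nbh x W)" "sat (nbh x W)" "x \<in> nbh x W" if x: "x \<in> carrier G" and W: "open_nbhd W" for x W
    proof -
      have "nbh x W = (\<Union>l\<in>L. {z \<in> carrier G. inv x \<otimes> (z \<otimes> l) \<in> W})" by (auto simp: nbh_def)
      moreover have "openin T {z \<in> carrier G. inv x \<otimes> (z \<otimes> l) \<in> W}" if "l \<in> L" for l
      proof -
        have "continuous_map T T (\<lambda>z. inv x \<otimes> (z \<otimes> l))" using x Lc[OF that]
          by (intro continuous_intros_group continuous_map_const_group) auto
        then show ?thesis using openin_preimage W unfolding open_nbhd_def by blast
      qed
      ultimately show "openin T (nbh x W)" by auto
      have "z \<otimes> l' \<in> nbh x W" if z: "z \<in> nbh x W" and l': "l' \<in> L" for z l'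
      proof -
        obtain l where l: "l \<in> L" "z \<in> carrier G" "inv x \<otimes> (z \<otimes> l) \<in> W" using z by (auto simp: nbh_def)
        have "z \<otimes> l' \<otimes> (inv l' \<otimes> l) = z \<otimes> l"
          using l(2) Lc[OF l'] Lc[OF l(1)] by (metis inv_closed m_assoc m_closed r_inv r_one)
        moreover have "inv l' \<otimes> l \<in> L" using L' l l' by blast
        ultimately show ?thesis using l Lc[OF l'] unfolding nbh_def by (auto intro!: bexI[of _ "inv l' \<otimes> l"])
      qed
      then show "sat (nbh x W)" unfolding sat_def by blast
      show "x \<in> nbh x W" using x open_nbhd_one[OF W] L'(4) unfolding nbh_def by (auto intro!: bexI[of _ \<one>])
    qed
    have opn: "openin TH (nbh x W \<inter> S)" if "x \<in> carrier G" "open_nbhd W" for x W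
      unfolding opTH op_def using nbh[OF that] by blast
    have "openin TH S" unfolding opTH op_def sat_def
      by (intro exI[of _ "carrier G"]) (use S_carrier Lc openin_topspace[of T] in auto)
    then have tsH: "topspace TH = S"
      using openin_subset[of TH S] openin_topspace[of TH] unfolding opTH op_def by blast
    interpret H: group H unfolding H_def using subgroup_imp_group[OF subgroup_S] .
    have invH: "inv\<^bsub>H\<^esub> x = inv x" if "x \<in> S" for x unfolding H_def using m_inv_consistent[OF subgroup_S that] .
    have tgH: "topgroup H TH"
      unfolding topgroup_def
    proof (intro conjI)
      show "group H" by (rule H.is_group)
      show "topspace TH = carrier H" by (simp add: tsH H_def)
      show "continuous_map (prod_topology TH TH) TH (\<lambda>(x, y). x \<otimes>\<^bsub>H\<^esub> y)"
        unfolding continuous_map_def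
      proof (intro conjI allI impI)
        show "(\<lambda>(x, y). x \<otimes>\<^bsub>H\<^esub> y) \<in> topspace (prod_topology TH TH) \<rightarrow> topspace TH"
          using S_mult by (auto simp: tsH H_def)
        fix A assume "openin TH A"
        then obtain B where B: "openin T B" "sat B" "A = B \<inter> S" unfolding opTH op_def by blast
        show "openin (prod_topology TH TH) {p \<in> topspace (prod_topology TH TH). (\<lambda>(x, y). x \<otimes>\<^bsub>H\<^esub> y) p \<in> A}"
          unfolding openin_prod_topology_alt
        proof (intro allI impI)
          fix x y assume "(x, y) \<in> {p \<in> topspace (prod_topology TH TH). (\<lambda>(x, y). x \<otimes>\<^bsub>H\<^esub> y) p \<in> A}"
          then have xy: "x \<in> S" "y \<in> S" "x \<otimes> y \<in> B" by (auto simp: tsH H_def B)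
          have xyc: "x \<in> carrier G" "y \<in> carrier G" using xy S_carrier by auto
          obtain W where W: "open_nbhd W" "\<forall>w\<in>W. \<forall>w'\<in>W. (x \<otimes> y) \<otimes> (w \<otimes> w') \<in> B"
            using open_nbhd_mult_at[OF B(1) xy(3)] by blast
          have "z \<otimes> z' \<in> B" if z: "z \<in> nbh x W" and z': "z' \<in> nbh y W" for z z'
          proof -
            obtain l where l: "l \<in> L" "z \<in> carrier G" "inv x \<otimes> (z \<otimes> l) \<in> W" using z by (auto simp: nbh_def)
            obtain l' where l': "l' \<in> L" "z' \<in> carrier G" "inv y \<otimes> (z' \<otimes> l') \<in> W" using z' by (auto simp: nbh_def)
            have cc: "l \<in> carrier G" "l' \<in> carrier G" using l l' Lc by auto
            have "(x \<otimes> y) \<otimes> ((inv x \<otimes> (z \<otimes> l)) \<otimes> (inv y \<otimes> (z' \<otimes> l'))) \<in> B" using W(2) l(3) l'(3) by blast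
            moreover have "(x \<otimes> y) \<otimes> ((inv x \<otimes> (z \<otimes> l)) \<otimes> (inv y \<otimes> (z' \<otimes> l'))) = (z \<otimes> z') \<otimes> (l \<otimes> l')"
            proof -
              have "(x \<otimes> y) \<otimes> ((inv x \<otimes> (z \<otimes> l)) \<otimes> (inv y \<otimes> (z' \<otimes> l'))) =
                 (x \<otimes> inv x) \<otimes> (y \<otimes> inv y) \<otimes> ((z \<otimes> z') \<otimes> (l \<otimes> l'))"
                using xyc l l' cc by (simp add: m_ac del: r_inv)
              then show ?thesis using xyc l l' cc by simp
            qed
            ultimately have "(z \<otimes> z') \<otimes> (l \<otimes> l') \<in> B" by simp
            moreover have "inv (l \<otimes> l') \<in> L" using L' l l' by blast
            ultimately have "(z \<otimes> z') \<otimes> (l \<otimes> l') \<otimes> inv (l \<otimes> l') \<in> B" using B(2) unfolding sat_def by blast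
            then show ?thesis using l(2) l'(2) cc by (simp add: m_assoc del: inv_mult_group)
          qed
          then have "(nbh x W \<inter> S) \<times> (nbh y W \<inter> S) \<subseteq> {p \<in> topspace (prod_topology TH TH). (\<lambda>(x, y). x \<otimes>\<^bsub>H\<^esub> y) p \<in> A}"
            using S_mult by (auto simp: tsH H_def B)
          then show "\<exists>U V. openin TH U \<and> openin TH V \<and> x \<in> U \<and> y \<in> V \<and> U \<times> V \<subseteq>
             {p \<in> topspace (prod_topology TH TH). (\<lambda>(x, y). x \<otimes>\<^bsub>H\<^esub> y) p \<in> A}"
            using opn[OF xyc(1) W(1)] opn[OF xyc(2) W(1)] nbh(3)[OF xyc(1) W(1)] nbh(3)[OF xyc(2) W(1)] xy(1,2)
            by (intro exI[of _ "nbh x W \<inter> S"] exI[of _ "nbh y W \<inter> S"]) simp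
        qed
      qed
      show "continuous_map TH TH (\<lambda>x. inv\<^bsub>H\<^esub> x)"
        unfolding continuous_map_def
      proof (intro conjI allI impI)
        show "(\<lambda>x. inv\<^bsub>H\<^esub> x) \<in> topspace TH \<rightarrow> topspace TH" using S_inv by (auto simp: tsH invH)
        fix A assume "openin TH A"
        then obtain B where B: "openin T B" "sat B" "A = B \<inter> S" unfolding opTH op_def by blast
        define B' where "B' = {z \<in> carrier G. inv z \<in> B}"
        have "openin T B'" unfolding B'_def by (intro openin_preimage B continuous_intros_group)
        moreover have "sat B'" unfolding sat_def
        proof (intro ballI)
          fix b l assume b: "b \<in> B'" "l \<in> L"
          then have "inv b \<otimes> inv l \<in> B" using B(2) L' unfolding sat_def B'_def by blast
          then show "b \<otimes> l \<in> B'" using b Lc by (auto simp: B'_def inv_mult)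
        qed
        moreover have "{x \<in> topspace TH. inv\<^bsub>H\<^esub> x \<in> A} = B' \<inter> S"
          using S_inv S_carrier by (auto simp: tsH invH B B'_def)
        ultimately show "openin TH {x \<in> topspace TH. inv\<^bsub>H\<^esub> x \<in> A}" unfolding opTH op_def by blast
      qed
    qed
    have hsH: "Hausdorff_space TH"
      unfolding Hausdorff_space_def
    proof (intro allI impI)
      fix x y assume xy: "x \<in> topspace TH \<and> y \<in> topspace TH \<and> x \<noteq> y"
      then have xyS: "x \<in> S" "y \<in> S" "x \<noteq> y" by (auto simp: tsH)
      have xyc: "x \<in> carrier G" "y \<in> carrier G" using xyS S_carrier by auto
      \<comment> \<open>Distinct points of \<open>S\<close> lie in distinct cosets of
        \<open>L\<close>; this is where the trivial intersection of \<open>L\<close> and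
        \<open>S\<close> enters.\<close>
      have "inv x \<otimes> y \<notin> L"
      proof
        assume "inv x \<otimes> y \<in> L"
        then have "inv x \<otimes> y = \<one>" using L(3) S_mult[OF S_inv[OF xyS(1)] xyS(2)] by blast
        then show False using xyc xyS(3) by (metis inv_closed inv_equality inv_inv m_comm)
      qed
      moreover have "openin T (carrier G - L)" using openin_diff[OF openin_topspace L'(1)] by simp
      moreover have "inv x \<otimes> y \<in> carrier G" using xyc by simp
      ultimately obtain W where W: "open_nbhd W" "\<forall>w\<in>W. \<forall>w'\<in>W. (inv x \<otimes> y) \<otimes> (w \<otimes> w') \<in> carrier G - L"
        "\<forall>w\<in>W. inv w \<in> W"
        using open_nbhd_mult_at[of "carrier G - L" "inv x \<otimes> y"] by blast
      have "nbh x W \<inter> nbh y W = {}"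
      proof (rule ccontr)
        assume "nbh x W \<inter> nbh y W \<noteq> {}"
        then obtain z l l' where l: "z \<in> carrier G" "l \<in> L" "inv x \<otimes> (z \<otimes> l) \<in> W" "l' \<in> L" "inv y \<otimes> (z \<otimes> l') \<in> W"
          by (auto simp: nbh_def)
        have cc: "l \<in> carrier G" "l' \<in> carrier G" using l Lc by auto
        have "(inv x \<otimes> y) \<otimes> ((inv y \<otimes> (z \<otimes> l')) \<otimes> inv (inv x \<otimes> (z \<otimes> l))) \<notin> L"
          using W(2,3) l(3,5) by blast
        moreover have "(inv x \<otimes> y) \<otimes> ((inv y \<otimes> (z \<otimes> l')) \<otimes> inv (inv x \<otimes> (z \<otimes> l))) = l' \<otimes> inv l"
        proof -
          define p where "p = inv x \<otimes> z"
          have p: "p \<in> carrier G" using xyc l by (simp add: p_def)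
          have cancel: "a \<otimes> (inv a \<otimes> b) = b" if "a \<in> carrier G" "b \<in> carrier G" for a b
            using that by (simp add: m_assoc[symmetric])
          have "(inv x \<otimes> y) \<otimes> ((inv y \<otimes> (z \<otimes> l')) \<otimes> inv (inv x \<otimes> (z \<otimes> l))) = (p \<otimes> l') \<otimes> inv (p \<otimes> l)"
            using xyc l cc by (simp add: p_def m_assoc cancel)
          also have "\<dots> = (l' \<otimes> p) \<otimes> (inv p \<otimes> inv l)" using p cc by (simp add: inv_mult m_comm[of p l'])
          also have "\<dots> = l' \<otimes> inv l" using p cc by (simp add: m_assoc cancel)
          finally show ?thesis .
        qed
        ultimately show False using L' l by simp
      qed
      then show "\<exists>U V. openin TH U \<and> openin TH V \<and> x \<in> U \<and> y \<in> V \<and> disjnt U V"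
        using opn[OF xyc(1) W(1)] opn[OF xyc(2) W(1)] nbh(3)[OF xyc(1) W(1)] nbh(3)[OF xyc(2) W(1)] xyS
        by (intro exI[of _ "nbh x W \<inter> S"] exI[of _ "nbh y W \<inter> S"]) (auto simp: disjnt_def)
    qed
    have "open_map (subtopology T S) TH (\<lambda>x. x)"
    proof (rule min[OF tgH hsH])
      show "(\<lambda>x. x) \<in> iso (G\<lparr>carrier := S\<rparr>) H" unfolding H_def by (auto simp: iso_def hom_def bij_betw_def)
      show "continuous_map (subtopology T S) TH (\<lambda>x. x)"
        unfolding continuous_map_def
      proof (intro conjI allI impI)
        show "(\<lambda>x. x) \<in> topspace (subtopology T S) \<rightarrow> topspace TH" by (auto simp: tsH)
        fix A assume "openin TH A"
        then obtain B where B: "openin T B" "A = B \<inter> S" unfolding opTH op_def by blast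
        then have "{x \<in> topspace (subtopology T S). x \<in> A} = B \<inter> S" using S_carrier by auto
        then show "openin (subtopology T S) {x \<in> topspace (subtopology T S). x \<in> A}"
          using B by (auto simp: openin_subtopology)
      qed
      \<comment> \<open>Smallness of \<open>L\<close> is used here: saturating \<open>V0\<close> by
        \<open>L\<close> stays inside \<open>Q\<close>, so \<open>V\<close> remains a neighbourhood
        of the identity in the coarser topology.\<close>
      have "nbh \<one> V0 \<inter> S \<subseteq> V"
      proof
        fix z assume z: "z \<in> nbh \<one> V0 \<inter> S"
        then obtain l where l: "l \<in> L" "z \<in> carrier G" "z \<in> S" "inv \<one> \<otimes> (z \<otimes> l) \<in> V0" by (auto simp: nbh_def)
        have lc: "l \<in> carrier G" using l Lc by auto
        have "inv l \<in> V0" using l(1) L(2) L' by blast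
        then have "(z \<otimes> l) \<otimes> inv l \<in> Q" using V0(3) l(2,4) lc by simp
        then have "z \<in> Q" using l lc by (simp add: m_assoc)
        then show "z \<in> V" using l(3) U0(3) Q(2) by blast
      qed
      then show "nbhd TH \<one>\<^bsub>H\<^esub> ((\<lambda>x. x) ` V)"
        unfolding nbhd_def using VS opn[OF one_closed V0(1)] nbh(3)[OF one_closed V0(1)] S_one
        by (auto simp: tsH H_def intro!: exI[of _ "nbh \<one> V0 \<inter> S"])
    qed
    then have om: "openin TH (B \<inter> S)" if "openin T B" for B
      using that unfolding open_map_def by (auto simp: openin_subtopology image_def)
    have "l \<in> U" if l: "l \<in> L" and U: "open_nbhd U" for l U
    proof -
      obtain W where W: "open_nbhd W" "T closure_of W \<subseteq> U" using closure_open_nbhd[OF U] by blast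
      \<comment> \<open>Openness of the identity map makes the trace of \<open>W\<close> the trace
        of a saturated open \<open>B\<close>. Saturation puts \<open>L\<close> into
        \<open>B\<close>, and density puts \<open>B\<close> into the closure of
        \<open>W\<close>.\<close>
      have "openin TH (W \<inter> S)" using om W by (simp add: open_nbhd_def)
      then obtain B where B: "openin T B" "sat B" "W \<inter> S = B \<inter> S" unfolding opTH op_def by blast
      have "\<one> \<in> B" using B(3) S_one open_nbhd_one[OF W(1)] by blast
      then have "\<one> \<otimes> l \<in> B" using B(2) l unfolding sat_def by blast
      then have lB: "l \<in> B" using Lc[OF l] by simp
      have "B \<inter> T closure_of S \<subseteq> T closure_of (B \<inter> S)" using openin_Int_closure_of_subset[OF B(1)] .
      then have "l \<in> T closure_of (W \<inter> S)" using lB Lc[OF l] dense_S B(3) by auto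
      moreover have "T closure_of (W \<inter> S) \<subseteq> T closure_of W" by (rule closure_of_mono) auto
      ultimately show ?thesis using W(2) by blast
    qed
    then have "l = \<one>" if "l \<in> L" for l using open_nbhd_Inter_one Lc that by blast
    then show ?thesis using L'(4) by blast
  qed
  then show ?thesis using that V0(1) by blast
qed

text \<open>The subgroup H stabilizes the trace on B of a clopen subset of S, which is compact.\<close>

lemma small_subgroup_of_subset_S:
  assumes B: "closed_subgroup B" "B \<subseteq> S" and U: "open_nbhd U"
  shows "\<exists>H n. subgroup H G \<and> H \<subseteq> U \<and> n > (0::nat) \<and> (\<forall>y\<in>B. y [^] n \<in> H)"
proof -
  note B' = closed_subgroupD[OF B(1)]
  define \<B> where "\<B> = {Z. closedin (subtopology T S) Z \<and> openin (subtopology T S) Z \<and> \<one> \<in> Z}"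
  \<comment> \<open>Since \<open>B\<close> lies in \<open>S\<close>, a relatively closed subset of
    \<open>S\<close> has a closed, hence compact, trace on \<open>B\<close>.\<close>
  have ZB: "closedin T (Z \<inter> B)" if Z: "closedin (subtopology T S) Z" for Z
  proof -
    obtain C where "closedin T C" "Z = C \<inter> S" using Z by (auto simp: closedin_subtopology)
    moreover then have "Z \<inter> B = C \<inter> B" using B(2) by auto
    ultimately show ?thesis using B'(1) by auto
  qed
  have "\<exists>Z\<in>\<B>. Z \<inter> B \<subseteq> U"
  proof (rule ccontr)
    assume neg: "\<not> ?thesis"
    have "\<Inter>((\<lambda>Z. Z \<inter> B - U) ` \<B>) \<noteq> {}"
    proof (rule chain_fip)
      fix C assume "C \<in> (\<lambda>Z. Z \<inter> B - U) ` \<B>"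
      then obtain Z where Z: "Z \<in> \<B>" "C = Z \<inter> B - U" by blast
      have "closedin T C" unfolding Z(2) using ZB Z(1) U by (intro closedin_diff) (auto simp: \<B>_def open_nbhd_def)
      then show "closedin T C \<and> C \<noteq> {}" using neg Z by blast
    next
      have "S \<in> \<B>" using S_one S_carrier openin_topspace[of "subtopology T S"] closedin_topspace[of "subtopology T S"]
        by (simp add: \<B>_def Int_absorb1)
      then show "(\<lambda>Z. Z \<inter> B - U) ` \<B> \<noteq> {}" by blast
    next
      fix C C' assume "C \<in> (\<lambda>Z. Z \<inter> B - U) ` \<B>" "C' \<in> (\<lambda>Z. Z \<inter> B - U) ` \<B>"
      then obtain Z Z' where Z: "Z \<in> \<B>" "C = Z \<inter> B - U" "Z' \<in> \<B>" "C' = Z' \<inter> B - U" by blast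
      then have "Z \<inter> Z' \<in> \<B>" by (auto simp: \<B>_def)
      moreover have "Z \<inter> Z' \<inter> B - U \<subseteq> C \<inter> C'" using Z by blast
      ultimately show "\<exists>E\<in>(\<lambda>Z. Z \<inter> B - U) ` \<B>. E \<subseteq> C \<inter> C'" by (intro bexI[OF _ imageI])
    qed
    then obtain x where x: "\<And>Z. Z \<in> \<B> \<Longrightarrow> x \<in> Z \<inter> B - U" by blast
    have SZ: "S \<in> \<B>" using S_one S_carrier openin_topspace[of "subtopology T S"] closedin_topspace[of "subtopology T S"]
      by (simp add: \<B>_def Int_absorb1)
    then have xB: "x \<in> S" "x \<notin> U" using x by blast+
    have "quasi_component_of (subtopology T S) \<one> x"
      unfolding quasi_component_of_def
    proof (intro conjI allI impI)
      show "\<one> \<in> topspace (subtopology T S)" "x \<in> topspace (subtopology T S)" using S_one xB S_carrier by auto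
      fix Z assume Z: "closedin (subtopology T S) Z \<and> openin (subtopology T S) Z"
      show "\<one> \<in> Z \<longleftrightarrow> x \<in> Z"
      proof (cases "\<one> \<in> Z")
        case True
        then have "Z \<in> \<B>" using Z by (simp add: \<B>_def)
        then show ?thesis using True x by blast
      next
        case False
        have ts: "topspace (subtopology T S) = S" using S_carrier by auto
        have "closedin (subtopology T S) (S - Z)" "openin (subtopology T S) (S - Z)"
          using Z closedin_diff[OF closedin_topspace, of "subtopology T S" Z] openin_diff[OF openin_topspace, of "subtopology T S" Z] ts
          by auto
        then have "S - Z \<in> \<B>" using False S_one by (simp add: \<B>_def)
        then have "x \<in> S - Z" using x by blast
        then show ?thesis using False by blast
      qed
    qed
    then have "x = \<one>" using tot_disconnected_S unfolding tot_disconnected_def by auto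
    then show False using xB(2) open_nbhd_one[OF U] by blast
  qed
  then obtain Z where Z: "Z \<in> \<B>" "Z \<inter> B \<subseteq> U" by blast
  define C where "C = Z \<inter> B"
  have Ccl: "closedin T C" unfolding C_def using ZB Z by (auto simp: \<B>_def)
  have one: "\<one> \<in> C" using Z B' by (auto simp: C_def \<B>_def)
  have "closedin T ((S - Z) \<inter> B)"
  proof (rule ZB)
    have ts: "topspace (subtopology T S) = S" using S_carrier by auto
    show "closedin (subtopology T S) (S - Z)"
      using Z(1) closedin_diff[OF closedin_topspace, of "subtopology T S" Z] ts by (auto simp: \<B>_def)
  qed
  moreover have "(S - Z) \<inter> B = B - C" using B(2) by (auto simp: C_def)
  ultimately have "openin T (carrier G - (B - C))" using openin_diff[OF openin_topspace, of T "B - C"] by simp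
  moreover have "C \<subseteq> carrier G - (B - C)" using closedin_subset[OF Ccl] by auto
  ultimately obtain W1 where W1: "open_nbhd W1" "\<And>w c. w \<in> W1 \<Longrightarrow> c \<in> C \<Longrightarrow> c \<otimes> w \<in> carrier G - (B - C)"
    using tube[OF Ccl] by blast
  obtain W where W: "open_nbhd W" "W \<subseteq> W1" "\<And>x y. x \<in> W \<Longrightarrow> y \<in> W \<Longrightarrow> x \<otimes> y \<in> W1" "\<And>x. x \<in> W \<Longrightarrow> inv x \<in> W"
    using open_nbhd_mult[OF W1(1)] by blast
  have Bc: "x \<in> carrier G" if "x \<in> B" for x using B' that by blast
  have CB: "C \<subseteq> B" by (auto simp: C_def)
  \<comment> \<open>Invariance is required under \<open>x\<close> and under its inverse, so closure
    under inversion holds by symmetry.\<close>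
  define H where "H = {x \<in> B. \<forall>c\<in>C. x \<otimes> c \<in> C \<and> inv x \<otimes> c \<in> C}"
  have "subgroup H G"
  proof (rule subgroupI')
    show "H \<subseteq> carrier G" using Bc by (auto simp: H_def)
    show "\<one> \<in> H" using B'(4) CB Bc by (auto simp: H_def subset_iff)
    show "x \<otimes> y \<in> H" if xy: "x \<in> H" "y \<in> H" for x y
    proof -
      have xyB: "x \<in> B" "y \<in> B" using xy by (auto simp: H_def)
      have "(x \<otimes> y) \<otimes> c \<in> C \<and> inv (x \<otimes> y) \<otimes> c \<in> C" if c: "c \<in> C" for c
      proof
        have cc: "c \<in> carrier G" using c CB Bc by blast
        have "x \<otimes> (y \<otimes> c) \<in> C" using xy c unfolding H_def by blast
        then show "(x \<otimes> y) \<otimes> c \<in> C" using xyB cc Bc by (simp add: m_assoc)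
        have "inv x \<otimes> (inv y \<otimes> c) \<in> C" using xy c unfolding H_def by blast
        then show "inv (x \<otimes> y) \<otimes> c \<in> C" using xyB cc Bc by (simp add: m_assoc inv_mult)
      qed
      then show ?thesis using B'(5) xyB by (simp add: H_def)
    qed
    show "inv x \<in> H" if "x \<in> H" for x using that B'(6) Bc by (auto simp: H_def)
  qed
  moreover have "H \<subseteq> U"
  proof
    fix x assume x: "x \<in> H"
    then have "x \<otimes> \<one> \<in> C" using one unfolding H_def by blast
    moreover have "x \<in> carrier G" using x Bc by (simp add: H_def)
    ultimately show "x \<in> U" using Z(2) by (simp add: C_def subset_iff)
  qed
  moreover have WH: "y \<in> H" if y: "y \<in> B" "y \<in> W1" "inv y \<in> W1" for y
  proof -
    have "y \<otimes> c \<in> C \<and> inv y \<otimes> c \<in> C" if c: "c \<in> C" for c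
    proof
      have cB: "c \<in> B" using c CB by blast
      have "c \<otimes> y \<in> C" using W1(2)[OF y(2) c] B'(5)[OF cB y(1)] by blast
      then show "y \<otimes> c \<in> C" using m_comm Bc cB y by simp
      have "c \<otimes> inv y \<in> C" using W1(2)[OF y(3) c] B'(5)[OF cB B'(6)[OF y(1)]] by blast
      then show "inv y \<otimes> c \<in> C" using m_comm[of c "inv y"] Bc cB y by simp
    qed
    then show ?thesis using y by (simp add: H_def)
  qed
  moreover obtain F where F: "finite F" "F \<subseteq> carrier G" "\<And>x. x \<in> carrier G \<Longrightarrow> \<exists>f\<in>F. inv f \<otimes> x \<in> W"
    using finite_cover[OF W(1)] by blast
  \<comment> \<open>The pigeonhole principle finds an exponent between 1 and \<open>card F\<close>
    that depends on \<open>y\<close>; the factorial is a common multiple of all possible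
    ones.\<close>
  moreover have "y [^] (fact (card F) :: nat) \<in> H" if y: "y \<in> B" for y
  proof -
    have yc: "y \<in> carrier G" using y Bc by blast
    obtain s where s: "\<And>x. x \<in> carrier G \<Longrightarrow> s x \<in> F \<and> inv (s x) \<otimes> x \<in> W" using F(3) by metis
    have "\<not> inj_on (\<lambda>n. s (y [^] (n::nat))) {..card F}"
    proof
      assume "inj_on (\<lambda>n. s (y [^] (n::nat))) {..card F}"
      then have "card {..card F} \<le> card F" using F(1) s yc by (intro card_inj_on_le[of "\<lambda>n. s (y [^] n)"]) auto
      then show False by simp
    qed
    then obtain i j where ij: "i < j" "j \<le> card F" "s (y [^] i) = s (y [^] j)"
      unfolding inj_on_def by (metis atMost_iff nat_neq_iff)
    define f where "f = s (y [^] i)"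
    have fc: "f \<in> carrier G" using s[of "y [^] i"] yc F(2) by (auto simp: f_def)
    have w: "inv f \<otimes> y [^] i \<in> W" "inv f \<otimes> y [^] j \<in> W"
      using s[of "y [^] i"] s[of "y [^] j"] yc ij(3) by (auto simp: f_def)
    have e: "inv (inv f \<otimes> y [^] i) \<otimes> (inv f \<otimes> y [^] j) = y [^] (j - i)"
    proof -
      define p where "p = inv f \<otimes> y [^] i"
      have pc: "p \<in> carrier G" using fc yc by (simp add: p_def)
      have "y [^] j = y [^] i \<otimes> y [^] (j - i)" using ij(1) yc by (simp add: nat_pow_mult)
      then have "inv f \<otimes> y [^] j = p \<otimes> y [^] (j - i)" using fc yc by (simp add: p_def m_assoc)
      then show ?thesis using pc yc by (simp add: p_def[symmetric] m_assoc[symmetric])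
    qed
    have "y [^] (j - i) \<in> W1" using W(3)[OF W(4)[OF w(1)] w(2)] e by simp
    moreover have "inv (y [^] (j - i)) \<in> W1"
    proof -
      have "inv (inv (inv f \<otimes> y [^] i) \<otimes> (inv f \<otimes> y [^] j)) = inv (inv f \<otimes> y [^] j) \<otimes> (inv f \<otimes> y [^] i)"
        using fc yc by (simp add: inv_mult_group)
      then show ?thesis using W(3)[OF W(4)[OF w(2)] w(1)] e by simp
    qed
    ultimately have "y [^] (j - i) \<in> H" using WH subgroup_pow[OF B'(2) y] by blast
    moreover have "(j - i) dvd fact (card F)" using ij by (intro dvd_fact) auto
    then obtain k where "fact (card F) = (j - i) * k" by (rule dvdE)
    ultimately show ?thesis using subgroup_pow[OF \<open>subgroup H G\<close>, of "y [^] (j - i)" k] yc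
      by (simp add: nat_pow_pow)
  qed
  ultimately show ?thesis using fact_gt_zero[of "card F"] by blast
qed

text \<open>By divisibility \<open>B\<close> consists of n-th powers, and for a suitable n all of
  these lie in a prescribed neighbourhood of the identity.\<close>

lemma divisible_subset_S_trivial:
  assumes B: "closed_subgroup B" "B \<subseteq> S" "divisible B" shows "B = {\<one>}"
proof -
  have "x = \<one>" if x: "x \<in> B" for x
  proof (rule open_nbhd_Inter_one)
    show "x \<in> carrier G" using x closed_subgroupD[OF B(1)] by blast
    fix U assume "open_nbhd U"
    then obtain H n where H: "H \<subseteq> U" "n > (0::nat)" "\<forall>y\<in>B. y [^] n \<in> H"
      using small_subgroup_of_subset_S[OF B(1,2), of U] by metis
    then have "x \<in> pow_set G n B" using B(3) x unfolding divisible_def by blast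
    then show "x \<in> U" using H by (auto simp: pow_set_def)
  qed
  then show ?thesis using closed_subgroupD(4)[OF B(1)] by blast
qed

text \<open>Apply \<open>small_subgroup_of_subset_S\<close> to the preimage of the right half plane:
  a subgroup of the circle inside that half plane is trivial.\<close>

lemma char_torsion_on_subset_S:
  assumes B: "closed_subgroup B" "B \<subseteq> S" and \<theta>: "\<theta> \<in> chars"
  shows "\<exists>n>0::nat. \<forall>y\<in>B. \<theta> y ^ n = 1"
proof -
  have "open {z. Re z > 0}" by (simp add: open_halfspace_Re_gt)
  then have "open_nbhd {x \<in> carrier G. \<theta> x \<in> {z. Re z > 0}}" by (intro char_open_nbhd \<theta>) auto
  from small_subgroup_of_subset_S[OF B this] obtain H n where H: "subgroup H G"
    "H \<subseteq> {x \<in> carrier G. \<theta> x \<in> {z. Re z > 0}}" "n > (0::nat)" "\<forall>y\<in>B. y [^] n \<in> H" by blast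
  have "\<theta> y ^ n = 1" if y: "y \<in> B" for y
  proof (rule unit_complex_powers_Re_pos)
    have yc: "y \<in> carrier G" using y closed_subgroupD[OF B(1)] by blast
    show "cmod (\<theta> y ^ n) = 1" using charsD(2)[OF \<theta> yc] by (simp add: norm_power)
    fix m :: nat
    have "(y [^] n) [^] m \<in> H" using subgroup_pow[OF H(1)] H(4) y by blast
    then have "Re (\<theta> ((y [^] n) [^] m)) > 0" using H(2) by blast
    then show "0 < Re ((\<theta> y ^ n) ^ m)" using char_pow[OF \<theta>] yc by simp
  qed
  then show ?thesis using H(3) by blast
qed

text \<open>On a minimal lift M of the torus, each character c i has finite order on the trace of S. Suitable powers
  d i kill this trace and still map M onto the circle. Take a minimal lift Y of the sequences whose i-th
  entry is a root of unity of order dividing 2^i, and y in Y with each d i y of exact order 2^i. An element s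
  of S in the closure of the powers of y is a limit of powers y^r with r divisible by 2^m for every
  m, and the intersection of the subgroups of 2^m-th powers of Y is trivial.\<close>

lemma no_infinite_torus_quotient:
  assumes V0: "\<And>L. closed_subgroup L \<Longrightarrow> L \<subseteq> V0 \<Longrightarrow> L \<inter> S \<subseteq> {\<one>} \<Longrightarrow> L = {\<one>}"
    and E: "closed_subgroup E" "E \<subseteq> V0" and c: "\<And>i::nat. c i \<in> chars"
    and onto: "lifts c E {t. \<forall>i. cmod (t i) = 1}"
  shows False
proof -
  define Q where "Q = {t :: nat \<Rightarrow> complex. \<forall>i. cmod (t i) = 1}"
  have roots: "\<exists>s. \<forall>i. cmod (s i) = 1 \<and> s i ^ n i = t i"
    if t: "\<And>i. cmod (t i) = 1" and n: "\<And>i. n i > 0" for t :: "nat \<Rightarrow> complex" and n :: "nat \<Rightarrow> nat"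
  proof (intro exI allI conjI)
    fix i
    show "cmod (cis (Arg (t i) / n i)) = 1" by simp
    have "t i \<noteq> 0" using t[of i] by auto
    then have "cis (Arg (t i)) = t i" using t[of i] by (simp add: cis_Arg sgn_div_norm)
    then show "cis (Arg (t i) / n i) ^ n i = t i" using n[of i] by (simp add: Complex.DeMoivre)
  qed
  obtain M where M: "M \<subseteq> E" "min_lifts c M Q"
    using minimal_lifts_exists[OF c E(1) onto[folded Q_def]] by blast
  have Mc: "closed_subgroup M" and Ml: "lifts c M Q" using M(2) by (auto simp: min_lifts_def)
  note M' = closed_subgroupD[OF Mc]
  have Mcar: "x \<in> carrier G" if "x \<in> M" for x using that M' by blast
  \<comment> \<open>The torus has n-th roots, so the n-th powers of \<open>M\<close> still cover it;
    minimality makes them all of \<open>M\<close>.\<close>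
  have divM: "divisible M"
    unfolding divisible_def
  proof (intro allI impI)
    fix n :: nat assume n: "n > 0"
    have "lifts c (pow_set G n M) Q"
      unfolding lifts_def
    proof
      fix t assume t: "t \<in> Q"
      obtain s where s: "\<forall>i. cmod (s i) = 1 \<and> s i ^ n = t i"
        using roots[of t "\<lambda>_. n"] t n by (auto simp: Q_def)
      then have "s \<in> Q" by (simp add: Q_def)
      then obtain x where x: "x \<in> M" "\<forall>i. c i x = s i" using Ml unfolding lifts_def by blast
      have "c i (x [^] n) = t i" for i using char_pow[OF c Mcar[OF x(1)]] x(2) s by simp
      then show "\<exists>x\<in>pow_set G n M. \<forall>i. c i x = t i" using x(1) by (auto simp: pow_set_def)
    qed
    then have "pow_set G n M = M" using M(2) closed_subgroup_pow_set[OF Mc] pow_set_subset[OF Mc] unfolding min_lifts_def by blast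
    then show "M \<subseteq> pow_set G n M" by simp
  qed
  have "gdelta_one M"
  proof (rule gdelta_one_of_countable_characters[OF Mc divM c])
    define A where "A = {x \<in> M. \<forall>i. c i x = 1}"
    have A: "closed_subgroup A" unfolding A_def by (rule closed_subgroup_sequence_annihilator[OF Mc c])
    show "divisible_part {x \<in> M. \<forall>i. c i x = 1} = {\<one>}" unfolding A_def[symmetric]
    proof (rule min_lifts_reduced[OF M(2) closed_subgroup_divisible_part[OF A] divisible_divisible_part[OF A] _ _ c])
      show "divisible_part A \<subseteq> M" using divisible_part_subset[OF A] by (auto simp: A_def)
      show "c i x = 1" if "x \<in> divisible_part A" for i x using that divisible_part_subset[OF A] by (auto simp: A_def)
    qed
  qed
  then have B: "closed_subgroup (S \<inter> M)" using closed_subgroup_gdelta_one_Int[OF Mc] by blast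
  have "\<exists>n>0::nat. \<forall>y\<in>S \<inter> M. c i y ^ n = 1" for i
    using char_torsion_on_subset_S[OF B _ c] by blast
  then obtain n :: "nat \<Rightarrow> nat" where n: "\<And>i. n i > 0" "\<And>i y. y \<in> S \<inter> M \<Longrightarrow> c i y ^ n i = 1" by metis
  define d where "d = (\<lambda>i x. c i x ^ n i)"
  have d: "d i \<in> chars" for i unfolding d_def by (rule char_power[OF c])
  \<comment> \<open>Each coordinate is torsion, which will make the divisible part of
    \<open>Y\<close> trivial, while the orders 2^i are unbounded, so that the coordinates detect
    ever higher 2-powers in an exponent of \<open>y\<close>.\<close>
  define Z where "Z = {t :: nat \<Rightarrow> complex. \<forall>i. t i ^ (2 ^ i) = 1}"
  define M2 where "M2 = {x \<in> M. \<forall>i. d i x ^ (2 ^ i) = 1}"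
  have M2: "closed_subgroup M2" unfolding M2_def
    using closed_subgroup_sequence_annihilator[OF Mc, of "\<lambda>i x. d i x ^ (2 ^ i)"] char_power[OF d] by blast
  have l2: "lifts d M2 Z"
    unfolding lifts_def
  proof
    fix t assume t: "t \<in> Z"
    have "cmod (t i) = 1" for i
    proof -
      have "t i ^ (2 ^ i) = 1" using t by (simp add: Z_def)
      then have "cmod (t i) ^ 2 ^ i = 1 ^ 2 ^ i" by (metis norm_one norm_power power_one)
      then show ?thesis by (rule power_eq_imp_eq_base) auto
    qed
    then obtain s where s: "\<forall>i. cmod (s i) = 1 \<and> s i ^ n i = t i" using roots[of t n] n(1) by blast
    then have "s \<in> Q" by (simp add: Q_def)
    then obtain x where x: "x \<in> M" "\<forall>i. c i x = s i" using Ml unfolding lifts_def by blast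
    have dx: "\<forall>i. d i x = t i" using x(2) s by (simp add: d_def)
    then have "x \<in> M2" using x(1) t by (simp add: M2_def Z_def)
    then show "\<exists>x\<in>M2. \<forall>i. d i x = t i" using dx by blast
  qed
  obtain Y where Y: "Y \<subseteq> M2" "min_lifts d Y Z" using minimal_lifts_exists[OF d M2 l2] by metis
  have Yc: "closed_subgroup Y" and Yl: "lifts d Y Z" using Y(2) by (auto simp: min_lifts_def)
  note Y' = closed_subgroupD[OF Yc]
  have Ycar: "x \<in> carrier G" if "x \<in> Y" for x using that Y' by blast
  have Yd: "d i x ^ (2 ^ i) = 1" if "x \<in> Y" for i x using that Y(1) by (auto simp: M2_def)
  \<comment> \<open>An odd exponent is invertible modulo every 2^i, so its power map permutes
    \<open>Z\<close>; minimality lifts this to \<open>Y\<close>.\<close>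
  have oddpow: "pow_set G q Y = Y" if q: "odd q" for q
  proof -
    have "lifts d (pow_set G q Y) Z"
      unfolding lifts_def
    proof
      fix t assume t: "t \<in> Z"
      have "\<exists>r. [q * r = 1] (mod 2 ^ i)" for i
        using q cong_solve_coprime_nat[of q "2 ^ i"] by simp
      then obtain r where r: "\<And>i. [q * r i = 1] (mod 2 ^ i)" by metis
      define s where "s = (\<lambda>i. t i ^ r i)"
      have "(t i ^ r i) ^ 2 ^ i = 1" for i using t by (simp add: Z_def power_mult[symmetric] mult.commute[of "r i"]) (simp add: power_mult)
      then have "s \<in> Z" by (simp add: Z_def s_def)
      then obtain x where x: "x \<in> Y" "\<forall>i. d i x = s i" using Yl unfolding lifts_def by blast
      have tp: "t i ^ a = t i ^ b" if "[a = b] (mod 2 ^ i)" for a b i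
      proof -
        have t1: "t i ^ (2 ^ i) = 1" using t by (simp add: Z_def)
        have "t i ^ m = t i ^ (m mod 2 ^ i)" for m
        proof -
          have "t i ^ m = t i ^ (2 ^ i * (m div 2 ^ i) + m mod 2 ^ i)" by simp
          also have "\<dots> = t i ^ (m mod 2 ^ i)" unfolding power_add power_mult t1 by simp
          finally show ?thesis .
        qed
        then show ?thesis using that unfolding cong_def by metis
      qed
      have "d i (x [^] q) = t i" for i
      proof -
        have "d i (x [^] q) = t i ^ (q * r i)"
          using char_pow[OF d Ycar[OF x(1)]] x(2) by (simp add: s_def power_mult[symmetric] mult.commute)
        also have "\<dots> = t i ^ 1" by (rule tp[OF r])
        finally show ?thesis by simp
      qed
      then show "\<exists>x\<in>pow_set G q Y. \<forall>i. d i x = t i" using x(1) by (auto simp: pow_set_def)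
    qed
    then show ?thesis using Y(2) closed_subgroup_pow_set[OF Yc] pow_set_subset[OF Yc] unfolding min_lifts_def by blast
  qed
  \<comment> \<open>Each element of the divisible part is a 2^i-th power of another one, and
    \<open>d i\<close> kills 2^i-th powers from \<open>Y\<close>. The divisible part thus lies in
    the joint kernel, and \<open>min_lifts_reduced\<close> applies.\<close>
  have dvY: "divisible_part Y = {\<one>}"
  proof (rule min_lifts_reduced[OF Y(2) closed_subgroup_divisible_part[OF Yc] divisible_divisible_part[OF Yc] divisible_part_subset[OF Yc] _ d])
    fix i x assume x: "x \<in> divisible_part Y"
    have "divisible_part Y \<subseteq> pow_set G (2 ^ i) (divisible_part Y)" using divisible_divisible_part[OF Yc] unfolding divisible_def by simp
    then have "x \<in> pow_set G (2 ^ i) (divisible_part Y)" using x by blast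
    then obtain y where y: "y \<in> divisible_part Y" "x = y [^] (2 ^ i :: nat)"
      unfolding pow_set_def by blast
    then have "y \<in> Y" using divisible_part_subset[OF Yc] by blast
    then show "d i x = 1" using y(2) char_pow[OF d Ycar] Yd by simp
  qed
  define P where "P = (\<lambda>m::nat. pow_set G (2 ^ m) Y)"
  have Pint: "x = \<one>" if x: "\<And>m. x \<in> P m" for x
  proof -
    \<comment> \<open>Odd factors of \<open>fact m\<close> do not change the group of powers, so
      only its 2-part counts.\<close>
    have "x \<in> pow_set G (fact m) Y" for m
    proof -
      have "(fact m :: nat) \<noteq> 0" "\<not> is_unit (2 :: nat)" by simp_all
      then obtain q :: nat where "fact m = 2 ^ multiplicity 2 (fact m :: nat) * q" "\<not> 2 dvd q"
        by (rule multiplicity_decompose')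
      then obtain e where q: "(fact m :: nat) = 2 ^ e * q" "\<not> 2 dvd q" by blast
      have "pow_set G (fact m) Y = pow_set G (2 ^ e) (pow_set G q Y)"
        using pow_set_mult[OF Y'(3), of "2 ^ e" q] q(1) by (simp add: mult.commute)
      also have "\<dots> = P e" using oddpow q(2) by (simp add: P_def)
      finally show ?thesis using x by simp
    qed
    then have "x \<in> divisible_part Y" by (simp add: divisible_part_def)
    then show ?thesis using dvY by simp
  qed
  define t where "t = (\<lambda>i::nat. cis (2 * pi / 2 ^ i))"
  have "t \<in> Z" by (simp add: Z_def t_def Complex.DeMoivre)
  then obtain y where y: "y \<in> Y" "\<And>i. d i y = t i" using Yl unfolding lifts_def by blast
  have yc: "y \<in> carrier G" using y Ycar by blast
  have "t 1 \<noteq> 1" by (simp add: t_def)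
  then have y1: "y \<noteq> \<one>" using y(2)[of 1] char_one[OF d] by auto
  define L where "L = T closure_of (range (\<lambda>k::int. y [^] k))"
  have gen: "subgroup (range (\<lambda>k::int. y [^] k)) G" by (rule subgroup_of_powers[OF yc])
  have L: "closed_subgroup L" unfolding L_def by (rule closure_subgroup[OF gen])
  have rY: "range (\<lambda>k::int. y [^] k) \<subseteq> Y" using subgroup_int_pow_closed[OF Y'(2) y(1)] by auto
  then have LY: "L \<subseteq> Y" unfolding L_def using Y'(1) by (rule closure_of_minimal)
  have rL: "range (\<lambda>k::int. y [^] k) \<subseteq> L" unfolding L_def using rY Y'(3) by (intro closure_of_subset) auto
  have "y \<in> L" using rL int_pow_1[OF yc] by (metis rangeI subsetD)
  then have "L \<noteq> {\<one>}" using y1 by blast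
  moreover have "L \<subseteq> V0" using LY Y(1) M(1) E(2) unfolding M2_def by blast
  ultimately obtain s where s: "s \<in> L" "s \<in> S" "s \<noteq> \<one>" using V0[OF L] by blast
  have sM: "s \<in> S \<inter> M" using s LY Y(1) unfolding M2_def by blast
  then have ds: "d i s = 1" for i using n(2) by (simp add: d_def)
  have sc: "s \<in> carrier G" using s LY Ycar by blast
  have "s \<in> P m" for m
  proof -
    have Pc: "closed_subgroup (P m)" unfolding P_def by (rule closed_subgroup_pow_set[OF Yc])
    have Pd: "d m x = 1" if "x \<in> P m" for x
      using that Yd char_pow[OF d Ycar] by (auto simp: P_def pow_set_def)
    have "y [^] (2 ^ m :: nat) \<in> P m" using y(1) by (auto simp: P_def pow_set_def)
    then obtain r :: nat where r: "r < 2 ^ m" "s \<otimes> inv (y [^] r) \<in> P m"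
      using closure_powers_in_cosets[OF Pc yc, of "2 ^ m" s] s(1) unfolding L_def by auto
    \<comment> \<open>Since \<open>d m\<close> kills both \<open>s\<close> and the error term, the
      primitive 2^m-th root of unity \<open>t m\<close> has r-th power 1. As \<open>r\<close> is
      below 2^m it must be 0, so \<open>s\<close> itself lies in \<open>P m\<close>.\<close>
    have "d m (s \<otimes> inv (y [^] r)) = 1" using Pd r(2) by blast
    then have "cnj (t m ^ r) = 1"
      using charsD(3)[OF d sc, of "inv (y [^] r)"] char_inv[OF d, of "y [^] r"] char_pow[OF d yc] ds y(2) yc by simp
    then have "t m ^ r = 1" by (metis complex_cnj_cnj complex_cnj_one)
    then have "cis (2 * pi * real r / real (2 ^ m)) = cis (2 * pi * real 0 / real (2 ^ m))"
      by (simp add: t_def Complex.DeMoivre mult.commute)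
    then have "r = 0" using Complex.bij_betw_roots_unity[of "2 ^ m"] r(1)
      unfolding bij_betw_def inj_on_def by (metis lessThan_iff zero_less_numeral zero_less_power)
    then show ?thesis using r(2) sc by simp
  qed
  then show False using Pint s(3) by blast
qed

text \<open>An element of D is a limit of a sequence of powers x^(n!) with x in S.\<close>

lemma max_divisible_subset_S:
  assumes "gdelta_one (divisible_part (carrier G))" shows "divisible_part (carrier G) \<subseteq> S"
proof
  define D where "D = divisible_part (carrier G)"
  have D: "closed_subgroup D" unfolding D_def by (rule closed_subgroup_divisible_part[OF closed_subgroup_carrier])
  fix c assume "c \<in> divisible_part (carrier G)"
  then have c: "c \<in> D" by (simp add: D_def)
  have cc: "c \<in> carrier G" using c closed_subgroupD[OF D] by blast
  obtain C :: "nat \<Rightarrow> 'a set" where C: "\<And>n. closedin T (C n)" "\<And>n. \<exists>W. open_nbhd W \<and> W \<subseteq> C n" "\<And>n. C (Suc n) \<subseteq> C n"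
    "D \<inter> (\<Inter>n. C n) \<subseteq> {\<one>}" using gdelta_one_nested[OF assms[folded D_def]] by blast
  define P where "P = (\<lambda>n::nat. pow_set G (fact n) (carrier G))"
  have P: "closed_subgroup (P n)" "P (Suc n) \<subseteq> P n" for n
    unfolding P_def by (rule closed_subgroup_pow_set[OF closed_subgroup_carrier], rule pow_set_fact_Suc[OF closed_subgroup_carrier])
  have DP: "D = (\<Inter>n. P n)" by (simp add: D_def divisible_part_def P_def)
  \<comment> \<open>Approximate a root of \<open>c\<close> of order \<open>fact n\<close> by an
    element of \<open>S\<close> and raise it to that power: the difference from \<open>c\<close>
    lies in \<open>P n\<close> automatically, and in \<open>C n\<close> by continuity.\<close>
  have "\<exists>x. x \<in> S \<and> x \<otimes> inv c \<in> P n \<inter> C n" for n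
  proof -
    obtain W where W: "open_nbhd W" "W \<subseteq> C n" using C(2) by blast
    obtain k where k: "k \<in> carrier G" "c = k [^] (fact n :: nat)" using c by (auto simp: DP P_def pow_set_def)
    have "continuous_map T T (\<lambda>x. x [^] (fact n :: nat) \<otimes> inv c)" using cc
      by (intro continuous_intros_group continuous_map_const_group) auto
    then have o: "openin T {x \<in> carrier G. x [^] (fact n :: nat) \<otimes> inv c \<in> W}"
      using openin_preimage W(1) unfolding open_nbhd_def by blast
    have "k \<in> {x \<in> carrier G. x [^] (fact n :: nat) \<otimes> inv c \<in> W}" using k cc open_nbhd_one[OF W(1)] by simp
    moreover have "k \<in> T closure_of S" using k dense_S by simp
    ultimately obtain x where x: "x \<in> S" "x \<in> {x \<in> carrier G. x [^] (fact n :: nat) \<otimes> inv c \<in> W}"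
      using o unfolding in_closure_of by meson
    have "x [^] (fact n :: nat) \<in> P n" using x by (auto simp: P_def pow_set_def)
    moreover have "inv c \<in> P n" using closed_subgroupD(6)[OF P(1)] c DP by blast
    ultimately have "x [^] (fact n :: nat) \<otimes> inv c \<in> P n" using closed_subgroupD(5)[OF P(1)] by blast
    then show ?thesis using x W(2) S_pow[OF x(1)] by blast
  qed
  then obtain x where x: "\<And>n. x n \<in> S" "\<And>n. x n \<otimes> inv c \<in> P n \<inter> C n" by metis
  show "c \<in> S"
  proof (rule seq_closed[OF x(1) cc])
    fix U assume U: "open_nbhd U"
    have "closedin T (P n \<inter> C n)" for n using closed_subgroupD(1)[OF P(1)] C(1) by blast
    moreover have dec: "P (Suc n) \<inter> C (Suc n) \<subseteq> P n \<inter> C n" for n using C(3) P(2) by blast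
    moreover have "openin T U" "(\<Inter>n. P n \<inter> C n) \<subseteq> U" using U C(4) open_nbhd_one[OF U] DP by (auto simp: open_nbhd_def)
    ultimately obtain N where N: "P N \<inter> C N \<subseteq> U" by (rule nest_subset)
    have "P n \<inter> C n \<subseteq> P N \<inter> C N" if "n \<ge> N" for n
      using lift_Suc_antimono_le[of "\<lambda>n. P n \<inter> C n", OF dec that] .
    then show "\<exists>N. \<forall>n\<ge>N. x n \<otimes> inv c \<in> U" using N x(2) by blast
  qed
qed

text \<open>A dichotomy over finite sets of characters, starting from one with small annihilator in
  the divisible part. If the annihilator of some finite enlargement has trivial divisible part,
  countably many neighbourhoods suffice and total disconnectedness applies. Otherwise characters can
  be adjoined forever, each nontrivial on the divisible part left by its predecessors, and jointly
  they map onto an infinite torus.\<close>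

lemma max_divisible_trivial: "divisible_part (carrier G) = {\<one>}"
proof -
  define D where "D = divisible_part (carrier G)"
  have D: "closed_subgroup D" "divisible D" unfolding D_def using closed_subgroup_divisible_part[OF closed_subgroup_carrier] divisible_divisible_part[OF closed_subgroup_carrier] by blast+
  obtain V0 where V0: "open_nbhd V0" "\<And>L. closed_subgroup L \<Longrightarrow> L \<subseteq> V0 \<Longrightarrow> L \<inter> S \<subseteq> {\<one>} \<Longrightarrow> L = {\<one>}"
    using locally_essential by blast
  obtain F0 where F0: "finite F0" "F0 \<subseteq> chars" "{x \<in> D. \<forall>\<theta>\<in>F0. \<theta> x = 1} \<subseteq> V0"
    using finitely_many_characters[OF D(1) V0(1)] by blast
  define k where "k = (\<lambda>\<F> :: ('a \<Rightarrow> complex) set. {x \<in> D. \<forall>\<theta>\<in>\<F>. \<theta> x = 1})"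
  have k: "closed_subgroup (k \<F>)" if "\<F> \<subseteq> chars" for \<F> unfolding k_def by (rule closed_subgroup_annihilator[OF D(1) that])
  have "\<exists>\<F>. finite \<F> \<and> F0 \<subseteq> \<F> \<and> \<F> \<subseteq> chars \<and> divisible_part (k \<F>) = {\<one>}"
  proof (rule ccontr)
    assume neg: "\<not> ?thesis"
    have "\<exists>\<theta>. \<theta> \<in> chars \<and> (\<exists>x\<in>divisible_part (k \<F>). \<theta> x \<noteq> 1)" if F: "finite \<F>" "F0 \<subseteq> \<F>" "\<F> \<subseteq> chars" for \<F>
    proof -
      have "divisible_part (k \<F>) \<noteq> {\<one>}" using neg F by blast
      then obtain x where x: "x \<in> divisible_part (k \<F>)" "x \<noteq> \<one>" using closed_subgroupD(4)[OF closed_subgroup_divisible_part[OF k[OF F(3)]]] by blast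
      moreover have "x \<in> carrier G" using x closed_subgroupD(3)[OF closed_subgroup_divisible_part[OF k[OF F(3)]]] by blast
      ultimately show ?thesis using characters_separate by metis
    qed
    then obtain g where g: "\<And>\<F>. finite \<F> \<Longrightarrow> F0 \<subseteq> \<F> \<Longrightarrow> \<F> \<subseteq> chars \<Longrightarrow> g \<F> \<in> chars \<and> (\<exists>x\<in>divisible_part (k \<F>). g \<F> x \<noteq> 1)"
      by metis
    define Fs where "Fs = rec_nat F0 (\<lambda>_ \<F>. insert (g \<F>) \<F>)"
    have Fs0: "Fs 0 = F0" and FsS: "Fs (Suc n) = insert (g (Fs n)) (Fs n)" for n by (auto simp: Fs_def)
    have Fs: "finite (Fs n) \<and> F0 \<subseteq> Fs n \<and> Fs n \<subseteq> chars" for n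
    proof (induction n)
      case (Suc n)
      then show ?case using g[of "Fs n"] by (auto simp: FsS)
    qed (use F0 in \<open>simp add: Fs0\<close>)
    define c where "c = (\<lambda>n. g (Fs n))"
    have c: "c n \<in> chars" for n unfolding c_def using g Fs by blast
    have cF: "c i \<in> Fs n" if "i < n" for i n
      using that
    proof (induction n)
      case (Suc n)
      then show ?case by (cases "i = n") (auto simp: FsS c_def)
    qed simp
    have Fmono: "Fs m \<subseteq> Fs n" if "m \<le> n" for m n
      using lift_Suc_mono_le[of Fs, OF _ that] by (auto simp: FsS)
    define E where "E = (\<lambda>n. divisible_part (k (Fs n)))"
    have E: "closed_subgroup (E n)" "divisible (E n)" for n unfolding E_def using closed_subgroup_divisible_part[OF k] divisible_divisible_part[OF k] Fs by blast+
    have E0: "E n \<subseteq> E 0" for n unfolding E_def using Fmono[of 0 n] by (intro divisible_part_mono) (auto simp: k_def)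
    have Eker: "c i x = 1" if "x \<in> E n" "i < n" for i n x
    proof -
      have "x \<in> k (Fs n)" using that(1) divisible_part_subset[OF k] Fs unfolding E_def by blast
      then show ?thesis using cF[OF that(2)] by (simp add: k_def)
    qed
    have Ecar: "x \<in> carrier G" if "x \<in> E n" for x n using that closed_subgroupD(3)[OF E(1)] by blast
    \<comment> \<open>Coordinates are corrected one at a time: \<open>c n\<close> maps the divisible
      group \<open>E n\<close> onto the circle, and all earlier characters are trivial there.
      Compactness passes from finitely many coordinates to all.\<close>
    have onto: "lifts c (E 0) {t. \<forall>i. cmod (t i) = 1}"
      unfolding lifts_def
    proof
      fix t :: "nat \<Rightarrow> complex" assume t: "t \<in> {t. \<forall>i. cmod (t i) = 1}"
      define R where "R = (\<lambda>n. {x \<in> E 0. \<forall>i<n. c i x = t i})"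
      have Rne: "R n \<noteq> {}" for n
      proof (induction n)
        case 0
        then show ?case using closed_subgroupD(4)[OF E(1)] by (auto simp: R_def)
      next
        case (Suc n)
        then obtain x where x: "x \<in> E 0" "\<forall>i<n. c i x = t i" by (auto simp: R_def)
        have xc: "x \<in> carrier G" using x Ecar by blast
        obtain e where e: "e \<in> E n" "c n e \<noteq> 1" using g[of "Fs n"] Fs by (auto simp: E_def c_def)
        have "cmod (t n * cnj (c n x)) = 1" using t charsD(2)[OF c xc] by (simp add: norm_mult)
        then obtain b where b: "b \<in> E n" "c n b = t n * cnj (c n x)"
          using char_image_divisible[OF E c e] by blast
        have bc: "b \<in> carrier G" using b Ecar by blast
        have "c n x * cnj (c n x) = 1" using charsD(2)[OF c xc] complex_norm_square[of "c n x"] by simp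
        then have "c n (x \<otimes> b) = t n" using charsD(3)[OF c xc bc] b(2) by (simp add: mult.left_commute)
        moreover have "c i (x \<otimes> b) = t i" if "i < n" for i
          using charsD(3)[OF c xc bc] Eker[OF b(1) that] x(2) that by simp
        moreover have "x \<otimes> b \<in> E 0" using closed_subgroupD(5)[OF E(1)] x(1) b(1) E0 by blast
        ultimately have "x \<otimes> b \<in> R (Suc n)" by (auto simp: R_def less_Suc_eq)
        then show ?case by blast
      qed
      have "closedin T (R n)" for n
      proof -
        have ft: "closedin T {x \<in> carrier G. c i x = t i}" for i
          using char_closedin[OF c, of "{t i}" i] by simp
        have "closedin T (\<Inter>(insert (E 0) ((\<lambda>i. {x \<in> carrier G. c i x \<in> {t i}}) ` {..<n})))"
          using closed_subgroupD(1)[OF E(1)] ft by (intro closedin_Inter) auto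
        moreover have "\<Inter>(insert (E 0) ((\<lambda>i. {x \<in> carrier G. c i x \<in> {t i}}) ` {..<n})) = R n"
          using Ecar by (auto simp: R_def)
        ultimately show ?thesis by simp
      qed
      then have "(\<Inter>n. R n) \<noteq> {}" by (rule nest_nonempty) (use Rne in \<open>auto simp: R_def\<close>)
      then obtain x where x: "\<And>n. x \<in> R n" by blast
      have "c i x = t i" for i using x[of "Suc i"] by (simp add: R_def)
      moreover have "x \<in> E 0" using x[of 0] by (simp add: R_def)
      ultimately show "\<exists>x\<in>E 0. \<forall>i. c i x = t i" by blast
    qed
    have "E 0 \<subseteq> V0" using divisible_part_subset[OF k[OF F0(2)]] F0(3) by (auto simp: E_def Fs0 k_def)
    then show False using no_infinite_torus_quotient[of V0 "E 0" c] V0(2) E(1) c onto by metis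
  qed
  then obtain \<F> where F: "finite \<F>" "\<F> \<subseteq> chars" "divisible_part (k \<F>) = {\<one>}" by blast
  \<comment> \<open>The constant character keeps the enumerated set nonempty; the finite family
    becomes a sequence with repetitions.\<close>
  define c where "c = from_nat_into (insert (\<lambda>x. 1) \<F>)"
  have rc: "range c = insert (\<lambda>x. 1) \<F>"
    unfolding c_def by (rule range_from_nat_into) (use F(1) in \<open>auto simp: countable_finite\<close>)
  have c: "c i \<in> chars" for i using rc F(2) char_const by (metis insert_iff rangeI subsetD)
  have "{x \<in> D. \<forall>i. c i x = 1} = {x \<in> D. \<forall>\<theta>\<in>range c. \<theta> x = 1}" by auto
  also have "\<dots> = k \<F>" unfolding rc by (auto simp: k_def)
  finally have "gdelta_one D" using gdelta_one_of_countable_characters[where c = c, OF D c] F(3) by simp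
  then have "D \<subseteq> S" using max_divisible_subset_S by (simp add: D_def)
  then show ?thesis using divisible_subset_S_trivial[OF D(1) _ D(2)] by (simp add: D_def)
qed

text \<open>With trivial divisible part the groups of \<open>fact n\<close>-th powers shrink to the
  identity, so a character maps one of them into the right half plane and hence to 1. Every
  character thus has finite order and an open kernel, and finite intersections of kernels are
  arbitrarily small.\<close>

lemma open_subgroup_base:
  assumes "open_nbhd U"
  obtains H where "subgroup H G" "openin T H" "H \<subseteq> U"
proof -
  have tors: "\<exists>n>0::nat. \<forall>x\<in>carrier G. \<theta> x ^ n = 1" if \<theta>: "\<theta> \<in> chars" for \<theta>
  proof -
    have "open {z. Re z > 0}" by (simp add: open_halfspace_Re_gt)
    then have nbt: "open_nbhd {x \<in> carrier G. \<theta> x \<in> {z. Re z > 0}}" by (intro char_open_nbhd \<theta>) auto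
    have "closedin T (pow_set G (fact n) (carrier G))" for n
      using closed_subgroupD(1)[OF closed_subgroup_pow_set[OF closed_subgroup_carrier]] .
    moreover have "pow_set G (fact (Suc n)) (carrier G) \<subseteq> pow_set G (fact n) (carrier G)" for n
      by (rule pow_set_fact_Suc[OF closed_subgroup_carrier])
    moreover have "openin T {x \<in> carrier G. \<theta> x \<in> {z. Re z > 0}}" using nbt by (simp add: open_nbhd_def)
    moreover have "(\<Inter>n. pow_set G (fact n) (carrier G)) \<subseteq> {x \<in> carrier G. \<theta> x \<in> {z. Re z > 0}}"
      using max_divisible_trivial open_nbhd_one[OF nbt] by (simp add: divisible_part_def)
    ultimately obtain n where n: "pow_set G (fact n) (carrier G) \<subseteq> {x \<in> carrier G. \<theta> x \<in> {z. Re z > 0}}"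
      by (rule nest_subset)
    have "\<theta> x ^ fact n = 1" if x: "x \<in> carrier G" for x
    proof (rule unit_complex_powers_Re_pos)
      show "cmod (\<theta> x ^ fact n) = 1" using charsD(2)[OF \<theta> x] by (simp add: norm_power)
      fix m :: nat
      have "(x [^] m) [^] (fact n :: nat) \<in> pow_set G (fact n) (carrier G)" using x by (auto simp: pow_set_def)
      then have "Re (\<theta> ((x [^] m) [^] (fact n :: nat))) > 0" using n by blast
      moreover have "\<theta> ((x [^] m) [^] (fact n :: nat)) = (\<theta> x ^ fact n) ^ m"
        using char_pow[OF \<theta>] x by (simp add: power_mult[symmetric] mult.commute)
      ultimately show "0 < Re ((\<theta> x ^ fact n) ^ m)" by simp
    qed
    then show ?thesis by (intro exI[of _ "fact n"]) simp
  qed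
  have ker: "subgroup {x \<in> carrier G. \<theta> x = 1} G \<and> openin T {x \<in> carrier G. \<theta> x = 1}" if \<theta>: "\<theta> \<in> chars" for \<theta>
  proof
    show "subgroup {x \<in> carrier G. \<theta> x = 1} G" using closed_subgroup_ker[OF \<theta>] by (simp add: closed_subgroup_def)
    obtain n :: nat where n: "n > 0" "\<forall>x\<in>carrier G. \<theta> x ^ n = 1" using tors[OF \<theta>] by blast
    \<comment> \<open>A character of finite order takes finitely many values, so the set where it
      differs from 1 is closed.\<close>
    have "finite ({z :: complex. z ^ n = 1} - {1})" using finite_roots_unity[of n] n(1) by auto
    then have "closedin T {x \<in> carrier G. \<theta> x \<in> {z. z ^ n = 1} - {1}}"
      by (intro char_closedin \<theta> finite_imp_closed)
    then have "openin T (carrier G - {x \<in> carrier G. \<theta> x \<in> {z. z ^ n = 1} - {1}})"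
      using openin_diff[OF openin_topspace, of T] by simp
    moreover have "carrier G - {x \<in> carrier G. \<theta> x \<in> {z. z ^ n = 1} - {1}} = {x \<in> carrier G. \<theta> x = 1}"
      using n(2) by auto
    ultimately show "openin T {x \<in> carrier G. \<theta> x = 1}" by simp
  qed
  obtain \<F> where F: "finite \<F>" "\<F> \<subseteq> chars" "{x \<in> carrier G. \<forall>\<theta>\<in>\<F>. \<theta> x = 1} \<subseteq> U"
    using finitely_many_characters[OF closed_subgroup_carrier assms] by blast
  have "open_nbhd (carrier G \<inter> (\<Inter>\<theta>\<in>\<F>. {x \<in> carrier G. \<theta> x = 1}))"
    by (rule open_nbhd_INT[OF F(1)]) (use ker F(2) char_one in \<open>auto simp: open_nbhd_def\<close>)
  moreover have "carrier G \<inter> (\<Inter>\<theta>\<in>\<F>. {x \<in> carrier G. \<theta> x = 1}) = {x \<in> carrier G. \<forall>\<theta>\<in>\<F>. \<theta> x = 1}" by auto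
  moreover have "closed_subgroup {x \<in> carrier G. \<forall>\<theta>\<in>\<F>. \<theta> x = 1}" by (rule closed_subgroup_annihilator[OF closed_subgroup_carrier F(2)])
  ultimately show ?thesis using that F(3) by (auto simp: open_nbhd_def closed_subgroup_def)
qed

end

section \<open>Primary components\<close>

lemma Zp_simps:
  "carrier (Zp p) = {a. \<forall>n. 0 \<le> a n \<and> a n < int p ^ n \<and> a (Suc n) mod (int p ^ n) = a n}"
  "a \<otimes>\<^bsub>Zp p\<^esub> b = (\<lambda>n. (a n + b n) mod (int p ^ n))" "\<one>\<^bsub>Zp p\<^esub> = (\<lambda>n. 0)"
  by (auto simp: Zp_def)

lemma group_Zp:
  assumes p: "p > 0" shows "group (Zp p)"
proof (rule groupI)
  have pp: "int p ^ n > 0" for n using p by simp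
  then show "\<one>\<^bsub>Zp p\<^esub> \<in> carrier (Zp p)" by (simp add: Zp_simps)
  have dvd: "int p ^ n dvd int p ^ Suc n" for n by simp
  fix a assume a: "a \<in> carrier (Zp p)"
  show "\<one>\<^bsub>Zp p\<^esub> \<otimes>\<^bsub>Zp p\<^esub> a = a" using a by (simp add: Zp_simps)
  show "\<exists>y\<in>carrier (Zp p). y \<otimes>\<^bsub>Zp p\<^esub> a = \<one>\<^bsub>Zp p\<^esub>"
  proof
    show "(\<lambda>n. (- a n) mod int p ^ n) \<otimes>\<^bsub>Zp p\<^esub> a = \<one>\<^bsub>Zp p\<^esub>" by (simp add: Zp_simps mod_simps)
    have "(- a (Suc n)) mod int p ^ Suc n mod int p ^ n = (- a n) mod int p ^ n" for n
    proof -
      have "(- a (Suc n)) mod int p ^ Suc n mod int p ^ n = (- a (Suc n)) mod int p ^ n"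
        by (rule mod_mod_cancel[OF dvd])
      also have "\<dots> = (- (a (Suc n) mod int p ^ n)) mod int p ^ n" by (simp add: mod_minus_eq)
      finally show ?thesis using a by (simp add: Zp_simps)
    qed
    then show "(\<lambda>n. (- a n) mod int p ^ n) \<in> carrier (Zp p)" using pp by (simp add: Zp_simps)
  qed
  fix b assume b: "b \<in> carrier (Zp p)"
  have m: "(a (Suc n) + b (Suc n)) mod int p ^ Suc n mod int p ^ n = (a n + b n) mod int p ^ n" for n
  proof -
    have "(a (Suc n) + b (Suc n)) mod int p ^ Suc n mod int p ^ n = (a (Suc n) + b (Suc n)) mod int p ^ n"
      by (rule mod_mod_cancel[OF dvd])
    also have "\<dots> = (a (Suc n) mod int p ^ n + b (Suc n) mod int p ^ n) mod int p ^ n" by (simp add: mod_add_eq)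
    finally show ?thesis using a b by (simp add: Zp_simps)
  qed
  then show "a \<otimes>\<^bsub>Zp p\<^esub> b \<in> carrier (Zp p)" using pp by (simp add: Zp_simps)
  fix c
  show "(a \<otimes>\<^bsub>Zp p\<^esub> b) \<otimes>\<^bsub>Zp p\<^esub> c = a \<otimes>\<^bsub>Zp p\<^esub> (b \<otimes>\<^bsub>Zp p\<^esub> c)"
    by (simp add: Zp_simps mod_simps add.assoc)
qed

lemma openin_Zp_top_zero:
  assumes "openin (Zp_top p) V" "(\<lambda>n. 0) \<in> V"
  obtains N where "\<And>b. b \<in> carrier (Zp p) \<Longrightarrow> (\<And>n. n \<le> N \<Longrightarrow> b n = 0) \<Longrightarrow> b \<in> V"
proof -
  obtain W where W: "openin (product_topology (\<lambda>_. discrete_topology UNIV) UNIV) W" "V = W \<inter> carrier (Zp p)"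
    using assms(1) unfolding Zp_top_def by (auto simp: openin_subtopology)
  then obtain U where U: "finite {i. U i \<noteq> (UNIV :: int set)}" "(\<lambda>n. 0) \<in> PiE UNIV U" "PiE UNIV U \<subseteq> W"
    using assms(2) unfolding openin_product_topology_alt by (fastforce simp del: PiE_UNIV_domain)
  obtain N where N: "\<And>i. U i \<noteq> UNIV \<Longrightarrow> i \<le> N"
    using U(1) finite_nat_set_iff_bounded_le by auto
  have "b \<in> V" if b: "b \<in> carrier (Zp p)" "\<And>n. n \<le> N \<Longrightarrow> b n = 0" for b
  proof -
    have "b i \<in> U i" for i
    proof (cases "i \<le> N")
      case True
      then show ?thesis using b(2)[of i] U(2) by auto
    next
      case False
      then have "U i = UNIV" using N by blast
      then show ?thesis by simp
    qed
    then show ?thesis using U(3) W(2) b(1) by auto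
  qed
  then show ?thesis using that by blast
qed

context compact_abelian_group
begin

text \<open>The topologically p-torsion elements, with neighbourhoods taken in the ambient group.
  This limit condition replaces the union of p-monothetic subgroups; \<open>td_eq_tdp\<close>
  identifies the two for a subgroup \<open>A\<close> and a prime p.\<close>

definition tdp :: "'a set \<Rightarrow> nat \<Rightarrow> 'a set" where
  "tdp A p = {x \<in> A. \<forall>U. open_nbhd U \<longrightarrow> (\<exists>j. \<forall>i\<ge>j. x [^] (p ^ i :: nat) \<in> U)}"

text \<open>In a finite p-group the order is a power of p. In a subgroup of \<open>Zp p\<close>,
  multiplication by p^i clears the coordinates up to i, and the homeomorphism carries this
  back.\<close>

lemma td_subset_tdp:
  assumes A: "subgroup A G" and p: "Factorial_Ring.prime p"
  shows "td (G\<lparr>carrier := A\<rparr>) (subtopology T A) p \<subseteq> tdp A p"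
proof
  fix x assume "x \<in> td (G\<lparr>carrier := A\<rparr>) (subtopology T A) p"
  then obtain B where B: "subgroup B (G\<lparr>carrier := A\<rparr>)" "p_monothetic (G\<lparr>carrier := A\<rparr>) (subtopology T A) p B" "x \<in> B"
    by (auto simp: td_def)
  have BG: "subgroup B G" by (rule incl_subgroup[OF A B(1)])
  have BA: "B \<subseteq> A" using subgroup.subset[OF B(1)] by simp
  have Bc: "B \<subseteq> carrier G" by (rule subgroup.subset[OF BG])
  have xc: "x \<in> carrier G" using B(3) Bc by blast
  have "\<exists>j. \<forall>i\<ge>j. x [^] (p ^ i :: nat) \<in> U" if U: "open_nbhd U" for U
    using B(2) unfolding p_monothetic_def
  proof (elim disjE conjE exE)
    fix k assume k: "card B = p ^ k"
    interpret B: group "G\<lparr>carrier := B\<rparr>" by (rule subgroup_imp_group[OF BG])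
    have "x [^]\<^bsub>G\<lparr>carrier := B\<rparr>\<^esub> (card B) = \<one>" using B.pow_order_eq_1[of x] B(3) by (simp add: order_def)
    then have 1: "x [^] (p ^ k :: nat) = \<one>" using k nat_pow_consistent[of x _ B] by simp
    have "x [^] (p ^ i :: nat) \<in> U" if i: "i \<ge> k" for i
    proof -
      have "(p ^ i :: nat) = p ^ k * p ^ (i - k)" using i by (simp add: power_add[symmetric])
      then have "x [^] (p ^ i :: nat) = \<one>" using 1 xc by (metis nat_pow_one nat_pow_pow)
      then show ?thesis using open_nbhd_one[OF U] by simp
    qed
    then show ?thesis by blast
  next
    fix D f assume D: "subgroup D (Zp p)"
      and "f \<in> iso (G\<lparr>carrier := A\<rparr>\<lparr>carrier := B\<rparr>) (Zp p\<lparr>carrier := D\<rparr>)"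
      and "homeomorphic_map (subtopology (subtopology T A) B) (subtopology (Zp_top p) D) f"
    then have f: "f \<in> iso (G\<lparr>carrier := B\<rparr>) (Zp p\<lparr>carrier := D\<rparr>)"
      and hf: "homeomorphic_map (subtopology T B) (subtopology (Zp_top p) D) f"
      using BA by (auto simp: subtopology_subtopology Int_absorb1)
    have fm: "f (a \<otimes> b) = (\<lambda>n. (f a n + f b n) mod int p ^ n)" if "a \<in> B" "b \<in> B" for a b
      using f that by (auto simp: iso_def hom_def Zp_simps)
    have fD: "f a \<in> D" if "a \<in> B" for a using f that by (auto simp: iso_def hom_def)
    have inj: "inj_on f B" using f by (auto simp: iso_def bij_betw_def)
    have Dc: "D \<subseteq> carrier (Zp p)" by (rule subgroup.subset[OF D])
    have f1: "f \<one> n = 0" for n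
    proof -
      have 1: "\<one> \<in> B" by (rule subgroup.one_closed[OF BG])
      have "f \<one> n = (f \<one> n + f \<one> n) mod int p ^ n" using fm[OF 1 1] by (metis one_closed r_one)
      moreover have "0 \<le> f \<one> n" "f \<one> n < int p ^ n" using fD[OF 1] Dc by (auto simp: Zp_simps)
      ultimately have "(f \<one> n) mod int p ^ n = (f \<one> n + f \<one> n) mod int p ^ n" by simp
      then have "int p ^ n dvd f \<one> n" by (simp add: mod_eq_dvd_iff)
      then show ?thesis using \<open>0 \<le> f \<one> n\<close> \<open>f \<one> n < int p ^ n\<close> zdvd_not_zless[of "f \<one> n" "int p ^ n"] by linarith
    qed
    have fp: "f (x [^] k) n = (int k * f x n) mod int p ^ n" for k :: nat and n
    proof (induction k)
      case 0
      then show ?case by (simp add: f1)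
    next
      case (Suc k)
      have "x [^] k \<in> B" by (rule subgroup_pow[OF BG B(3)])
      then have "f (x [^] Suc k) n = (f (x [^] k) n + f x n) mod int p ^ n" using fm B(3) by simp
      also have "\<dots> = (int (Suc k) * f x n) mod int p ^ n" by (simp add: Suc mod_simps algebra_simps)
      finally show ?case .
    qed
    have "openin (subtopology T B) (U \<inter> B)" using U by (auto simp: open_nbhd_def openin_subtopology)
    then have "openin (subtopology (Zp_top p) D) (f ` (U \<inter> B))"
      using homeomorphic_imp_open_map[OF hf] unfolding open_map_def by blast
    then obtain V where V: "openin (Zp_top p) V" "f ` (U \<inter> B) = V \<inter> D" by (auto simp: openin_subtopology)
    have "f \<one> \<in> f ` (U \<inter> B)" using open_nbhd_one[OF U] subgroup.one_closed[OF BG] by blast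
    moreover have "f \<one> = (\<lambda>n. 0)" using f1 by auto
    ultimately have "(\<lambda>n. 0) \<in> V" using V(2) by auto
    then obtain N where N: "\<And>b. b \<in> carrier (Zp p) \<Longrightarrow> (\<And>n. n \<le> N \<Longrightarrow> b n = 0) \<Longrightarrow> b \<in> V"
      using openin_Zp_top_zero[OF V(1)] by metis
    have "x [^] (p ^ i :: nat) \<in> U" if i: "i \<ge> N" for i
    proof -
      have xB: "x [^] (p ^ i :: nat) \<in> B" by (rule subgroup_pow[OF BG B(3)])
      have "f (x [^] (p ^ i :: nat)) n = 0" if "n \<le> N" for n
      proof -
        have "int p ^ n dvd int (p ^ i) * f x n" using that i by (simp add: le_imp_power_dvd)
        then show ?thesis by (simp add: fp)
      qed
      then have "f (x [^] (p ^ i :: nat)) \<in> V \<inter> D" using N fD[OF xB] Dc by blast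
      then have "f (x [^] (p ^ i :: nat)) \<in> f ` (U \<inter> B)" using V(2) by simp
      then show ?thesis using inj xB unfolding inj_on_def by blast
    qed
    then show ?thesis by blast
  qed
  then show "x \<in> tdp A p" using B(3) BA by (auto simp: tdp_def)
qed

lemma subgroup_gcd_pow:
  assumes H: "subgroup H G" and x: "x \<in> carrier G" and "x [^] (a::int) \<in> H" "x [^] (b::int) \<in> H"
  shows "x [^] (gcd a b) \<in> H"
proof -
  obtain u v where uv: "u * a + v * b = gcd a b" using bezout_int by blast
  have "x [^] (gcd a b) = (x [^] a) [^] u \<otimes> (x [^] b) [^] v"
    using x by (simp add: uv[symmetric] int_pow_mult int_pow_pow mult.commute)
  then show ?thesis using assms subgroup_int_pow_closed[OF H] subgroup.m_closed[OF H] by simp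
qed

end

context locally_minimal_dense_subgroup
begin

text \<open>The factorial powers form a decreasing sequence of closed subgroups whose intersection
  is the divisible part, which is trivial; compactness does the rest.\<close>

lemma exponent_in_open_nbhd:
  assumes "open_nbhd U" obtains n where "pow_set G (fact n) (carrier G) \<subseteq> U"
proof -
  have "closedin T (pow_set G (fact n) (carrier G))" for n
    using closed_subgroupD(1)[OF closed_subgroup_pow_set[OF closed_subgroup_carrier]] .
  moreover have "pow_set G (fact (Suc n)) (carrier G) \<subseteq> pow_set G (fact n) (carrier G)" for n
    by (rule pow_set_fact_Suc[OF closed_subgroup_carrier])
  moreover have "openin T U" "(\<Inter>n. pow_set G (fact n) (carrier G)) \<subseteq> U"
    using assms max_divisible_trivial by (auto simp: open_nbhd_def divisible_part_def)
  ultimately show ?thesis using that by (rule nest_subset)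
qed

lemma open_subgroup_open_nbhd: "subgroup H G \<Longrightarrow> openin T H \<Longrightarrow> open_nbhd H"
  by (simp add: open_nbhd_def subgroup.one_closed)

lemma tdp_iff:
  assumes "x \<in> carrier G"
  shows "x \<in> tdp (carrier G) p \<longleftrightarrow> (\<forall>H. subgroup H G \<and> openin T H \<longrightarrow> (\<exists>j. x [^] (p ^ j :: nat) \<in> H))"
proof
  assume "x \<in> tdp (carrier G) p"
  then show "\<forall>H. subgroup H G \<and> openin T H \<longrightarrow> (\<exists>j. x [^] (p ^ j :: nat) \<in> H)"
    using open_subgroup_open_nbhd unfolding tdp_def by blast
next
  assume r: "\<forall>H. subgroup H G \<and> openin T H \<longrightarrow> (\<exists>j. x [^] (p ^ j :: nat) \<in> H)"
  have "\<exists>j. \<forall>i\<ge>j. x [^] (p ^ i :: nat) \<in> U" if U: "open_nbhd U" for U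
  proof -
    obtain H where H: "subgroup H G" "openin T H" "H \<subseteq> U" using open_subgroup_base[OF U] by blast
    then obtain j where j: "x [^] (p ^ j :: nat) \<in> H" using r by blast
    have "x [^] (p ^ i :: nat) \<in> U" if "i \<ge> j" for i
    proof -
      have "(p ^ i :: nat) = p ^ j * p ^ (i - j)" using that by (simp add: power_add[symmetric])
      then have "x [^] (p ^ i :: nat) = (x [^] (p ^ j :: nat)) [^] (p ^ (i - j) :: nat)"
        using assms by (simp add: nat_pow_pow)
      then show ?thesis using subgroup_pow[OF H(1) j] H(3) by auto
    qed
    then show ?thesis by blast
  qed
  then show "x \<in> tdp (carrier G) p" using assms by (simp add: tdp_def)
qed

text \<open>The cyclic group generated by \<open>x\<close> is itself p-monothetic; no closure is
  taken, because any subgroup of \<open>Zp p\<close> is allowed as a model. If it is infinite,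
  sending the m-th power of \<open>x\<close> to m identifies its topology with the p-adic topology
  of the integers.\<close>

lemma tdp_subset_td:
  assumes A: "subgroup A G" and p: "Factorial_Ring.prime p"
  shows "tdp A p \<subseteq> td (G\<lparr>carrier := A\<rparr>) (subtopology T A) p"
proof
  fix x assume x: "x \<in> tdp A p"
  have Ac: "A \<subseteq> carrier G" by (rule subgroup.subset[OF A])
  have xA: "x \<in> A" using x by (simp add: tdp_def)
  have xc: "x \<in> carrier G" using xA Ac by blast
  have lim: "\<exists>j. \<forall>i\<ge>j. x [^] (p ^ i :: nat) \<in> U" if "open_nbhd U" for U using x that by (simp add: tdp_def)
  have p0: "p > 0" using p by (simp add: prime_gt_0_nat)
  define H where "H = range (\<lambda>k::int. x [^] k)"
  have HG: "subgroup H G" unfolding H_def by (rule subgroup_of_powers[OF xc])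
  have HA: "H \<subseteq> A" unfolding H_def using subgroup_int_pow_closed[OF A xA] by blast
  have HsA: "subgroup H (G\<lparr>carrier := A\<rparr>)" by (rule subgroup_incl[OF HG A HA])
  have xH: "x \<in> H" unfolding H_def using int_pow_1[OF xc] by (metis rangeI)
  interpret GA: group "G\<lparr>carrier := A\<rparr>" by (rule subgroup_imp_group[OF A])
  have gen: "generate (G\<lparr>carrier := A\<rparr>) {x} = H"
  proof -
    have "generate (G\<lparr>carrier := A\<rparr>) {x} = {x [^]\<^bsub>G\<lparr>carrier := A\<rparr>\<^esub> (k::int) | k. k \<in> UNIV}"
      using xA by (intro GA.generate_pow) simp
    then show ?thesis unfolding H_def by (auto simp: int_pow_consistent[OF A xA])
  qed
  have "p_monothetic (G\<lparr>carrier := A\<rparr>) (subtopology T A) p H"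
  proof (cases "ord x = 0")
    case False
    have cardH: "card H = ord x" using generate_pow_card[OF xc] generate_pow[OF xc] unfolding H_def
      by (simp add: full_SetCompr_eq)
    then have fin: "finite H" using False card.infinite by fastforce
    have "closedin T (H - {\<one>})" using fin subgroup.subset[OF HG]
      by (intro closedin_Hausdorff_finite Hausdorff) auto
    then have "open_nbhd (carrier G - (H - {\<one>}))" using openin_diff[OF openin_topspace, of T "H - {\<one>}"] by (simp add: open_nbhd_def)
    then obtain j where "x [^] (p ^ j :: nat) \<in> carrier G - (H - {\<one>})" using lim by blast
    moreover have "x [^] (p ^ j :: nat) \<in> H" by (rule subgroup_pow[OF HG xH])
    ultimately have "x [^] (p ^ j :: nat) = \<one>" by blast
    then have "ord x dvd p ^ j" using pow_eq_id[OF xc] by blast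
    then obtain k where "card H = p ^ k" using divides_primepow_nat[OF p] cardH by auto
    then show ?thesis unfolding p_monothetic_def using fin gen xH by blast
  next
    case True
    have inj: "x [^] (m::int) = x [^] (n::int) \<longleftrightarrow> m = n" for m n
      using int_pow_eq[OF xc, of m n] True by auto
    \<comment> \<open>Suppose an open subgroup contains a power of \<open>x\<close> whose exponent
      is not divisible by p^n. It also contains a power with a p-power exponent, so the gcd gives an
      exponent p^i with i < n, and then p^n itself. If this happened for all open subgroups, the
      p^n-th power of \<open>x\<close> would be trivial, against infinite order.\<close>
    have fine: "\<exists>K. subgroup K G \<and> openin T K \<and> (\<forall>m::int. x [^] m \<in> K \<longrightarrow> int p ^ n dvd m)" for n
    proof (rule ccontr)
      assume neg: "\<not> ?thesis"
      have "x [^] (int p ^ n) \<in> U" if U: "open_nbhd U" for U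
      proof -
        obtain K where K: "subgroup K G" "openin T K" "K \<subseteq> U" using open_subgroup_base[OF U] by blast
        then obtain m :: int where m: "x [^] m \<in> K" "\<not> int p ^ n dvd m" using neg by blast
        obtain j where "x [^] (p ^ j :: nat) \<in> K" using lim[OF open_subgroup_open_nbhd[OF K(1,2)]] by blast
        then have "x [^] (int (p ^ j)) \<in> K" by (metis int_pow_int)
        then have g: "x [^] gcd m (int (p ^ j)) \<in> K" by (rule subgroup_gcd_pow[OF K(1) xc m(1)])
        define g where "g = nat (gcd m (int (p ^ j)))"
        have gi: "int g = gcd m (int (p ^ j))" by (simp add: g_def)
        have "int g dvd int (p ^ j)" unfolding gi by simp
        then have "g dvd p ^ j" by (simp only: int_dvd_int_iff)
        then obtain i where i: "g = p ^ i" using divides_primepow_nat[OF p] by blast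
        have "int g dvd m" unfolding gi by simp
        then have "\<not> n \<le> i" using m(2) i dvd_trans[of "int p ^ n" "int p ^ i" m] by (auto simp: le_imp_power_dvd)
        then have "int p ^ n = int g * int p ^ (n - i)" unfolding i by (simp add: power_add[symmetric])
        then have "x [^] (int p ^ n) = (x [^] int g) [^] (int p ^ (n - i))"
          using xc by (simp add: int_pow_pow)
        moreover have "x [^] int g \<in> K" using g gi by simp
        ultimately show ?thesis using subgroup_int_pow_closed[OF K(1)] K(3) by (metis subsetD)
      qed
      then have "x [^] (int p ^ n) = \<one>" using open_nbhd_Inter_one int_pow_closed[OF xc] by blast
      then have "x [^] (int p ^ n) = x [^] (0::int)" by simp
      then have "int p ^ n = 0" using inj[of "int p ^ n" 0] by blast
      then show False using p0 by simp
    qed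
    \<comment> \<open>The standard embedding of the integers in the p-adic integers.\<close>
    define \<phi> where "\<phi> = (\<lambda>m::int. \<lambda>n::nat. m mod int p ^ n)"
    have p1: "p \<ge> 2" using p by (rule prime_ge_2_nat)
    have \<phi>inj: "\<phi> m = \<phi> m' \<longleftrightarrow> m = m'" for m m'
    proof
      assume eq: "\<phi> m = \<phi> m'"
      have d: "int p ^ n dvd m - m'" for n using fun_cong[OF eq, of n] by (simp add: \<phi>_def mod_eq_dvd_iff)
      show "m = m'"
      proof (rule ccontr)
        assume "m \<noteq> m'"
        then have "int p ^ n \<le> \<bar>m - m'\<bar>" for n using d[of n] by (intro zdvd_imp_le) auto
        then have "int p ^ (nat \<bar>m - m'\<bar>) \<le> int (nat \<bar>m - m'\<bar>)" by simp
        then have "p ^ (nat \<bar>m - m'\<bar>) \<le> nat \<bar>m - m'\<bar>" by (metis of_nat_le_iff of_nat_power)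
        moreover have "nat \<bar>m - m'\<bar> < p ^ (nat \<bar>m - m'\<bar>)" using p1 by (intro power_gt_expt) auto
        ultimately show False by simp
      qed
    qed simp
    have pp: "int p ^ n > 0" for n using p0 by simp
    have \<phi>c: "\<phi> m \<in> carrier (Zp p)" for m
      unfolding \<phi>_def Zp_simps using pp by (auto intro: mod_mod_cancel)
    have \<phi>m: "\<phi> (m + m') = \<phi> m \<otimes>\<^bsub>Zp p\<^esub> \<phi> m'" for m m' by (auto simp: \<phi>_def Zp_simps mod_simps)
    interpret Z: group "Zp p" by (rule group_Zp[OF p0])
    define D where "D = range \<phi>"
    have "subgroup D (Zp p)"
    proof (rule Z.subgroupI)
      show "D \<subseteq> carrier (Zp p)" "D \<noteq> {}" using \<phi>c by (auto simp: D_def)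
      show "inv\<^bsub>Zp p\<^esub> a \<in> D" if a: "a \<in> D" for a
      proof -
        obtain m where m: "a = \<phi> m" using a by (auto simp: D_def)
        have "\<phi> (- m) \<otimes>\<^bsub>Zp p\<^esub> \<phi> m = \<one>\<^bsub>Zp p\<^esub>" unfolding \<phi>m[symmetric] by (simp add: \<phi>_def Zp_simps)
        then have "inv\<^bsub>Zp p\<^esub> a = \<phi> (- m)" unfolding m using \<phi>c by (intro Z.inv_equality)
        then show ?thesis by (simp add: D_def)
      qed
      show "a \<otimes>\<^bsub>Zp p\<^esub> b \<in> D" if ab: "a \<in> D" "b \<in> D" for a b
      proof -
        obtain m m' where "a = \<phi> m" "b = \<phi> m'" using ab by (auto simp: D_def)
        then show ?thesis using \<phi>m by (metis D_def rangeI)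
      qed
    qed
    define l where "l = (\<lambda>y. THE m::int. y = x [^] m)"
    have l: "l (x [^] m) = m" for m unfolding l_def by (rule the_equality) (auto simp: inj)
    define f where "f = (\<lambda>y. \<phi> (l y))"
    have fx: "f (x [^] m) = \<phi> m" for m by (simp add: f_def l)
    define r where "r = (\<lambda>a. x [^] (THE m. a = \<phi> m))"
    have r: "r (\<phi> m) = x [^] m" for m
    proof -
      have "(THE m'. \<phi> m = \<phi> m') = m" by (rule the_equality) (auto simp: \<phi>inj)
      then show ?thesis by (simp add: r_def)
    qed
    have fiso: "f \<in> iso (G\<lparr>carrier := A\<rparr>\<lparr>carrier := H\<rparr>) (Zp p\<lparr>carrier := D\<rparr>)"
    proof -
      have "f (a \<otimes> b) = f a \<otimes>\<^bsub>Zp p\<^esub> f b" if ab: "a \<in> H" "b \<in> H" for a b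
      proof -
        obtain m m' :: int where "a = x [^] m" "b = x [^] m'" using ab by (auto simp: H_def)
        then show ?thesis using xc by (simp add: int_pow_mult[symmetric] fx \<phi>m)
      qed
      moreover have "bij_betw f H D"
        by (rule bij_betw_byWitness[of _ r]) (auto simp: H_def D_def fx r)
      ultimately show ?thesis by (auto simp: iso_def hom_def bij_betw_def)
    qed
    have tsH: "topspace (subtopology T H) = H" using subgroup.subset[OF HG] by auto
    have tsD: "topspace (subtopology (Zp_top p) D) = D"
      using \<phi>c by (auto simp: Zp_top_def D_def)
    have fcont: "continuous_map (subtopology T H) (subtopology (Zp_top p) D) f"
    proof -
      have "continuous_map (subtopology T H) (product_topology (\<lambda>_. discrete_topology UNIV) UNIV) f"
        unfolding continuous_map_componentwise_UNIV
      proof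
        fix n
        obtain K where K: "subgroup K G" "openin T K" "\<forall>m::int. x [^] m \<in> K \<longrightarrow> int p ^ n dvd m" using fine by blast
        show "continuous_map (subtopology T H) (discrete_topology UNIV) (\<lambda>y. f y n)"
          unfolding continuous_map_def
        proof (intro conjI allI impI)
          fix V :: "int set"
          show "openin (subtopology T H) {y \<in> topspace (subtopology T H). f y n \<in> V}"
          proof (subst openin_subopen, intro ballI)
            fix y assume y: "y \<in> {y \<in> topspace (subtopology T H). f y n \<in> V}"
            then have yH: "y \<in> H" "f y n \<in> V" using tsH by auto
            then obtain m :: int where m: "y = x [^] m" by (auto simp: H_def)
            define Q where "Q = {z \<in> carrier G. inv y \<otimes> z \<in> K}"
            have yc: "y \<in> carrier G" using m xc by simp
            have "continuous_map T T (\<lambda>z. inv y \<otimes> z)" using yc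
              by (intro continuous_intros_group continuous_map_const_group) auto
            then have "openin T Q" unfolding Q_def using openin_preimage K(2) by blast
            then have "openin (subtopology T H) (Q \<inter> H)" by (auto simp: openin_subtopology)
            moreover have "y \<in> Q \<inter> H" using yH yc subgroup.one_closed[OF K(1)] by (simp add: Q_def)
            moreover have "Q \<inter> H \<subseteq> {y \<in> topspace (subtopology T H). f y n \<in> V}"
            proof
              fix z assume z: "z \<in> Q \<inter> H"
              then obtain m' :: int where m': "z = x [^] m'" by (auto simp: H_def)
              have "inv y \<otimes> z = x [^] (m' - m)" using xc m m' by (simp add: int_pow_diff m_comm)
              then have "int p ^ n dvd m' - m" using z K(3) by (auto simp: Q_def)
              then have "m' mod int p ^ n = m mod int p ^ n" by (simp add: mod_eq_dvd_iff)
              then have "f z n = f y n" by (simp add: m m' fx \<phi>_def)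
              then show "z \<in> {y \<in> topspace (subtopology T H). f y n \<in> V}" using yH z tsH by auto
            qed
            ultimately show "\<exists>Sa. openin (subtopology T H) Sa \<and> y \<in> Sa \<and> Sa \<subseteq> {y \<in> topspace (subtopology T H). f y n \<in> V}"
              by blast
          qed
        qed auto
      qed
      moreover have "f y \<in> D" if "y \<in> H" for y using that by (auto simp: H_def D_def fx)
      moreover have "f y \<in> carrier (Zp p)" if "y \<in> H" for y using that \<phi>c by (auto simp: H_def fx)
      ultimately show ?thesis unfolding Zp_top_def
        using tsH \<phi>c by (auto simp: continuous_map_in_subtopology subtopology_subtopology D_def Pi_def)
    qed
    have rcont: "continuous_map (subtopology (Zp_top p) D) (subtopology T H) r"
      unfolding continuous_map_def
    proof (intro conjI allI impI)
      show "r \<in> topspace (subtopology (Zp_top p) D) \<rightarrow> topspace (subtopology T H)"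
        unfolding tsH tsD by (auto simp: D_def H_def r)
      fix V assume "openin (subtopology T H) V"
      then obtain V' where V': "openin T V'" "V = V' \<inter> H" by (auto simp: openin_subtopology)
      show "openin (subtopology (Zp_top p) D) {a \<in> topspace (subtopology (Zp_top p) D). r a \<in> V}"
      proof (subst openin_subopen, intro ballI)
        fix a assume "a \<in> {a \<in> topspace (subtopology (Zp_top p) D). r a \<in> V}"
        then have a: "a \<in> D" "r a \<in> V" using tsD by auto
        then obtain m where m: "a = \<phi> m" by (auto simp: D_def)
        have xm: "x [^] m \<in> V'" using a(2) m r V'(2) by simp
        obtain K where K: "subgroup K G" "openin T K" "K \<subseteq> {w \<in> carrier G. x [^] m \<otimes> w \<in> V'}"
          using open_subgroup_base[OF open_nbhd_translate[OF V'(1) xm]] by blast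
        obtain n where n: "x [^] (p ^ n :: nat) \<in> K" using lim[OF open_subgroup_open_nbhd[OF K(1,2)]] by blast
        define Q where "Q = {b :: nat \<Rightarrow> int. b n = a n}"
        have "openin (product_topology (\<lambda>_. discrete_topology UNIV) UNIV) {b \<in> topspace (product_topology (\<lambda>_. discrete_topology (UNIV :: int set)) (UNIV :: nat set)). b n \<in> {a n}}"
          by (rule openin_continuous_map_preimage[OF continuous_map_product_coordinates]) auto
        then have "openin (product_topology (\<lambda>_. discrete_topology UNIV) UNIV) Q" by (simp add: Q_def)
        then have "openin (subtopology (Zp_top p) D) (Q \<inter> D)"
          unfolding Zp_top_def subtopology_subtopology using \<phi>c by (auto simp: openin_subtopology D_def)
        moreover have "a \<in> Q \<inter> D" using a by (simp add: Q_def)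
        moreover have "Q \<inter> D \<subseteq> {a \<in> topspace (subtopology (Zp_top p) D). r a \<in> V}"
        proof
          fix b assume b: "b \<in> Q \<inter> D"
          then obtain m' where m': "b = \<phi> m'" by (auto simp: D_def)
          have "m' mod int p ^ n = m mod int p ^ n" using b by (simp add: Q_def m m' \<phi>_def)
          then have "int p ^ n dvd m' - m" by (simp add: mod_eq_dvd_iff)
          then obtain k where k: "m' - m = int p ^ n * k" by blast
          have "x [^] (int p ^ n * k) = (x [^] (p ^ n :: nat)) [^] k"
            using xc by (metis int_pow_int int_pow_pow of_nat_power)
          then have "x [^] (m' - m) \<in> K" using subgroup_int_pow_closed[OF K(1) n] k by simp
          then have "x [^] m \<otimes> x [^] (m' - m) \<in> V'" using K(3) by blast
          then have "x [^] m' \<in> V'" using xc by (simp add: int_pow_mult[symmetric])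
          then have "r b \<in> V" using m' r V'(2) by (auto simp: H_def)
          then show "b \<in> {a \<in> topspace (subtopology (Zp_top p) D). r a \<in> V}" using b tsD by auto
        qed
        ultimately show "\<exists>S. openin (subtopology (Zp_top p) D) S \<and> a \<in> S \<and> S \<subseteq> {a \<in> topspace (subtopology (Zp_top p) D). r a \<in> V}"
          by blast
      qed
    qed
    have "homeomorphic_maps (subtopology T H) (subtopology (Zp_top p) D) f r"
      unfolding homeomorphic_maps_def tsH tsD using fcont rcont by (auto simp: H_def D_def fx r)
    then have "homeomorphic_map (subtopology T H) (subtopology (Zp_top p) D) f" using homeomorphic_maps_map by blast
    then have "homeomorphic_map (subtopology (subtopology T A) H) (subtopology (Zp_top p) D) f"
      using HA by (simp add: subtopology_subtopology Int_absorb1)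
    then show ?thesis unfolding p_monothetic_def using \<open>subgroup D (Zp p)\<close> fiso by blast
  qed
  then show "x \<in> td (G\<lparr>carrier := A\<rparr>) (subtopology T A) p" using HsA xH by (auto simp: td_def)
qed

lemma td_eq_tdp:
  assumes "subgroup A G" "Factorial_Ring.prime p"
  shows "td (G\<lparr>carrier := A\<rparr>) (subtopology T A) p = tdp A p"
  using td_subset_tdp[OF assms] tdp_subset_td[OF assms] by blast

lemma td_carrier:
  assumes "Factorial_Ring.prime p" shows "td G T p = tdp (carrier G) p"
  using td_eq_tdp[OF subgroup_self assms] subtopology_topspace[of T] by simp

end

text \<open>Split \<open>N\<close> as p^v w with w prime to p; the Chinese remainder theorem gives c
  congruent to 1 modulo p^v and to 0 modulo w.\<close>

lemma primary_idempotent_exists: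
  fixes N p :: nat
  assumes p: "Factorial_Ring.prime p" and N: "N > 0"
  shows "\<exists>c::nat. (\<forall>j. p ^ j dvd N \<longrightarrow> [c = 1] (mod p ^ j)) \<and> (\<forall>m. m dvd N \<and> coprime m p \<longrightarrow> m dvd c)"
proof -
  have "N \<noteq> 0" "\<not> is_unit p" using N p by auto
  then obtain w where "N = p ^ multiplicity p N * w" "\<not> p dvd w" by (rule multiplicity_decompose')
  then obtain v where v: "N = p ^ v * w" "\<not> p dvd w" by blast
  have cw: "coprime p w" using p v(2) by (simp add: prime_imp_coprime)
  then obtain c where c: "[c = 1] (mod p ^ v)" "[c = 0] (mod w)"
    using binary_chinese_remainder_nat[of "p ^ v" w 1 0] by auto
  have "[c = 1] (mod p ^ j)" if "p ^ j dvd N" for j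
  proof -
    have "coprime (p ^ j) w" using cw by simp
    then have "p ^ j dvd p ^ v" using that v(1) by (simp add: coprime_dvd_mult_left_iff)
    then show ?thesis using c(1) cong_dvd_modulus_nat by blast
  qed
  moreover have "m dvd c" if "m dvd N" "coprime m p" for m
  proof -
    have "coprime m (p ^ v)" using that(2) by simp
    then have "m dvd w" using that(1) v(1) by (simp add: coprime_dvd_mult_right_iff)
    then show ?thesis using c(2) by (meson cong_0_iff dvd_trans)
  qed
  ultimately show ?thesis by blast
qed

text \<open>Exponents c with x^c tending to the p-component of x: modulo n! they are the idempotent that is 1 at p
  and 0 away from p.\<close>

definition idem_exp :: "nat \<Rightarrow> nat \<Rightarrow> nat" where
  "idem_exp p n = (SOME c. (\<forall>j. p ^ j dvd fact n \<longrightarrow> [c = 1] (mod p ^ j)) \<and> (\<forall>m. m dvd fact n \<and> coprime m p \<longrightarrow> m dvd c))"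

lemma idem_exp:
  assumes p: "Factorial_Ring.prime p"
  shows "p ^ j dvd fact n \<Longrightarrow> [idem_exp p n = 1] (mod p ^ j)" "m dvd fact n \<Longrightarrow> coprime m p \<Longrightarrow> m dvd idem_exp p n"
proof -
  have "\<exists>c::nat. (\<forall>j. p ^ j dvd fact n \<longrightarrow> [c = 1] (mod p ^ j)) \<and> (\<forall>m. m dvd fact n \<and> coprime m p \<longrightarrow> m dvd c)"
    by (rule primary_idempotent_exists[OF p]) simp
  from someI_ex[OF this, folded idem_exp_def]
  show "p ^ j dvd fact n \<Longrightarrow> [idem_exp p n = 1] (mod p ^ j)" "m dvd fact n \<Longrightarrow> coprime m p \<Longrightarrow> m dvd idem_exp p n" by blast+
qed

lemma fact_primary_part:
  assumes p: "Factorial_Ring.prime p"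
  obtains v w where "(fact n :: nat) = p ^ v * w" "coprime p w"
proof -
  have "(fact n :: nat) \<noteq> 0" "\<not> is_unit p" using p by auto
  then obtain w where "(fact n :: nat) = p ^ multiplicity p (fact n) * w" "\<not> p dvd w" by (rule multiplicity_decompose')
  then obtain v where "(fact n :: nat) = p ^ v * w" "\<not> p dvd w" by blast
  then show ?thesis using that p by (simp add: prime_imp_coprime)
qed

text \<open>The arbitrary choices at successive levels are coherent because the two congruences
  determine the exponent modulo \<open>fact n\<close>.\<close>

lemma idem_exp_Suc:
  assumes p: "Factorial_Ring.prime p" shows "[idem_exp p (Suc n) = idem_exp p n] (mod fact n)"
proof -
  obtain v w where vw: "(fact n :: nat) = p ^ v * w" "coprime p w" using fact_primary_part[OF p] by blast
  have d: "(fact n :: nat) dvd fact (Suc n)" by simp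
  have "p ^ v dvd fact n" "w dvd fact n" using vw by auto
  then have d': "p ^ v dvd fact (Suc n)" "w dvd fact (Suc n)" using d dvd_trans by blast+
  have "[idem_exp p (Suc n) = idem_exp p n] (mod p ^ v)"
    using idem_exp(1)[OF p d'(1)] idem_exp(1)[OF p \<open>p ^ v dvd fact n\<close>] cong_sym cong_trans by blast
  moreover have cw: "coprime w p" using vw(2) by (simp add: coprime_commute)
  have "[idem_exp p (Suc n) = idem_exp p n] (mod w)"
    using idem_exp(2)[OF p d'(2) cw] idem_exp(2)[OF p \<open>w dvd fact n\<close> cw] by (simp add: cong_def)
  ultimately show ?thesis unfolding vw(1) using vw(2) by (intro coprime_cong_mult_nat) auto
qed

context locally_minimal_dense_subgroup
begin

abbreviation Kn :: "nat \<Rightarrow> 'a set" where "Kn n \<equiv> pow_set G (fact n) (carrier G)"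

abbreviation Kp :: "nat \<Rightarrow> 'a set" where "Kp p \<equiv> tdp (carrier G) p"

section \<open>Projections onto the primary components\<close>

lemma closed_subgroup_Kn: "closed_subgroup (Kn n)" by (rule closed_subgroup_pow_set[OF closed_subgroup_carrier])

lemmas KnD = closed_subgroupD[OF closed_subgroup_Kn]

lemma Kn_mono: assumes "m \<le> n" shows "Kn n \<subseteq> Kn m"
  by (rule pow_set_dvd[OF closed_subgroup_carrier]) (rule fact_dvd[OF assms])

lemma Kn_Inter: assumes "\<And>n. x \<in> Kn n" shows "x = \<one>"
  using assms max_divisible_trivial by (auto simp: divisible_part_def)

lemma Kn_in_open_nbhd: assumes "open_nbhd U" shows "\<exists>N. \<forall>n\<ge>N. Kn n \<subseteq> U"
  using exponent_in_open_nbhd[OF assms] Kn_mono by (meson order_trans)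

lemma pow_in_Kn: assumes "x \<in> carrier G" "fact n dvd k" shows "x [^] (k::nat) \<in> Kn n"
proof -
  obtain l where "k = fact n * l" using assms(2) by blast
  then have "x [^] k = (x [^] l) [^] (fact n :: nat)" using assms(1) by (simp add: nat_pow_pow mult.commute)
  then show ?thesis using assms(1) by (auto simp: pow_set_def)
qed

lemma pow_cong_Kn:
  assumes x: "x \<in> carrier G" and ab: "[a = b] (mod fact n)"
  shows "x [^] (a::nat) \<otimes> inv (x [^] (b::nat)) \<in> Kn n"
proof -
  have le: "x [^] a \<otimes> inv (x [^] b) \<in> Kn n" if "b \<le> a" "[a = b] (mod fact n)" for a b :: nat
  proof -
    have "fact n dvd a - b" using that by (simp add: cong_altdef_nat)
    then have "x [^] (a - b) \<in> Kn n" using pow_in_Kn[OF x] by blast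
    moreover have "x [^] a = x [^] (a - b) \<otimes> x [^] b" using x that(1) by (simp add: nat_pow_mult)
    ultimately show ?thesis using x by (simp add: m_assoc)
  qed
  show ?thesis
  proof (cases "b \<le> a")
    case False
    then have "inv (x [^] b \<otimes> inv (x [^] a)) \<in> Kn n" using le[of a b] ab KnD(6) by (simp add: cong_sym)
    then show ?thesis using x by (simp add: inv_mult m_comm)
  qed (use le ab in blast)
qed

text \<open>The limit of the powers of \<open>x\<close> with exponents \<open>idem_exp p n\<close>,
  specified by congruences modulo the closed subgroups \<open>Kn n\<close>. These intersect
  trivially, so the value is unique, and uniqueness is what makes \<open>pr p\<close> a
  homomorphism.\<close>

definition pr :: "nat \<Rightarrow> 'a \<Rightarrow> 'a" where
  "pr p x = (SOME y. y \<in> carrier G \<and> (\<forall>n. y \<otimes> inv (x [^] idem_exp p n) \<in> Kn n))"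

lemma cancel: "a \<in> carrier G \<Longrightarrow> b \<in> carrier G \<Longrightarrow> a \<otimes> inv b \<otimes> b = a"
  by (simp add: m_assoc)

lemma diff_trans: "a \<in> carrier G \<Longrightarrow> b \<in> carrier G \<Longrightarrow> c \<in> carrier G \<Longrightarrow>
  (a \<otimes> inv b) \<otimes> (b \<otimes> inv c) = a \<otimes> inv c"
  by (metis cancel inv_closed m_assoc m_closed)

lemma diff_swap: "a \<in> carrier G \<Longrightarrow> b \<in> carrier G \<Longrightarrow> inv (a \<otimes> inv b) = b \<otimes> inv a"
  by (simp add: inv_mult_group)

lemma diff_mult: assumes "a \<in> carrier G" "b \<in> carrier G" "c \<in> carrier G" "d \<in> carrier G"
  shows "(a \<otimes> b) \<otimes> inv (c \<otimes> d) = (a \<otimes> inv c) \<otimes> (b \<otimes> inv d)"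
  using assms by (simp add: inv_mult m_ac)

text \<open>The cosets of \<open>Kn n\<close> through the approximating powers are closed and, by
  \<open>idem_exp_Suc\<close>, nested; compactness gives a common point.\<close>

lemma pr_spec:
  assumes p: "Factorial_Ring.prime p" and x: "x \<in> carrier G"
  shows "pr p x \<in> carrier G" "pr p x \<otimes> inv (x [^] idem_exp p n) \<in> Kn n"
proof -
  have "(\<Inter>n. {y \<in> carrier G. y \<otimes> inv (x [^] idem_exp p n) \<in> Kn n}) \<noteq> {}"
  proof (rule nest_nonempty)
    show "closedin T {y \<in> carrier G. y \<otimes> inv (x [^] idem_exp p n) \<in> Kn n}" for n
      using x KnD(1) by (intro closedin_preimage continuous_intros_group continuous_map_const_group) auto
    show "{y \<in> carrier G. y \<otimes> inv (x [^] idem_exp p n) \<in> Kn n} \<noteq> {}" for n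
      using x KnD(4) by (auto intro!: exI[of _ "x [^] idem_exp p n"])
    show "{y \<in> carrier G. y \<otimes> inv (x [^] idem_exp p (Suc n)) \<in> Kn (Suc n)} \<subseteq> {y \<in> carrier G. y \<otimes> inv (x [^] idem_exp p n) \<in> Kn n}" for n
    proof safe
      fix y assume y: "y \<in> carrier G" "y \<otimes> inv (x [^] idem_exp p (Suc n)) \<in> Kn (Suc n)"
      have "y \<otimes> inv (x [^] idem_exp p (Suc n)) \<in> Kn n" using y(2) Kn_mono[of n "Suc n"] by auto
      moreover have "x [^] idem_exp p (Suc n) \<otimes> inv (x [^] idem_exp p n) \<in> Kn n"
        by (rule pow_cong_Kn[OF x idem_exp_Suc[OF p]])
      ultimately show "y \<otimes> inv (x [^] idem_exp p n) \<in> Kn n"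
        using KnD(5) diff_trans[of y "x [^] idem_exp p (Suc n)" "x [^] idem_exp p n"] x y(1) by (metis nat_pow_closed)
    qed
  qed
  then have "\<exists>y. y \<in> carrier G \<and> (\<forall>n. y \<otimes> inv (x [^] idem_exp p n) \<in> Kn n)" by blast
  from someI_ex[OF this, folded pr_def]
  show "pr p x \<in> carrier G" "pr p x \<otimes> inv (x [^] idem_exp p n) \<in> Kn n" by blast+
qed

lemma pr_unique:
  assumes p: "Factorial_Ring.prime p" and x: "x \<in> carrier G" and y: "y \<in> carrier G"
    "\<And>n. y \<otimes> inv (x [^] idem_exp p n) \<in> Kn n"
  shows "pr p x = y"
proof -
  have "pr p x \<otimes> inv y \<in> Kn n" for n
  proof -
    have "x [^] idem_exp p n \<otimes> inv y \<in> Kn n"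
      using KnD(6)[OF y(2)[of n]] diff_swap[OF y(1), of "x [^] idem_exp p n"] x by simp
    then show ?thesis using KnD(5)[OF pr_spec(2)[OF p x]] diff_trans[OF pr_spec(1)[OF p x] _ y(1), of "x [^] idem_exp p n"] x
      by (metis nat_pow_closed)
  qed
  then have "pr p x \<otimes> inv y = \<one>" by (rule Kn_Inter)
  then show ?thesis using pr_spec(1)[OF p x] y(1) by (metis inv_closed inv_equality inv_inv)
qed

lemma pr_mult:
  assumes p: "Factorial_Ring.prime p" and x: "x \<in> carrier G" and y: "y \<in> carrier G"
  shows "pr p (x \<otimes> y) = pr p x \<otimes> pr p y"
proof (rule pr_unique[OF p])
  show "x \<otimes> y \<in> carrier G" "pr p x \<otimes> pr p y \<in> carrier G" using x y pr_spec(1)[OF p] by auto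
  show "pr p x \<otimes> pr p y \<otimes> inv ((x \<otimes> y) [^] idem_exp p n) \<in> Kn n" for n
  proof -
    have "(x \<otimes> y) [^] idem_exp p n = x [^] idem_exp p n \<otimes> y [^] idem_exp p n" using x y by (simp add: pow_mult_distrib m_comm)
    then show ?thesis using diff_mult[of "pr p x" "pr p y" "x [^] idem_exp p n" "y [^] idem_exp p n"] x y pr_spec[OF p] KnD(5) by simp
  qed
qed

lemma pr_one: assumes p: "Factorial_Ring.prime p" shows "pr p \<one> = \<one>"
  by (rule pr_unique[OF p]) (auto simp: KnD(4))

lemma pr_inv: assumes p: "Factorial_Ring.prime p" and x: "x \<in> carrier G" shows "pr p (inv x) = inv (pr p x)"
  using pr_mult[OF p x inv_closed[OF x]] pr_one[OF p] x pr_spec(1)[OF p] by (metis inv_closed inv_equality m_comm r_inv)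

lemma pr_lim:
  assumes p: "Factorial_Ring.prime p" and x: "x \<in> carrier G" and U: "open_nbhd U"
  shows "\<exists>N. \<forall>n\<ge>N. x [^] idem_exp p n \<otimes> inv (pr p x) \<in> U"
proof -
  obtain N where N: "\<And>n. n \<ge> N \<Longrightarrow> Kn n \<subseteq> U" using Kn_in_open_nbhd[OF U] by blast
  have "x [^] idem_exp p n \<otimes> inv (pr p x) \<in> Kn n" for n
    using KnD(6)[OF pr_spec(2)[OF p x, of n]] diff_swap[OF pr_spec(1)[OF p x], of "x [^] idem_exp p n"] x by simp
  then show ?thesis using N by blast
qed

lemma pr_continuous: assumes p: "Factorial_Ring.prime p" shows "continuous_map T T (pr p)"
  unfolding continuous_map_def
proof (intro conjI allI impI)
  show "pr p \<in> topspace T \<rightarrow> topspace T" using pr_spec(1)[OF p] by auto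
  fix V assume V: "openin T V"
  show "openin T {x \<in> topspace T. pr p x \<in> V}"
  proof (subst openin_subopen, intro ballI)
    fix x assume "x \<in> {x \<in> topspace T. pr p x \<in> V}"
    then have x: "x \<in> carrier G" "pr p x \<in> V" by auto
    obtain H where H: "subgroup H G" "openin T H" "H \<subseteq> {w \<in> carrier G. pr p x \<otimes> w \<in> V}"
      using open_subgroup_base[OF open_nbhd_translate[OF V x(2)]] by blast
    obtain n where n: "Kn n \<subseteq> H" using exponent_in_open_nbhd[OF open_subgroup_open_nbhd[OF H(1,2)]] by blast
    define Q where "Q = {z \<in> carrier G. inv x \<otimes> z \<in> H}"
    have "openin T Q" unfolding Q_def using x(1)
      by (intro openin_preimage H continuous_intros_group continuous_map_const_group) auto
    moreover have "x \<in> Q" using x(1) subgroup.one_closed[OF H(1)] by (simp add: Q_def)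
    moreover have "Q \<subseteq> {x \<in> topspace T. pr p x \<in> V}"
    proof
      fix z assume z: "z \<in> Q"
      then have zc: "z \<in> carrier G" by (simp add: Q_def)
      define w where "w = inv x \<otimes> z"
      have w: "w \<in> H" "w \<in> carrier G" using z zc x(1) by (auto simp: Q_def w_def)
      \<comment> \<open>Once \<open>Kn n\<close> lies in \<open>H\<close>, the projection maps
        \<open>H\<close> into itself, since it differs from a power of \<open>w\<close> by an
        element of \<open>Kn n\<close>.\<close>
      have "pr p w = (pr p w \<otimes> inv (w [^] idem_exp p n)) \<otimes> w [^] idem_exp p n"
        using cancel[OF pr_spec(1)[OF p w(2)], of "w [^] idem_exp p n"] w(2) by simp
      also have "\<dots> \<in> H" using pr_spec(2)[OF p w(2), of n] n subgroup_pow[OF H(1) w(1)] by (rule_tac subgroup.m_closed[OF H(1)]) auto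
      finally have "pr p w \<in> H" .
      moreover have "z = x \<otimes> w" using zc x(1) by (simp add: w_def m_assoc[symmetric])
      ultimately show "z \<in> {x \<in> topspace T. pr p x \<in> V}" using H(3) pr_mult[OF p x(1) w(2)] zc by auto
    qed
    ultimately show "\<exists>S. openin T S \<and> x \<in> S \<and> S \<subseteq> {x \<in> topspace T. pr p x \<in> V}" by blast
  qed
qed

text \<open>With p^v the p-part of \<open>fact n\<close>, the exponent \<open>idem_exp p n\<close>
  supplies the remaining factor, so \<open>fact n\<close> divides its product with p^j. The bound
  \<open>v\<close> does not depend on \<open>x\<close>, which \<open>Kp_uniform\<close>
  needs.\<close>

lemma pr_pow_Kn:
  assumes p: "Factorial_Ring.prime p"
  shows "\<exists>v. \<forall>j\<ge>v. \<forall>x\<in>carrier G. pr p x [^] (p ^ j :: nat) \<in> Kn n"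
proof -
  obtain v w where vw: "(fact n :: nat) = p ^ v * w" "coprime p w" using fact_primary_part[OF p] by blast
  have "w dvd idem_exp p n" using idem_exp(2)[OF p, of w n] vw by (simp add: coprime_commute)
  have "pr p x [^] (p ^ j :: nat) \<in> Kn n" if j: "j \<ge> v" and x: "x \<in> carrier G" for j x
  proof -
    have "fact n dvd p ^ j * idem_exp p n" unfolding vw(1) using \<open>w dvd idem_exp p n\<close> j by (simp add: le_imp_power_dvd mult_dvd_mono)
    then have 1: "(x [^] idem_exp p n) [^] (p ^ j :: nat) \<in> Kn n" using pow_in_Kn[OF x] x by (simp add: nat_pow_pow mult.commute)
    have 2: "(pr p x \<otimes> inv (x [^] idem_exp p n)) [^] (p ^ j :: nat) \<in> Kn n"
      by (rule subgroup_pow[OF KnD(2) pr_spec(2)[OF p x]])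
    have "pr p x [^] (p ^ j :: nat) = ((pr p x \<otimes> inv (x [^] idem_exp p n)) \<otimes> x [^] idem_exp p n) [^] (p ^ j :: nat)"
      using cancel[OF pr_spec(1)[OF p x], of "x [^] idem_exp p n"] x by simp
    also have "\<dots> = (pr p x \<otimes> inv (x [^] idem_exp p n)) [^] (p ^ j :: nat) \<otimes> (x [^] idem_exp p n) [^] (p ^ j :: nat)"
      using pr_spec(1)[OF p x] x by (intro pow_mult_distrib m_comm) auto
    finally show ?thesis using KnD(5)[OF 2 1] by simp
  qed
  then show ?thesis by blast
qed

lemma pr_in_Kp: assumes p: "Factorial_Ring.prime p" and x: "x \<in> carrier G" shows "pr p x \<in> Kp p"
  unfolding tdp_iff[OF pr_spec(1)[OF p x]]
proof (intro allI impI)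
  fix H assume H: "subgroup H G \<and> openin T H"
  then obtain n where n: "Kn n \<subseteq> H" using exponent_in_open_nbhd[OF open_subgroup_open_nbhd] by blast
  obtain v where "\<forall>j\<ge>v. \<forall>x\<in>carrier G. pr p x [^] (p ^ j :: nat) \<in> Kn n" using pr_pow_Kn[OF p] by blast
  then show "\<exists>j. pr p x [^] (p ^ j :: nat) \<in> H" using n x by blast
qed

lemma Kp_carrier: "x \<in> Kp p \<Longrightarrow> x \<in> carrier G" by (simp add: tdp_def)

lemma prime_power_dvd_fact: assumes "Factorial_Ring.prime q" "n \<ge> q ^ j" shows "q ^ j dvd fact n"
  using assms by (intro dvd_fact) (auto simp: Suc_le_eq prime_gt_0_nat)

text \<open>Modulo an open subgroup the order of \<open>x\<close> divides some p^j, and for large n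
  the exponent is 1 modulo p^j.\<close>

lemma Kp_pr: assumes p: "Factorial_Ring.prime p" and x: "x \<in> Kp p" shows "pr p x = x"
proof -
  have xc: "x \<in> carrier G" by (rule Kp_carrier[OF x])
  have "pr p x \<otimes> inv x \<in> U" if U: "open_nbhd U" for U
  proof -
    obtain H where H: "subgroup H G" "openin T H" "H \<subseteq> U" using open_subgroup_base[OF U] by blast
    obtain j where j: "x [^] (p ^ j :: nat) \<in> H" using x H unfolding tdp_iff[OF xc] by blast
    obtain N where N: "Kn N \<subseteq> H" using exponent_in_open_nbhd[OF open_subgroup_open_nbhd[OF H(1,2)]] by blast
    define n where "n = max N (p ^ j)"
    have "Kn n \<subseteq> H" using N Kn_mono[of N n] by (auto simp: n_def)
    then have 1: "pr p x \<otimes> inv (x [^] idem_exp p n) \<in> H" using pr_spec(2)[OF p xc] by blast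
    have "[idem_exp p n = 1] (mod p ^ j)" by (intro idem_exp[OF p] prime_power_dvd_fact[OF p]) (simp add: n_def)
    \<comment> \<open>Subtracting 1 from the exponent in the natural numbers is safe except for the
      trivial modulus p^0, which is treated apart.\<close>
    moreover have "idem_exp p n \<noteq> 0 \<or> j = 0"
    proof (rule ccontr)
      assume "\<not> ?thesis"
      then have "[0 = 1] (mod p ^ j)" "j \<noteq> 0" using calculation by auto
      then have "p ^ j dvd 1" by (metis cong_dvd_iff dvd_0_right)
      then show False using \<open>j \<noteq> 0\<close> p by (metis is_unit_power_iff not_prime_unit)
    qed
    ultimately have "x [^] idem_exp p n \<otimes> inv x \<in> H"
    proof (cases "j = 0")
      case True
      then have "x \<in> H" using j xc by simp
      then show ?thesis using subgroup_pow[OF H(1)] subgroup.m_closed[OF H(1)] subgroup.m_inv_closed[OF H(1)] by blast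
    next
      case False
      assume c: "[idem_exp p n = 1] (mod p ^ j)" "idem_exp p n \<noteq> 0 \<or> j = 0"
      then have "p ^ j dvd idem_exp p n - 1" using False by (simp add: cong_altdef_nat)
      then obtain k where "idem_exp p n = Suc (p ^ j * k)" using c False by (metis Suc_pred' dvd_def neq0_conv Suc_diff_1)
      then have "x [^] idem_exp p n = (x [^] (p ^ j :: nat)) [^] k \<otimes> x" using xc by (simp add: nat_pow_pow)
      then have "x [^] idem_exp p n \<otimes> inv x = (x [^] (p ^ j :: nat)) [^] k" using xc by (simp add: m_assoc)
      then show ?thesis using subgroup_pow[OF H(1) j] by simp
    qed
    then have "pr p x \<otimes> inv x \<in> H"
      using subgroup.m_closed[OF H(1) 1] diff_trans[OF pr_spec(1)[OF p xc] _ xc, of "x [^] idem_exp p n"] xc by (metis nat_pow_closed)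
    then show ?thesis using H(3) by blast
  qed
  then have "pr p x \<otimes> inv x = \<one>" using open_nbhd_Inter_one[of "pr p x \<otimes> inv x"] pr_spec(1)[OF p xc] xc by simp
  then show ?thesis using pr_spec(1)[OF p xc] xc by (metis inv_closed inv_equality inv_inv)
qed

text \<open>For large n the exponent is a multiple of q^j, because q^j is coprime to p.\<close>

lemma Kp_pr_other:
  assumes p: "Factorial_Ring.prime p" and q: "Factorial_Ring.prime q" "q \<noteq> p" and x: "x \<in> Kp q" shows "pr p x = \<one>"
proof (rule open_nbhd_Inter_one)
  have xc: "x \<in> carrier G" by (rule Kp_carrier[OF x])
  show "pr p x \<in> carrier G" by (rule pr_spec(1)[OF p xc])
  fix U assume U: "open_nbhd U"
  obtain H where H: "subgroup H G" "openin T H" "H \<subseteq> U" using open_subgroup_base[OF U] by blast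
  obtain j where j: "x [^] (q ^ j :: nat) \<in> H" using x H unfolding tdp_iff[OF xc] by blast
  obtain N where N: "Kn N \<subseteq> H" using exponent_in_open_nbhd[OF open_subgroup_open_nbhd[OF H(1,2)]] by blast
  define n where "n = max N (q ^ j)"
  have "Kn n \<subseteq> H" using N Kn_mono[of N n] by (auto simp: n_def)
  then have 1: "pr p x \<otimes> inv (x [^] idem_exp p n) \<in> H" using pr_spec(2)[OF p xc] by blast
  have "q ^ j dvd idem_exp p n"
    by (intro idem_exp(2)[OF p] prime_power_dvd_fact[OF q(1)]) (use p q in \<open>auto simp: n_def primes_coprime\<close>)
  then obtain k where "idem_exp p n = q ^ j * k" by blast
  then have "x [^] idem_exp p n = (x [^] (q ^ j :: nat)) [^] k" using xc by (simp add: nat_pow_pow)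
  then have 2: "x [^] idem_exp p n \<in> H" using subgroup_pow[OF H(1) j] by simp
  have "pr p x \<in> H" using subgroup.m_closed[OF H(1) 1 2] cancel[OF pr_spec(1)[OF p xc], of "x [^] idem_exp p n"] xc by simp
  then show "pr p x \<in> U" using H(3) by blast
qed

text \<open>Let m be the order of \<open>x\<close> modulo an open subgroup. If \<open>pr p x\<close>
  is trivial, m divides \<open>idem_exp p n\<close> for large n; a prime p dividing m would then
  divide a number congruent to 1 modulo p.\<close>

lemma pr_injective:
  assumes x: "x \<in> carrier G" and triv: "\<And>p. Factorial_Ring.prime p \<Longrightarrow> pr p x = \<one>" shows "x = \<one>"
proof (rule open_nbhd_Inter_one[OF x])
  fix U assume U: "open_nbhd U"
  obtain H where H: "subgroup H G" "openin T H" "H \<subseteq> U" using open_subgroup_base[OF U] by blast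
  obtain N where N: "Kn N \<subseteq> H" using exponent_in_open_nbhd[OF open_subgroup_open_nbhd[OF H(1,2)]] by blast
  define m where "m = (LEAST m. m > 0 \<and> x [^] (m::nat) \<in> H)"
  have ex: "\<exists>m. m > 0 \<and> x [^] (m::nat) \<in> H" using pow_in_Kn[OF x, of N "fact N"] N by (intro exI[of _ "fact N"]) auto
  have m: "m > 0" "x [^] m \<in> H" using LeastI_ex[OF ex] by (auto simp: m_def)
  have mmin: "m dvd k" if k: "x [^] (k::nat) \<in> H" for k
  proof -
    have "x [^] int k \<in> H" "x [^] int m \<in> H" using k m(2) by (simp_all add: int_pow_int)
    then have "x [^] (gcd (int k) (int m)) \<in> H" by (intro subgroup_gcd_pow[OF H(1) x])
    then have "x [^] (gcd k m) \<in> H" by (simp add: gcd_int_int_eq int_pow_int)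
    moreover have "gcd k m > 0" using m(1) by simp
    ultimately have "m \<le> gcd k m" unfolding m_def by (intro Least_le) simp
    moreover have "gcd k m \<le> m" using m(1) by (intro dvd_imp_le) auto
    ultimately have "gcd k m = m" by simp
    then show ?thesis by (metis gcd_dvd1)
  qed
  have "m = 1"
  proof (rule ccontr)
    assume "m \<noteq> 1"
    then obtain p where p: "Factorial_Ring.prime p" "p dvd m" using prime_factor_nat by blast
    define n where "n = max N p"
    have "Kn n \<subseteq> H" using N Kn_mono[of N n] by (auto simp: n_def)
    then have "pr p x \<otimes> inv (x [^] idem_exp p n) \<in> H" using pr_spec(2)[OF p(1) x] by blast
    then have "inv (x [^] idem_exp p n) \<in> H" using triv[OF p(1)] x by simp
    then have "inv (inv (x [^] idem_exp p n)) \<in> H" by (rule subgroup.m_inv_closed[OF H(1)])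
    then have "m dvd idem_exp p n" using mmin x by simp
    then have "p dvd idem_exp p n" using p(2) dvd_trans by blast
    moreover have "[idem_exp p n = 1] (mod p ^ 1)" by (intro idem_exp[OF p(1)] prime_power_dvd_fact[OF p(1)]) (simp add: n_def)
    ultimately have "p dvd 1" by (metis cong_dvd_iff power_one_right)
    then show False using p(1) by (metis not_prime_unit)
  qed
  then show "x \<in> U" using m(2) H(3) x by auto
qed

text \<open>\<open>Kp p\<close> is the fixed-point set of the continuous homomorphism
  \<open>pr p\<close>.\<close>

lemma closed_subgroup_Kp: assumes p: "Factorial_Ring.prime p" shows "closed_subgroup (Kp p)"
proof -
  have "x \<in> Kp p \<longleftrightarrow> x \<in> carrier G \<and> pr p x \<otimes> inv x \<in> {\<one>}" for x
  proof
    assume x: "x \<in> Kp p"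
    then show "x \<in> carrier G \<and> pr p x \<otimes> inv x \<in> {\<one>}" using Kp_pr[OF p x] Kp_carrier[OF x] by simp
  next
    assume x: "x \<in> carrier G \<and> pr p x \<otimes> inv x \<in> {\<one>}"
    then have "pr p x = x" using pr_spec(1)[OF p] by (metis inv_closed inv_equality inv_inv singletonD)
    then show "x \<in> Kp p" using pr_in_Kp[OF p] x by metis
  qed
  then have eq: "Kp p = {x \<in> carrier G. pr p x \<otimes> inv x \<in> {\<one>}}" by blast
  have "closedin T (Kp p)" unfolding eq by (intro closedin_preimage closedin_one continuous_intros_group pr_continuous[OF p])
  moreover have "subgroup (Kp p) G"
  proof (rule subgroupI')
    show "Kp p \<subseteq> carrier G" using Kp_carrier by blast
    show "\<one> \<in> Kp p" using pr_in_Kp[OF p one_closed] pr_one[OF p] by simp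
    show "x \<otimes> y \<in> Kp p" if "x \<in> Kp p" "y \<in> Kp p" for x y
      using pr_in_Kp[OF p, of "x \<otimes> y"] pr_mult[OF p] Kp_pr[OF p] that Kp_carrier by simp
    show "inv x \<in> Kp p" if "x \<in> Kp p" for x
      using pr_in_Kp[OF p, of "inv x"] pr_inv[OF p] Kp_pr[OF p] that Kp_carrier by simp
  qed
  ultimately show ?thesis by (simp add: closed_subgroup_def)
qed

lemma Kp_uniform:
  assumes p: "Factorial_Ring.prime p" and U: "open_nbhd U"
  shows "\<exists>v. \<forall>j\<ge>v. pow_set G (p ^ j) (Kp p) \<subseteq> U"
proof -
  obtain n where n: "Kn n \<subseteq> U" using exponent_in_open_nbhd[OF U] by blast
  obtain v where v: "\<forall>j\<ge>v. \<forall>x\<in>carrier G. pr p x [^] (p ^ j :: nat) \<in> Kn n" using pr_pow_Kn[OF p] by blast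
  have "pow_set G (p ^ j) (Kp p) \<subseteq> U" if "j \<ge> v" for j
  proof
    fix y assume "y \<in> pow_set G (p ^ j) (Kp p)"
    then obtain x where x: "x \<in> Kp p" "y = x [^] (p ^ j)" by (auto simp: pow_set_def)
    then have "y = pr p x [^] (p ^ j)" using Kp_pr[OF p] by simp
    then show "y \<in> U" using v that Kp_carrier[OF x(1)] n by blast
  qed
  then show ?thesis by blast
qed

text \<open>Stepping through all naturals and skipping the nonprimes turns the product over the
  primes into a sequence, to which \<open>seq_closed\<close> can be applied.\<close>

fun part :: "(nat \<Rightarrow> 'a) \<Rightarrow> nat \<Rightarrow> 'a" where
  "part y 0 = \<one>"
| "part y (Suc n) = (if Factorial_Ring.prime n then part y n \<otimes> y n else part y n)"

lemma part_closed:
  assumes "subgroup H G" "\<And>q. Factorial_Ring.prime q \<Longrightarrow> y q \<in> H" shows "part y n \<in> H"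
  using assms by (induction n) (auto intro: subgroup.one_closed subgroup.m_closed)

lemma pr_part:
  assumes y: "\<And>q. Factorial_Ring.prime q \<Longrightarrow> y q \<in> Kp q" and p: "Factorial_Ring.prime p"
  shows "pr p (part y n) = (if p < n then y p else \<one>)"
proof (induction n)
  case 0
  then show ?case by (simp add: pr_one[OF p])
next
  case (Suc n)
  have c: "part y n \<in> carrier G" by (rule part_closed[OF subgroup_self]) (use y Kp_carrier in blast)
  show ?case
  proof (cases "Factorial_Ring.prime n")
    case True
    have yn: "y n \<in> carrier G" using Kp_carrier[OF y[OF True]] .
    have "pr p (part y (Suc n)) = pr p (part y n) \<otimes> pr p (y n)" using True pr_mult[OF p c yn] by simp
    also have "\<dots> = (if p < Suc n then y p else \<one>)"
      using Suc Kp_pr[OF p] Kp_pr_other[OF p True _ y[OF True]] y[OF True] yn y[OF p] Kp_carrier by (cases "p = n") auto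
    finally show ?thesis .
  next
    case False
    then show ?thesis using Suc p by (auto simp: less_Suc_eq)
  qed
qed

text \<open>Partial products realize finitely many prescribed components; compactness realizes all
  of them.\<close>

lemma pr_surjective:
  assumes y: "\<And>q. Factorial_Ring.prime q \<Longrightarrow> y q \<in> Kp q"
  obtains x where "x \<in> carrier G" "\<And>q. Factorial_Ring.prime q \<Longrightarrow> pr q x = y q"
proof -
  define R where "R = (\<lambda>n. carrier G \<inter> (\<Inter>q\<in>{q. Factorial_Ring.prime q \<and> q < n}. {z \<in> carrier G. pr q z \<in> {y q}}))"
  have "(\<Inter>n. R n) \<noteq> {}"
  proof (rule nest_nonempty)
    fix n
    have "closedin T (\<Inter>(insert (carrier G) ((\<lambda>q. {z \<in> carrier G. pr q z \<in> {y q}}) ` {q. Factorial_Ring.prime q \<and> q < n})))"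
    proof (rule closedin_Inter)
      fix C assume "C \<in> insert (carrier G) ((\<lambda>q. {z \<in> carrier G. pr q z \<in> {y q}}) ` {q. Factorial_Ring.prime q \<and> q < n})"
      then consider "C = carrier G" | q where "Factorial_Ring.prime q" "C = {z \<in> carrier G. pr q z \<in> {y q}}" by blast
      then show "closedin T C"
      proof cases
        case 2
        have "closedin T {y q}" using Kp_carrier[OF y[OF 2(1)]] by (simp add: closedin_Hausdorff_singleton Hausdorff)
        then show ?thesis unfolding 2(2) by (intro closedin_preimage pr_continuous[OF 2(1)])
      qed (use closed_subgroupD(1)[OF closed_subgroup_carrier] in simp)
    qed simp
    then show "closedin T (R n)" by (simp add: R_def)
    have "part y n \<in> carrier G" by (rule part_closed[OF subgroup_self]) (use y Kp_carrier in blast)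
    then have "part y n \<in> R n" using pr_part[OF y] by (simp add: R_def)
    then show "R n \<noteq> {}" by blast
    show "R (Suc n) \<subseteq> R n" by (auto simp: R_def)
  qed
  then obtain x where x: "\<And>n. x \<in> R n" by blast
  then have "x \<in> carrier G" by (auto simp: R_def)
  moreover have "pr q x = y q" if "Factorial_Ring.prime q" for q using x[of "Suc q"] that by (auto simp: R_def)
  ultimately show ?thesis using that by blast
qed

text \<open>The quotient of a partial product by \<open>x\<close> has trivial components at all
  primes below n. The closed sets \<open>R n\<close> of such elements decrease to the identity by
  \<open>pr_injective\<close>, so they are eventually inside \<open>U\<close>.\<close>

lemma part_lim:
  assumes x: "x \<in> carrier G" and U: "open_nbhd U"
  shows "\<exists>N. \<forall>n\<ge>N. part (\<lambda>q. pr q x) n \<otimes> inv x \<in> U"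
proof -
  define R where "R = (\<lambda>n. carrier G \<inter> (\<Inter>q\<in>{q. Factorial_Ring.prime q \<and> q < n}. {z \<in> carrier G. pr q z \<in> {\<one>}}))"
  have cl: "closedin T (R n)" for n
  proof -
    have "closedin T (\<Inter>(insert (carrier G) ((\<lambda>q. {z \<in> carrier G. pr q z \<in> {\<one>}}) ` {q. Factorial_Ring.prime q \<and> q < n})))"
      by (rule closedin_Inter)
        (use closed_subgroupD(1)[OF closed_subgroup_carrier] closedin_preimage[OF pr_continuous closedin_one] in auto)
    then show ?thesis by (simp add: R_def)
  qed
  have dec: "R (Suc n) \<subseteq> R n" for n by (auto simp: R_def)
  have "(\<Inter>n. R n) \<subseteq> U"
  proof
    fix z assume z: "z \<in> (\<Inter>n. R n)"
    then have "z \<in> carrier G" by (auto simp: R_def)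
    moreover have "pr q z = \<one>" if "Factorial_Ring.prime q" for q
    proof -
      have "z \<in> R (Suc q)" using z by blast
      then show ?thesis using that by (auto simp: R_def)
    qed
    ultimately show "z \<in> U" using pr_injective open_nbhd_one[OF U] by metis
  qed
  then obtain N where N: "R N \<subseteq> U" using nest_subset[of R, OF cl dec] U unfolding open_nbhd_def by blast
  have "part (\<lambda>q. pr q x) n \<otimes> inv x \<in> U" if n: "n \<ge> N" for n
  proof -
    have c: "part (\<lambda>q. pr q x) n \<in> carrier G" by (rule part_closed[OF subgroup_self]) (use pr_spec(1) x in blast)
    have "pr q (part (\<lambda>q. pr q x) n \<otimes> inv x) = \<one>" if q: "Factorial_Ring.prime q" "q < n" for q
      using pr_mult[OF q(1) c inv_closed[OF x]] pr_inv[OF q(1) x] pr_part[of "\<lambda>q. pr q x", OF pr_in_Kp[OF _ x] q(1)] q(2)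
        pr_spec(1)[OF q(1) x] by simp
    then have "part (\<lambda>q. pr q x) n \<otimes> inv x \<in> R n" using c x by (simp add: R_def)
    moreover have "R n \<subseteq> R N" using lift_Suc_antimono_le[of R, OF dec n] .
    ultimately show ?thesis using N by blast
  qed
  then show ?thesis by blast
qed

lemma pr_in_S: assumes p: "Factorial_Ring.prime p" and x: "x \<in> S" shows "pr p x \<in> S"
proof -
  have xc: "x \<in> carrier G" using x S_carrier by blast
  show ?thesis by (rule seq_closed[OF S_pow[OF x] pr_spec(1)[OF p xc] pr_lim[OF p xc]])
qed

lemma in_S_of_pr: assumes x: "x \<in> carrier G" and "\<And>p. Factorial_Ring.prime p \<Longrightarrow> pr p x \<in> S" shows "x \<in> S"
  by (rule seq_closed[OF part_closed[OF subgroup_S assms(2)] x part_lim[OF x]])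

lemma in_open_subgroup_of_pr:
  assumes H: "subgroup H G" "openin T H" and x: "x \<in> carrier G" "\<And>p. Factorial_Ring.prime p \<Longrightarrow> pr p x \<in> H"
  shows "x \<in> H"
proof -
  obtain N where "part (\<lambda>q. pr q x) N \<otimes> inv x \<in> H" using part_lim[OF x(1) open_subgroup_open_nbhd[OF H]] by blast
  moreover have pH: "part (\<lambda>q. pr q x) N \<in> H" by (rule part_closed[OF H(1) x(2)])
  ultimately have "inv (part (\<lambda>q. pr q x) N \<otimes> inv x) \<otimes> part (\<lambda>q. pr q x) N \<in> H"
    using subgroup.m_closed[OF H(1)] subgroup.m_inv_closed[OF H(1)] by blast
  moreover have "part (\<lambda>q. pr q x) N \<in> carrier G" using pH subgroup.subset[OF H(1)] by blast
  ultimately show ?thesis using diff_swap[of "part (\<lambda>q. pr q x) N" x] cancel x(1) by simp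
qed

lemma closedin_open_subgroup: assumes H: "subgroup H G" "openin T H" shows "closedin T H"
proof -
  have "openin T (carrier G - H)"
  proof (subst openin_subopen, intro ballI)
    fix x assume x: "x \<in> carrier G - H"
    define Q where "Q = {z \<in> carrier G. inv x \<otimes> z \<in> H}"
    have "openin T Q" unfolding Q_def using x
      by (intro openin_preimage H continuous_intros_group continuous_map_const_group) auto
    moreover have "x \<in> Q" using x subgroup.one_closed[OF H(1)] by (simp add: Q_def)
    moreover have "z \<notin> H" if z: "z \<in> Q" for z
    proof
      assume "z \<in> H"
      then have "z \<otimes> inv (inv x \<otimes> z) \<in> H" using z subgroup.m_closed[OF H(1)] subgroup.m_inv_closed[OF H(1)] by (auto simp: Q_def)
      moreover have "z \<otimes> inv (inv x \<otimes> z) = x" using z x by (simp add: Q_def inv_mult_group m_assoc[symmetric])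
      ultimately show False using x by simp
    qed
    ultimately show "\<exists>S. openin T S \<and> x \<in> S \<and> S \<subseteq> carrier G - H" unfolding Q_def by blast
  qed
  then show ?thesis using subgroup.subset[OF H(1)] by (simp add: closedin_def)
qed

end

context compact_abelian_group
begin

text \<open>The group generated by \<open>C\<close> and \<open>y\<close> is a finite union of closed
  cosets of \<open>C\<close>, so it is closed and \<open>C\<close> is open in it; \<open>U\<close>
  cuts off the other cosets. Iteration keeps a neighbourhood of the identity under control while
  generators are added one by one.\<close>

lemma adjoin_element:
  assumes C: "closed_subgroup C" and y: "y \<in> carrier G" and N: "N > 0" "y [^] (N::nat) \<in> C"
  obtains C' U where "closed_subgroup C'" "C \<subseteq> C'" "y \<in> C'" "open_nbhd U" "C' \<inter> U \<subseteq> C"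
proof -
  note C0 = closed_subgroupD[OF C]
  define C' where "C' = {x \<in> carrier G. \<exists>r::int. x \<otimes> y [^] r \<in> C}"
  have red: "\<exists>r<N. x \<otimes> y [^] r \<in> C" if x: "x \<in> C'" for x
  proof -
    obtain k :: int where k: "x \<in> carrier G" "x \<otimes> y [^] k \<in> C" using x by (auto simp: C'_def)
    define r where "r = nat (k mod int N)"
    have r: "r < N" "int r = k mod int N" unfolding r_def using N(1) by (auto simp: nat_less_iff)
    have "int r = k + int N * (- (k div int N))" unfolding r(2) by (simp add: minus_mult_div_eq_mod[symmetric])
    then have "y [^] r = y [^] k \<otimes> (y [^] N) [^] (- (k div int N))"
      using y by (metis int_pow_int int_pow_mult int_pow_pow)
    moreover have "(y [^] N) [^] (- (k div int N)) \<in> C" by (rule subgroup_int_pow_closed[OF C0(2) N(2)])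
    ultimately have "x \<otimes> y [^] r \<in> C" using k y C0(5)[OF k(2)] by (simp add: m_assoc[symmetric])
    then show ?thesis using r(1) by blast
  qed
  have cl: "closedin T {x \<in> carrier G. x \<otimes> y [^] (r::nat) \<in> C}" for r
    using y C0(1) by (intro closedin_preimage continuous_intros_group continuous_map_const_group) auto
  have sub: "{x \<in> carrier G. x \<otimes> y [^] (r::nat) \<in> C} \<subseteq> C'" for r
    unfolding C'_def by (auto intro: exI[of _ "int r"] simp: int_pow_int)
  have "C' = (\<Union>r\<in>{..<N}. {x \<in> carrier G. x \<otimes> y [^] r \<in> C})"
  proof
    show "C' \<subseteq> (\<Union>r\<in>{..<N}. {x \<in> carrier G. x \<otimes> y [^] r \<in> C})"
    proof
      fix x assume x: "x \<in> C'"
      then obtain r where "r < N" "x \<otimes> y [^] r \<in> C" using red by blast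
      moreover have "x \<in> carrier G" using x by (simp add: C'_def)
      ultimately show "x \<in> (\<Union>r\<in>{..<N}. {x \<in> carrier G. x \<otimes> y [^] r \<in> C})" by blast
    qed
  qed (use sub in blast)
  moreover have "closedin T (\<Union>r\<in>{..<N}. {x \<in> carrier G. x \<otimes> y [^] r \<in> C})"
    by (intro closedin_Union) (use cl in auto)
  ultimately have C'cl: "closedin T C'" by simp
  have "subgroup C' G"
  proof (rule subgroupI')
    show "C' \<subseteq> carrier G" by (auto simp: C'_def)
    show "\<one> \<in> C'" using C0(4) by (auto simp: C'_def intro: exI[of _ "0::int"])
    show "a \<otimes> b \<in> C'" if ab: "a \<in> C'" "b \<in> C'" for a b
    proof -
      obtain r s :: int where rs: "a \<in> carrier G" "b \<in> carrier G" "a \<otimes> y [^] r \<in> C" "b \<otimes> y [^] s \<in> C"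
        using ab by (auto simp: C'_def)
      have "(a \<otimes> y [^] r) \<otimes> (b \<otimes> y [^] s) = (a \<otimes> b) \<otimes> y [^] (r + s)"
        using rs y by (simp add: int_pow_mult m_ac)
      then have "(a \<otimes> b) \<otimes> y [^] (r + s) \<in> C" using C0(5)[OF rs(3,4)] by simp
      then show ?thesis using rs by (auto simp: C'_def)
    qed
    show "inv a \<in> C'" if a: "a \<in> C'" for a
    proof -
      obtain r :: int where r: "a \<in> carrier G" "a \<otimes> y [^] r \<in> C" using a by (auto simp: C'_def)
      have "inv (a \<otimes> y [^] r) = inv a \<otimes> y [^] (- r)" using r y by (simp add: inv_mult int_pow_neg)
      then have "inv a \<otimes> y [^] (- r) \<in> C" using C0(6)[OF r(2)] by simp
      then show ?thesis using r by (auto simp: C'_def)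
    qed
  qed
  then have C1: "closed_subgroup C'" using C'cl by (simp add: closed_subgroup_def)
  have CC': "C \<subseteq> C'"
  proof
    fix x assume x: "x \<in> C"
    then have "x \<otimes> y [^] (0::int) \<in> C" using C0(3) by auto
    then show "x \<in> C'" unfolding C'_def using x C0(3) by blast
  qed
  have yC': "y \<in> C'"
  proof -
    have "y \<otimes> y [^] (-1::int) \<in> C" using y C0(4) by (simp add: int_pow_neg)
    then show ?thesis unfolding C'_def using y by blast
  qed
  define D where "D = (\<Union>r\<in>{r. r < N \<and> y [^] r \<notin> C}. {x \<in> carrier G. x \<otimes> y [^] r \<in> C})"
  have "closedin T D" unfolding D_def by (intro closedin_Union) (use cl in auto)
  then have "openin T (carrier G - D)" using openin_diff[OF openin_topspace, of T D] by simp
  moreover have "\<one> \<notin> D" using y by (auto simp: D_def)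
  ultimately have nD: "open_nbhd (carrier G - D)" by (simp add: open_nbhd_def)
  have DC: "C' \<inter> (carrier G - D) \<subseteq> C"
  proof
    fix x assume x: "x \<in> C' \<inter> (carrier G - D)"
    then obtain r where r: "r < N" "x \<otimes> y [^] r \<in> C" using red by blast
    then have "y [^] r \<in> C" using x by (auto simp: D_def)
    then have "(x \<otimes> y [^] r) \<otimes> inv (y [^] r) \<in> C" using C0(5)[OF r(2)] C0(6) by blast
    then show "x \<in> C" using x y by (simp add: m_assoc)
  qed
  show ?thesis by (rule that[OF C1 CC' yC' nD DC])
qed

end

context locally_minimal_dense_subgroup
begin

section \<open>Bounded exponent modulo the dense subgroup\<close>

text \<open>Essentiality gives a nontrivial \<open>s\<close> of \<open>S\<close> in the closure of
  the powers of \<open>x\<close>. Modulo the p^n-th powers of \<open>Kp p\<close>, \<open>s\<close>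
  is x^r, and the p-part of r stays below p^n0 for all n because \<open>s\<close> avoids a fixed
  open subgroup. A suitable power of \<open>s\<close> is then close to the p^n0-th power of
  \<open>x\<close>, which lies in \<open>S\<close> in the limit.\<close>

lemma torsion_mod_S:
  assumes p: "Factorial_Ring.prime p"
    and V0: "\<And>L. closed_subgroup L \<Longrightarrow> L \<subseteq> V0 \<Longrightarrow> L \<inter> S \<subseteq> {\<one>} \<Longrightarrow> L = {\<one>}"
    and H: "closed_subgroup H" "H \<subseteq> V0" and x: "x \<in> Kp p" "x \<in> H"
  shows "\<exists>m. x [^] (p ^ m :: nat) \<in> S"
proof (cases "x = \<one>")
  case True
  then show ?thesis using S_one by (metis nat_pow_one)
next
  case False
  have xc: "x \<in> carrier G" by (rule Kp_carrier[OF x(1)])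
  define L where "L = T closure_of (range (\<lambda>k::int. x [^] k))"
  have gen: "subgroup (range (\<lambda>k::int. x [^] k)) G" by (rule subgroup_of_powers[OF xc])
  have L: "closed_subgroup L" unfolding L_def by (rule closure_subgroup[OF gen])
  have KH: "closed_subgroup (Kp p \<inter> H)" by (rule closed_subgroup_Int[OF closed_subgroup_Kp[OF p] H(1)])
  have rY: "range (\<lambda>k::int. x [^] k) \<subseteq> Kp p \<inter> H" using subgroup_int_pow_closed[OF closed_subgroupD(2)[OF KH], of x] x by auto
  then have LY: "L \<subseteq> Kp p \<inter> H" unfolding L_def using closed_subgroupD(1)[OF KH] by (rule closure_of_minimal)
  have rL: "range (\<lambda>k::int. x [^] k) \<subseteq> L" unfolding L_def using rY closed_subgroupD(3)[OF KH] by (intro closure_of_subset) auto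
  have "x \<in> L" using rL int_pow_1[OF xc] by (metis rangeI subsetD)
  then have "L \<noteq> {\<one>}" using False by blast
  moreover have "L \<subseteq> V0" using LY H(2) by blast
  ultimately obtain s where s: "s \<in> L" "s \<in> S" "s \<noteq> \<one>" using V0[OF L] by blast
  have sc: "s \<in> carrier G" using s(2) S_carrier by blast
  have "closedin T {s}" using sc by (simp add: closedin_Hausdorff_singleton Hausdorff)
  then have "open_nbhd (carrier G - {s})" using openin_diff[OF openin_topspace, of T "{s}"] s(3) by (simp add: open_nbhd_def)
  then obtain A where A: "subgroup A G" "openin T A" "A \<subseteq> carrier G - {s}" using open_subgroup_base by blast
  define Q where "Q = (\<lambda>n. pow_set G (p ^ n) (Kp p))"
  have Q: "closed_subgroup (Q n)" for n unfolding Q_def by (rule closed_subgroup_pow_set[OF closed_subgroup_Kp[OF p]])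
  have Qmono: "Q n \<subseteq> Q m" if "m \<le> n" for m n
    unfolding Q_def by (rule pow_set_dvd[OF closed_subgroup_Kp[OF p]]) (simp add: le_imp_power_dvd that)
  obtain n0 where n0: "\<forall>j\<ge>n0. Q j \<subseteq> A" using Kp_uniform[OF p open_subgroup_open_nbhd[OF A(1,2)]] unfolding Q_def by blast
  have xQ: "x [^] (p ^ n :: nat) \<in> Q n" for n using x(1) by (auto simp: Q_def pow_set_def)
  have p0: "p > 0" using p by (simp add: prime_gt_0_nat)
  have "\<exists>t\<in>S. t \<otimes> inv (x [^] (p ^ n0 :: nat)) \<in> Q n" if n: "n \<ge> n0" for n
  proof -
    obtain r where r: "r < p ^ n" "s \<otimes> inv (x [^] (r::nat)) \<in> Q n"
      using closure_powers_in_cosets[OF Q xc _ xQ s(1)[unfolded L_def]] p0 by (metis zero_less_power)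
    define q where "q = s \<otimes> inv (x [^] r)"
    have qc: "q \<in> carrier G" using sc xc by (simp add: q_def)
    have sq: "s = q \<otimes> x [^] r" using cancel[OF sc, of "x [^] r"] xc by (simp add: q_def)
    have qA: "q \<in> A" using r(2) n0 n by (auto simp: q_def)
    have nd: "\<not> p ^ n0 dvd r"
    proof
      assume "p ^ n0 dvd r"
      then obtain k where "r = p ^ n0 * k" by blast
      then have "x [^] r = (x [^] (p ^ n0 :: nat)) [^] k" using xc by (simp add: nat_pow_pow)
      moreover have "x [^] (p ^ n0 :: nat) \<in> A" using xQ n0 by blast
      ultimately have "x [^] r \<in> A" using subgroup_pow[OF A(1)] by simp
      then have "s \<in> A" using sq subgroup.m_closed[OF A(1) qA] by simp
      then show False using A(3) by blast
    qed
    then have "r \<noteq> 0" "\<not> is_unit p" using p by (auto intro: ccontr)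
    then obtain u where "r = p ^ multiplicity p r * u" "\<not> p dvd u" by (rule multiplicity_decompose')
    then obtain m where m: "r = p ^ m * u" "\<not> p dvd u" by blast
    have mn: "m < n0" using nd m(1) le_imp_power_dvd[of n0 m p] by (metis dvd_mult2 not_less)
    have "coprime u (p ^ n)" using m(2) p by (simp add: prime_imp_coprime coprime_commute)
    then obtain u' where u': "[u * u' = 1] (mod p ^ n)" using cong_solve_coprime_nat[of u "p ^ n"] by auto
    \<comment> \<open>The factor \<open>u'\<close> cancels the part of \<open>r\<close> prime to p,
      and the power of p raises the exponent to p^n0, the same for every n.\<close>
    define e where "e = u' * p ^ (n0 - m)"
    have "[p ^ n0 * (u * u') = p ^ n0 * 1] (mod p ^ n)" using u' cong_scalar_left by blast
    moreover have "r * e = p ^ n0 * (u * u')"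
    proof -
      have "p ^ n0 = p ^ m * p ^ (n0 - m)" using mn by (simp add: power_add[symmetric])
      then show ?thesis by (simp add: m(1) e_def)
    qed
    ultimately have re: "[r * e = p ^ n0] (mod p ^ n)" by simp
    have diff: "x [^] (r * e) \<otimes> inv (x [^] (p ^ n0 :: nat)) \<in> Q n"
    proof -
      have le: "x [^] a \<otimes> inv (x [^] b) \<in> Q n" if "b \<le> a" "[a = b] (mod p ^ n)" for a b :: nat
      proof -
        have "p ^ n dvd a - b" using that by (simp add: cong_altdef_nat)
        then obtain k where "a - b = p ^ n * k" by blast
        then have "x [^] (a - b) = (x [^] (p ^ n :: nat)) [^] k" using xc by (simp add: nat_pow_pow)
        then have "x [^] (a - b) \<in> Q n" using subgroup_pow[OF closed_subgroupD(2)[OF Q] xQ] by simp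
        moreover have "x [^] a = x [^] (a - b) \<otimes> x [^] b" using xc that(1) by (simp add: nat_pow_mult)
        ultimately show ?thesis using xc by (simp add: m_assoc)
      qed
      show ?thesis
      proof (cases "p ^ n0 \<le> r * e")
        case True
        then show ?thesis using le re by blast
      next
        case False
        then have "x [^] (p ^ n0 :: nat) \<otimes> inv (x [^] (r * e)) \<in> Q n" using le re by (simp add: cong_sym)
        then have "inv (x [^] (p ^ n0 :: nat) \<otimes> inv (x [^] (r * e))) \<in> Q n" by (rule closed_subgroupD(6)[OF Q])
        then show ?thesis using diff_swap[of "x [^] (p ^ n0 :: nat)" "x [^] (r * e)"] xc by simp
      qed
    qed
    have "s [^] e = q [^] e \<otimes> x [^] (r * e)"
      unfolding sq using qc xc by (simp add: pow_mult_distrib m_comm nat_pow_pow)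
    then have "s [^] e \<otimes> inv (x [^] (p ^ n0 :: nat)) = q [^] e \<otimes> (x [^] (r * e) \<otimes> inv (x [^] (p ^ n0 :: nat)))"
      using qc xc by (simp add: m_assoc)
    moreover have "q [^] e \<in> Q n" using subgroup_pow[OF closed_subgroupD(2)[OF Q] r(2)] by (simp add: q_def)
    ultimately have "s [^] e \<otimes> inv (x [^] (p ^ n0 :: nat)) \<in> Q n" using closed_subgroupD(5)[OF Q _ diff] by simp
    then show ?thesis using S_pow[OF s(2)] by blast
  qed
  then have "\<forall>n. \<exists>t. t \<in> S \<and> t \<otimes> inv (x [^] (p ^ n0 :: nat)) \<in> Q (n + n0)" using le_add2 by blast
  then have "\<exists>t. \<forall>n. t n \<in> S \<and> t n \<otimes> inv (x [^] (p ^ n0 :: nat)) \<in> Q (n + n0)" by (rule choice)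
  then obtain t where t: "\<And>n. t n \<in> S" "\<And>n. t n \<otimes> inv (x [^] (p ^ n0 :: nat)) \<in> Q (n + n0)" by blast
  have "x [^] (p ^ n0 :: nat) \<in> S"
  proof (rule seq_closed[OF t(1)])
    show "x [^] (p ^ n0 :: nat) \<in> carrier G" using xc by simp
    fix U assume "open_nbhd U"
    then obtain N where "\<forall>j\<ge>N. Q j \<subseteq> U" using Kp_uniform[OF p] unfolding Q_def by blast
    then have "t n \<otimes> inv (x [^] (p ^ n0 :: nat)) \<in> U" if "n \<ge> N" for n using t(2)[of n] that by (meson subsetD trans_le_add1)
    then show "\<exists>N. \<forall>n\<ge>N. t n \<otimes> inv (x [^] (p ^ n0 :: nat)) \<in> U" by blast
  qed
  then show ?thesis by blast
qed

text \<open>If no power of Kp lay in S, there would be elements y i tending to the identity whose orders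
  modulo S are unbounded. They generate a metrizable closed subgroup M, whose intersection with S is
  closed, and the Baire category theorem bounds the exponent of M modulo S near the identity.\<close>

lemma bounded_mod_S:
  assumes p: "Factorial_Ring.prime p"
    and V0: "open_nbhd V0" "\<And>L. closed_subgroup L \<Longrightarrow> L \<subseteq> V0 \<Longrightarrow> L \<inter> S \<subseteq> {\<one>} \<Longrightarrow> L = {\<one>}"
  shows "\<exists>k. pow_set G (p ^ k) (Kp p) \<subseteq> S"
proof (rule ccontr)
  assume neg: "\<not> ?thesis"
  obtain H where H: "subgroup H G" "openin T H" "H \<subseteq> V0" using open_subgroup_base[OF V0(1)] by blast
  have Hc: "closed_subgroup H" using H closedin_open_subgroup by (simp add: closed_subgroup_def)
  define Q where "Q = (\<lambda>n. pow_set G (p ^ n) (Kp p))"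
  have Q: "closed_subgroup (Q n)" for n unfolding Q_def by (rule closed_subgroup_pow_set[OF closed_subgroup_Kp[OF p]])
  have Qmono: "Q n \<subseteq> Q m" if "m \<le> n" for m n
    unfolding Q_def by (rule pow_set_dvd[OF closed_subgroup_Kp[OF p]]) (simp add: le_imp_power_dvd that)
  have QK: "Q n \<subseteq> Kp p" for n unfolding Q_def by (rule pow_set_subset[OF closed_subgroup_Kp[OF p]])
  have p0: "p > 0" using p by (simp add: prime_gt_0_nat)
  obtain j where j: "Q j \<subseteq> H" using Kp_uniform[OF p open_subgroup_open_nbhd[OF H(1,2)]] unfolding Q_def by blast
  \<comment> \<open>Failure of the claim at exponent j + 2i gives a \<open>w\<close>. Its p^(j+i)-th
    power is close to the identity, and a further p^i-th power still lies outside
    \<open>S\<close>.\<close>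
  have "\<exists>y. y \<in> Q (j + i) \<and> y [^] (p ^ i :: nat) \<notin> S" for i
  proof -
    obtain w where w: "w \<in> Kp p" "w [^] (p ^ (j + i + i) :: nat) \<notin> S"
      using neg by (auto simp: pow_set_def)
    have "(w [^] (p ^ (j + i) :: nat)) [^] (p ^ i :: nat) = w [^] (p ^ (j + i + i) :: nat)"
      using Kp_carrier[OF w(1)] by (simp add: nat_pow_pow power_add)
    then show ?thesis using w by (intro exI[of _ "w [^] (p ^ (j + i) :: nat)"]) (auto simp: Q_def pow_set_def)
  qed
  then obtain y where y: "\<And>i. y i \<in> Q (j + i)" "\<And>i. y i [^] (p ^ i :: nat) \<notin> S" by metis
  have yQ: "y i \<in> Q i" for i using y(1) Qmono[of i "j + i"] by auto
  have yK: "y i \<in> Kp p" for i using yQ QK by blast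
  have yc: "y i \<in> carrier G" for i using Kp_carrier[OF yK] .
  have yH: "y i \<in> H" for i using y(1) Qmono[of j "j + i"] j by auto
  define M where "M = T closure_of (generate G (range y))"
  have gen: "subgroup (generate G (range y)) G" by (rule generate_is_subgroup) (use yc in auto)
  have M: "closed_subgroup M" unfolding M_def by (rule closure_subgroup[OF gen])
  note M' = closed_subgroupD[OF M]
  have min: "M \<subseteq> C" if "closed_subgroup C" "\<And>i. y i \<in> C" for C
    unfolding M_def using generate_subgroup_incl[of "range y" C] closed_subgroupD(1,2)[OF that(1)] that(2)
    by (intro closure_of_minimal) auto
  have yM: "y i \<in> M" for i
  proof -
    have "generate G (range y) \<subseteq> M" unfolding M_def using subgroup.subset[OF gen] by (intro closure_of_subset) simp
    then show ?thesis using generate.incl[of "y i" "range y" G] by blast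
  qed
  have MKH: "M \<subseteq> Kp p \<inter> H" by (rule min[OF closed_subgroup_Int[OF closed_subgroup_Kp[OF p] Hc]]) (use yK yH in blast)
  \<comment> \<open>All but the first n generators lie in \<open>Q n\<close>, and the p^n-th powers
    of the others do, so \<open>M\<close> is contained in a finite extension of
    \<open>Q n\<close>.\<close>
  have fin: "\<exists>U. open_nbhd U \<and> M \<inter> U \<subseteq> Q n" for n
  proof -
    have "\<exists>C U. closed_subgroup C \<and> Q n \<subseteq> C \<and> (\<forall>i<k. y i \<in> C) \<and> open_nbhd U \<and> C \<inter> U \<subseteq> Q n" for k
    proof (induction k)
      case 0
      then show ?case using Q[of n] open_nbhd_carrier by (intro exI[of _ "Q n"] exI[of _ "carrier G"]) auto
    next
      case (Suc k)
      then obtain C U where C: "closed_subgroup C" "Q n \<subseteq> C" "\<forall>i<k. y i \<in> C" "open_nbhd U" "C \<inter> U \<subseteq> Q n" by blast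
      have "y k [^] (p ^ n :: nat) \<in> Q n" using yK by (auto simp: Q_def pow_set_def)
      then have yN: "y k [^] (p ^ n :: nat) \<in> C" using C(2) by blast
      have "p ^ n > 0" using p0 by simp
      then obtain C' U' where C': "closed_subgroup C'" "C \<subseteq> C'" "y k \<in> C'" "open_nbhd U'" "C' \<inter> U' \<subseteq> C"
        using adjoin_element[OF C(1) yc _ yN] by blast
      show ?case
      proof (rule exI[of _ C'], rule exI[of _ "U \<inter> U'"], intro conjI)
        show "\<forall>i<Suc k. y i \<in> C'" using C(3) C'(2,3) by (auto simp: less_Suc_eq)
        show "open_nbhd (U \<inter> U')" by (rule open_nbhd_Int[OF C(4) C'(4)])
        show "C' \<inter> (U \<inter> U') \<subseteq> Q n" using C(5) C'(5) by blast
      qed (use C C' in auto)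
    qed
    then obtain C U where C: "closed_subgroup C" "Q n \<subseteq> C" "\<forall>i<n. y i \<in> C" "open_nbhd U" "C \<inter> U \<subseteq> Q n" by blast
    have "y i \<in> C" for i
    proof (cases "i < n")
      case False
      then have "y i \<in> Q n" using yQ[of i] Qmono[of n i] by auto
      then show ?thesis using C(2) by blast
    qed (use C(3) in blast)
    then have "M \<subseteq> C" using min[OF C(1)] by blast
    then show ?thesis using C(4,5) by blast
  qed
  then obtain U where U: "\<And>n. open_nbhd (U n)" "\<And>n. M \<inter> U n \<subseteq> Q n" by metis
  have "gdelta_one M"
    unfolding gdelta_one_def
  proof (intro exI[of _ U] conjI allI)
    show "M \<inter> (\<Inter>n. U n) \<subseteq> {\<one>}"
    proof
      fix x assume x: "x \<in> M \<inter> (\<Inter>n. U n)"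
      then have xQ: "x \<in> Q n" for n using U(2) by blast
      have "x = \<one>"
      proof (rule open_nbhd_Inter_one)
        show "x \<in> carrier G" using x M' by blast
        fix W assume "open_nbhd W"
        then show "x \<in> W" using Kp_uniform[OF p] xQ unfolding Q_def by blast
      qed
      then show "x \<in> {\<one>}" by simp
    qed
  qed (use U in blast)
  then have MS: "closed_subgroup (S \<inter> M)" by (rule closed_subgroup_gdelta_one_Int[OF M])
  define F where "F = (\<lambda>m::nat. {x \<in> M. x [^] (p ^ m :: nat) \<in> S \<inter> M})"
  have Fcl: "closedin T (F m)" for m
  proof -
    have "closedin T (M \<inter> {x \<in> carrier G. x [^] (p ^ m :: nat) \<in> S \<inter> M})"
      by (intro closedin_Int M' closedin_preimage continuous_intros_group closed_subgroupD(1)[OF MS])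
    moreover have "M \<inter> {x \<in> carrier G. x [^] (p ^ m :: nat) \<in> S \<inter> M} = F m" using M'(3) by (auto simp: F_def)
    ultimately show ?thesis by simp
  qed
  have Fsub: "x \<otimes> z \<in> F m" "inv x \<in> F m" if "x \<in> F m" "z \<in> F m" for x z m
  proof -
    have xz: "x \<in> carrier G" "z \<in> carrier G" using that M'(3) by (auto simp: F_def)
    have "(x \<otimes> z) [^] (p ^ m :: nat) = x [^] (p ^ m :: nat) \<otimes> z [^] (p ^ m :: nat)"
      using xz by (simp add: pow_mult_distrib m_comm)
    then show "x \<otimes> z \<in> F m" using that M'(5) closed_subgroupD(5)[OF MS] by (auto simp: F_def)
    have "(inv x) [^] (p ^ m :: nat) = inv (x [^] (p ^ m :: nat))" using xz by (simp add: nat_pow_inv)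
    then show "inv x \<in> F m" using that(1) M'(6) closed_subgroupD(6)[OF MS] by (auto simp: F_def)
  qed
  have MF: "M = \<Union>(range F)"
  proof -
    have "x \<in> \<Union>(range F)" if x: "x \<in> M" for x
    proof -
      have "x \<in> Kp p" "x \<in> H" using x MKH by auto
      then obtain m where "x [^] (p ^ m :: nat) \<in> S" using torsion_mod_S[OF p V0(2) Hc H(3)] by metis
      moreover have "x [^] (p ^ m :: nat) \<in> M" by (rule subgroup_pow[OF M'(2) x])
      ultimately show ?thesis using x by (auto simp: F_def)
    qed
    then show ?thesis by (auto simp: F_def)
  qed
  define Y where "Y = subtopology T M"
  have tY: "topspace Y = M" using M'(3) by (auto simp: Y_def)
  have "compact_space Y" unfolding Y_def using closedin_compactin[OF M'(1)] by (rule compact_space_subtopology)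
  moreover have "Hausdorff_space Y" unfolding Y_def by (rule Hausdorff_space_subtopology[OF Hausdorff])
  ultimately have lc: "locally_compact_space Y \<and> regular_space Y"
    using compact_imp_locally_compact_space compact_Hausdorff_imp_regular_space by blast
  have "\<exists>m. Y interior_of (F m) \<noteq> {}"
  proof (rule ccontr)
    assume "\<not> ?thesis"
    then have "Y interior_of \<Union>(range F) = {}"
      using lc Fcl by (intro Baire_category_alt) (auto simp: Y_def F_def closedin_closed_subtopology[OF M'(1)])
    then show False using MF[symmetric] tY interior_of_topspace[of Y] M'(4) by auto
  qed
  then obtain m v where v: "v \<in> Y interior_of (F m)" by blast
  then obtain W where W: "openin Y W" "v \<in> W" "W \<subseteq> F m" by (auto simp: interior_of_def)
  then obtain W' where W': "openin T W'" "W = W' \<inter> M" by (auto simp: Y_def openin_subtopology)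
  have vF: "v \<in> F m" using W by blast
  have vM: "v \<in> M" using vF by (simp add: F_def)
  have "open_nbhd {w \<in> carrier G. v \<otimes> w \<in> W'}" using open_nbhd_translate[OF W'(1)] W(2) W'(2) by blast
  then obtain N where N: "\<forall>i\<ge>N. Q i \<subseteq> {w \<in> carrier G. v \<otimes> w \<in> W'}" using Kp_uniform[OF p] unfolding Q_def by blast
  \<comment> \<open>With i at least m, a p^m-th power in \<open>S\<close> contradicts the choice of
    \<open>y i\<close>, whose p^i-th power lies outside \<open>S\<close>.\<close>
  define i where "i = max N m"
  have "y i \<in> Q i" by (rule yQ)
  moreover have "Q i \<subseteq> {w \<in> carrier G. v \<otimes> w \<in> W'}" using N unfolding i_def by simp
  ultimately have "v \<otimes> y i \<in> W'" by blast
  then have "v \<otimes> y i \<in> F m" using W(3) W'(2) M'(5)[OF vM yM] by blast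
  then have "inv v \<otimes> (v \<otimes> y i) \<in> F m" using Fsub vF by blast
  moreover have "inv v \<otimes> (v \<otimes> y i) = y i" using vM M'(3) yc by (simp add: m_assoc[symmetric] subset_iff)
  ultimately have "y i [^] (p ^ m :: nat) \<in> S" by (simp add: F_def)
  then have "(y i [^] (p ^ m :: nat)) [^] (p ^ (i - m) :: nat) \<in> S" by (rule S_pow)
  moreover have "(p ^ m :: nat) * p ^ (i - m) = p ^ i" by (simp add: power_add[symmetric] i_def)
  ultimately have "y i [^] (p ^ i :: nat) \<in> S" using yc by (simp add: nat_pow_pow)
  then show False using y(2) by blast
qed

section \<open>The quotient\<close>

text \<open>Given a continuous isomorphism onto a group \<open>H\<close>, pull the neighbourhoods of
  its identity back to \<open>S\<close> and intersect their closures in the compact group. The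
  intersection \<open>L\<close> is a closed subgroup, lies in \<open>H0\<close> by the choice of
  \<open>V\<close>, and meets \<open>S\<close> within \<open>N\<close> because the target is
  Hausdorff, so essentiality relative to \<open>N\<close> puts it into \<open>N\<close>. By
  compactness some pulled-back neighbourhood fits into any open set containing \<open>L\<close>,
  which gives openness.\<close>

lemma quotient_locally_minimal:
  assumes N: "subgroup N G" "N \<subseteq> S" "N \<subseteq> H0" and H0: "subgroup H0 G" "openin T H0"
    and ess: "\<And>L. closed_subgroup L \<Longrightarrow> L \<subseteq> H0 \<Longrightarrow> L \<inter> S \<subseteq> N \<Longrightarrow> L \<subseteq> N"
  shows "locally_minimal (G\<lparr>carrier := S\<rparr> Mod N) (quot_top (G\<lparr>carrier := S\<rparr>) (subtopology T S) N)"
proof -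
  define GS where "GS = G\<lparr>carrier := S\<rparr>"
  define TS where "TS = subtopology T S"
  define TQ where "TQ = quot_top GS TS N"
  have GS: "carrier GS = S" "\<And>x y. x \<otimes>\<^bsub>GS\<^esub> y = x \<otimes> y" "\<one>\<^bsub>GS\<^esub> = \<one>" by (auto simp: GS_def)
  interpret GS: comm_group GS
    unfolding GS_def using subgroup.subgroup_is_group[OF subgroup_S is_group] S_carrier
    by (intro group.group_comm_groupI) (auto simp: m_comm subset_iff)
  have tTS: "topspace TS = S" using S_carrier by (auto simp: TS_def)
  have NGS: "subgroup N GS" unfolding GS_def by (rule subgroup_incl[OF N(1) subgroup_S N(2)])
  interpret N: normal N GS by (rule GS.subgroup_imp_normal[OF NGS])
  define \<pi> where "\<pi> = (\<lambda>s. N #>\<^bsub>GS\<^esub> s)"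
  have rc: "rcosets\<^bsub>GS\<^esub> N = \<pi> ` S" by (auto simp: RCOSETS_def \<pi>_def GS)
  have \<pi>S: "\<pi> s \<subseteq> S" if "s \<in> S" for s using that N(2) S_mult by (auto simp: \<pi>_def r_coset_def GS)
  have self: "s \<in> \<pi> s" if "s \<in> S" for s using GS.rcos_self[of s N] NGS that by (simp add: \<pi>_def GS)
  have \<pi>eq: "\<pi> s = \<pi> t" if "t \<in> \<pi> s" "s \<in> S" for s t
    using GS.repr_independence[of t N s] that NGS by (simp add: \<pi>_def GS)
  have \<pi>m: "\<pi> (s \<otimes> t) = \<pi> s \<otimes>\<^bsub>GS Mod N\<^esub> \<pi> t" if "s \<in> S" "t \<in> S" for s t
    using N.rcos_sum[of s t] that by (simp add: \<pi>_def GS FactGroup_def)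
  have Uinter: "\<Union>(A \<inter> B) = \<Union>A \<inter> \<Union>B" if AB: "A \<subseteq> \<pi> ` S" "B \<subseteq> \<pi> ` S" for A B
  proof
    show "\<Union>A \<inter> \<Union>B \<subseteq> \<Union>(A \<inter> B)"
    proof
      fix x assume "x \<in> \<Union>A \<inter> \<Union>B"
      then obtain C D where CD: "x \<in> C" "C \<in> A" "x \<in> D" "D \<in> B" by blast
      then obtain s t where st: "s \<in> S" "C = \<pi> s" "t \<in> S" "D = \<pi> t" using AB by blast
      have "C = \<pi> x" "D = \<pi> x" using \<pi>eq st CD by blast+
      then show "x \<in> \<Union>(A \<inter> B)" using CD by blast
    qed
  qed blast
  have ist: "istopology (\<lambda>U. U \<subseteq> rcosets\<^bsub>GS\<^esub> N \<and> openin TS (\<Union>U))"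
    unfolding istopology_def
  proof (intro conjI allI impI)
    fix A B assume "A \<subseteq> rcosets\<^bsub>GS\<^esub> N \<and> openin TS (\<Union>A)" "B \<subseteq> rcosets\<^bsub>GS\<^esub> N \<and> openin TS (\<Union>B)"
    then show "A \<inter> B \<subseteq> rcosets\<^bsub>GS\<^esub> N" "openin TS (\<Union>(A \<inter> B))" using Uinter[of A B] by (auto simp: rc)
  next
    fix \<K> assume K: "\<forall>A\<in>\<K>. A \<subseteq> rcosets\<^bsub>GS\<^esub> N \<and> openin TS (\<Union>A)"
    then show "\<Union>\<K> \<subseteq> rcosets\<^bsub>GS\<^esub> N" by blast
    have "\<Union>(\<Union>\<K>) = \<Union>(Union ` \<K>)" by blast
    then show "openin TS (\<Union>(\<Union>\<K>))" using K by (metis (no_types, lifting) imageE openin_Union)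
  qed
  have oTQ: "openin TQ U \<longleftrightarrow> U \<subseteq> \<pi> ` S \<and> openin TS (\<Union>U)" for U
    unfolding TQ_def quot_top_def topology_inverse'[OF ist] by (simp add: rc)
  have US: "\<Union>(\<pi> ` S) = S" using self \<pi>S by blast
  have tTQ: "topspace TQ = \<pi> ` S"
  proof -
    have "openin TQ (\<pi> ` S)" unfolding oTQ US using openin_topspace[of TS] tTS by simp
    then show ?thesis using openin_subset[of TQ "\<pi> ` S"] openin_topspace[of TQ] oTQ by blast
  qed
  have oTS: "openin TS A \<longleftrightarrow> (\<exists>B. openin T B \<and> A = B \<inter> S)" for A by (simp add: TS_def openin_subtopology)
  \<comment> \<open>The witness for local minimality. Its preimage in \<open>S\<close> is
    \<open>H0 \<inter> S\<close>, whose closure stays in the clopen group \<open>H0\<close>.\<close>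
  define V where "V = {C \<in> \<pi> ` S. C \<subseteq> H0}"
  have \<pi>H0: "\<pi> s \<subseteq> H0" if "s \<in> H0" for s
    using that N(3) subgroup.m_closed[OF H0(1)] by (auto simp: \<pi>_def r_coset_def GS)
  have UV: "\<Union>V = H0 \<inter> S"
  proof
    show "\<Union>V \<subseteq> H0 \<inter> S" using \<pi>S by (auto simp: V_def)
    show "H0 \<inter> S \<subseteq> \<Union>V" using \<pi>H0 self by (auto simp: V_def)
  qed
  have "openin TQ V" unfolding oTQ UV using H0(2) by (auto simp: V_def oTS)
  moreover have oneV: "\<one>\<^bsub>GS Mod N\<^esub> \<in> V"
  proof -
    have "\<pi> \<one> = N" using GS.coset_join2[of \<one> N] NGS S_one subgroup.one_closed[OF N(1)] by (simp add: \<pi>_def GS)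
    then have "N \<in> \<pi> ` S" using S_one by blast
    then show ?thesis using N(3) by (simp add: V_def FactGroup_def)
  qed
  ultimately have nV: "nbhd TQ \<one>\<^bsub>GS Mod N\<^esub> V" unfolding nbhd_def using tTQ by (auto simp: V_def)
  have "open_map TQ TH f"
    if H: "topgroup H TH" "Hausdorff_space TH" and f: "f \<in> iso (GS Mod N) H" and cf: "continuous_map TQ TH f"
      and nf: "nbhd TH \<one>\<^bsub>H\<^esub> (f ` V)" for H :: "'a set monoid" and TH f
  proof -
    interpret H: group H using H(1) by (simp add: topgroup_def)
    have tH: "topspace TH = carrier H" using H(1) by (simp add: topgroup_def)
    have cM: "carrier (GS Mod N) = \<pi> ` S" by (simp add: FactGroup_def rc)
    have fm: "f (\<pi> s \<otimes>\<^bsub>GS Mod N\<^esub> \<pi> t) = f (\<pi> s) \<otimes>\<^bsub>H\<^esub> f (\<pi> t)" if "s \<in> S" "t \<in> S" for s t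
      using f that by (auto simp: iso_def hom_def cM)
    have finj: "inj_on f (\<pi> ` S)" and fsurj: "f ` \<pi> ` S = carrier H"
      using f by (auto simp: iso_def bij_betw_def cM)
    define g where "g = (\<lambda>s. f (\<pi> s))"
    have gm: "g (s \<otimes> t) = g s \<otimes>\<^bsub>H\<^esub> g t" if "s \<in> S" "t \<in> S" for s t
      using \<pi>m[OF that] fm[OF that] by (simp add: g_def)
    have gc: "g s \<in> carrier H" if "s \<in> S" for s using that fsurj by (auto simp: g_def)
    have g1: "g \<one> = \<one>\<^bsub>H\<^esub>" using gm[OF S_one S_one] gc[OF S_one] H.l_cancel_one' by (metis one_closed r_one)
    have gi: "g (inv s) = inv\<^bsub>H\<^esub> g s" if s: "s \<in> S" for s
    proof -
      have "g (inv s) \<otimes>\<^bsub>H\<^esub> g s = \<one>\<^bsub>H\<^esub>" using gm[OF S_inv[OF s] s] g1 s S_carrier by (simp add: subset_iff)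
      then show ?thesis using gc s S_inv H.inv_equality by metis
    qed
    have gker: "s \<in> N" if s: "s \<in> S" "g s = \<one>\<^bsub>H\<^esub>" for s
    proof -
      have "\<pi> s = \<pi> \<one>" using finj s g1 S_one unfolding g_def inj_on_def by (metis imageI)
      then have "s \<in> \<pi> \<one>" using self[OF s(1)] by simp
      then show ?thesis using N(2) S_carrier by (auto simp: \<pi>_def r_coset_def GS)
    qed
    define A where "A = (\<lambda>U. {s \<in> S. g s \<in> U})"
    have oA: "openin TS (A U)" if U: "openin TH U" for U
    proof -
      have "openin TQ {C \<in> \<pi> ` S. f C \<in> U}" using openin_continuous_map_preimage[OF cf U] tTQ by simp
      then have "openin TS (\<Union>{C \<in> \<pi> ` S. f C \<in> U})" by (simp add: oTQ)
      moreover have "\<Union>{C \<in> \<pi> ` S. f C \<in> U} = A U"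
      proof
        show "\<Union>{C \<in> \<pi> ` S. f C \<in> U} \<subseteq> A U"
        proof
          fix x assume "x \<in> \<Union>{C \<in> \<pi> ` S. f C \<in> U}"
          then obtain s where s: "s \<in> S" "x \<in> \<pi> s" "f (\<pi> s) \<in> U" by blast
          then show "x \<in> A U" using \<pi>eq[OF s(2,1)] \<pi>S[OF s(1)] by (auto simp: A_def g_def)
        qed
        show "A U \<subseteq> \<Union>{C \<in> \<pi> ` S. f C \<in> U}" using self by (auto simp: A_def g_def)
      qed
      ultimately show ?thesis by simp
    qed
    define nH where "nH = (\<lambda>U. openin TH U \<and> \<one>\<^bsub>H\<^esub> \<in> U)"
    have A1: "\<one> \<in> A U" if "nH U" for U using that g1 S_one by (simp add: A_def nH_def)
    have AS: "A U \<subseteq> S" for U by (auto simp: A_def)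
    define L where "L = (\<Inter>U\<in>Collect nH. T closure_of (A U))"
    have nHtop: "nH (carrier H)" using openin_topspace[of TH] tH by (simp add: nH_def)
    have clc: "T closure_of (A U) \<subseteq> carrier G" for U using closure_of_subset_topspace[of T "A U"] by simp
    have Acl: "A U \<subseteq> T closure_of (A U)" for U using AS S_carrier by (intro closure_of_subset) auto
    have Lc: "L \<subseteq> carrier G" using nHtop clc unfolding L_def by blast
    have clm: "x \<otimes> y \<in> T closure_of C" if B: "B \<subseteq> carrier G" "\<And>a b. a \<in> B \<Longrightarrow> b \<in> B \<Longrightarrow> a \<otimes> b \<in> C" "C \<subseteq> carrier G"
      and xy: "x \<in> T closure_of B" "y \<in> T closure_of B" for x y B C
    proof -
      have CT: "C \<subseteq> T closure_of C" using B(3) by (simp add: closure_of_subset)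
      have yc: "y \<in> carrier G" using xy closure_of_subset_topspace[of T B] by auto
      have im: "h ` (T closure_of B) \<subseteq> T closure_of C"
        if "continuous_map T T h" "h ` B \<subseteq> T closure_of C" for h
        by (meson that closedin_closure_of closure_of_minimal continuous_map_image_closure_subset order_trans)
      have 1: "a \<otimes> y \<in> T closure_of C" if a: "a \<in> B" for a
      proof -
        have "(\<lambda>b. a \<otimes> b) ` (T closure_of B) \<subseteq> T closure_of C"
          by (rule im) (use a B CT in \<open>auto intro!: continuous_intros_group\<close>)
        then show ?thesis using xy(2) by blast
      qed
      have "(\<lambda>a. a \<otimes> y) ` (T closure_of B) \<subseteq> T closure_of C"
        by (rule im) (use yc 1 in \<open>auto intro!: continuous_intros_group\<close>)
      then show ?thesis using xy(1) by blast
    qed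
    have L: "closed_subgroup L"
    proof -
      have "closedin T L" unfolding L_def using nHtop by (intro closedin_INT) auto
      moreover have "subgroup L G"
      proof (rule subgroupI'[OF Lc])
        show "\<one> \<in> L" using A1 Acl by (auto simp: L_def)
        show "x \<otimes> y \<in> L" if xy: "x \<in> L" "y \<in> L" for x y
          unfolding L_def
        proof (rule INT_I)
          fix U assume "U \<in> Collect nH"
          then have U: "openin TH U" "\<one>\<^bsub>H\<^esub> \<in> U" by (auto simp: nH_def)
          have "continuous_map (prod_topology TH TH) TH (\<lambda>(x, y). x \<otimes>\<^bsub>H\<^esub> y)"
            using H(1) by (simp add: topgroup_def)
          then have o: "openin (prod_topology TH TH) {z \<in> topspace (prod_topology TH TH). (\<lambda>(x, y). x \<otimes>\<^bsub>H\<^esub> y) z \<in> U}"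
            using U(1) openin_continuous_map_preimage by blast
          have 1: "(\<one>\<^bsub>H\<^esub>, \<one>\<^bsub>H\<^esub>) \<in> {z \<in> topspace (prod_topology TH TH). (\<lambda>(x, y). x \<otimes>\<^bsub>H\<^esub> y) z \<in> U}"
            using U(2) by (simp add: tH)
          obtain B C where BC: "openin TH B" "openin TH C" "\<one>\<^bsub>H\<^esub> \<in> B" "\<one>\<^bsub>H\<^esub> \<in> C"
            "B \<times> C \<subseteq> {z \<in> topspace (prod_topology TH TH). (\<lambda>(x, y). x \<otimes>\<^bsub>H\<^esub> y) z \<in> U}"
            using o[unfolded openin_prod_topology_alt, rule_format, OF 1] by (elim exE conjE)
          have nBC: "nH (B \<inter> C)" using BC by (auto simp: nH_def)
          show "x \<otimes> y \<in> T closure_of (A U)"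
          proof (rule clm)
            show "a \<otimes> b \<in> A U" if "a \<in> A (B \<inter> C)" "b \<in> A (B \<inter> C)" for a b
              using that BC(5) gm S_mult by (auto simp: A_def)
            show "x \<in> T closure_of (A (B \<inter> C))" "y \<in> T closure_of (A (B \<inter> C))" using xy nBC by (auto simp: L_def)
          qed (use AS S_carrier in auto)
        qed
        show "inv x \<in> L" if x: "x \<in> L" for x
          unfolding L_def
        proof (rule INT_I)
          fix U assume "U \<in> Collect nH"
          then have U: "openin TH U" "\<one>\<^bsub>H\<^esub> \<in> U" by (auto simp: nH_def)
          have ci: "continuous_map TH TH (\<lambda>x. inv\<^bsub>H\<^esub> x)" using H(1) by (simp add: topgroup_def)
          define B where "B = {h \<in> carrier H. inv\<^bsub>H\<^esub> h \<in> U}"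
          have "nH B" unfolding nH_def B_def using openin_continuous_map_preimage[OF ci U(1)] U(2) tH by simp
          then have xB: "x \<in> T closure_of (A B)" using x by (auto simp: L_def)
          have "(\<lambda>x. inv x) ` A B \<subseteq> A U" using gi S_inv by (auto simp: A_def B_def)
          then have "(\<lambda>x. inv x) ` A B \<subseteq> T closure_of (A U)" using Acl by blast
          moreover have "continuous_map T T (\<lambda>x. inv x)" by (intro continuous_intros_group)
          ultimately have "(\<lambda>x. inv x) ` (T closure_of (A B)) \<subseteq> T closure_of (A U)"
            by (meson closedin_closure_of closure_of_minimal continuous_map_image_closure_subset order_trans)
          then show "inv x \<in> T closure_of (A U)" using xB by blast
        qed
      qed
      ultimately show ?thesis by (simp add: closed_subgroup_def)
    qed
    have "L \<subseteq> H0"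
    proof -
      obtain U where U: "openin TH U" "\<one>\<^bsub>H\<^esub> \<in> U" "U \<subseteq> f ` V" using nf unfolding nbhd_def by blast
      have "A U \<subseteq> H0"
      proof
        fix s assume "s \<in> A U"
        then have s: "s \<in> S" "f (\<pi> s) \<in> f ` V" using U(3) by (auto simp: A_def g_def)
        then have "\<pi> s \<in> V" using finj unfolding inj_on_def V_def by blast
        then show "s \<in> H0" using self[OF s(1)] by (auto simp: V_def)
      qed
      then have "T closure_of (A U) \<subseteq> H0" using closedin_open_subgroup[OF H0] by (rule closure_of_minimal)
      moreover have "L \<subseteq> T closure_of (A U)" using U by (auto simp: L_def nH_def)
      ultimately show ?thesis by blast
    qed
    moreover have "L \<inter> S \<subseteq> N"
    proof
      fix x assume x: "x \<in> L \<inter> S"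
      show "x \<in> N"
      proof (rule ccontr)
        assume "x \<notin> N"
        then have "g x \<noteq> \<one>\<^bsub>H\<^esub>" using gker x by blast
        then obtain U W where UW: "openin TH U" "openin TH W" "\<one>\<^bsub>H\<^esub> \<in> U" "g x \<in> W" "disjnt U W"
          using H(2) gc x unfolding Hausdorff_space_def tH by (metis H.one_closed IntD2)
        obtain Z where Z: "openin T Z" "A W = Z \<inter> S" using oA[OF UW(2)] oTS by blast
        have "x \<in> Z" using Z(2) x UW(4) by (auto simp: A_def)
        moreover have "x \<in> T closure_of (A U)" using x UW by (auto simp: L_def nH_def)
        ultimately obtain z where z: "z \<in> A U" "z \<in> Z" using Z(1) unfolding in_closure_of by blast
        then have "z \<in> A W" using Z(2) AS by blast
        then show False using z(1) UW(5) by (auto simp: A_def disjnt_def)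
      qed
    qed
    ultimately have LN: "L \<subseteq> N" using ess[OF L] by blast
    show ?thesis
      unfolding open_map_def
    proof (intro allI impI)
      fix Q assume Q: "openin TQ Q"
      then have Q': "Q \<subseteq> \<pi> ` S" "openin TS (\<Union>Q)" by (auto simp: oTQ)
      obtain Z where Z: "openin T Z" "\<Union>Q = Z \<inter> S" using Q'(2) oTS by blast
      show "openin TH (f ` Q)"
      proof (subst openin_subopen, intro ballI)
        fix h assume "h \<in> f ` Q"
        then obtain s where s: "s \<in> S" "\<pi> s \<in> Q" "h = g s" using Q'(1) by (auto simp: g_def)
        have sc: "s \<in> carrier G" using s(1) S_carrier by blast
        define Z' where "Z' = {x \<in> carrier G. s \<otimes> x \<in> Z}"
        have Z'o: "openin T Z'" unfolding Z'_def using sc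
          by (intro openin_preimage Z(1) continuous_intros_group continuous_map_const_group) auto
        \<comment> \<open>\<open>Z'\<close> contains all of \<open>N\<close>, because
          \<open>Q\<close> contains the whole coset of \<open>s\<close>.\<close>
        have LZ: "L \<subseteq> Z'"
        proof
          fix n assume n: "n \<in> L"
          then have nN: "n \<in> N" "n \<in> carrier G" using LN Lc by auto
          then have "n \<otimes> s \<in> \<pi> s" by (auto simp: \<pi>_def r_coset_def GS)
          then have "n \<otimes> s \<in> Z" using s(2) Z(2) by blast
          then show "n \<in> Z'" using nN sc m_comm by (simp add: Z'_def)
        qed
        have "\<exists>U. nH U \<and> T closure_of (A U) \<subseteq> Z'"
        proof (rule ccontr)
          assume neg: "\<not> ?thesis"
          have "\<Inter>((\<lambda>U. T closure_of (A U) - Z') ` Collect nH) \<noteq> {}"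
          proof (rule chain_fip)
            fix C assume "C \<in> (\<lambda>U. T closure_of (A U) - Z') ` Collect nH"
            then obtain U where "nH U" "C = T closure_of (A U) - Z'" by blast
            then show "closedin T C \<and> C \<noteq> {}" using neg Z'o by (auto intro: closedin_diff)
          next
            show "(\<lambda>U. T closure_of (A U) - Z') ` Collect nH \<noteq> {}" using nHtop by blast
          next
            fix C D assume "C \<in> (\<lambda>U. T closure_of (A U) - Z') ` Collect nH" "D \<in> (\<lambda>U. T closure_of (A U) - Z') ` Collect nH"
            then obtain U W where UW: "nH U" "C = T closure_of (A U) - Z'" "nH W" "D = T closure_of (A W) - Z'" by blast
            have "nH (U \<inter> W)" using UW by (auto simp: nH_def)
            moreover have "T closure_of (A (U \<inter> W)) \<subseteq> T closure_of (A U)" "T closure_of (A (U \<inter> W)) \<subseteq> T closure_of (A W)"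
              by (intro closure_of_mono; auto simp: A_def)+
            ultimately show "\<exists>E\<in>(\<lambda>U. T closure_of (A U) - Z') ` Collect nH. E \<subseteq> C \<inter> D"
              unfolding UW by (intro bexI[OF _ imageI[of "U \<inter> W"]]) auto
          qed
          then obtain x where x: "\<And>U. nH U \<Longrightarrow> x \<in> T closure_of (A U) - Z'" by blast
          then have "x \<in> L" by (auto simp: L_def)
          moreover have "x \<notin> Z'" using x[OF nHtop] by blast
          ultimately show False using LZ by blast
        qed
        then obtain U where U: "nH U" "T closure_of (A U) \<subseteq> Z'" by blast
        have hc: "h \<in> carrier H" using s gc by blast
        have ct: "continuous_map TH TH (\<lambda>k. inv\<^bsub>H\<^esub> h \<otimes>\<^bsub>H\<^esub> k)"
        proof -
          have "continuous_map TH (prod_topology TH TH) (\<lambda>k. (inv\<^bsub>H\<^esub> h, k))"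
            using hc tH by (intro continuous_map_pairedI) (auto simp: continuous_map_id[unfolded id_def])
          moreover have "continuous_map (prod_topology TH TH) TH (\<lambda>(x, y). x \<otimes>\<^bsub>H\<^esub> y)"
            using H(1) by (simp add: topgroup_def)
          ultimately have "continuous_map TH TH ((\<lambda>(x, y). x \<otimes>\<^bsub>H\<^esub> y) \<circ> (\<lambda>k. (inv\<^bsub>H\<^esub> h, k)))"
            by (rule continuous_map_compose)
          then show ?thesis by (simp add: o_def)
        qed
        define E where "E = {k \<in> topspace TH. inv\<^bsub>H\<^esub> h \<otimes>\<^bsub>H\<^esub> k \<in> U}"
        have "openin TH E" unfolding E_def by (rule openin_continuous_map_preimage[OF ct]) (use U(1) in \<open>simp add: nH_def\<close>)
        moreover have "h \<in> E" using hc U(1) tH by (simp add: E_def nH_def)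
        moreover have "E \<subseteq> f ` Q"
        proof
          fix k assume k: "k \<in> E"
          then have "k \<in> f ` \<pi> ` S" using fsurj tH by (simp add: E_def)
          then obtain t where t: "t \<in> S" "k = g t" by (auto simp: g_def)
          have tc: "t \<in> carrier G" using t S_carrier by blast
          have "g (inv s \<otimes> t) \<in> U" using k t gm[OF S_inv[OF s(1)] t(1)] gi[OF s(1)] s(3) by (simp add: E_def)
          then have "inv s \<otimes> t \<in> A U" using S_mult[OF S_inv[OF s(1)] t(1)] by (simp add: A_def)
          then have "inv s \<otimes> t \<in> Z'" using Acl U(2) by blast
          then have "t \<in> Z" using sc tc by (simp add: Z'_def m_assoc[symmetric])
          then have "t \<in> \<Union>Q" using t(1) Z(2) by blast
          then obtain C where C: "C \<in> Q" "t \<in> C" by blast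
          then obtain u where "u \<in> S" "C = \<pi> u" using Q'(1) by blast
          then have "\<pi> t = C" using \<pi>eq C(2) by blast
          then show "k \<in> f ` Q" using C(1) t(2) by (auto simp: g_def)
        qed
        ultimately show "\<exists>R. openin TH R \<and> h \<in> R \<and> R \<subseteq> f ` Q" by blast
      qed
    qed
  qed
  then show ?thesis unfolding locally_minimal_def GS_def[symmetric] TS_def[symmetric] TQ_def[symmetric]
    using nV by blast
qed

text \<open>The exponent from \<open>bounded_mod_S\<close> is enlarged until the powers also lie in
  an open subgroup where essentiality holds; the argument for the quotient needs both
  inclusions.\<close>

lemma exponents_exist:
  obtains H0 and k :: "nat \<Rightarrow> nat" where "subgroup H0 G" "openin T H0"
    "\<And>L. closed_subgroup L \<Longrightarrow> L \<subseteq> H0 \<Longrightarrow> L \<inter> S \<subseteq> {\<one>} \<Longrightarrow> L = {\<one>}"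
    "\<And>p. Factorial_Ring.prime p \<Longrightarrow> pow_set G (p ^ k p) (Kp p) \<subseteq> S \<inter> H0"
proof -
  obtain V0 where V0: "open_nbhd V0" "\<And>L. closed_subgroup L \<Longrightarrow> L \<subseteq> V0 \<Longrightarrow> L \<inter> S \<subseteq> {\<one>} \<Longrightarrow> L = {\<one>}"
    using locally_essential by blast
  obtain H where H: "subgroup H G" "openin T H" "H \<subseteq> V0" using open_subgroup_base[OF V0(1)] by blast
  have "\<exists>k. pow_set G (p ^ k) (Kp p) \<subseteq> S \<inter> H" if p: "Factorial_Ring.prime p" for p
  proof -
    obtain k1 where k1: "pow_set G (p ^ k1) (Kp p) \<subseteq> S" using bounded_mod_S[OF p V0] by blast
    obtain v where v: "\<forall>j\<ge>v. pow_set G (p ^ j) (Kp p) \<subseteq> H" using Kp_uniform[OF p open_subgroup_open_nbhd[OF H(1,2)]] by blast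
    have "pow_set G (p ^ max k1 v) (Kp p) \<subseteq> pow_set G (p ^ k1) (Kp p)"
      by (rule pow_set_dvd[OF closed_subgroup_Kp[OF p]]) (simp add: le_imp_power_dvd)
    then show ?thesis using k1 v by (intro exI[of _ "max k1 v"]) auto
  qed
  then obtain k where "\<And>p. Factorial_Ring.prime p \<Longrightarrow> pow_set G (p ^ k p) (Kp p) \<subseteq> S \<inter> H" by metis
  moreover have "L = {\<one>}" if "closed_subgroup L" "L \<subseteq> H" "L \<inter> S \<subseteq> {\<one>}" for L
    using V0(2)[OF that(1)] that H(3) by blast
  ultimately show ?thesis using that H(1,2) by blast
qed

text \<open>The product of the groups of p^(k p)-th powers of \<open>Kp p\<close>, realized inside
  the compact group through the coordinates \<open>pr p\<close>.\<close>

definition prod_pow :: "(nat \<Rightarrow> nat) \<Rightarrow> 'a set" where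
  "prod_pow k = {x \<in> carrier G. \<forall>p. Factorial_Ring.prime p \<longrightarrow> pr p x \<in> pow_set G (p ^ k p) (Kp p)}"

lemma subgroup_prod_pow: "subgroup (prod_pow k) G"
proof (rule subgroupI')
  have D: "subgroup (pow_set G (p ^ k p) (Kp p)) G" if "Factorial_Ring.prime p" for p
    using closed_subgroup_pow_set[OF closed_subgroup_Kp[OF that]] by (simp add: closed_subgroup_def)
  show "prod_pow k \<subseteq> carrier G" by (auto simp: prod_pow_def)
  show "\<one> \<in> prod_pow k" using subgroup.one_closed[OF D] pr_one by (simp add: prod_pow_def)
  show "x \<otimes> y \<in> prod_pow k" if "x \<in> prod_pow k" "y \<in> prod_pow k" for x y
    using that subgroup.m_closed[OF D] pr_mult by (simp add: prod_pow_def)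
  show "inv x \<in> prod_pow k" if "x \<in> prod_pow k" for x
    using that subgroup.m_inv_closed[OF D] pr_inv by (simp add: prod_pow_def)
qed

text \<open>An element y of L outside the subgroup N can be taken in a single Kp and of order p modulo N;
  subtracting a suitable power of z gives an element t of order p in G near the identity, which
  therefore lies in S.\<close>

lemma essential_mod_prod_pow:
  assumes H0: "subgroup H0 G" "openin T H0"
    and ess: "\<And>L. closed_subgroup L \<Longrightarrow> L \<subseteq> H0 \<Longrightarrow> L \<inter> S \<subseteq> {\<one>} \<Longrightarrow> L = {\<one>}"
    and k: "\<And>p. Factorial_Ring.prime p \<Longrightarrow> pow_set G (p ^ k p) (Kp p) \<subseteq> S \<inter> H0"
    and L: "closed_subgroup L" "L \<subseteq> H0" "L \<inter> S \<subseteq> prod_pow (\<lambda>p. k p + 1)"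
  shows "L \<subseteq> prod_pow (\<lambda>p. k p + 1)"
proof
  note L' = closed_subgroupD[OF L(1)]
  fix x assume x: "x \<in> L"
  have xc: "x \<in> carrier G" using x L' by blast
  have "pr p x \<in> pow_set G (p ^ (k p + 1)) (Kp p)" if p: "Factorial_Ring.prime p" for p
  proof (rule ccontr)
    define P where "P = pow_set G (p ^ (k p + 1)) (Kp p)"
    have P: "closed_subgroup P" unfolding P_def by (rule closed_subgroup_pow_set[OF closed_subgroup_Kp[OF p]])
    assume "pr p x \<notin> pow_set G (p ^ (k p + 1)) (Kp p)"
    then have nP: "pr p x \<notin> P" by (simp add: P_def)
    \<comment> \<open>\<open>L\<close> is closed, and \<open>pr p x\<close> is a limit of powers of
      \<open>x\<close>.\<close>
    have prL: "pr p x \<in> L"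
    proof (rule ccontr)
      assume "pr p x \<notin> L"
      then have "pr p x \<in> carrier G - L" using pr_spec(1)[OF p xc] by blast
      moreover have "openin T (carrier G - L)" using openin_diff[OF openin_topspace L'(1)] by simp
      ultimately have "open_nbhd {w \<in> carrier G. pr p x \<otimes> w \<in> carrier G - L}" by (intro open_nbhd_translate)
      then obtain n where n: "x [^] idem_exp p n \<otimes> inv (pr p x) \<in> {w \<in> carrier G. pr p x \<otimes> w \<in> carrier G - L}"
        using pr_lim[OF p xc] by blast
      moreover have "pr p x \<otimes> (x [^] idem_exp p n \<otimes> inv (pr p x)) = x [^] idem_exp p n"
        using pr_spec(1)[OF p xc] xc by (metis inv_closed m_assoc m_closed m_comm nat_pow_closed r_inv r_one)
      ultimately have "x [^] idem_exp p n \<notin> L" by simp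
      then show False using subgroup_pow[OF L'(2) x] by blast
    qed
    have prK: "pr p x \<in> Kp p" by (rule pr_in_Kp[OF p xc])
    \<comment> \<open>The last iterated p-th power outside \<open>P\<close> is the element
      \<open>y\<close> of order p modulo \<open>P\<close>.\<close>
    define j where "j = (LEAST j. pr p x [^] (p ^ j :: nat) \<in> P)"
    have "pr p x [^] (p ^ (k p + 1) :: nat) \<in> P" using prK by (auto simp: P_def pow_set_def)
    then have j: "pr p x [^] (p ^ j :: nat) \<in> P" unfolding j_def by (rule LeastI)
    have "j \<noteq> 0" using j nP pr_spec(1)[OF p xc] by (auto intro: ccontr)
    then have "pr p x [^] (p ^ (j - 1) :: nat) \<notin> P"
      using not_less_Least[of "j - 1" "\<lambda>j. pr p x [^] (p ^ j :: nat) \<in> P"] by (simp add: j_def[symmetric])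
    moreover define y where "y = pr p x [^] (p ^ (j - 1) :: nat)"
    ultimately have yP: "y \<notin> P" by simp
    have yL: "y \<in> L" unfolding y_def by (rule subgroup_pow[OF L'(2) prL])
    have yK: "y \<in> Kp p" unfolding y_def by (rule subgroup_pow[OF closed_subgroupD(2)[OF closed_subgroup_Kp[OF p]] prK])
    have yc: "y \<in> carrier G" by (rule Kp_carrier[OF yK])
    have "p ^ j = p ^ (j - 1) * p" using \<open>j \<noteq> 0\<close> by (metis power_minus_mult neq0_conv)
    then have "y [^] p = pr p x [^] (p ^ j :: nat)" using pr_spec(1)[OF p xc] by (simp add: y_def nat_pow_pow)
    then have "y [^] p \<in> P" using j by simp
    then obtain z where z: "z \<in> Kp p" "y [^] p = z [^] (p ^ (k p + 1))" by (auto simp: P_def pow_set_def)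
    have zc: "z \<in> carrier G" by (rule Kp_carrier[OF z(1)])
    \<comment> \<open>The exponent \<open>k p + 1\<close> pays off here: its extra factor p leaves a
      p-th root \<open>u\<close> of \<open>y [^] p\<close> that lies in both \<open>S\<close> and
      \<open>H0\<close>, so that \<open>y\<close> and \<open>u\<close> differ by an element with
      trivial p-th power.\<close>
    define u where "u = z [^] (p ^ k p)"
    have uSH: "u \<in> S" "u \<in> H0" using k[OF p] z(1) by (auto simp: u_def pow_set_def)
    have uc: "u \<in> carrier G" using uSH S_carrier by blast
    have "u [^] p = y [^] p" using z(2) zc by (simp add: u_def nat_pow_pow mult.commute)
    define t where "t = y \<otimes> inv u"
    have tc: "t \<in> carrier G" using yc uc by (simp add: t_def)
    have "t [^] p = y [^] p \<otimes> inv (u [^] p)"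
      using yc uc by (simp add: t_def pow_mult_distrib m_comm nat_pow_inv)
    then have tp: "t [^] p = \<one>" using \<open>u [^] p = y [^] p\<close> yc by simp
    have tH: "t \<in> H0" using yL L(2) uSH subgroup.m_closed[OF H0(1)] subgroup.m_inv_closed[OF H0(1)] by (auto simp: t_def)
    \<comment> \<open>Otherwise the group generated by \<open>t\<close>, of prime order p, would lie
      in \<open>H0\<close> and meet \<open>S\<close> trivially, against essentiality.\<close>
    have tS: "t \<in> S"
    proof (rule ccontr)
      assume tnS: "t \<notin> S"
      have p0: "p > 0" using p by (simp add: prime_gt_0_nat)
      define R where "R = range (\<lambda>i::int. t [^] i)"
      have R: "subgroup R G" unfolding R_def by (rule subgroup_of_powers[OF tc])
      have Rrep: "\<exists>r<p. w = t [^] r" if w: "w \<in> R" for w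
      proof -
        obtain i :: int where i: "w = t [^] i" using w by (auto simp: R_def)
        define r where "r = nat (i mod int p)"
        have r: "r < p" "int r = i mod int p" unfolding r_def using p0 by (auto simp: nat_less_iff)
        have "w = t [^] (int r + int p * (i div int p))" unfolding i r(2) by simp
        also have "\<dots> = t [^] r \<otimes> (t [^] p) [^] (i div int p)"
          using tc by (simp add: int_pow_mult int_pow_int int_pow_pow[symmetric])
        finally show ?thesis using r(1) tc tp by auto
      qed
      then have "R \<subseteq> (\<lambda>r. t [^] r) ` {..<p}" by auto
      then have "finite R" using finite_surj by blast
      then have "closedin T R" using subgroup.subset[OF R] by (intro closedin_Hausdorff_finite Hausdorff) auto
      then have "closed_subgroup R" using R by (simp add: closed_subgroup_def)
      moreover have "R \<subseteq> H0" using subgroup_int_pow_closed[OF H0(1) tH] by (auto simp: R_def)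
      moreover have "R \<inter> S \<subseteq> {\<one>}"
      proof
        fix w assume w: "w \<in> R \<inter> S"
        then obtain r where r: "r < p" "w = t [^] r" using Rrep by blast
        show "w \<in> {\<one>}"
        proof (cases "r = 0")
          case False
          then have "\<not> p dvd r" using r(1) by (auto dest: dvd_imp_le)
          then have "coprime r p" using p by (simp add: prime_imp_coprime coprime_commute)
          then obtain q where q: "[r * q = 1] (mod p)" using cong_solve_coprime_nat[of r p] by auto
          have "r * q \<noteq> 0"
          proof
            assume "r * q = 0"
            then have "[0 = 1] (mod p)" using q by metis
            then have "p dvd 1" by (metis cong_dvd_iff dvd_0_right)
            then show False using p by (metis not_prime_unit)
          qed
          then have "p dvd r * q - 1" using q by (simp add: cong_altdef_nat)
          then obtain l where "r * q - 1 = p * l" by blast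
          then have "r * q = Suc (p * l)" using \<open>r * q \<noteq> 0\<close> by linarith
          then have "w [^] q = (t [^] p) [^] l \<otimes> t" using r(2) tc by (simp add: nat_pow_pow)
          then have "w [^] q = t" using tp tc by simp
          moreover have "w [^] q \<in> S" using S_pow w by blast
          ultimately show ?thesis using tnS by simp
        qed (use r in simp)
      qed
      ultimately have "R = {\<one>}" by (rule ess)
      moreover have "t \<in> R" unfolding R_def using int_pow_1[OF tc] by (metis rangeI)
      ultimately show False using tnS S_one by simp
    qed
    have "y = t \<otimes> u" using yc uc by (simp add: t_def m_assoc)
    then have "y \<in> S" using S_mult[OF tS uSH(1)] by simp
    then have "pr p y \<in> P" using L(3) yL p by (auto simp: prod_pow_def P_def)
    then show False using Kp_pr[OF p yK] yP by simp
  qed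
  then show "x \<in> prod_pow (\<lambda>p. k p + 1)" using xc by (simp add: prod_pow_def)
qed

lemma compact_tot_disconnected: "tot_disconnected G T"
proof -
  have "x = \<one>" if "quasi_component_of T \<one> x" for x
  proof (rule open_nbhd_Inter_one)
    show "x \<in> carrier G" using that by (auto simp: quasi_component_of_def)
    fix U assume "open_nbhd U"
    then obtain H where H: "subgroup H G" "openin T H" "H \<subseteq> U" using open_subgroup_base by blast
    have "\<one> \<in> H \<longleftrightarrow> x \<in> H" using that H closedin_open_subgroup[OF H(1,2)] unfolding quasi_component_of_def by blast
    then show "x \<in> U" using H(3) subgroup.one_closed[OF H(1)] by blast
  qed
  then show ?thesis unfolding tot_disconnected_def by auto
qed

end

theorem theorem4p7:
  fixes K :: "'a monoid" and TK :: "'a topology" and S :: "'a set"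
  assumes K_abelian: "comm_group K"
    and K_topgroup: "topgroup K TK"
    and K_Hausdorff: "Hausdorff_space TK"
    and K_compact: "compact_space TK"
    and G_subgroup: "subgroup S K"
    and G_dense: "TK closure_of S = carrier K"
    and G_seq_complete: "seq_complete (K\<lparr>carrier := S\<rparr>) (subtopology TK S)"
    and G_loc_min: "locally_minimal (K\<lparr>carrier := S\<rparr>) (subtopology TK S)"
    and G_tot_disc: "tot_disconnected (K\<lparr>carrier := S\<rparr>) (subtopology TK S)"
  shows
   "let G = K\<lparr>carrier := S\<rparr>; TG = subtopology TK S; P = primes_set in
    tot_disconnected K TK \<and>
    (\<exists>\<Phi>. \<Phi> \<in> iso K (product_group P (\<lambda>p. K\<lparr>carrier := td K TK p\<rparr>)) \<and>
         homeomorphic_map TK (product_topology (\<lambda>p. subtopology TK (td K TK p)) P) \<Phi> \<and>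
         (\<forall>p\<in>P. \<forall>x\<in>td K TK p. \<Phi> x = (\<lambda>q\<in>P. if q = p then x else \<one>\<^bsub>K\<^esub>)) \<and>
         S = {x \<in> carrier K. \<forall>p\<in>P. \<Phi> x p \<in> td G TG p} \<and>
         (\<exists>k :: nat \<Rightarrow> nat.
            let N = {x \<in> carrier K. \<forall>p\<in>P. \<Phi> x p \<in> pow_set K (p ^ k p) (td K TK p)};
                Nstar = {x \<in> carrier K. \<forall>p\<in>P. \<Phi> x p \<in> pow_set K (p ^ (k p + 1)) (td K TK p)}
            in N \<subseteq> S \<and> locally_minimal (G Mod Nstar) (quot_top G TG Nstar)))"
proof -
  interpret locally_minimal_dense_subgroup K TK S
    by (intro locally_minimal_dense_subgroup.intro compact_abelian_group.intro compact_abelian_group_axioms.intro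
      locally_minimal_dense_subgroup_axioms.intro assms)
  define P where "P = primes_set"
  define G where "G = K\<lparr>carrier := S\<rparr>"
  define TG where "TG = subtopology TK S"
  have prime: "Factorial_Ring.prime p" if "p \<in> P" for p using that by (simp add: P_def primes_set_def)
  have Pp: "p \<in> P \<longleftrightarrow> Factorial_Ring.prime p" for p by (simp add: P_def primes_set_def)
  have tdK: "td K TK p = Kp p" if "p \<in> P" for p by (rule td_carrier[OF prime[OF that]])
  have tdG: "td G TG p = S \<inter> Kp p" if "p \<in> P" for p
    unfolding G_def TG_def td_eq_tdp[OF G_subgroup prime[OF that]] using S_carrier by (auto simp: tdp_def)
  define \<Phi> where "\<Phi> = (\<lambda>x. \<lambda>p\<in>P. pr p x)"
  have \<Phi>: "\<Phi> x p = pr p x" if "p \<in> P" for x p using that by (simp add: \<Phi>_def)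
  have PiE: "PiE P (\<lambda>p. td K TK p) = PiE P Kp" by (intro PiE_cong tdK)
  have \<Phi>in: "\<Phi> x \<in> PiE P Kp" if "x \<in> carrier K" for x
    using pr_in_Kp[OF prime that] by (auto simp: \<Phi>_def)
  have inj: "inj_on \<Phi> (carrier K)"
  proof (rule inj_onI)
    fix x y assume xy: "x \<in> carrier K" "y \<in> carrier K" "\<Phi> x = \<Phi> y"
    have "x \<otimes>\<^bsub>K\<^esub> inv\<^bsub>K\<^esub> y = \<one>\<^bsub>K\<^esub>"
    proof (rule pr_injective)
      fix p :: nat assume p: "Factorial_Ring.prime p"
      then have "pr p x = pr p y" using \<Phi>[of p x] \<Phi>[of p y] xy(3) by (simp add: Pp)
      then show "pr p (x \<otimes>\<^bsub>K\<^esub> inv\<^bsub>K\<^esub> y) = \<one>\<^bsub>K\<^esub>" using pr_mult[OF p] pr_inv[OF p] pr_spec(1)[OF p] xy by simp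
    qed (use xy in simp)
    then show "x = y" using xy by (metis inv_closed inv_equality inv_inv)
  qed
  have surj: "\<Phi> ` carrier K = PiE P Kp"
  proof
    show "PiE P Kp \<subseteq> \<Phi> ` carrier K"
    proof
      fix y assume y: "y \<in> PiE P Kp"
      then have "\<And>q. Factorial_Ring.prime q \<Longrightarrow> y q \<in> Kp q" by (auto simp: Pp[symmetric])
      then obtain x where x: "x \<in> carrier K" "\<And>q. Factorial_Ring.prime q \<Longrightarrow> pr q x = y q" using pr_surjective by blast
      have "y = \<Phi> x" by (rule PiE_ext[OF y \<Phi>in[OF x(1)]]) (simp add: \<Phi> x(2) prime)
      then show "y \<in> \<Phi> ` carrier K" using x(1) by blast
    qed
  qed (use \<Phi>in in blast)
  have iso: "\<Phi> \<in> iso K (product_group P (\<lambda>p. K\<lparr>carrier := td K TK p\<rparr>))"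
    unfolding iso_def hom_def bij_betw_def
    using inj surj PiE by (auto simp: \<Phi>_def pr_mult prime intro!: restrict_ext)
  have homeo: "homeomorphic_map TK (product_topology (\<lambda>p. subtopology TK (td K TK p)) P) \<Phi>"
  proof (rule continuous_imp_homeomorphic_map)
    have tp: "topspace (product_topology (\<lambda>p. subtopology TK (td K TK p)) P) = PiE P Kp"
    proof -
      have "topspace (subtopology TK (td K TK p)) = Kp p" if "p \<in> P" for p
        using tdK[OF that] Kp_carrier by auto
      then show ?thesis by (simp add: topspace_product_topology cong: PiE_cong)
    qed
    show "continuous_map TK (product_topology (\<lambda>p. subtopology TK (td K TK p)) P) \<Phi>"
      unfolding continuous_map_componentwise
    proof (intro conjI ballI)
      show "\<Phi> ` topspace TK \<subseteq> extensional P" by (auto simp: \<Phi>_def)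
      fix p assume p: "p \<in> P"
      show "continuous_map TK (subtopology TK (td K TK p)) (\<lambda>x. \<Phi> x p)"
        using pr_continuous[OF prime[OF p]] pr_in_Kp[OF prime[OF p]]
        by (auto simp: continuous_map_in_subtopology \<Phi>[OF p] tdK[OF p])
    qed
    show "Hausdorff_space (product_topology (\<lambda>p. subtopology TK (td K TK p)) P)"
      by (simp add: Hausdorff_space_product_topology Hausdorff_space_subtopology Hausdorff)
    show "\<Phi> ` topspace TK = topspace (product_topology (\<lambda>p. subtopology TK (td K TK p)) P)"
      using surj tp by simp
  qed (use inj compact in auto)
  have emb: "\<Phi> x = (\<lambda>q\<in>P. if q = p then x else \<one>\<^bsub>K\<^esub>)" if p: "p \<in> P" and x: "x \<in> td K TK p" for p x
    using x Kp_pr[OF prime[OF p]] Kp_pr_other[OF prime prime[OF p]] tdK[OF p]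
    by (auto simp: \<Phi>_def intro!: restrict_ext)
  have SG: "S = {x \<in> carrier K. \<forall>p\<in>P. \<Phi> x p \<in> td G TG p}"
  proof
    show "S \<subseteq> {x \<in> carrier K. \<forall>p\<in>P. \<Phi> x p \<in> td G TG p}"
      using pr_in_S[OF prime] pr_in_Kp[OF prime] S_carrier by (auto simp: \<Phi> tdG)
    show "{x \<in> carrier K. \<forall>p\<in>P. \<Phi> x p \<in> td G TG p} \<subseteq> S"
      using in_S_of_pr by (auto simp: \<Phi> tdG Pp)
  qed
  obtain H0 and k :: "nat \<Rightarrow> nat" where H0: "subgroup H0 K" "openin TK H0"
    and ess: "\<And>L. closed_subgroup L \<Longrightarrow> L \<subseteq> H0 \<Longrightarrow> L \<inter> S \<subseteq> {\<one>\<^bsub>K\<^esub>} \<Longrightarrow> L = {\<one>\<^bsub>K\<^esub>}"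
    and k: "\<And>p. Factorial_Ring.prime p \<Longrightarrow> pow_set K (p ^ k p) (Kp p) \<subseteq> S \<inter> H0"
    using exponents_exist by metis
  have Neq: "{x \<in> carrier K. \<forall>p\<in>P. \<Phi> x p \<in> pow_set K (p ^ l p) (td K TK p)} = prod_pow l" for l
    by (auto simp: prod_pow_def \<Phi> tdK Pp)
  have NS: "prod_pow k \<subseteq> S"
  proof
    fix x assume x: "x \<in> prod_pow k"
    show "x \<in> S" by (rule in_S_of_pr) (use x k in \<open>unfold prod_pow_def, blast\<close>)+
  qed
  have "pow_set K (p ^ (k p + 1)) (Kp p) \<subseteq> pow_set K (p ^ k p) (Kp p)" if "Factorial_Ring.prime p" for p
    by (rule pow_set_dvd[OF closed_subgroup_Kp[OF that]]) simp
  then have Nsub: "prod_pow (\<lambda>p. k p + 1) \<subseteq> prod_pow k" unfolding prod_pow_def by blast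
  have NH: "prod_pow k \<subseteq> H0"
  proof
    fix x assume x: "x \<in> prod_pow k"
    show "x \<in> H0" by (rule in_open_subgroup_of_pr[OF H0]) (use x k in \<open>unfold prod_pow_def, blast\<close>)+
  qed
  have "locally_minimal (G Mod prod_pow (\<lambda>p. k p + 1)) (quot_top G TG (prod_pow (\<lambda>p. k p + 1)))"
    unfolding G_def TG_def
    by (rule quotient_locally_minimal[OF subgroup_prod_pow _ _ H0])
      (use Nsub NS NH essential_mod_prod_pow[OF H0 ess k] in blast)+
  then have "\<exists>k :: nat \<Rightarrow> nat. prod_pow k \<subseteq> S \<and>
      locally_minimal (G Mod prod_pow (\<lambda>p. k p + 1)) (quot_top G TG (prod_pow (\<lambda>p. k p + 1)))"
    using NS by blast
  then show ?thesis
    unfolding Let_def G_def[symmetric] TG_def[symmetric] P_def[symmetric]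
  proof (intro conjI exI[of _ \<Phi>])
    show "\<forall>p\<in>P. \<forall>x\<in>td K TK p. \<Phi> x = (\<lambda>q\<in>P. if q = p then x else \<one>\<^bsub>K\<^esub>)" using emb by blast
  qed (unfold Neq, (rule compact_tot_disconnected iso homeo SG | assumption)+)
qed

end
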